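(* Let $\mathbb K$ be a field of characteristic $p>0$ and $\lambda\in\mathfrak t_{\mathbb Z}^*$. The functor $$\bigoplus_{\mathbf x\in\tilde\Lambda(\lambda)}\operatorname{Hom}(P_{\mathbf x},-):\ A^\lambda_{\mathbb K}\text{-mod}^D_o\to\tilde H^\lambda_{\mathbb K}\text{-mod}_o$$ is an equivalence of categories between $A^\lambda_{\mathbb K}\text{-mod}_o^D$ and the category of finite-dimensional representations of $\tilde H^\lambda_{\mathbb K}$ on which each $\mathsf s_i$ acts nilpotently.
   Context: **Tori.** $D=\mathbb G_m^n$ has coordinate characters $\epsilon_i$; $T\subset D$ is a split subtorus with $G=D/T$ a torus; $\mathfrak t_{\mathbb Z}\subset\mathfrak d_{\mathbb Z}=\mathbb Z^n$, $\mathfrak g_{\mathbb Z}=\mathfrak d_{\mathbb Z}/\mathfrak t_{\mathbb Z}$, $\mathfrak g_{\mathbb Z}^*=\mathfrak t_{\mathbb Z}^\perp\subset\mathbb Z^n$. $\mathfrak g^{*,\lambda}_{\mathbb Z}=\{\mathbf a\in\mathbb Z^n:\mathbf a|_{\mathfrak t_{\mathbb Z}}=\lambda\}$. **Hypertoric enveloping algebra.** $W_n$ is the Weyl algebra over $\mathbb Z$ on $z_i,\partial_i$ with $[\partial_i,z_j]=\delta_{ij}$; $D$ acts with $z_i$ of weight $\epsilon_i$, $\partial_i$ of weight $-\epsilon_i$; $h_i^+=z_i\partial_i$. $A_{\mathbb K}=W_n^T\otimes\mathbb K$ and $A^\lambda_{\mathbb K}=A_{\mathbb K}/\langle\sum_i\langle\epsilon_i,\chi\rangle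 h_i^+-\lambda(\chi):\chi\in\mathfrak t_{\mathbb Z}\rangle$. Sending $\mathsf z_i\mapsto z_i^p$, $\mathsf w_i\mapsto\partial_i^p$ makes $A^\lambda_{\mathbb K}$ an algebra over the functions on $\mathfrak N^{(1)}_{\mathbb K}$ (Frobenius twist), where $\mathfrak N_{\mathbb K}=\operatorname{Spec}(\mathbb K[\mathsf z,\mathsf w]^T/\langle\sum_i\langle\epsilon_i,\chi\rangle\mathsf z_i\mathsf w_i\rangle)$; $o\in\mathfrak N^{(1)}$ is the point $\mathsf z=\mathsf w=0$. **Categories.** $A^\lambda_{\mathbb K}\text{-mod}_o$: finitely generated $A^\lambda_{\mathbb K}$-modules set-theoretically supported at $o$. $A^\lambda_{\mathbb K}\text{-mod}^D_o$: such modules with a compatible $D$-action such that $T$ acts via $\lambda$ and, $d_i$ denoting the $i$th coordinate of the $D$-weight, $h_i^+-d_i$ acts nilpotently on every vector. $\mathsf s_i=h_i^+-d_i$ then acts by module endomorphisms. $W_{\mathbf a}(M)$ is the $D$-weight space of weight $\mathbf a$; it is pro-represented by $Q_{\mathbf a}=\varprojlim_NA^\lambda_{\mathbb K}/\sum_iA^\lambda_{\mathbb K}(h_i^+-a_i)^N$ (the image $1_{\mathbf a}$ of $1$ having weight $\mathbf a$), so $\operatorname{Hom}(Q_{\mathbf a},M)=W_{\mathbf a}(M)$; Homs are continuous and $D$-compatible. $\Delta_{\mathbf x}=\{\mathbf a\in\mathfrak g_{\mathbb Z}^{*,\lambda}:px_i\le a_i<px_i+p\ \forall i\}$, $\tilde\Lambda(\lambda)=\{\mathbf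 x\in\mathbb Z^n:\Delta_{\mathbf x}\ne\emptyset\}$. For each $\mathbf x\in\tilde\Lambda(\lambda)$ fix $\mathbf b_{\mathbf x}\in\Delta_{\mathbf x}$ and put $P_{\mathbf x}=Q_{\mathbf b_{\mathbf x}}$. **The algebra.** $\tilde H^\lambda_{\mathbb K}$ is generated over $S=\operatorname{Sym}(\mathfrak g_{\mathbb K})$ (central; $\mathsf s_i$ is the image in $\mathfrak g$ of the $i$th coordinate vector) by orthogonal idempotents $1_{\mathbf x}$ and $c_{\mathbf x,\mathbf y}=1_{\mathbf x}c_{\mathbf x,\mathbf y}1_{\mathbf y}$ ($\mathbf x,\mathbf y\in\tilde\Lambda(\lambda)$, $c_{\mathbf x,\mathbf x}=1_{\mathbf x}$) with $c_{\mathbf x,\mathbf y}c_{\mathbf y,\mathbf u}=\prod_i\mathsf s_i^{\eta_i}c_{\mathbf x,\mathbf u}$, $\eta_i=\frac12(|x_i-y_i|+|y_i-u_i|-|x_i-u_i|)$. **Module structure.** On $\bigoplus_{\mathbf x}\operatorname{Hom}(P_{\mathbf x},M)=\bigoplus_{\mathbf x}W_{\mathbf b_{\mathbf x}}(M)$, $\mathsf s_i$ acts as $h_i^+-d_i$ and $c_{\mathbf x,\mathbf y}$ acts as the operator $W_{\mathbf a}(M)\to W_{\mathbf a+\mathbf b}(M)$, $\mathbf a=\mathbf b_{\mathbf y}$, $\mathbf b=\mathbf b_{\mathbf x}-\mathbf b_{\mathbf y}$, given by $m(\mathbf b)\prod_i\prod_{j=1}^{b_i}q(\mathsf s_i,a_i+j)$,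 where $m(\mathbf b)=\prod_{b_i>0}z_i^{b_i}\prod_{b_i<0}\partial_i^{-b_i}$, products over $1\le j\le b_i$ with $b_i\le0$ are empty, and $q(y,k)=1$ if $k=0$ in $\mathbb K$, $q(y,k)=1/(y+k)$ otherwise. *)

theory Defs
  imports
    "HOL-Analysis.Finite_Cartesian_Product"
    "HOL-Analysis.Function_Topology"
    "HOL-Algebra.QuotRing"
    "HOL-Algebra.Module"
    "HOL-Library.Poly_Mapping"
begin

section \<open>Free algebras\<close>

datatype 'g word = Word (letters: "'g list")

instantiation word :: (type) monoid_add
begin
definition "0 = Word []"
definition "u + v = Word (letters u @ letters v)"
instance by standard (auto simp: zero_word_def plus_word_def)
end

text \<open>Words form a monoid under concatenation, written additively so that
  \<^typ>\<open>'g word \<Rightarrow>\<^sub>0 'k\<close> is the free associative \<open>'k\<close>-algebra on \<open>'g\<close>.\<close>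

definition gen :: "'g \<Rightarrow> 'g word \<Rightarrow>\<^sub>0 'k::comm_ring_1" where
  "gen g = Poly_Mapping.single (Word [g]) 1"

inductive_set two_sided_ideal :: "'a::ring_1 set \<Rightarrow> 'a set" for R where
  zero: "0 \<in> two_sided_ideal R"
| rel: "r \<in> R \<Longrightarrow> a * r * b \<in> two_sided_ideal R"
| add: "x \<in> two_sided_ideal R \<Longrightarrow> y \<in> two_sided_ideal R \<Longrightarrow> x + y \<in> two_sided_ideal R"

lemma two_sided_ideal_mult:
  "x \<in> two_sided_ideal R \<Longrightarrow> a * x * b \<in> two_sided_ideal R"
proof (induction rule: two_sided_ideal.induct)
  case (rel r c d)
  then have "(a * c) * r * (d * b) \<in> two_sided_ideal R" by (rule two_sided_ideal.rel)
  then show ?case by (simp add: mult.assoc)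
qed (auto simp: algebra_simps intro: two_sided_ideal.intros)

lemma two_sided_ideal_left: "x \<in> two_sided_ideal R \<Longrightarrow> a * x \<in> two_sided_ideal R"
  using two_sided_ideal_mult[of x R a 1] by simp

lemma two_sided_ideal_right: "x \<in> two_sided_ideal R \<Longrightarrow> x * b \<in> two_sided_ideal R"
  using two_sided_ideal_mult[of x R 1 b] by simp

lemma two_sided_ideal_uminus: "x \<in> two_sided_ideal R \<Longrightarrow> - x \<in> two_sided_ideal R"
  using two_sided_ideal_left[of x R "-1"] by simp

lemma two_sided_ideal_diff:
  "x \<in> two_sided_ideal R \<Longrightarrow> y \<in> two_sided_ideal R \<Longrightarrow> x - y \<in> two_sided_ideal R"
  using two_sided_ideal.add[of x R "- y"] two_sided_ideal_uminus[of y R] by simp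

lemma poly_mapping_single_add_induct [case_names zero add]:
  assumes "P 0" and "\<And>f a b. P f \<Longrightarrow> P (Poly_Mapping.single a b + f)"
  shows "P (f :: 'a \<Rightarrow>\<^sub>0 'b::comm_monoid_add)"
proof (induction f rule: update_induct)
  case const then show ?case by (rule assms)
next
  case (update f a b)
  have "Poly_Mapping.update a b f = Poly_Mapping.single a b + f"
    using update(1)
    by (intro poly_mapping_eqI) (auto simp: lookup_update lookup_add lookup_single when_def in_keys_iff)
  then show ?case using assms(2) update(3) by simp
qed


section \<open>The Weyl algebra\<close>

datatype 'n weyl_gen = Zg 'n | Dg 'n

definition weyl_rels :: "('n weyl_gen word \<Rightarrow>\<^sub>0 'k::comm_ring_1) set" where
  "weyl_rels =
     {gen (Dg i) * gen (Zg j) - gen (Zg j) * gen (Dg i) - (if i = j then 1 else 0) | i j. True}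
   \<union> {gen (Zg i) * gen (Zg j) - gen (Zg j) * gen (Zg i) | i j. True}
   \<union> {gen (Dg i) * gen (Dg j) - gen (Dg j) * gen (Dg i) | i j. True}"

text \<open>The relations do not generate the unit ideal: they hold in the action on formal power
  series, given by their coefficient functions.\<close>

fun series_act_gen :: "'n weyl_gen \<Rightarrow> (('n \<Rightarrow> nat) \<Rightarrow> 'k::comm_ring_1) \<Rightarrow> ('n \<Rightarrow> nat) \<Rightarrow> 'k" where
  "series_act_gen (Zg i) g = (\<lambda>e. if e i = 0 then 0 else g (e(i := e i - 1)))"
| "series_act_gen (Dg i) g = (\<lambda>e. of_nat (e i + 1) * g (e(i := e i + 1)))"

definition series_act_word :: "'n weyl_gen word \<Rightarrow> (('n \<Rightarrow> nat) \<Rightarrow> 'k::comm_ring_1) \<Rightarrow> ('n \<Rightarrow> nat) \<Rightarrow> 'k"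
  where "series_act_word w g = foldr series_act_gen (letters w) g"

definition series_act ::
  "('n weyl_gen word \<Rightarrow>\<^sub>0 'k) \<Rightarrow> (('n \<Rightarrow> nat) \<Rightarrow> 'k::comm_ring_1) \<Rightarrow> ('n \<Rightarrow> nat) \<Rightarrow> 'k" where
  "series_act f g e = (\<Sum>w\<in>Poly_Mapping.keys f. Poly_Mapping.lookup f w * series_act_word w g e)"

lemma series_act_superset:
  assumes "finite S" "Poly_Mapping.keys f \<subseteq> S"
  shows "series_act f g e = (\<Sum>w\<in>S. Poly_Mapping.lookup f w * series_act_word w g e)"
  unfolding series_act_def
  by (rule sum.mono_neutral_left) (use assms in \<open>auto simp: in_keys_iff\<close>)

lemma series_act_0 [simp]: "series_act 0 g = (\<lambda>_. 0)"
  by (simp add: fun_eq_iff series_act_def)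

lemma series_act_single [simp]:
  "series_act (Poly_Mapping.single w c) g = (\<lambda>e. c * series_act_word w g e)"
  by (auto simp: fun_eq_iff series_act_def)

lemma series_act_add:
  "series_act (f + f') g = (\<lambda>e. series_act f g e + series_act f' g e)"
proof
  fix e
  let ?S = "Poly_Mapping.keys f \<union> Poly_Mapping.keys f'"
  have "series_act h g e = (\<Sum>w\<in>?S. Poly_Mapping.lookup h w * series_act_word w g e)"
    if "Poly_Mapping.keys h \<subseteq> ?S" for h
    by (rule series_act_superset) (use that in auto)
  from this[of f] this[of f'] this[of "f + f'"]
  show "series_act (f + f') g e = series_act f g e + series_act f' g e"
    using keys_add[of f f']
    by (simp add: lookup_add algebra_simps sum.distrib)
qed

lemma series_act_gen_linear:
  "series_act_gen x (\<lambda>e. c * g e + d * h e) = (\<lambda>e. c * series_act_gen x g e + d * series_act_gen x h e)"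
  by (cases x) (auto simp: fun_eq_iff algebra_simps)

lemma series_act_word_linear:
  "series_act_word w (\<lambda>e. c * g e + d * h e) = (\<lambda>e. c * series_act_word w g e + d * series_act_word w h e)"
proof -
  have "foldr series_act_gen xs (\<lambda>e. c * g e + d * h e)
      = (\<lambda>e. c * foldr series_act_gen xs g e + d * foldr series_act_gen xs h e)" for xs
    by (induction xs) (auto simp: series_act_gen_linear)
  then show ?thesis by (simp add: series_act_word_def)
qed

lemma series_act_word_zero: "series_act_word w (\<lambda>_. 0) = (\<lambda>_. 0)"
  using series_act_word_linear[of w 0 "\<lambda>_. 0" 0 "\<lambda>_. 0"] by simp

lemma series_act_zero: "series_act f (\<lambda>_. 0) = (\<lambda>_. 0)"
  by (simp add: fun_eq_iff series_act_def series_act_word_zero)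

lemma series_act_single_mult:
  "series_act (Poly_Mapping.single w c * f) g = (\<lambda>e. c * series_act_word w (series_act f g) e)"
proof (induction f rule: poly_mapping_single_add_induct)
  case zero
  then show ?case by (simp add: series_act_word_zero)
next
  case (add f v d)
  have "series_act_word (w + v) g = series_act_word w (series_act_word v g)"
    by (simp add: series_act_word_def plus_word_def)
  moreover have "series_act_word w (\<lambda>e. d * series_act_word v g e + series_act f g e)
     = (\<lambda>e. d * series_act_word w (series_act_word v g) e + series_act_word w (series_act f g) e)"
    using series_act_word_linear[of w d "series_act_word v g" 1 "series_act f g"] by simp
  ultimately show ?case
    by (simp add: distrib_left mult_single series_act_add add algebra_simps)
qed

lemma series_act_mult: "series_act (f * f') g = series_act f (series_act f' g)"
  by (induction f rule: poly_mapping_single_add_induct)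
    (simp_all add: distrib_right series_act_add series_act_single_mult)

lemma series_act_diff:
  "series_act (f - f') g = (\<lambda>e. series_act f g e - series_act f' g e)"
  using series_act_add[of "f - f'" f' g] by (simp add: fun_eq_iff)

lemma series_act_gen_eq: "series_act (gen x) g = series_act_gen x g"
  by (simp add: gen_def series_act_word_def)

lemma series_act_1: "series_act 1 g = g"
  by (simp flip: single_one add: series_act_word_def zero_word_def)

lemma series_act_comm:
  "series_act (gen x * gen y - gen y * gen x) g e
   = series_act_gen x (series_act_gen y g) e - series_act_gen y (series_act_gen x g) e"
  by (simp add: series_act_diff series_act_mult series_act_gen_eq)

lemma series_act_rels:
  fixes r :: "'n weyl_gen word \<Rightarrow>\<^sub>0 'k::comm_ring_1"
  assumes "r \<in> weyl_rels" shows "series_act r g = (\<lambda>_. 0)"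
proof
  fix e :: "'n \<Rightarrow> nat"
  have twist: "e(i := u, j := v) = e(j := v, i := u)" if "i \<noteq> j" for i j :: 'n and u v
    using that by (rule fun_upd_twist)
  from assms consider
      (dz) i j where "r = (gen (Dg i) * gen (Zg j) - gen (Zg j) * gen (Dg i)) - (if i = j then 1 else 0)"
    | (zz) i j where "r = gen (Zg i) * gen (Zg j) - gen (Zg j) * gen (Zg i)"
    | (dd) i j where "r = gen (Dg i) * gen (Dg j) - gen (Dg j) * gen (Dg i)"
    unfolding weyl_rels_def by fast
  then show "series_act r g e = 0"
  proof cases
    case dz
    then have "series_act r g e = series_act_gen (Dg i) (series_act_gen (Zg j) g) e
       - series_act_gen (Zg j) (series_act_gen (Dg i) g) e - (if i = j then g e else 0)"
      by (simp only: series_act_diff[of _ "if i = j then 1 else 0"] series_act_comm)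
        (simp add: series_act_1)
    also have "\<dots> = 0"
    proof (cases "i = j")
      case True
      moreover have "e(j := Suc m) = e" if "e j = Suc m" for m
        using that by (metis fun_upd_triv)
      ultimately show ?thesis by (cases "e j") (simp_all add: distrib_right)
    next
      case False
      then show ?thesis using twist[of i j "Suc (e i)" "e j - 1"] by simp
    qed
    finally show ?thesis .
  next
    case zz
    then show ?thesis
      using twist[of i j "e i - 1" "e j - 1"] by (cases "i = j") (simp_all add: series_act_comm)
  next
    case dd
    then show ?thesis
      using twist[of i j "Suc (e i)" "Suc (e j)"]
      by (cases "i = j") (simp_all add: series_act_comm mult.left_commute)
  qed
qed

lemma series_act_ideal: "f \<in> two_sided_ideal weyl_rels \<Longrightarrow> series_act f g = (\<lambda>_. 0)"
  by (induction arbitrary: g rule: two_sided_ideal.induct)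
    (simp_all add: series_act_mult series_act_rels series_act_zero series_act_add)

lemma one_notin_weyl_ideal: "(1 :: 'n weyl_gen word \<Rightarrow>\<^sub>0 'k::comm_ring_1) \<notin> two_sided_ideal weyl_rels"
  using series_act_ideal[of "1 :: 'n weyl_gen word \<Rightarrow>\<^sub>0 'k" "\<lambda>_. 1"]
  by (auto simp: series_act_1 fun_eq_iff)

definition weyl_rel :: "('n weyl_gen word \<Rightarrow>\<^sub>0 'k::comm_ring_1) \<Rightarrow> ('n weyl_gen word \<Rightarrow>\<^sub>0 'k) \<Rightarrow> bool"
  where "weyl_rel f g \<longleftrightarrow> f - g \<in> two_sided_ideal weyl_rels"

lemma equivp_weyl_rel: "equivp weyl_rel"
proof (rule equivpI)
  show "reflp weyl_rel" by (auto simp: reflp_def weyl_rel_def two_sided_ideal.zero)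
  show "symp weyl_rel"
  proof (rule sympI)
    fix f g assume "weyl_rel f g"
    then show "weyl_rel g f"
      unfolding weyl_rel_def using two_sided_ideal_uminus[of "f - g" weyl_rels] by simp
  qed
  show "transp weyl_rel"
  proof (rule transpI)
    fix f g h assume "weyl_rel f g" "weyl_rel g h"
    then show "weyl_rel f h"
      unfolding weyl_rel_def using two_sided_ideal.add[of "f - g" weyl_rels "g - h"] by simp
  qed
qed

quotient_type (overloaded) ('n, 'k) weyl = "'n weyl_gen word \<Rightarrow>\<^sub>0 ('k::comm_ring_1)" / weyl_rel
  by (rule equivp_weyl_rel)

instantiation weyl :: (type, comm_ring_1) ring_1
begin

lift_definition zero_weyl :: "('a, 'b) weyl" is 0 .
lift_definition one_weyl :: "('a, 'b) weyl" is 1 .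
lift_definition plus_weyl :: "('a, 'b) weyl \<Rightarrow> ('a, 'b) weyl \<Rightarrow> ('a, 'b) weyl" is "(+)"
  by (simp add: weyl_rel_def add_diff_add two_sided_ideal.add)
lift_definition minus_weyl :: "('a, 'b) weyl \<Rightarrow> ('a, 'b) weyl \<Rightarrow> ('a, 'b) weyl" is "(-)"
proof -
  fix f f' g g' :: "'a weyl_gen word \<Rightarrow>\<^sub>0 'b"
  assume "weyl_rel f f'" "weyl_rel g g'"
  then have "(f - f') - (g - g') \<in> two_sided_ideal weyl_rels"
    unfolding weyl_rel_def by (rule two_sided_ideal_diff)
  then show "weyl_rel (f - g) (f' - g')"
    unfolding weyl_rel_def by (simp add: algebra_simps)
qed
lift_definition uminus_weyl :: "('a, 'b) weyl \<Rightarrow> ('a, 'b) weyl" is uminus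
proof -
  fix f f' :: "'a weyl_gen word \<Rightarrow>\<^sub>0 'b"
  assume "weyl_rel f f'"
  then have "- (f - f') \<in> two_sided_ideal weyl_rels"
    unfolding weyl_rel_def by (rule two_sided_ideal_uminus)
  then show "weyl_rel (- f) (- f')"
    unfolding weyl_rel_def by simp
qed
lift_definition times_weyl :: "('a, 'b) weyl \<Rightarrow> ('a, 'b) weyl \<Rightarrow> ('a, 'b) weyl" is "(*)"
proof -
  fix f f' g g' :: "'a weyl_gen word \<Rightarrow>\<^sub>0 'b"
  assume "weyl_rel f f'" "weyl_rel g g'"
  then have "(f - f') * g + f' * (g - g') \<in> two_sided_ideal weyl_rels"
    unfolding weyl_rel_def
    by (intro two_sided_ideal.add two_sided_ideal_left two_sided_ideal_right)
  then show "weyl_rel (f * g) (f' * g')"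
    unfolding weyl_rel_def by (simp add: algebra_simps)
qed

instance
proof
  show "(0 :: ('a, 'b) weyl) \<noteq> 1"
    by transfer
      (use one_notin_weyl_ideal two_sided_ideal_uminus in \<open>force simp: weyl_rel_def\<close>)
qed (transfer; simp add: weyl_rel_def algebra_simps two_sided_ideal.zero)+

end

section \<open>Categories\<close>

text \<open>Arrows are kept in hom-sets indexed by source and target, which need not be disjoint;
  accordingly composition takes the three objects as arguments, \<open>Comp C X Y Z g f\<close> being
  \<open>g \<circ> f\<close> for \<open>f : X \<rightarrow> Y\<close> and \<open>g : Y \<rightarrow> Z\<close>.\<close>

record ('o, 'm) category =
  Ob :: "'o set"
  Arr :: "'o \<Rightarrow> 'o \<Rightarrow> 'm set"
  Idt :: "'o \<Rightarrow> 'm"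
  Comp :: "'o \<Rightarrow> 'o \<Rightarrow> 'o \<Rightarrow> 'm \<Rightarrow> 'm \<Rightarrow> 'm"

definition is_category :: "('o, 'm) category \<Rightarrow> bool" where
  "is_category C \<longleftrightarrow>
     (\<forall>X\<in>Ob C. Idt C X \<in> Arr C X X) \<and>
     (\<forall>X\<in>Ob C. \<forall>Y\<in>Ob C. \<forall>Z\<in>Ob C. \<forall>f\<in>Arr C X Y. \<forall>g\<in>Arr C Y Z. Comp C X Y Z g f \<in> Arr C X Z) \<and>
     (\<forall>X\<in>Ob C. \<forall>Y\<in>Ob C. \<forall>f\<in>Arr C X Y.
        Comp C X X Y f (Idt C X) = f \<and> Comp C X Y Y (Idt C Y) f = f) \<and>
     (\<forall>W\<in>Ob C. \<forall>X\<in>Ob C. \<forall>Y\<in>Ob C. \<forall>Z\<in>Ob C. \<forall>f\<in>Arr C W X. \<forall>g\<in>Arr C X Y. \<forall>h\<in>Arr C Y Z.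
        Comp C W X Z (Comp C X Y Z h g) f = Comp C W Y Z h (Comp C W X Y g f))"

text \<open>A functor consists of an object map and, for each pair of objects, an arrow map.\<close>

record ('o, 'm, 'o2, 'm2) cfunctor =
  FOb :: "'o \<Rightarrow> 'o2"
  FArr :: "'o \<Rightarrow> 'o \<Rightarrow> 'm \<Rightarrow> 'm2"

definition is_functor ::
  "('o, 'm) category \<Rightarrow> ('o2, 'm2) category \<Rightarrow> ('o, 'm, 'o2, 'm2) cfunctor \<Rightarrow> bool" where
  "is_functor C D F \<longleftrightarrow>
     (\<forall>X\<in>Ob C. FOb F X \<in> Ob D) \<and>
     (\<forall>X\<in>Ob C. \<forall>Y\<in>Ob C. \<forall>f\<in>Arr C X Y. FArr F X Y f \<in> Arr D (FOb F X) (FOb F Y)) \<and>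
     (\<forall>X\<in>Ob C. FArr F X X (Idt C X) = Idt D (FOb F X)) \<and>
     (\<forall>X\<in>Ob C. \<forall>Y\<in>Ob C. \<forall>Z\<in>Ob C. \<forall>f\<in>Arr C X Y. \<forall>g\<in>Arr C Y Z.
        FArr F X Z (Comp C X Y Z g f) =
        Comp D (FOb F X) (FOb F Y) (FOb F Z) (FArr F Y Z g) (FArr F X Y f))"

definition id_functor :: "('o, 'm, 'o, 'm) cfunctor" where
  "id_functor = \<lparr>FOb = (\<lambda>X. X), FArr = (\<lambda>X Y f. f)\<rparr>"

definition comp_functor ::
  "('o2, 'm2, 'o3, 'm3) cfunctor \<Rightarrow> ('o, 'm, 'o2, 'm2) cfunctor \<Rightarrow> ('o, 'm, 'o3, 'm3) cfunctor" where
  "comp_functor G F =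
     \<lparr>FOb = (\<lambda>X. FOb G (FOb F X)),
      FArr = (\<lambda>X Y f. FArr G (FOb F X) (FOb F Y) (FArr F X Y f))\<rparr>"

definition is_iso :: "('o, 'm) category \<Rightarrow> 'o \<Rightarrow> 'o \<Rightarrow> 'm \<Rightarrow> bool" where
  "is_iso C X Y f \<longleftrightarrow> f \<in> Arr C X Y \<and>
     (\<exists>g\<in>Arr C Y X. Comp C X Y X g f = Idt C X \<and> Comp C Y X Y f g = Idt C Y)"

definition naturally_isomorphic ::
  "('o, 'm) category \<Rightarrow> ('o2, 'm2) category \<Rightarrow> ('o, 'm, 'o2, 'm2) cfunctor \<Rightarrow>
   ('o, 'm, 'o2, 'm2) cfunctor \<Rightarrow> bool" where
  "naturally_isomorphic C D F G \<longleftrightarrow>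
     (\<exists>\<tau>. (\<forall>X\<in>Ob C. is_iso D (FOb F X) (FOb G X) (\<tau> X)) \<and>
          (\<forall>X\<in>Ob C. \<forall>Y\<in>Ob C. \<forall>f\<in>Arr C X Y.
             Comp D (FOb F X) (FOb F Y) (FOb G Y) (\<tau> Y) (FArr F X Y f) =
             Comp D (FOb F X) (FOb G X) (FOb G Y) (FArr G X Y f) (\<tau> X)))"

definition is_equivalence ::
  "('o, 'm) category \<Rightarrow> ('o2, 'm2) category \<Rightarrow> ('o, 'm, 'o2, 'm2) cfunctor \<Rightarrow> bool" where
  "is_equivalence C D F \<longleftrightarrow>
     is_category C \<and> is_category D \<and> is_functor C D F \<and>
     (\<exists>G. is_functor D C G \<and>
          naturally_isomorphic C C id_functor (comp_functor G F) \<and>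
          naturally_isomorphic D D (comp_functor F G) id_functor)"


section \<open>Modules\<close>

text \<open>The library's \<^locale>\<open>module\<close> requires a commutative ring; this is the same over any
  ring. The fields \<^const>\<open>mult\<close> and \<^const>\<open>one\<close> of a module record carry no meaning.\<close>

locale left_module = R?: ring R + M?: abelian_group M for R (structure) and M (structure) +
  assumes smult_closed: "\<lbrakk>r \<in> carrier R; v \<in> carrier M\<rbrakk> \<Longrightarrow> r \<odot>\<^bsub>M\<^esub> v \<in> carrier M"
    and smult_l_distr: "\<lbrakk>r \<in> carrier R; s \<in> carrier R; v \<in> carrier M\<rbrakk> \<Longrightarrow>
      (r \<oplus>\<^bsub>R\<^esub> s) \<odot>\<^bsub>M\<^esub> v = r \<odot>\<^bsub>M\<^esub> v \<oplus>\<^bsub>M\<^esub> s \<odot>\<^bsub>M\<^esub> v"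
    and smult_r_distr: "\<lbrakk>r \<in> carrier R; v \<in> carrier M; w \<in> carrier M\<rbrakk> \<Longrightarrow>
      r \<odot>\<^bsub>M\<^esub> (v \<oplus>\<^bsub>M\<^esub> w) = r \<odot>\<^bsub>M\<^esub> v \<oplus>\<^bsub>M\<^esub> r \<odot>\<^bsub>M\<^esub> w"
    and smult_assoc: "\<lbrakk>r \<in> carrier R; s \<in> carrier R; v \<in> carrier M\<rbrakk> \<Longrightarrow>
      (r \<otimes>\<^bsub>R\<^esub> s) \<odot>\<^bsub>M\<^esub> v = r \<odot>\<^bsub>M\<^esub> (s \<odot>\<^bsub>M\<^esub> v)"
    and smult_one: "v \<in> carrier M \<Longrightarrow> \<one>\<^bsub>R\<^esub> \<odot>\<^bsub>M\<^esub> v = v"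

text \<open>Homomorphisms are extensional on the carrier, so that equal homomorphisms are equal
  functions.\<close>

definition linear_maps ::
  "('r, 'x) ring_scheme \<Rightarrow> ('r, 'v, 'y) module_scheme \<Rightarrow> ('r, 'w, 'z) module_scheme \<Rightarrow> ('v \<Rightarrow> 'w) set"
  where "linear_maps R M N = {f \<in> carrier M \<rightarrow>\<^sub>E carrier N.
     (\<forall>v\<in>carrier M. \<forall>w\<in>carrier M. f (v \<oplus>\<^bsub>M\<^esub> w) = f v \<oplus>\<^bsub>N\<^esub> f w) \<and>
     (\<forall>r\<in>carrier R. \<forall>v\<in>carrier M. f (r \<odot>\<^bsub>M\<^esub> v) = r \<odot>\<^bsub>N\<^esub> f v)}"

definition class_ring :: "'a::ring_1 set \<Rightarrow> 'a ring" where
  "class_ring S = \<lparr>carrier = S, mult = (*), one = 1, zero = 0, add = (+)\<rparr>"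


section \<open>Tori\<close>

definition pairing :: "int ^ 'n \<Rightarrow> int ^ 'n \<Rightarrow> int" where
  "pairing a x = (\<Sum>i\<in>UNIV. a $ i * x $ i)"

text \<open>The cocharacter lattices of split subtori of \<open>\<G>\<^sub>m\<^sup>n\<close> are the saturated subgroups of the
  cocharacter lattice of \<open>\<G>\<^sub>m\<^sup>n\<close>.\<close>

definition subtorus_lattice :: "(int ^ 'n) set \<Rightarrow> bool" where
  "subtorus_lattice t \<longleftrightarrow> 0 \<in> t \<and> (\<forall>x\<in>t. \<forall>y\<in>t. x - y \<in> t) \<and>
     (\<forall>m x. m \<noteq> 0 \<and> m *s x \<in> t \<longrightarrow> x \<in> t)"

text \<open>\<open>lattice_fiber t lam\<close> is \<open>\<gg>\<^sub>\<int>\<^sup>*\<^sup>,\<^sup>\<lambda>\<close>, and \<open>lattice_fiber t 0\<close> is \<open>\<gg>\<^sub>\<int>\<^sup>*\<close>.\<close>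

definition lattice_fiber :: "(int ^ 'n) set \<Rightarrow> (int ^ 'n \<Rightarrow> int) \<Rightarrow> (int ^ 'n) set" where
  "lattice_fiber t lam = {a. \<forall>x\<in>t. pairing a x = lam x}"

abbreviation g_star :: "(int ^ 'n) set \<Rightarrow> (int ^ 'n) set" where
  "g_star t \<equiv> lattice_fiber t (\<lambda>_. 0)"

definition alcove :: "(int ^ 'n) set \<Rightarrow> (int ^ 'n \<Rightarrow> int) \<Rightarrow> nat \<Rightarrow> int ^ 'n \<Rightarrow> (int ^ 'n) set" where
  "alcove t lam p x =
     {a \<in> lattice_fiber t lam. \<forall>i. int p * x $ i \<le> a $ i \<and> a $ i < int p * x $ i + int p}"

definition alcove_labels :: "(int ^ 'n) set \<Rightarrow> (int ^ 'n \<Rightarrow> int) \<Rightarrow> nat \<Rightarrow> (int ^ 'n) set" where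
  "alcove_labels t lam p = {x. alcove t lam p x \<noteq> {}}"

text \<open>An enumeration of the coordinates, used to write products of commuting factors.\<close>

definition coords :: "'n::finite list" where
  "coords = (SOME xs. set xs = UNIV \<and> distinct xs)"


section \<open>The hypertoric enveloping algebra\<close>

definition scal :: "'k::comm_ring_1 \<Rightarrow> ('n, 'k) weyl" where
  "scal c = abs_weyl (Poly_Mapping.single 0 c)"

definition zW :: "'n \<Rightarrow> ('n, 'k::comm_ring_1) weyl" where "zW i = abs_weyl (gen (Zg i))"

definition dW :: "'n \<Rightarrow> ('n, 'k::comm_ring_1) weyl" where "dW i = abs_weyl (gen (Dg i))"

definition hplus :: "'n \<Rightarrow> ('n, 'k::comm_ring_1) weyl" where "hplus i = zW i * dW i"

lemma dW_zW_commutator: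
  "dW i * zW j - zW j * dW i = (if i = j then 1 else 0 :: ('n, 'k::comm_ring_1) weyl)"
proof -
  let ?r = "(gen (Dg i) * gen (Zg j) - gen (Zg j) * gen (Dg i)) :: 'n weyl_gen word \<Rightarrow>\<^sub>0 'k"
  have "?r - (if i = j then 1 else 0) \<in> weyl_rels"
    unfolding weyl_rels_def by fast
  from two_sided_ideal.rel[OF this, of 1 1]
  have "weyl_rel ?r (if i = j then 1 else 0)"
    by (simp only: weyl_rel_def mult_1_left mult_1_right)
  then have "abs_weyl ?r = abs_weyl (if i = j then 1 else 0)"
    by (simp only: weyl.abs_eq_iff)
  then show ?thesis
    by (simp add: zW_def dW_def times_weyl.abs_eq minus_weyl.abs_eq one_weyl.abs_eq
        zero_weyl.abs_eq split: if_splits)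
qed

fun gen_weight :: "'n::finite weyl_gen \<Rightarrow> int ^ 'n" where
  "gen_weight (Zg i) = axis i 1"
| "gen_weight (Dg i) = - axis i 1"

definition word_weight :: "'n::finite weyl_gen word \<Rightarrow> int ^ 'n" where
  "word_weight w = (\<Sum>x\<leftarrow>letters w. gen_weight x)"

definition weyl_weights :: "(int ^ 'n) set \<Rightarrow> ('n::finite, 'k::comm_ring_1) weyl set" where
  "weyl_weights B = abs_weyl ` {f. \<forall>w\<in>Poly_Mapping.keys f. word_weight w \<in> B}"

text \<open>\<open>weyl_weights B\<close> is the sum of the \<open>D\<close>-weight spaces with weight in \<open>B\<close>; a weight is trivial
  on \<open>T\<close> iff it lies in \<open>\<gg>\<^sub>\<int>\<^sup>*\<close>. The weight decomposition is defined over \<open>\<int>\<close>, so invariants of the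
  torus \<open>T\<close> commute with base change and \<open>W\<^sub>n\<^sup>T \<otimes> \<bbbK>\<close> is the algebra of invariants
  of \<open>W\<^sub>n \<otimes> \<bbbK>\<close>, that is, of the Weyl algebra with coefficients in \<open>\<bbbK>\<close>.\<close>

definition A_alg :: "(int ^ 'n) set \<Rightarrow> ('n::finite, 'k::field) weyl ring" where
  "A_alg t = class_ring (weyl_weights (g_star t))"

definition A_moment :: "(int ^ 'n) set \<Rightarrow> (int ^ 'n \<Rightarrow> int) \<Rightarrow> ('n::finite, 'k::field) weyl set" where
  "A_moment t lam = Idl\<^bsub>A_alg t\<^esub> {(\<Sum>i\<in>UNIV. of_int (x $ i) * hplus i) - of_int (lam x) | x. x \<in> t}"

definition A_lam :: "(int ^ 'n) set \<Rightarrow> (int ^ 'n \<Rightarrow> int) \<Rightarrow> ('n::finite, 'k::field) weyl set ring" where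
  "A_lam t lam = A_alg t Quot A_moment t lam"

definition A_cls :: "(int ^ 'n) set \<Rightarrow> (int ^ 'n \<Rightarrow> int) \<Rightarrow> ('n::finite, 'k::field) weyl \<Rightarrow>
    ('n, 'k) weyl set" where
  "A_cls t lam u = A_moment t lam +>\<^bsub>A_alg t\<^esub> u"

text \<open>Polynomials in \<open>z, w\<close>: the exponents of a monomial form a pair in \<open>\<nat>\<^sup>n \<times> \<nat>\<^sup>n\<close>. The substitution
  is \<open>z\<^sub>i \<mapsto> z\<^sub>i\<^sup>p\<close>, \<open>w\<^sub>i \<mapsto> \<partial>\<^sub>i\<^sup>p\<close>. The maximal ideal of the point \<open>o\<close> in the functions on \<open>\<NN>\<^sup>(\<^sup>1\<^sup>)\<close> is the
  image of the ideal \<open>o_ideal\<close> of \<open>T\<close>-invariant polynomials vanishing at \<open>z = w = 0\<close>.\<close>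

type_synonym ('n, 'k) zw_poly = "((nat ^ 'n) \<times> (nat ^ 'n)) \<Rightarrow>\<^sub>0 'k"

definition frobenius_sub :: "nat \<Rightarrow> ('n::finite, 'k::field) zw_poly \<Rightarrow> ('n, 'k) weyl" where
  "frobenius_sub p f = (\<Sum>m\<in>Poly_Mapping.keys f. scal (Poly_Mapping.lookup f m)
     * (\<Prod>i\<leftarrow>coords. (zW i ^ p) ^ (fst m $ i)) * (\<Prod>i\<leftarrow>coords. (dW i ^ p) ^ (snd m $ i)))"

definition o_ideal :: "(int ^ 'n) set \<Rightarrow> ('n::finite, 'k::field) zw_poly set" where
  "o_ideal t = {f. (\<forall>m\<in>Poly_Mapping.keys f. (\<chi> i. int (fst m $ i) - int (snd m $ i)) \<in> g_star t)
     \<and> Poly_Mapping.lookup f 0 = 0}"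


section \<open>The category of \<open>D\<close>-equivariant modules supported at \<open>o\<close>\<close>

text \<open>An action of the split torus \<open>D\<close> is a coaction \<open>M \<rightarrow> M \<otimes> \<bbbK>[\<int>\<^sup>n]\<close> of its coordinate
  Hopf algebra; \<open>coact M v a\<close> is the coefficient of the character \<open>a\<close> in the image of \<open>v\<close>.\<close>

record ('r, 'v, 'w) dmodule = "('r, 'v) module" +
  coact :: "'v \<Rightarrow> 'w \<Rightarrow> 'v"

type_synonym ('n, 'k, 'v) Dmod = "(('n, 'k) weyl set, 'v, int ^ 'n) dmodule"

definition coact_supp :: "('r, 'v, 'w, 'x) dmodule_scheme \<Rightarrow> 'v \<Rightarrow> 'w set" where
  "coact_supp M v = {a. coact M v a \<noteq> \<zero>\<^bsub>M\<^esub>}"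

definition is_D_action :: "(int ^ 'n) set \<Rightarrow> (int ^ 'n \<Rightarrow> int) \<Rightarrow>
    ('n::finite, 'k::field, 'v) Dmod \<Rightarrow> bool" where
  "is_D_action t lam M \<longleftrightarrow>
     (\<forall>v\<in>carrier M. \<forall>a. coact M v a \<in> carrier M) \<and>
     (\<forall>v\<in>carrier M. finite (coact_supp M v)) \<and>
     (\<forall>v\<in>carrier M. \<forall>w\<in>carrier M. \<forall>a. coact M (v \<oplus>\<^bsub>M\<^esub> w) a = coact M v a \<oplus>\<^bsub>M\<^esub> coact M w a) \<and>
     (\<forall>c. \<forall>v\<in>carrier M. \<forall>a. coact M (A_cls t lam (scal c) \<odot>\<^bsub>M\<^esub> v) a = A_cls t lam (scal c) \<odot>\<^bsub>M\<^esub> coact M v a) \<and>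
     (\<forall>v\<in>carrier M. (\<Oplus>\<^bsub>M\<^esub>a\<in>coact_supp M v. coact M v a) = v) \<and>
     (\<forall>v\<in>carrier M. \<forall>a b. coact M (coact M v a) b = (if a = b then coact M v a else \<zero>\<^bsub>M\<^esub>))"

definition compatible_D_action :: "(int ^ 'n) set \<Rightarrow> (int ^ 'n \<Rightarrow> int) \<Rightarrow>
    ('n::finite, 'k::field, 'v) Dmod \<Rightarrow> bool" where
  "compatible_D_action t lam M \<longleftrightarrow>
     (\<forall>a\<in>g_star t. \<forall>u\<in>weyl_weights {a}. \<forall>v\<in>carrier M. \<forall>b.
        coact M (A_cls t lam u \<odot>\<^bsub>M\<^esub> v) (a + b) = A_cls t lam u \<odot>\<^bsub>M\<^esub> coact M v b)"

definition weight_space :: "('r, 'v, 'w, 'x) dmodule_scheme \<Rightarrow> 'w \<Rightarrow> 'v set" where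
  "weight_space M a = {v \<in> carrier M. \<forall>b. coact M v b = (if b = a then v else \<zero>\<^bsub>M\<^esub>)}"

text \<open>The operator \<open>h\<^sub>i\<^sup>+ - d\<^sub>i\<close>.\<close>

definition s_op :: "(int ^ 'n) set \<Rightarrow> (int ^ 'n \<Rightarrow> int) \<Rightarrow>
    ('n::finite, 'k::field, 'v) Dmod \<Rightarrow> 'n \<Rightarrow> 'v \<Rightarrow> 'v" where
  "s_op t lam M i v = A_cls t lam (hplus i) \<odot>\<^bsub>M\<^esub> v \<ominus>\<^bsub>M\<^esub>
     (\<Oplus>\<^bsub>M\<^esub>a\<in>coact_supp M v. A_cls t lam (of_int (a $ i)) \<odot>\<^bsub>M\<^esub> coact M v a)"

definition A_modules_o :: "(int ^ 'n) set \<Rightarrow> (int ^ 'n \<Rightarrow> int) \<Rightarrow> nat \<Rightarrow>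
    ('n::finite, 'k::field, 'v) Dmod set" where
  "A_modules_o t lam p = {M. left_module (A_lam t lam) M \<and>
     (\<exists>S. finite S \<and> S \<subseteq> carrier M \<and>
        (\<forall>v\<in>carrier M. \<exists>r\<in>S \<rightarrow> carrier (A_lam t lam). v = (\<Oplus>\<^bsub>M\<^esub>s\<in>S. r s \<odot>\<^bsub>M\<^esub> s))) \<and>
     (\<forall>v\<in>carrier M. \<forall>f\<in>o_ideal t. \<exists>N. ((\<lambda>w. A_cls t lam (frobenius_sub p f) \<odot>\<^bsub>M\<^esub> w) ^^ N) v = \<zero>\<^bsub>M\<^esub>)}"

definition A_modules_D_o :: "(int ^ 'n) set \<Rightarrow> (int ^ 'n \<Rightarrow> int) \<Rightarrow> nat \<Rightarrow>
    ('n::finite, 'k::field, 'v) Dmod set" where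
  "A_modules_D_o t lam p = {M \<in> A_modules_o t lam p. is_D_action t lam M \<and> compatible_D_action t lam M \<and>
     (\<forall>v\<in>carrier M. coact_supp M v \<subseteq> lattice_fiber t lam) \<and>
     (\<forall>i. \<forall>v\<in>carrier M. \<exists>N. (s_op t lam M i ^^ N) v = \<zero>\<^bsub>M\<^esub>)}"

text \<open>The type \<open>'v\<close> plays the role of the universe: objects have their carrier in it. The
  algebra has countable dimension, so finitely generated modules are no larger than \<open>'k list\<close>, and
  a type into which \<open>'k list\<close> embeds contains all of them up to isomorphism.\<close>

definition A_mod_D_o :: "(int ^ 'n) set \<Rightarrow> (int ^ 'n \<Rightarrow> int) \<Rightarrow> nat \<Rightarrow>
    (('n::finite, 'k::field, 'v) Dmod, 'v \<Rightarrow> 'v) category" where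
  "A_mod_D_o t lam p =
     \<lparr>Ob = A_modules_D_o t lam p,
      Arr = (\<lambda>M N. {f \<in> linear_maps (A_lam t lam) M N.
               \<forall>v\<in>carrier M. \<forall>a. f (coact M v a) = coact N (f v) a}),
      Idt = (\<lambda>M. restrict id (carrier M)),
      Comp = (\<lambda>L M N g f. compose (carrier L) g f)\<rparr>"


section \<open>The pro-objects \<open>Q\<^sub>a\<close>\<close>

definition Q_left_ideal :: "(int ^ 'n) set \<Rightarrow> (int ^ 'n \<Rightarrow> int) \<Rightarrow> int ^ 'n \<Rightarrow> nat \<Rightarrow>
    ('n::finite, 'k::field) weyl set set" where
  "Q_left_ideal t lam a N =
     {\<Oplus>\<^bsub>A_lam t lam\<^esub>i\<in>UNIV. r i \<otimes>\<^bsub>A_lam t lam\<^esub> A_cls t lam ((hplus i - of_int (a $ i)) ^ N) | r.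
        r \<in> UNIV \<rightarrow> carrier (A_lam t lam)}"

text \<open>An element of the inverse limit is a compatible sequence of cosets of these left ideals; the
  transition maps send a coset to the coset containing it.\<close>

type_synonym ('n, 'k) Qelt = "nat \<Rightarrow> ('n, 'k) weyl set set"

definition Q_mod :: "(int ^ 'n) set \<Rightarrow> (int ^ 'n \<Rightarrow> int) \<Rightarrow> int ^ 'n \<Rightarrow>
    (('n::finite, 'k::field) weyl set, ('n, 'k) Qelt) module" where
  "Q_mod t lam a =
     \<lparr>carrier = {q. \<forall>N. q N \<in> a_rcosets\<^bsub>A_lam t lam\<^esub> (Q_left_ideal t lam a N) \<and> q (Suc N) \<subseteq> q N},
      mult = undefined, one = undefined,
      zero = Q_left_ideal t lam a,
      add = (\<lambda>q r N. q N <+>\<^bsub>A_lam t lam\<^esub> r N),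
      smult = (\<lambda>u q N. \<Union>x\<in>q N. Q_left_ideal t lam a N +>\<^bsub>A_lam t lam\<^esub> (u \<otimes>\<^bsub>A_lam t lam\<^esub> x))\<rparr>"

definition Q_one :: "(int ^ 'n) set \<Rightarrow> (int ^ 'n \<Rightarrow> int) \<Rightarrow> int ^ 'n \<Rightarrow> ('n::finite, 'k::field) Qelt" where
  "Q_one t lam a = (\<lambda>N. Q_left_ideal t lam a N +>\<^bsub>A_lam t lam\<^esub> \<one>\<^bsub>A_lam t lam\<^esub>)"

text \<open>The element \<open>Q_one\<close> has weight \<open>a\<close>, so elements of weight \<open>c\<close> come from elements of the algebra
  of weight \<open>c - a\<close>.\<close>

definition Q_weight_space :: "(int ^ 'n) set \<Rightarrow> (int ^ 'n \<Rightarrow> int) \<Rightarrow> int ^ 'n \<Rightarrow> int ^ 'n \<Rightarrow>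
    ('n::finite, 'k::field) Qelt set" where
  "Q_weight_space t lam a c = {q \<in> carrier (Q_mod t lam a).
     \<forall>N. \<exists>u\<in>weyl_weights ({c - a} \<inter> g_star t). q N = Q_left_ideal t lam a N +>\<^bsub>A_lam t lam\<^esub> A_cls t lam u}"

definition Q_topology :: "(int ^ 'n) set \<Rightarrow> (int ^ 'n \<Rightarrow> int) \<Rightarrow> int ^ 'n \<Rightarrow>
    ('n::finite, 'k::field) Qelt topology" where
  "Q_topology t lam a = subtopology
     (product_topology (\<lambda>N. discrete_topology (a_rcosets\<^bsub>A_lam t lam\<^esub> (Q_left_ideal t lam a N))) UNIV)
     (carrier (Q_mod t lam a))"

definition Hom_Q :: "(int ^ 'n) set \<Rightarrow> (int ^ 'n \<Rightarrow> int) \<Rightarrow> int ^ 'n \<Rightarrow>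
    ('n::finite, 'k::field, 'v) Dmod \<Rightarrow> (('n, 'k) Qelt \<Rightarrow> 'v) set" where
  "Hom_Q t lam a M = {\<phi> \<in> linear_maps (A_lam t lam) (Q_mod t lam a) M.
     continuous_map (Q_topology t lam a) (discrete_topology (carrier M)) \<phi> \<and>
     (\<forall>c. \<forall>q\<in>Q_weight_space t lam a c. \<phi> q \<in> weight_space M c)}"


section \<open>The algebra \<open>H\<close> and its representations\<close>

text \<open>\<open>H\<close> is presented as a quotient of the free algebra over \<open>\<bbbK>[s\<^sub>1,\<dots>,s\<^sub>n]\<close> on the generators
  \<open>c\<^sub>x\<^sub>,\<^sub>y\<close>, with \<open>1\<^sub>x = c\<^sub>x\<^sub>,\<^sub>x\<close>. The first family of relations cuts \<open>\<bbbK>[s\<^sub>1,\<dots>,s\<^sub>n]\<close> down to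
  \<open>S = Sym(\<gg>\<^sub>\<bbbK>)\<close>, and the last one discards the generators with an index outside of \<open>L\<close>;
  the set \<open>L\<close> of labels will be \<^const>\<open>alcove_labels\<close>.
  When \<open>L\<close> is infinite, \<open>H\<close> itself has no unit but the local units \<open>\<Sum>\<^sub>x\<^sub>\<in>\<^sub>X 1\<^sub>x\<close>. The ring below is
  \<open>H\<close> together with the scalars \<open>S\<cdot>1\<close>, so that the representations of the \<open>S\<close>-algebra \<open>H\<close> are its
  modules \<open>N\<close> with \<open>N = \<Sum>\<^sub>x 1\<^sub>x N\<close>.\<close>

type_synonym ('n, 'k) s_poly = "nat ^ 'n \<Rightarrow>\<^sub>0 'k"

type_synonym ('n, 'k) Hfree = "((int ^ 'n) \<times> (int ^ 'n)) word \<Rightarrow>\<^sub>0 ('n, 'k) s_poly"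

definition s_var :: "'n \<Rightarrow> ('n::finite, 'k::field) s_poly" where
  "s_var i = Poly_Mapping.single (axis i 1) 1"

definition eta :: "int ^ 'n \<Rightarrow> int ^ 'n \<Rightarrow> int ^ 'n \<Rightarrow> nat ^ 'n" where
  "eta x y u = (\<chi> i. nat ((\<bar>x $ i - y $ i\<bar> + \<bar>y $ i - u $ i\<bar> - \<bar>x $ i - u $ i\<bar>) div 2))"

definition H_scal :: "('n::finite, 'k::field) s_poly \<Rightarrow> ('n, 'k) Hfree" where
  "H_scal f = Poly_Mapping.single 0 f"

definition H_rels :: "(int ^ 'n) set \<Rightarrow> (int ^ 'n) set \<Rightarrow> ('n::finite, 'k::field) Hfree set" where
  "H_rels t L =
     {H_scal (\<Sum>i\<in>UNIV. of_int (x $ i) * s_var i) | x. x \<in> t}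
   \<union> {gen (x, y) * gen (y, u) - H_scal (\<Prod>i\<in>UNIV. s_var i ^ (eta x y u $ i)) * gen (x, u) | x y u.
        x \<in> L \<and> y \<in> L \<and> u \<in> L}
   \<union> {gen (x, y) * gen (y', u) | x y y' u. x \<in> L \<and> y \<in> L \<and> y' \<in> L \<and> u \<in> L \<and> y \<noteq> y'}
   \<union> {gen (x, y) | x y. x \<notin> L \<or> y \<notin> L}"

definition H_ideal :: "(int ^ 'n) set \<Rightarrow> (int ^ 'n) set \<Rightarrow> ('n::finite, 'k::field) Hfree set" where
  "H_ideal t L = Idl\<^bsub>class_ring UNIV\<^esub> (H_rels t L)"

definition H_alg :: "(int ^ 'n) set \<Rightarrow> (int ^ 'n) set \<Rightarrow> ('n::finite, 'k::field) Hfree set ring" where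
  "H_alg t L = class_ring UNIV Quot H_ideal t L"

definition H_cls :: "(int ^ 'n) set \<Rightarrow> (int ^ 'n) set \<Rightarrow> ('n::finite, 'k::field) Hfree \<Rightarrow>
    ('n, 'k) Hfree set" where
  "H_cls t L f = H_ideal t L +>\<^bsub>class_ring UNIV\<^esub> f"

definition H_modules_o :: "(int ^ 'n) set \<Rightarrow> (int ^ 'n) set \<Rightarrow>
    (('n::finite, 'k::field) Hfree set, 'w) module set" where
  "H_modules_o t L = {N. left_module (H_alg t L) N \<and>
     (\<forall>v\<in>carrier N. \<exists>X. finite X \<and> X \<subseteq> L \<and> v = (\<Oplus>\<^bsub>N\<^esub>x\<in>X. H_cls t L (gen (x, x)) \<odot>\<^bsub>N\<^esub> v)) \<and>
     (\<exists>B. finite B \<and> B \<subseteq> carrier N \<and> (\<forall>v\<in>carrier N. \<exists>c :: 'w \<Rightarrow> 'k.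
        v = (\<Oplus>\<^bsub>N\<^esub>w\<in>B. H_cls t L (H_scal (Poly_Mapping.single 0 (c w))) \<odot>\<^bsub>N\<^esub> w))) \<and>
     (\<forall>i. \<exists>m. \<forall>v\<in>carrier N. ((\<lambda>w. H_cls t L (H_scal (s_var i)) \<odot>\<^bsub>N\<^esub> w) ^^ m) v = \<zero>\<^bsub>N\<^esub>)}"

definition H_mod_o :: "(int ^ 'n) set \<Rightarrow> (int ^ 'n) set \<Rightarrow>
    ((('n::finite, 'k::field) Hfree set, 'w) module, 'w \<Rightarrow> 'w) category" where
  "H_mod_o t L =
     \<lparr>Ob = H_modules_o t L,
      Arr = (\<lambda>M N. linear_maps (H_alg t L) M N),
      Idt = (\<lambda>M. restrict id (carrier M)),
      Comp = (\<lambda>K M N g f. compose (carrier K) g f)\<rparr>"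


section \<open>The functor\<close>

definition m_elt :: "int ^ 'n \<Rightarrow> ('n::finite, 'k::field) weyl" where
  "m_elt b = (\<Prod>i\<leftarrow>coords. zW i ^ nat (b $ i)) * (\<Prod>i\<leftarrow>coords. dW i ^ nat (- b $ i))"

text \<open>\<open>q(s\<^sub>i, k)\<close>; when \<open>k\<close> is invertible in \<open>\<bbbK>\<close>, \<open>s\<^sub>i + k\<close> is bijective on \<open>M\<close> as \<open>s\<^sub>i\<close> is locally
  nilpotent.\<close>

definition q_op :: "(int ^ 'n) set \<Rightarrow> (int ^ 'n \<Rightarrow> int) \<Rightarrow>
    ('n::finite, 'k::field, 'v) Dmod \<Rightarrow> 'n \<Rightarrow> int \<Rightarrow> 'v \<Rightarrow> 'v" where
  "q_op t lam M i k = (if of_int k = (0 :: 'k) then id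
     else the_inv_into (carrier M) (\<lambda>v. s_op t lam M i v \<oplus>\<^bsub>M\<^esub> A_cls t lam (of_int k) \<odot>\<^bsub>M\<^esub> v))"

text \<open>The operator from weight \<open>a\<close> to weight \<open>a + b\<close>.\<close>

definition shift_op :: "(int ^ 'n) set \<Rightarrow> (int ^ 'n \<Rightarrow> int) \<Rightarrow>
    ('n::finite, 'k::field, 'v) Dmod \<Rightarrow> int ^ 'n \<Rightarrow> int ^ 'n \<Rightarrow> 'v \<Rightarrow> 'v" where
  "shift_op t lam M a b v = A_cls t lam (m_elt b) \<odot>\<^bsub>M\<^esub>
     fold (\<lambda>i. fold (\<lambda>j. q_op t lam M i (a $ i + j)) [1..b $ i]) coords v"

text \<open>The action of the free algebra on \<open>\<Oplus>\<^sub>x W\<^sub>b\<^sub>(\<^sub>x\<^sub>)(M)\<close>, whose elements are families \<open>w\<close> of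
  vectors: first the generators \<open>c\<^sub>x\<^sub>,\<^sub>y\<close> and the words in them, then the coefficients.\<close>

definition c_act :: "(int ^ 'n) set \<Rightarrow> (int ^ 'n \<Rightarrow> int) \<Rightarrow> (int ^ 'n) set \<Rightarrow> (int ^ 'n \<Rightarrow> int ^ 'n) \<Rightarrow>
    ('n::finite, 'k::field, 'v) Dmod \<Rightarrow> (int ^ 'n) \<times> (int ^ 'n) \<Rightarrow> (int ^ 'n \<Rightarrow> 'v) \<Rightarrow> int ^ 'n \<Rightarrow> 'v" where
  "c_act t lam L b M xy w = (case xy of (x, y) \<Rightarrow> \<lambda>u\<in>L.
     if u = x \<and> y \<in> L then shift_op t lam M (b y) (b x - b y) (w y) else \<zero>\<^bsub>M\<^esub>)"

definition s_poly_act :: "(int ^ 'n) set \<Rightarrow> (int ^ 'n \<Rightarrow> int) \<Rightarrow>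
    ('n::finite, 'k::field, 'v) Dmod \<Rightarrow> ('n, 'k) s_poly \<Rightarrow> 'v \<Rightarrow> 'v" where
  "s_poly_act t lam M f v = (\<Oplus>\<^bsub>M\<^esub>m\<in>Poly_Mapping.keys f.
     A_cls t lam (scal (Poly_Mapping.lookup f m)) \<odot>\<^bsub>M\<^esub> fold (\<lambda>i. s_op t lam M i ^^ (m $ i)) coords v)"

definition H_act :: "(int ^ 'n) set \<Rightarrow> (int ^ 'n \<Rightarrow> int) \<Rightarrow> (int ^ 'n) set \<Rightarrow> (int ^ 'n \<Rightarrow> int ^ 'n) \<Rightarrow>
    ('n::finite, 'k::field, 'v) Dmod \<Rightarrow> ('n, 'k) Hfree \<Rightarrow> (int ^ 'n \<Rightarrow> 'v) \<Rightarrow> int ^ 'n \<Rightarrow> 'v" where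
  "H_act t lam L b M f w = (\<lambda>x\<in>L. \<Oplus>\<^bsub>M\<^esub>e\<in>Poly_Mapping.keys f.
     s_poly_act t lam M (Poly_Mapping.lookup f e) (foldr (c_act t lam L b M) (letters e) w x))"

definition Hom_sum :: "(int ^ 'n) set \<Rightarrow> (int ^ 'n \<Rightarrow> int) \<Rightarrow> (int ^ 'n) set \<Rightarrow> (int ^ 'n \<Rightarrow> int ^ 'n) \<Rightarrow>
    ('n::finite, 'k::field, 'v) Dmod \<Rightarrow> (int ^ 'n \<Rightarrow> ('n, 'k) Qelt \<Rightarrow> 'v) set" where
  "Hom_sum t lam L b M = {\<Phi> \<in> (\<Pi>\<^sub>E x\<in>L. Hom_Q t lam (b x) M).
     finite {x\<in>L. \<exists>q\<in>carrier (Q_mod t lam (b x)). \<Phi> x q \<noteq> \<zero>\<^bsub>M\<^esub>}}"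

text \<open>The identification of \<open>\<Oplus>\<^sub>x Hom(P\<^sub>x, M)\<close> with \<open>\<Oplus>\<^sub>x W\<^sub>b\<^sub>(\<^sub>x\<^sub>)(M)\<close>.\<close>

definition eval_one :: "(int ^ 'n) set \<Rightarrow> (int ^ 'n \<Rightarrow> int) \<Rightarrow> (int ^ 'n) set \<Rightarrow> (int ^ 'n \<Rightarrow> int ^ 'n) \<Rightarrow>
    (int ^ 'n \<Rightarrow> ('n::finite, 'k::field) Qelt \<Rightarrow> 'v) \<Rightarrow> int ^ 'n \<Rightarrow> 'v" where
  "eval_one t lam L b \<Phi> = (\<lambda>x\<in>L. \<Phi> x (Q_one t lam (b x)))"

text \<open>An element of \<open>H\<close> is a coset; it acts through any of its representatives.\<close>

definition Hom_sum_module :: "(int ^ 'n) set \<Rightarrow> (int ^ 'n \<Rightarrow> int) \<Rightarrow> (int ^ 'n) set \<Rightarrow>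
    (int ^ 'n \<Rightarrow> int ^ 'n) \<Rightarrow> ('n::finite, 'k::field, 'v) Dmod \<Rightarrow>
    (('n, 'k) Hfree set, int ^ 'n \<Rightarrow> ('n, 'k) Qelt \<Rightarrow> 'v) module" where
  "Hom_sum_module t lam L b M =
     \<lparr>carrier = Hom_sum t lam L b M,
      mult = undefined, one = undefined,
      zero = (\<lambda>x\<in>L. \<lambda>q\<in>carrier (Q_mod t lam (b x)). \<zero>\<^bsub>M\<^esub>),
      add = (\<lambda>\<Phi> \<Psi>. \<lambda>x\<in>L. \<lambda>q\<in>carrier (Q_mod t lam (b x)). \<Phi> x q \<oplus>\<^bsub>M\<^esub> \<Psi> x q),
      smult = (\<lambda>h \<Phi>. the_inv_into (Hom_sum t lam L b M) (eval_one t lam L b)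
                 (H_act t lam L b M (SOME f. f \<in> h) (eval_one t lam L b \<Phi>)))\<rparr>"

definition Hom_P_functor :: "(int ^ 'n) set \<Rightarrow> (int ^ 'n \<Rightarrow> int) \<Rightarrow> (int ^ 'n) set \<Rightarrow>
    (int ^ 'n \<Rightarrow> int ^ 'n) \<Rightarrow>
    (('n::finite, 'k::field, 'v) Dmod, 'v \<Rightarrow> 'v,
     (('n, 'k) Hfree set, int ^ 'n \<Rightarrow> ('n, 'k) Qelt \<Rightarrow> 'v) module,
     (int ^ 'n \<Rightarrow> ('n, 'k) Qelt \<Rightarrow> 'v) \<Rightarrow> (int ^ 'n \<Rightarrow> ('n, 'k) Qelt \<Rightarrow> 'v)) cfunctor" where
  "Hom_P_functor t lam L b =
     \<lparr>FOb = Hom_sum_module t lam L b,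
      FArr = (\<lambda>M N f. \<lambda>\<Phi>\<in>Hom_sum t lam L b M. \<lambda>x\<in>L. \<lambda>q\<in>carrier (Q_mod t lam (b x)). f (\<Phi> x q))\<rparr>"

end

theory Submission
  imports Defs
begin

text \<open>
  On a vector of weight \<open>a\<close> the elements \<open>h\<^sub>i - a\<^sub>i\<close> act as the commuting nilpotent operators \<open>s\<^sub>i\<close>, and
  every homogeneous element of the Weyl algebra is a monomial \<open>m(b)\<close> times a polynomial in the \<open>h\<^sub>i\<close>. An
  object is therefore a family of modules \<open>W\<^sub>a\<close> over \<open>\<bbbK>[s]\<close>, one for each weight \<open>a\<close> in the fibre over \<open>\<lambda>\<close>,
  linked by the operators \<open>m(b)\<close>. Going up from \<open>a\<close> to \<open>a + b\<close> and back multiplies by factors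
  \<open>s\<^sub>i + a\<^sub>i + j\<close>. In characteristic \<open>p\<close> such a factor is invertible on nilpotent \<open>s\<^sub>i\<close> unless \<open>p\<close> divides
  \<open>a\<^sub>i + j\<close>, when it is \<open>s\<^sub>i\<close>. Dividing \<open>m(b)\<close> by the invertible factors, which is what the operators \<open>q\<close>
  do, leaves normalised operators between the weight spaces whose composites depend only on the
  alcoves of the weights: a power \<open>s\<^sup>\<eta>\<close> appears that counts the walls crossed back and forth
  (\<open>tr_tr\<close>). This is the composition law of the generators \<open>c\<^sub>x\<^sub>,\<^sub>y\<close> of \<open>H\<close>. In particular the weight spaces
  of one alcove are isomorphic to each other, and nothing is lost by keeping one weight per alcove.

  The bookkeeping is done once and for all in a universal module, the functions on the weight lattice
  with values in \<open>\<bbbK>[s]\<close>. There an element \<open>u\<close> has matrix coefficients in \<open>\<bbbK>[s]\<close>, and splitting off the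
  powers of \<open>s\<close> forced by the alcoves gives normalised coefficients, which multiply by the same
  rule with \<open>s\<^sup>\<eta>\<close> (\<open>ncoeff_mult\<close>). In any object a homogeneous \<open>u\<close> acts as its normalised coefficient followed
  by a normalised operator (\<open>act_eq_tr\<close>).

  The functor takes values in representations of \<open>H\<close>: the pro-object \<open>Q\<^sub>a\<close> represents \<open>W\<^sub>a\<close>, as the multiples
  of its generator are dense and a weight vector is killed by powers of the \<open>h\<^sub>i - a\<^sub>i\<close> (\<open>HomQ_inj\<close>,
  \<open>Q_map_HomQ\<close>), and objects are finite-dimensional. For the latter, if infinitely many \<open>m(b)\<close> acted
  nontrivially on a vector, a Dickson-type argument (\<open>conformal_growth\<close>) would exhibit a direction in
  which arbitrarily high powers of a Frobenius monomial act nontrivially, contrary to the support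
  condition. The functor is full and faithful because an \<open>H\<close>-linear map is given on the weight spaces
  at the base points of the alcoves and extends uniquely along the normalised operators (\<open>Farr_lift\<close>,
  \<open>Farr_faithful\<close>).

  For a representation \<open>N\<close> of \<open>H\<close>, an object is obtained by taking \<open>1\<^sub>x N\<close> as the weight space of every weight
  in the alcove \<open>x\<close> and letting \<open>u\<close> act by its normalised coefficients followed by the \<open>c\<^sub>x\<^sub>,\<^sub>y\<close>; the two
  composition laws match (\<open>weyl_act_mult\<close>). Alcoves are finite and \<open>N\<close> involves finitely many of them, so
  the result is finite-dimensional, and Frobenius monomials of high degree kill it because they either
  leave the finite set of weights or contain a high power of some \<open>s\<^sub>i\<close> (\<open>weyl_act_frob\<close>). Being
  finite-dimensional, it can be coded in the prescribed type. The functor sends it back to \<open>N\<close>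
  (\<open>tr_code_concentrated\<close>, \<open>unit_map_bij\<close>), and a full, faithful and essentially surjective functor is
  an equivalence (\<open>equivalenceI\<close>).
\<close>

section \<open>Normal forms in the Weyl algebra\<close>

lemma set_coords [simp]: "set coords = (UNIV :: 'n::finite set)"
  and distinct_coords [simp]: "distinct (coords :: 'n list)"
proof -
  have "set (coords :: 'n list) = UNIV \<and> distinct (coords :: 'n list)"
    unfolding coords_def by (rule someI_ex) (rule finite_distinct_list, simp)
  then show "set coords = (UNIV :: 'n::finite set)" "distinct (coords :: 'n list)" by auto
qed

lemma commute_prod_list:
  fixes x :: "'a::monoid_mult"
  shows "(\<And>i. i \<in> set is \<Longrightarrow> x * f i = f i * x) \<Longrightarrow> x * (\<Prod>i\<leftarrow>is. f i) = (\<Prod>i\<leftarrow>is. f i) * x"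
proof (induction "is")
  case (Cons i "is")
  have "x * (f i * (\<Prod>i\<leftarrow>is. f i)) = f i * (x * (\<Prod>i\<leftarrow>is. f i))"
    using Cons.prems by (simp flip: mult.assoc)
  also have "\<dots> = f i * (\<Prod>i\<leftarrow>is. f i) * x"
    using Cons by (simp add: mult.assoc)
  finally show ?case by simp
qed simp

lemma commute_mult:
  fixes x :: "'a::monoid_mult"
  assumes "x * y = y * x" "x * z = z * x" shows "x * (y * z) = y * z * x"
proof -
  have "x * (y * z) = y * x * z" by (simp only: assms(1) mult.assoc[symmetric])
  also have "\<dots> = y * z * x" by (simp only: assms(2) mult.assoc)
  finally show ?thesis .
qed

lemma prod_list_mult_commuting:
  fixes f g :: "'i \<Rightarrow> 'a::monoid_mult"
  shows "(\<And>i j. i \<in> set is \<Longrightarrow> j \<in> set is \<Longrightarrow> f i * g j = g j * f i) \<Longrightarrow>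
    (\<Prod>i\<leftarrow>is. f i * g i) = (\<Prod>i\<leftarrow>is. f i) * (\<Prod>i\<leftarrow>is. g i)"
proof (induction "is")
  case (Cons i "is")
  have "g i * (\<Prod>i\<leftarrow>is. f i) = (\<Prod>i\<leftarrow>is. f i) * g i"
    by (rule commute_prod_list) (use Cons.prems in simp)
  note comm = this
  have IH: "(\<Prod>i\<leftarrow>is. f i * g i) = (\<Prod>i\<leftarrow>is. f i) * (\<Prod>i\<leftarrow>is. g i)"
    by (rule Cons.IH) (rule Cons.prems; simp)
  have "f i * g i * ((\<Prod>i\<leftarrow>is. f i) * (\<Prod>i\<leftarrow>is. g i))
      = f i * (g i * (\<Prod>i\<leftarrow>is. f i)) * (\<Prod>i\<leftarrow>is. g i)"
    by (simp only: mult.assoc)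
  also have "\<dots> = f i * (\<Prod>i\<leftarrow>is. f i) * (g i * (\<Prod>i\<leftarrow>is. g i))"
    unfolding comm by (simp only: mult.assoc)
  finally show ?case by (simp add: IH)
qed simp

text \<open>For products over the coordinates in which the factors of different coordinates commute.\<close>

lemma prod_list_extract:
  fixes f g :: "'i \<Rightarrow> 'a::monoid_mult"
  assumes "distinct is" "i \<in> set is" "f i = y * g i"
    and "\<And>j. j \<in> set is \<Longrightarrow> j \<noteq> i \<Longrightarrow> f j = g j \<and> g j * y = y * g j"
  shows "(\<Prod>j\<leftarrow>is. f j) = y * (\<Prod>j\<leftarrow>is. g j)"
  using assms
proof (induction "is")
  case (Cons k "is")
  show ?case
  proof (cases "k = i")
    case True
    have "map f is = map g is" by (rule map_cong) (use Cons.prems True in auto)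
    then have "prod_list (map f is) = prod_list (map g is)" by (rule arg_cong)
    then show ?thesis using True Cons.prems by (simp add: mult.assoc)
  next
    case False
    then have "(\<Prod>j\<leftarrow>is. f j) = y * (\<Prod>j\<leftarrow>is. g j)" using Cons by auto
    moreover have "f k = g k" "g k * y = y * g k" using Cons.prems False by auto
    ultimately show ?thesis by (simp flip: mult.assoc)
  qed
qed simp

lemma poly_mapping_induct_single [case_names single add]:
  assumes "\<And>a c. P (Poly_Mapping.single a c)" and "\<And>f g. P f \<Longrightarrow> P g \<Longrightarrow> P (f + g)"
  shows "P (f :: 'a \<Rightarrow>\<^sub>0 'b::comm_monoid_add)"
proof (induction f rule: poly_mapping_single_add_induct)
  case zero
  show ?case using assms(1)[of undefined 0] by simp
qed (auto intro: assms)

subsection \<open>Scalars and words\<close>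

lemma scal_add: "scal (c + d) = scal c + scal d"
  by (simp add: scal_def plus_weyl.abs_eq single_add)

lemma scal_mult: "scal (c * d) = scal c * scal d"
  by (simp add: scal_def times_weyl.abs_eq mult_single)

lemma scal_0 [simp]: "scal 0 = 0"
  by (simp add: scal_def zero_weyl.abs_eq)

lemma scal_1 [simp]: "scal 1 = 1"
  by (simp add: scal_def one_weyl.abs_eq)

lemma scal_uminus: "scal (- c) = - scal c"
  using scal_add[of c "- c"] by (simp add: eq_neg_iff_add_eq_0 add.commute)

lemma scal_of_nat: "scal (of_nat k) = of_nat k"
  by (induction k) (simp_all add: scal_add)

lemma scal_of_int: "scal (of_int k) = of_int k"
proof (cases k)
  case (nonneg n)
  then show ?thesis by (simp add: scal_of_nat)
next
  case (neg n)
  have "scal (of_int (- int (Suc n))) = - scal (of_nat (Suc n))"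
    by (simp only: of_int_minus of_int_of_nat_eq scal_uminus)
  then show ?thesis using neg by (simp only: scal_of_nat of_int_minus of_int_of_nat_eq)
qed

lemma single_zero_commute:
  "Poly_Mapping.single (0::'g word) (c::'k::comm_ring_1) * f = f * Poly_Mapping.single 0 c"
  by (induction f rule: poly_mapping_induct_single)
    (simp_all add: mult_single mult.commute distrib_left distrib_right)

lemma scal_commute: "scal c * u = u * scal c"
  by (induction u rule: weyl.abs_induct) (simp add: scal_def times_weyl.abs_eq single_zero_commute)

lemma of_int_commute: "of_int k * (u :: ('n, 'k::comm_ring_1) weyl) = u * of_int k"
  using scal_commute[of "of_int k" u] by (simp add: scal_of_int)

fun weyl_letter :: "'n weyl_gen \<Rightarrow> ('n, 'k::comm_ring_1) weyl" where
  "weyl_letter (Zg i) = zW i"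
| "weyl_letter (Dg i) = dW i"

definition weyl_word :: "'n weyl_gen list \<Rightarrow> 'k \<Rightarrow> ('n, 'k::comm_ring_1) weyl" where
  "weyl_word ws c = abs_weyl (Poly_Mapping.single (Word ws) c)"

lemma weyl_word_Nil [simp]: "weyl_word [] c = scal c"
  by (simp add: weyl_word_def scal_def zero_word_def)

lemma weyl_word_Cons [simp]: "weyl_word (x # ws) c = weyl_letter x * weyl_word ws c"
  by (cases x) (simp_all add: weyl_word_def zW_def dW_def gen_def times_weyl.abs_eq mult_single
      plus_word_def)

lemma sum_single_lookup: "(\<Sum>w\<in>Poly_Mapping.keys f. Poly_Mapping.single w (Poly_Mapping.lookup f w)) = f"
  by (rule poly_mapping_eqI) (simp add: lookup_sum lookup_single when_def in_keys_iff)

lemma abs_weyl_induct [case_names word add]: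
  assumes "\<And>w. w \<in> Poly_Mapping.keys f \<Longrightarrow> P (weyl_word (letters w) (Poly_Mapping.lookup f w))"
    and "P 0" and "\<And>u v. P u \<Longrightarrow> P v \<Longrightarrow> P (u + v)"
  shows "P (abs_weyl f)"
proof -
  have "P (abs_weyl (\<Sum>w\<in>S. Poly_Mapping.single w (Poly_Mapping.lookup f w)))"
    if "finite S" "S \<subseteq> Poly_Mapping.keys f" for S
    using that
  proof (induction S)
    case empty then show ?case using assms(2) by (simp add: zero_weyl.abs_eq)
  next
    case (insert w S)
    then have "P (weyl_word (letters w) (Poly_Mapping.lookup f w)
      + abs_weyl (\<Sum>w\<in>S. Poly_Mapping.single w (Poly_Mapping.lookup f w)))"
      using assms by auto
    then show ?case using insert by (simp add: weyl_word_def plus_weyl.abs_eq)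
  qed
  from this[of "Poly_Mapping.keys f"] show ?thesis
    by (simp add: sum_single_lookup)
qed

lemma word_weight_Nil [simp]: "word_weight (Word []) = 0"
  and word_weight_Cons [simp]: "word_weight (Word (x # ws)) = gen_weight x + word_weight (Word ws)"
  by (simp_all add: word_weight_def)

lemma weyl_weights_induct [consumes 1, case_names zero word add]:
  assumes "u \<in> weyl_weights B" and "P 0"
    and "\<And>ws c. word_weight (Word ws) \<in> B \<Longrightarrow> P (weyl_word ws c)"
    and "\<And>u v. P u \<Longrightarrow> P v \<Longrightarrow> P (u + v)"
  shows "P u"
proof -
  from assms(1) obtain f where f: "u = abs_weyl f" "\<forall>w\<in>Poly_Mapping.keys f. word_weight w \<in> B"
    by (auto simp: weyl_weights_def)
  show ?thesis unfolding f(1)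
    by (rule abs_weyl_induct) (use f(2) assms(2-4) in auto)
qed

subsection \<open>Weights\<close>

lemma weyl_weightsI: "\<forall>w\<in>Poly_Mapping.keys f. word_weight w \<in> B \<Longrightarrow> abs_weyl f \<in> weyl_weights B"
  by (auto simp: weyl_weights_def)

lemma weyl_weights_mono: "A \<subseteq> B \<Longrightarrow> weyl_weights A \<subseteq> weyl_weights B"
  by (auto simp: weyl_weights_def)

lemma weyl_weights_subsetD: "u \<in> weyl_weights {b} \<Longrightarrow> b \<in> B \<Longrightarrow> u \<in> weyl_weights B"
  using weyl_weights_mono[of "{b}" B] by auto

lemma weyl_weights_zero [simp]: "0 \<in> weyl_weights B"
  using weyl_weightsI[of 0 B] by (simp add: zero_weyl.abs_eq)

lemma weyl_weights_add: "u \<in> weyl_weights B \<Longrightarrow> v \<in> weyl_weights B \<Longrightarrow> u + v \<in> weyl_weights B"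
proof -
  assume "u \<in> weyl_weights B" "v \<in> weyl_weights B"
  then obtain f g where "u = abs_weyl f" "\<forall>w\<in>Poly_Mapping.keys f. word_weight w \<in> B"
    "v = abs_weyl g" "\<forall>w\<in>Poly_Mapping.keys g. word_weight w \<in> B"
    by (auto simp: weyl_weights_def)
  then show ?thesis
    using Poly_Mapping.keys_add[of f g] by (auto simp: plus_weyl.abs_eq intro!: weyl_weightsI)
qed

lemma word_weight_add: "word_weight (v + w) = word_weight v + word_weight w"
  by (simp add: word_weight_def plus_word_def)

lemma weyl_weights_mult:
  assumes "u \<in> weyl_weights A" "v \<in> weyl_weights B" "\<And>a b. a \<in> A \<Longrightarrow> b \<in> B \<Longrightarrow> a + b \<in> C"
  shows "u * v \<in> weyl_weights C"
proof -
  from assms obtain f g where "u = abs_weyl f" "\<forall>w\<in>Poly_Mapping.keys f. word_weight w \<in> A"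
    "v = abs_weyl g" "\<forall>w\<in>Poly_Mapping.keys g. word_weight w \<in> B"
    by (auto simp: weyl_weights_def)
  moreover have "\<exists>w1\<in>Poly_Mapping.keys f. \<exists>w2\<in>Poly_Mapping.keys g. w = w1 + w2"
    if "w \<in> Poly_Mapping.keys (f * g)" for w
    using Poly_Mapping.keys_mult[of f g] that by fast
  ultimately show ?thesis
    using assms(3) by (fastforce simp: times_weyl.abs_eq word_weight_add intro!: weyl_weightsI)
qed

lemma weyl_weights_scal: "0 \<in> B \<Longrightarrow> scal c \<in> weyl_weights B"
  unfolding scal_def by (rule weyl_weightsI) (auto simp: zero_word_def)

lemma weyl_weights_one: "0 \<in> B \<Longrightarrow> 1 \<in> weyl_weights B"
  using weyl_weights_scal[of B 1] by simp

lemma weyl_weights_of_int: "0 \<in> B \<Longrightarrow> of_int k \<in> weyl_weights B"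
  using weyl_weights_scal[of B "of_int k"] by (simp add: scal_of_int)

lemma weyl_weights_uminus: "u \<in> weyl_weights B \<Longrightarrow> - u \<in> weyl_weights B"
  using weyl_weights_mult[of "-1" "{0}" u B B] weyl_weights_of_int[of "{0}" "-1"] by simp

lemma weyl_weights_diff: "u \<in> weyl_weights B \<Longrightarrow> v \<in> weyl_weights B \<Longrightarrow> u - v \<in> weyl_weights B"
  using weyl_weights_add[of u B "- v"] weyl_weights_uminus[of v B] by simp

lemma weyl_weights_sum: "(\<And>i. i \<in> I \<Longrightarrow> f i \<in> weyl_weights B) \<Longrightarrow> (\<Sum>i\<in>I. f i) \<in> weyl_weights B"
  by (induction I rule: infinite_finite_induct) (auto intro: weyl_weights_add)

lemma weyl_weights_prod_list:
  "(\<And>i. i \<in> set is \<Longrightarrow> f i \<in> weyl_weights {w i}) \<Longrightarrow>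
    (\<Prod>i\<leftarrow>is. f i) \<in> weyl_weights {\<Sum>i\<leftarrow>is. w i}"
proof (induction "is")
  case Nil
  then show ?case by (simp add: weyl_weights_one)
next
  case (Cons i "is")
  then show ?case by (auto intro!: weyl_weights_mult[of "f i" "{w i}" _ "{\<Sum>i\<leftarrow>is. w i}"])
qed

lemma weyl_weights_power:
  assumes "u \<in> weyl_weights {b}" shows "u ^ k \<in> weyl_weights {int k *s b}"
proof (induction k)
  case 0
  then show ?case by (simp add: weyl_weights_one)
next
  case (Suc k)
  then show ?case
    by (auto intro!: weyl_weights_mult[OF assms Suc] simp: vec_eq_iff algebra_simps)
qed

lemma weyl_weights_zW: "zW i \<in> weyl_weights {axis i 1}"
  unfolding zW_def gen_def by (rule weyl_weightsI) auto

lemma weyl_weights_dW: "dW i \<in> weyl_weights {- axis i 1}"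
  unfolding dW_def gen_def by (rule weyl_weightsI) auto

lemma weyl_weights_hplus: "0 \<in> B \<Longrightarrow> hplus i \<in> weyl_weights B"
  unfolding hplus_def
  by (rule weyl_weights_mult[OF weyl_weights_zW weyl_weights_dW]) auto

lemma weyl_weights_mult0: "u \<in> weyl_weights {0} \<Longrightarrow> v \<in> weyl_weights {0} \<Longrightarrow> u * v \<in> weyl_weights {0}"
  by (rule weyl_weights_mult) auto

subsection \<open>Commutation relations\<close>

lemma zW_commute: "zW i * zW j = zW j * zW i"
proof -
  have "gen (Zg i) * gen (Zg j) - gen (Zg j) * gen (Zg i) \<in> weyl_rels"
    unfolding weyl_rels_def by blast
  from two_sided_ideal.rel[OF this, of 1 1] show ?thesis
    by (simp add: zW_def times_weyl.abs_eq weyl.abs_eq_iff weyl_rel_def)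
qed

lemma dW_commute: "dW i * dW j = dW j * dW i"
proof -
  have "gen (Dg i) * gen (Dg j) - gen (Dg j) * gen (Dg i) \<in> weyl_rels"
    unfolding weyl_rels_def by blast
  from two_sided_ideal.rel[OF this, of 1 1] show ?thesis
    by (simp add: dW_def times_weyl.abs_eq weyl.abs_eq_iff weyl_rel_def)
qed

lemma dW_zW: "dW i * zW j = zW j * dW i + (if i = j then 1 else 0)"
  using dW_zW_commutator[of i j] by (simp add: algebra_simps split: if_splits)

lemma dW_zW_commute: "i \<noteq> j \<Longrightarrow> dW i * zW j = zW j * dW i"
  by (simp add: dW_zW)

lemma commute_power2: "x * y = y * x \<Longrightarrow> x ^ m * y ^ k = y ^ k * (x ^ m :: 'a::monoid_mult)"
  by (rule power_commuting_commutes[OF power_commuting_commutes[symmetric], symmetric]) simp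

lemma hplus_letter:
  fixes x :: "'n::finite weyl_gen"
  shows "hplus i * weyl_letter x
    = (weyl_letter x * (hplus i + of_int (gen_weight x $ i)) :: ('n, 'k::comm_ring_1) weyl)"
proof (cases x)
  case (Zg j)
  have "zW i * dW i * zW j = (zW i * zW j * dW i + (if i = j then zW j else 0) :: ('n, 'k) weyl)"
    by (simp add: dW_zW mult.assoc distrib_left)
  also have "\<dots> = zW j * (zW i * dW i) + (if i = j then zW j else 0)"
    by (simp only: zW_commute[of i j] mult.assoc)
  finally show ?thesis using Zg by (auto simp: hplus_def distrib_left axis_def)
next
  case (Dg j)
  have "dW j * (zW i * dW i) = (zW i * (dW j * dW i) + (if i = j then dW j else 0) :: ('n, 'k) weyl)"
    by (simp add: dW_zW distrib_right mult.assoc[symmetric])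
  also have "\<dots> = zW i * dW i * dW j + (if i = j then dW j else 0)"
    by (simp only: dW_commute[of j i] mult.assoc)
  finally show ?thesis using Dg by (auto simp: hplus_def right_diff_distrib axis_def)
qed

lemma hplus_word:
  "hplus i * weyl_word ws c = weyl_word ws c * (hplus i + of_int (word_weight (Word ws) $ i))"
proof (induction ws)
  case Nil
  show ?case by (simp add: scal_commute)
next
  case (Cons x ws)
  have "hplus i * weyl_word (x # ws) c
      = weyl_letter x * (hplus i * weyl_word ws c + of_int (gen_weight x $ i) * weyl_word ws c)"
    by (simp add: hplus_letter distrib_right distrib_left flip: mult.assoc)
  then show ?case by (simp add: Cons of_int_commute algebra_simps)
qed

text \<open>This is the relation that makes \<open>h\<^sub>i\<close> act on vectors of weight \<open>a\<close> as \<open>s\<^sub>i + a\<^sub>i\<close> with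
  \<open>s\<^sub>i\<close> commuting with the algebra.\<close>

lemma hplus_homogeneous:
  assumes "u \<in> weyl_weights {b}"
  shows "hplus i * u = u * (hplus i + of_int (b $ i))"
  using assms
  by (induction rule: weyl_weights_induct) (auto simp: hplus_word distrib_left distrib_right)

lemma hplus_commute: "hplus i * hplus j = hplus j * (hplus i :: ('n::finite, 'k::comm_ring_1) weyl)"
  using hplus_homogeneous[OF weyl_weights_hplus[of "{0}" j], of i] by simp

subsection \<open>Polynomials in the commuting elements \<open>h\<^sub>i - a\<^sub>i\<close>\<close>

definition hdiff :: "int ^ 'n \<Rightarrow> 'n \<Rightarrow> ('n::finite, 'k::field) weyl" where
  "hdiff a i = hplus i - of_int (a $ i)"

definition hmonom :: "int ^ 'n \<Rightarrow> nat ^ 'n \<Rightarrow> ('n::finite, 'k::field) weyl" where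
  "hmonom a m = (\<Prod>i\<leftarrow>coords. hdiff a i ^ (m $ i))"

text \<open>The ring homomorphism with \<open>s\<^sub>i \<mapsto> h\<^sub>i - a\<^sub>i\<close>.\<close>

definition heval :: "int ^ 'n \<Rightarrow> ('n::finite, 'k::field) s_poly \<Rightarrow> ('n, 'k) weyl" where
  "heval a f = (\<Sum>m\<in>Poly_Mapping.keys f. scal (Poly_Mapping.lookup f m) * hmonom a m)"

lemma hdiff_commute: "hdiff a i * hdiff a j = hdiff a j * hdiff a i"
  by (simp add: hdiff_def left_diff_distrib right_diff_distrib hplus_commute[of i j]
      of_int_commute[of _ "hplus _"] mult.commute[of "a $ i"] flip: of_int_mult)

lemma hdiff_weight: "hdiff a i \<in> weyl_weights {0}"
  unfolding hdiff_def by (intro weyl_weights_diff weyl_weights_hplus weyl_weights_of_int) auto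

lemma hdiff_shift:
  assumes "u \<in> weyl_weights {b}" shows "hdiff (a + b) i * u = u * hdiff a i"
  using hplus_homogeneous[OF assms, of i]
  by (simp add: hdiff_def algebra_simps of_int_commute)

lemma hmonom_weight: "hmonom a m \<in> weyl_weights {0}"
proof -
  have "hdiff a i ^ (m $ i) \<in> weyl_weights {0}" for i
    using weyl_weights_power[OF hdiff_weight, of a i "m $ i"] by simp
  then show ?thesis unfolding hmonom_def using weyl_weights_prod_list[of coords _ "\<lambda>_. 0"] by force
qed

lemma power_intertwine:
  fixes x :: "'a::monoid_mult"
  assumes "x * u = u * y" shows "x ^ k * u = u * y ^ k"
proof (induction k)
  case (Suc k)
  then have "x * (x ^ k * u) = x * u * y ^ k" by (simp add: mult.assoc)
  also have "\<dots> = u * y * y ^ k" by (simp only: assms)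
  finally show ?case by (simp add: mult.assoc)
qed simp

lemma hmonom_shift:
  assumes "u \<in> weyl_weights {b}" shows "hmonom (a + b) m * u = u * hmonom a m"
proof -
  have "(\<Prod>i\<leftarrow>is. hdiff (a + b) i ^ (m $ i)) * u = u * (\<Prod>i\<leftarrow>is. hdiff a i ^ (m $ i))" for "is"
  proof (induction "is")
    case (Cons i "is")
    have "hdiff (a + b) i ^ (m $ i) * u = u * hdiff a i ^ (m $ i)"
      by (rule power_intertwine) (rule hdiff_shift[OF assms])
    then have "hdiff (a + b) i ^ (m $ i) * (u * H) = u * (hdiff a i ^ (m $ i) * H)" for H
      by (simp flip: mult.assoc)
    with Cons show ?case by (simp add: mult.assoc)
  qed simp
  then show ?thesis by (simp add: hmonom_def)
qed

lemma hmonom_add: "hmonom a (m + m') = hmonom a m * hmonom a m'"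
  unfolding hmonom_def vector_add_component power_add
  by (rule prod_list_mult_commuting) (intro commute_power2 hdiff_commute)

lemma hmonom_0 [simp]: "hmonom a 0 = 1"
proof -
  have "(\<Prod>i\<leftarrow>is. hdiff a i ^ 0) = 1" for "is" by (induction "is") auto
  then show ?thesis by (simp add: hmonom_def)
qed

lemma hmonom_axis:
  fixes a :: "int ^ 'n::finite"
  shows "hmonom a (axis i 1) = (hdiff a i :: ('n, 'k::field) weyl)"
proof -
  have "(\<Prod>j\<leftarrow>coords. hdiff a j ^ (axis i 1 $ j)) = hdiff a i * (\<Prod>j::'n\<leftarrow>coords. (1 :: ('n, 'k) weyl))"
    by (rule prod_list_extract[where i = i]) (auto simp: axis_def)
  moreover have "(\<Prod>j\<leftarrow>is. (1 :: ('n, 'k) weyl)) = 1" for "is" :: "'n list" by (induction "is") auto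
  ultimately show ?thesis by (simp add: hmonom_def)
qed

lemma heval_superset:
  "finite S \<Longrightarrow> Poly_Mapping.keys f \<subseteq> S \<Longrightarrow> heval a f = (\<Sum>m\<in>S. scal (Poly_Mapping.lookup f m) * hmonom a m)"
  unfolding heval_def by (rule sum.mono_neutral_left) (auto simp: in_keys_iff)

lemma heval_single [simp]: "heval a (Poly_Mapping.single m c) = scal c * hmonom a m"
  by (simp add: heval_def)

lemma heval_add: "heval a (f + g) = heval a f + heval a g"
proof -
  let ?S = "Poly_Mapping.keys f \<union> Poly_Mapping.keys g"
  have "heval a h = (\<Sum>m\<in>?S. scal (Poly_Mapping.lookup h m) * hmonom a m)"
    if "Poly_Mapping.keys h \<subseteq> ?S" for h
    by (rule heval_superset) (use that in auto)
  from this[of f] this[of g] this[of "f + g"] Poly_Mapping.keys_add[of f g] show ?thesis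
    by (simp add: lookup_add scal_add distrib_right sum.distrib)
qed

lemma heval_mult: "heval a (f * g) = heval a f * heval a g"
proof (induction f rule: poly_mapping_induct_single)
  case (single m c)
  show ?case
  proof (induction g rule: poly_mapping_induct_single)
    case (single m' d)
    have "scal d * (hmonom a m * H) = hmonom a m * (scal d * H)" for H
      by (simp add: scal_commute[of d] mult.assoc)
    then show ?case by (simp add: mult_single scal_mult hmonom_add mult.assoc)
  qed (simp add: heval_add distrib_left)
qed (simp add: heval_add distrib_right)

lemma heval_0 [simp]: "heval a 0 = 0" by (simp add: heval_def)

lemma heval_1 [simp]: "heval a 1 = 1" by (simp flip: single_one)

lemma heval_s_var [simp]: "heval a (s_var i) = hdiff a i"
  unfolding s_var_def heval_single hmonom_axis by simp

lemma heval_uminus: "heval a (- f) = - heval a f"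
  using heval_add[of a f "- f"] by (simp add: eq_neg_iff_add_eq_0 add.commute)

lemma heval_of_nat [simp]: "heval a (of_nat k) = of_nat k"
  by (induction k) (simp_all add: heval_add)

lemma heval_of_int [simp]: "heval a (of_int k) = of_int k"
proof (cases k)
  case (neg n)
  have "heval a (of_int (- int (Suc n))) = - heval a (of_nat (Suc n))"
    by (simp only: of_int_minus of_int_of_nat_eq heval_uminus)
  then show ?thesis using neg by (simp only: heval_of_nat of_int_minus of_int_of_nat_eq)
qed simp

lemma heval_power: "heval a (f ^ k) = heval a f ^ k"
  by (induction k) (simp_all add: heval_mult)

lemma heval_sum: "heval a (\<Sum>i\<in>I. f i) = (\<Sum>i\<in>I. heval a (f i))"
  by (induction I rule: infinite_finite_induct) (simp_all add: heval_add)

lemma heval_weight: "heval a f \<in> weyl_weights {0}"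
  unfolding heval_def
  by (intro weyl_weights_sum weyl_weights_mult0 weyl_weights_scal hmonom_weight) auto

text \<open>On weight vectors \<open>heval\<close> is the action of \<open>\<bbbK>[s]\<close>, so this expresses that the \<open>s\<^sub>i\<close> commute with
  the algebra.\<close>

lemma heval_shift:
  assumes "u \<in> weyl_weights {b}" shows "heval (a + b) f * u = u * heval a f"
proof (induction f rule: poly_mapping_induct_single)
  case (single m c)
  have "scal c * hmonom (a + b) m * u = scal c * u * hmonom a m"
    by (simp add: mult.assoc hmonom_shift[OF assms])
  then show ?case by (simp add: scal_commute[of c u] mult.assoc)
qed (simp add: heval_add distrib_left distrib_right)

subsection \<open>Every homogeneous element is a monomial times a polynomial in the \<open>h\<^sub>i\<close>\<close>

definition m_factor :: "'n \<Rightarrow> int \<Rightarrow> ('n, 'k::field) weyl" where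
  "m_factor i k = zW i ^ nat k * dW i ^ nat (- k)"

lemma m_factor_commute: "i \<noteq> j \<Longrightarrow> m_factor i k * m_factor j l = m_factor j l * m_factor i k"
proof -
  assume ij: "i \<noteq> j"
  have 1: "zW i ^ r * m_factor j l = m_factor j l * zW i ^ r" for r
    unfolding m_factor_def
    by (rule commute_mult) (use ij in \<open>auto intro!: commute_power2 zW_commute dW_zW_commute[symmetric]\<close>)
  have 2: "dW i ^ r * m_factor j l = m_factor j l * dW i ^ r" for r
    unfolding m_factor_def
    by (rule commute_mult) (use ij in \<open>auto intro!: commute_power2 dW_commute dW_zW_commute\<close>)
  have "m_factor j l * m_factor i k = m_factor i k * m_factor j l"
    unfolding m_factor_def[of i] by (rule commute_mult) (simp_all only: 1 2)
  then show ?thesis by (rule sym)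
qed

text \<open>Grouping by coordinates allows one to change one exponent at a time.\<close>

lemma m_elt_eq_prod: "m_elt b = (\<Prod>i\<leftarrow>coords. m_factor i (b $ i))"
  unfolding m_elt_def m_factor_def
proof (rule prod_list_mult_commuting[symmetric])
  fix i j :: 'a
  show "zW i ^ nat (b $ i) * dW j ^ nat (- b $ j) = dW j ^ nat (- b $ j) * (zW i ^ nat (b $ i) :: ('a, 'b) weyl)"
  proof (cases "i = j")
    case True
    then show ?thesis by (cases "b $ i \<ge> 0") auto
  next
    case False
    then have "j \<noteq> i" by simp
    show ?thesis by (rule commute_power2[OF dW_zW_commute[OF \<open>j \<noteq> i\<close>], symmetric])
  qed
qed

lemma m_elt_extract: "m_elt b = m_factor i (b $ i) * m_elt (b - axis i (b $ i))"
  unfolding m_elt_eq_prod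
  by (rule prod_list_extract[where i = i]) (auto simp: axis_def m_factor_def[of i 0] intro: m_factor_commute)

lemma m_elt_0 [simp]: "m_elt 0 = 1"
proof -
  have "(\<Prod>i\<leftarrow>is. m_factor i 0) = (1 :: ('a, 'b) weyl)" for "is"
    by (induction "is") (auto simp: m_factor_def)
  then show ?thesis by (simp add: m_elt_eq_prod)
qed

lemma zW_m_elt:
  "zW i * m_elt b = (if b $ i \<ge> 0 then 1 else hplus i) * m_elt (b + axis i 1)"
proof -
  have "zW i * m_factor i k = (if k \<ge> 0 then 1 else hplus i) * (m_factor i (k + 1) :: ('a, 'b) weyl)" for k
  proof (cases "k \<ge> 0")
    case True
    then show ?thesis by (simp add: m_factor_def nat_add_distrib)
  next
    case False
    then obtain r where "k = - int (Suc r)" by (metis negD not_le)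
    then show ?thesis by (simp add: m_factor_def hplus_def mult.assoc nat_add_distrib nat_diff_distrib)
  qed
  moreover have "b + axis i 1 - axis i (b $ i + 1) = b - axis i (b $ i)"
    by (simp add: vec_eq_iff axis_def)
  then have "m_elt (b + axis i 1) = (m_factor i (b $ i + 1) * m_elt (b - axis i (b $ i)) :: ('a, 'b) weyl)"
    using m_elt_extract[of "b + axis i 1" i] by (simp only: vector_add_component axis_nth)
  ultimately show ?thesis
    by (simp only: m_elt_extract[of b i] mult.assoc[symmetric])
qed

lemma dW_m_elt:
  "dW i * m_elt b = (if b $ i \<le> 0 then 1 else hplus i + 1) * m_elt (b - axis i 1)"
proof -
  have "dW i * m_factor i k = (if k \<le> 0 then 1 else hplus i + 1) * (m_factor i (k - 1) :: ('a, 'b) weyl)" for k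
  proof (cases "k \<le> 0")
    case True
    then have "nat (- (k - 1)) = Suc (nat (- k))" "nat k = 0" "nat (k - 1) = 0" by auto
    then show ?thesis using True by (simp add: m_factor_def del: minus_diff_eq)
  next
    case False
    then obtain r where "k = int (Suc r)" by (metis not_le zero_less_imp_eq_int gr0_conv_Suc)
    moreover have "dW i * zW i = (hplus i + 1 :: ('a, 'b) weyl)" by (simp add: hplus_def dW_zW)
    ultimately show ?thesis by (simp add: m_factor_def nat_add_distrib nat_diff_distrib flip: mult.assoc)
  qed
  moreover have "b - axis i 1 - axis i (b $ i - 1) = b - axis i (b $ i)"
    by (simp add: vec_eq_iff axis_def)
  then have "m_elt (b - axis i 1) = (m_factor i (b $ i - 1) * m_elt (b - axis i (b $ i)) :: ('a, 'b) weyl)"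
    using m_elt_extract[of "b - axis i 1" i] by (simp only: vector_minus_component axis_nth)
  ultimately show ?thesis
    by (simp only: m_elt_extract[of b i] mult.assoc[symmetric])
qed

lemma m_factor_weight: "m_factor i k \<in> weyl_weights {axis i k}"
proof -
  have *: "axis i k = int (nat k) *s axis i 1 + int (nat (- k)) *s - axis i 1"
    by (cases "k \<ge> 0") (simp_all add: vec_eq_iff axis_def)
  show ?thesis unfolding m_factor_def *
    by (rule weyl_weights_mult[OF weyl_weights_power[OF weyl_weights_zW] weyl_weights_power[OF weyl_weights_dW]]) auto
qed

lemma m_elt_weight: "m_elt b \<in> weyl_weights {b}"
proof -
  have "(\<Sum>i\<leftarrow>coords. axis i (b $ i)) = b"
    by (simp add: sum_list_distinct_conv_sum_set vec_eq_iff axis_def)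
  then show ?thesis unfolding m_elt_eq_prod
    using weyl_weights_prod_list[of coords "\<lambda>i. m_factor i (b $ i)" "\<lambda>i. axis i (b $ i)"]
    by (simp add: m_factor_weight)
qed

lemma hplus_m_elt: "hplus i * m_elt b = m_elt b * heval a (s_var i + of_int (a $ i + b $ i))"
  by (simp add: hplus_homogeneous[OF m_elt_weight] heval_add hdiff_def)

text \<open>Multiplication by \<open>z\<^sub>i\<close> raises the exponent of \<open>m(b)\<close>, except that for \<open>b\<^sub>i < 0\<close> it leaves a factor
  \<open>z\<^sub>i \<partial>\<^sub>i = h\<^sub>i\<close> behind; similarly \<open>\<partial>\<^sub>i\<close> leaves \<open>\<partial>\<^sub>i z\<^sub>i = h\<^sub>i + 1\<close>. These factors move to the right after a shift.\<close>

lemma weyl_word_span: "\<exists>r. weyl_word ws c = m_elt (word_weight (Word ws)) * heval a r"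
proof (induction ws)
  case Nil
  have "scal c = m_elt 0 * heval a (Poly_Mapping.single 0 c)" by simp
  then show ?case by (metis weyl_word_Nil word_weight_Nil)
next
  case (Cons x ws)
  let ?b = "word_weight (Word ws)"
  from Cons obtain r where r: "weyl_word ws c = m_elt ?b * heval a r" by blast
  show ?case
  proof (cases x)
    case (Zg i)
    then have "weyl_word (x # ws) c = (if ?b $ i \<ge> 0 then 1 else hplus i) * m_elt (?b + axis i 1) * heval a r"
      by (simp only: weyl_word_Cons r weyl_letter.simps zW_m_elt flip: mult.assoc)
    also have "\<exists>r'. \<dots> = m_elt (?b + axis i 1) * heval a r'"
    proof (cases "?b $ i \<ge> 0")
      case False
      have "hplus i * m_elt (?b + axis i 1) * heval a r
        = m_elt (?b + axis i 1) * heval a ((s_var i + of_int (a $ i + (?b + axis i 1) $ i)) * r)"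
        by (simp only: hplus_m_elt[of _ _ a] heval_mult mult.assoc)
      then show ?thesis using False by auto
    qed auto
    finally show ?thesis using Zg by (simp add: add.commute)
  next
    case (Dg i)
    then have "weyl_word (x # ws) c = (if ?b $ i \<le> 0 then 1 else hplus i + 1) * m_elt (?b - axis i 1) * heval a r"
      by (simp only: weyl_word_Cons r weyl_letter.simps dW_m_elt flip: mult.assoc)
    also have "\<exists>r'. \<dots> = m_elt (?b - axis i 1) * heval a r'"
    proof (cases "?b $ i \<le> 0")
      case False
      have "(hplus i + 1) * m_elt (?b - axis i 1) * heval a r
        = m_elt (?b - axis i 1) * heval a ((s_var i + of_int (a $ i + (?b - axis i 1) $ i) + 1) * r)"
        by (simp only: distrib_right distrib_left hplus_m_elt[of _ _ a] heval_add heval_mult heval_1 mult_1_left mult.assoc mult_1_right)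
      then show ?thesis using False by auto
    qed auto
    finally show ?thesis using Dg by simp
  qed
qed

lemma homogeneous_span:
  assumes "u \<in> weyl_weights {b}" shows "\<exists>r. u = m_elt b * heval a r"
  using assms
proof (induction rule: weyl_weights_induct)
  case zero
  then show ?case by (rule exI[of _ 0]) simp
next
  case (word ws c)
  then show ?case using weyl_word_span[of ws c a] by simp
next
  case (add u v)
  then show ?case by (metis heval_add distrib_left)
qed

section \<open>The universal weight module\<close>

text \<open>The functions on \<open>\<int>\<^sup>n\<close> with values in \<open>\<bbbK>[s]\<close> form a module over the Weyl algebra in which \<open>h\<^sub>i\<close>
  multiplies the value at \<open>e\<close> by \<open>s\<^sub>i + e\<^sub>i\<close>. The operators \<open>z\<^sub>i\<close> carry these factors and the \<open>\<partial>\<^sub>i\<close> carry none.\<close>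

fun shift_gen :: "'n weyl_gen \<Rightarrow> (int ^ 'n \<Rightarrow> ('n::finite, 'k::field) s_poly) \<Rightarrow> int ^ 'n \<Rightarrow> ('n, 'k) s_poly"
  where
  "shift_gen (Zg i) g = (\<lambda>e. (s_var i + of_int (e $ i)) * g (e - axis i 1))"
| "shift_gen (Dg i) g = (\<lambda>e. g (e + axis i 1))"

definition shift_word :: "'n weyl_gen word \<Rightarrow> (int ^ 'n \<Rightarrow> ('n::finite, 'k::field) s_poly) \<Rightarrow>
    int ^ 'n \<Rightarrow> ('n, 'k) s_poly"
  where "shift_word w g = foldr shift_gen (letters w) g"

definition s_const :: "'k \<Rightarrow> ('n::finite, 'k::field) s_poly" where
  "s_const c = Poly_Mapping.single 0 c"

definition shift_free :: "('n weyl_gen word \<Rightarrow>\<^sub>0 'k) \<Rightarrow> (int ^ 'n \<Rightarrow> ('n::finite, 'k::field) s_poly) \<Rightarrow>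
    int ^ 'n \<Rightarrow> ('n, 'k) s_poly" where
  "shift_free f g e = (\<Sum>w\<in>Poly_Mapping.keys f. s_const (Poly_Mapping.lookup f w) * shift_word w g e)"

lemma s_const_simps [simp]:
  "s_const 0 = 0" "s_const 1 = 1" "s_const (c + d) = s_const c + s_const d"
  "s_const (c * d) = s_const c * s_const d"
  by (simp_all add: s_const_def single_add mult_single)

lemma shift_free_superset:
  assumes "finite S" "Poly_Mapping.keys f \<subseteq> S"
  shows "shift_free f g e = (\<Sum>w\<in>S. s_const (Poly_Mapping.lookup f w) * shift_word w g e)"
  unfolding shift_free_def
  by (rule sum.mono_neutral_left) (use assms in \<open>auto simp: in_keys_iff\<close>)

lemma shift_free_single [simp]:
  "shift_free (Poly_Mapping.single w c) g = (\<lambda>e. s_const c * shift_word w g e)"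
  by (auto simp: fun_eq_iff shift_free_def)

lemma shift_free_add: "shift_free (f + f') g = (\<lambda>e. shift_free f g e + shift_free f' g e)"
proof
  fix e
  let ?S = "Poly_Mapping.keys f \<union> Poly_Mapping.keys f'"
  have "shift_free h g e = (\<Sum>w\<in>?S. s_const (Poly_Mapping.lookup h w) * shift_word w g e)"
    if "Poly_Mapping.keys h \<subseteq> ?S" for h
    by (rule shift_free_superset) (use that in auto)
  from this[of f] this[of f'] this[of "f + f'"] Poly_Mapping.keys_add[of f f']
  show "shift_free (f + f') g e = shift_free f g e + shift_free f' g e"
    by (simp add: lookup_add distrib_right sum.distrib)
qed

lemma shift_free_zero_left: "shift_free 0 g = (\<lambda>_. 0)"
  by (simp add: fun_eq_iff shift_free_def)

lemma shift_free_diff: "shift_free (f - f') g = (\<lambda>e. shift_free f g e - shift_free f' g e)"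
  using shift_free_add[of "f - f'" f' g] by (simp add: fun_eq_iff)

lemma shift_gen_linear:
  "shift_gen x (\<lambda>e. c * g e + h e) = (\<lambda>e. c * shift_gen x g e + shift_gen x h e)"
  by (cases x) (auto simp: fun_eq_iff algebra_simps)

lemma shift_word_linear:
  "shift_word w (\<lambda>e. c * g e + h e) = (\<lambda>e. c * shift_word w g e + shift_word w h e)"
proof -
  have "foldr shift_gen xs (\<lambda>e. c * g e + h e)
      = (\<lambda>e. c * foldr shift_gen xs g e + foldr shift_gen xs h e)" for xs
    by (induction xs) (auto simp: shift_gen_linear)
  then show ?thesis by (simp add: shift_word_def)
qed

lemma shift_word_zero: "shift_word w (\<lambda>_. 0) = (\<lambda>_. 0)"
  using shift_word_linear[of w "-1" "\<lambda>_. 0" "\<lambda>_. 0"] by (simp add: fun_eq_iff)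

lemma shift_free_linear:
  "shift_free f (\<lambda>e. c * g e + h e) = (\<lambda>e. c * shift_free f g e + shift_free f h e)"
  by (simp add: fun_eq_iff shift_free_def shift_word_linear distrib_left sum.distrib sum_distrib_left
      mult.left_commute)

lemma shift_free_zero: "shift_free f (\<lambda>_. 0) = (\<lambda>_. 0)"
  by (simp add: fun_eq_iff shift_free_def shift_word_zero)

lemma shift_free_mult: "shift_free (f * f') g = shift_free f (shift_free f' g)"
proof (induction f rule: poly_mapping_induct_single)
  case (single w c)
  show ?case
  proof (induction f' rule: poly_mapping_induct_single)
    case (single v d)
    have "shift_word (w + v) g = shift_word w (shift_word v g)"
      by (simp add: shift_word_def plus_word_def)
    moreover have "shift_word w (\<lambda>e. s_const d * h e) = (\<lambda>e. s_const d * shift_word w h e)" for h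
      using shift_word_linear[of w "s_const d" h "\<lambda>_. 0"] by (simp add: shift_word_zero)
    ultimately show ?case by (simp add: mult_single mult.assoc)
  next
    case (add f1 f2)
    then show ?case using shift_word_linear[of w 1 "shift_free f1 g" "shift_free f2 g"]
      by (simp add: distrib_left shift_free_add)
  qed
qed (simp add: distrib_right shift_free_add)

lemma shift_free_gen: "shift_free (gen x) g = shift_gen x g"
  by (simp add: gen_def shift_word_def)

lemma shift_free_1: "shift_free 1 g = g"
proof -
  have "(Poly_Mapping.single 0 1 :: ('a, 'b) s_poly) = 1" by (rule single_one)
  then show ?thesis by (simp add: shift_word_def zero_word_def s_const_def flip: single_one[where 'a = "'a weyl_gen word"])
qed

lemma shift_free_commutator:
  "shift_free (gen x * gen y - gen y * gen x) g e
   = shift_gen x (shift_gen y g) e - shift_gen y (shift_gen x g) e"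
  by (simp add: shift_free_diff shift_free_mult shift_free_gen)

lemma shift_free_rels:
  fixes r :: "'n::finite weyl_gen word \<Rightarrow>\<^sub>0 'k::field"
  assumes "r \<in> weyl_rels" shows "shift_free r g = (\<lambda>_. 0)"
proof
  fix e :: "int ^ 'n"
  from assms consider
      (dz) i j where "r = (gen (Dg i) * gen (Zg j) - gen (Zg j) * gen (Dg i)) - (if i = j then 1 else 0)"
    | (zz) i j where "r = gen (Zg i) * gen (Zg j) - gen (Zg j) * gen (Zg i)"
    | (dd) i j where "r = gen (Dg i) * gen (Dg j) - gen (Dg j) * gen (Dg i)"
    unfolding weyl_rels_def by fast
  then show "shift_free r g e = 0"
  proof cases
    case dz
    then have "shift_free r g e = shift_gen (Dg i) (shift_gen (Zg j) g) e
       - shift_gen (Zg j) (shift_gen (Dg i) g) e - (if i = j then g e else 0)"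
      by (simp only: shift_free_diff[of _ "if i = j then 1 else 0"] shift_free_commutator)
        (simp add: shift_free_1 shift_free_zero_left)
    also have "\<dots> = 0"
    proof -
      have "e + axis i 1 - axis j 1 = e - axis j 1 + axis i 1" by simp
      then show ?thesis by (simp add: axis_def algebra_simps)
    qed
    finally show ?thesis .
  next
    case zz
    have "i = j \<or> axis i (1::int) $ j = 0 \<and> axis j (1::int) $ i = 0" by (auto simp: axis_def)
    then show ?thesis using zz by (auto simp: shift_free_commutator mult.left_commute diff_right_commute)
  next
    case dd
    then show ?thesis by (simp add: shift_free_commutator add.assoc add.commute[of "axis i 1"])
  qed
qed

lemma shift_free_ideal: "f \<in> two_sided_ideal weyl_rels \<Longrightarrow> shift_free f g = (\<lambda>_. 0)"
  by (induction arbitrary: g rule: two_sided_ideal.induct)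
    (simp_all add: shift_free_mult shift_free_rels shift_free_zero shift_free_add fun_eq_iff shift_free_def)

lift_definition shift_rep :: "('n, 'k) weyl \<Rightarrow> (int ^ 'n \<Rightarrow> ('n::finite, 'k::field) s_poly) \<Rightarrow>
    int ^ 'n \<Rightarrow> ('n, 'k) s_poly" is shift_free
proof -
  fix f f' :: "'n weyl_gen word \<Rightarrow>\<^sub>0 'k"
  assume "weyl_rel f f'"
  then have "shift_free (f - f') g = (\<lambda>_. 0)" for g
    unfolding weyl_rel_def by (rule shift_free_ideal)
  then show "shift_free f = shift_free f'"
    by (simp add: fun_eq_iff shift_free_diff)
qed

lemma shift_rep_add: "shift_rep (u + v) g = (\<lambda>e. shift_rep u g e + shift_rep v g e)"
  by transfer (rule shift_free_add)

lemma shift_rep_mult: "shift_rep (u * v) g = shift_rep u (shift_rep v g)"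
  by transfer (rule shift_free_mult)

lemma shift_rep_linear: "shift_rep u (\<lambda>e. c * g e + h e) = (\<lambda>e. c * shift_rep u g e + shift_rep u h e)"
  by transfer (rule shift_free_linear)

lemma shift_rep_1: "shift_rep 1 g = g"
  by transfer (rule shift_free_1)

lemma shift_rep_0: "shift_rep 0 g = (\<lambda>_. 0)"
  by transfer (simp add: fun_eq_iff shift_free_def)

lemma shift_rep_scal: "shift_rep (scal c) g = (\<lambda>e. s_const c * g e)"
  by (simp add: scal_def shift_rep.abs_eq shift_word_def zero_word_def)

lemma shift_rep_zW: "shift_rep (zW i) g = shift_gen (Zg i) g"
  by (simp add: zW_def shift_rep.abs_eq shift_free_gen)

lemma shift_rep_dW: "shift_rep (dW i) g = shift_gen (Dg i) g"
  by (simp add: dW_def shift_rep.abs_eq shift_free_gen)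

definition point_fun :: "int ^ 'n \<Rightarrow> ('n::finite, 'k::field) s_poly \<Rightarrow> int ^ 'n \<Rightarrow> ('n, 'k) s_poly" where
  "point_fun a f = (\<lambda>e. if e = a then f else 0)"

text \<open>The action on functions is \<open>\<bbbK>[s]\<close>-linear, so elements of the Weyl algebra become matrices over
  \<open>\<bbbK>[s]\<close> with rows and columns indexed by the weights.\<close>

definition coeff :: "('n, 'k) weyl \<Rightarrow> int ^ 'n \<Rightarrow> int ^ 'n \<Rightarrow> ('n::finite, 'k::field) s_poly" where
  "coeff u a' a = shift_rep u (point_fun a 1) a'"

lemma shift_rep_zero: "shift_rep u (\<lambda>_. 0) = (\<lambda>_. 0)"
  using shift_rep_linear[of u "-1" "\<lambda>_. 0" "\<lambda>_. 0"] by (simp add: fun_eq_iff)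

lemma shift_rep_point: "shift_rep u (point_fun a f) = (\<lambda>e. f * coeff u e a)"
proof -
  have "point_fun a f = (\<lambda>e. f * point_fun a 1 e + 0)" by (auto simp: point_fun_def)
  then have "shift_rep u (point_fun a f) = (\<lambda>e. f * shift_rep u (point_fun a 1) e + shift_rep u (\<lambda>_. 0) e)"
    by (simp only: shift_rep_linear)
  then show ?thesis by (simp add: shift_rep_zero coeff_def)
qed

lemma coeff_add: "coeff (u + v) a' a = coeff u a' a + coeff v a' a"
  by (simp add: coeff_def shift_rep_add)

lemma coeff_0 [simp]: "coeff 0 a' a = 0"
  by (simp add: coeff_def shift_rep_0)

lemma coeff_scal: "coeff (scal c) a' a = (if a' = a then s_const c else 0)"
  by (simp add: coeff_def shift_rep_scal point_fun_def)

lemma coeff_1: "coeff 1 a' a = (if a' = a then 1 else 0)"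
  by (simp add: coeff_def shift_rep_1 point_fun_def)

lemma shift_gen_point:
  fixes a :: "int ^ 'n::finite"
  shows "\<exists>q :: ('n, 'k::field) s_poly. \<forall>f. shift_gen x (point_fun a f) = point_fun (a + gen_weight x) (q * f)"
proof (cases x)
  case (Zg i)
  have "shift_gen x (point_fun a f) = point_fun (a + gen_weight x) ((s_var i + of_int (a $ i + 1)) * f)" for f :: "('n, 'k) s_poly"
    using Zg by (auto simp: point_fun_def fun_eq_iff axis_def)
  then show ?thesis by blast
next
  case (Dg i)
  have "shift_gen x (point_fun a f) = point_fun (a + gen_weight x) (1 * f)" for f :: "('n, 'k) s_poly"
    using Dg by (auto simp: point_fun_def fun_eq_iff axis_def vec_eq_iff)
  then show ?thesis by blast
qed

lemma shift_word_point:
  fixes a :: "int ^ 'n::finite"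
  shows "\<exists>q :: ('n, 'k::field) s_poly. \<forall>f. shift_word (Word ws) (point_fun a f) = point_fun (a + word_weight (Word ws)) (q * f)"
proof (induction ws)
  case Nil
  show ?case by (rule exI[of _ 1]) (simp add: shift_word_def)
next
  case (Cons x ws)
  then obtain q :: "('n, 'k) s_poly" where q: "\<And>f. shift_word (Word ws) (point_fun a f) = point_fun (a + word_weight (Word ws)) (q * f)"
    by blast
  obtain q' :: "('n, 'k) s_poly" where q': "\<And>f. shift_gen x (point_fun (a + word_weight (Word ws)) f)
      = point_fun (a + word_weight (Word ws) + gen_weight x) (q' * f)"
    using shift_gen_point by blast
  have "shift_word (Word (x # ws)) (point_fun a f) = point_fun (a + word_weight (Word (x # ws))) (q' * q * f)" for f
    using q[of f] q'[of "q * f"] by (simp add: shift_word_def ac_simps)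
  then show ?case by blast
qed

lemma shift_rep_homogeneous:
  fixes u :: "('n::finite, 'k::field) weyl"
  assumes "u \<in> weyl_weights {b}"
  shows "shift_rep u (point_fun a f) = point_fun (a + b) (f * coeff u (a + b) a)"
proof -
  have "\<exists>q :: ('n, 'k) s_poly. \<forall>f. shift_rep u (point_fun a f) = point_fun (a + b) (q * f)"
    using assms
  proof (induction rule: weyl_weights_induct)
    case zero
    show ?case by (rule exI[of _ 0]) (simp add: shift_rep_0 point_fun_def)
  next
    case (word ws c)
    obtain q :: "('n, 'k) s_poly" where q: "\<And>f. shift_word (Word ws) (point_fun a f) = point_fun (a + word_weight (Word ws)) (q * f)"
      using shift_word_point by blast
    have "shift_rep (weyl_word ws c) (point_fun a f) = point_fun (a + b) (s_const c * q * f)" for f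
      using q[of f] word by (auto simp: weyl_word_def shift_rep.abs_eq point_fun_def fun_eq_iff mult.assoc)
    then show ?case by blast
  next
    case (add u v)
    then obtain q r where "\<And>f. shift_rep u (point_fun a f) = point_fun (a + b) (q * f)"
      "\<And>f. shift_rep v (point_fun a f) = point_fun (a + b) (r * f)" by blast
    then have "shift_rep (u + v) (point_fun a f) = point_fun (a + b) ((q + r) * f)" for f
      by (auto simp: shift_rep_add point_fun_def fun_eq_iff distrib_right)
    then show ?case by blast
  qed
  then obtain q where q: "\<And>f. shift_rep u (point_fun a f) = point_fun (a + b) (q * f)" by blast
  then have "coeff u (a + b) a = q" by (simp add: coeff_def point_fun_def)
  with q show ?thesis by (simp add: mult.commute)
qed

lemma coeff_homogeneous_zero:
  assumes "u \<in> weyl_weights {b}" "a' \<noteq> a + b"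
  shows "coeff u a' a = 0"
proof -
  have "coeff u a' a = point_fun (a + b) (1 * coeff u (a + b) a) a'"
    unfolding coeff_def[of u a' a] by (simp only: shift_rep_homogeneous[OF assms(1)])
  with assms(2) show ?thesis by (simp add: point_fun_def)
qed

lemma coeff_mult:
  assumes "v \<in> weyl_weights {b}"
  shows "coeff (u * v) a' a = coeff u a' (a + b) * coeff v (a + b) a"
proof -
  have "coeff (u * v) a' a = shift_rep u (point_fun (a + b) (1 * coeff v (a + b) a)) a'"
    unfolding coeff_def[of "u * v"] by (simp only: shift_rep_mult shift_rep_homogeneous[OF assms])
  then show ?thesis by (simp add: shift_rep_point mult.commute)
qed

lemma coeff_uminus: "coeff (- u) a' a = - coeff u a' a"
  using coeff_add[of u "- u" a' a] by (simp add: eq_neg_iff_add_eq_0 add.commute)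

lemma coeff_diff: "coeff (u - v) a' a = coeff u a' a - coeff v a' a"
  using coeff_add[of u "- v"] by (simp add: coeff_uminus)

lemma s_const_uminus: "s_const (- c) = - s_const c"
  by (simp add: s_const_def single_uminus)

lemma s_const_of_nat: "s_const (of_nat m) = of_nat m"
  by (induction m) simp_all

lemma s_const_of_int: "s_const (of_int k) = of_int k"
  by (cases k rule: int_cases2) (simp_all add: s_const_of_nat s_const_uminus)

lemma coeff_of_int: "coeff (of_int k) a' a = (if a' = a then of_int k else 0)"
  unfolding scal_of_int[symmetric] by (simp add: coeff_scal s_const_of_int)

lemma coeff_hplus: "coeff (hplus i) a' a = (if a' = a then s_var i + of_int (a $ i) else 0)"
  unfolding coeff_def hplus_def shift_rep_mult shift_rep_zW shift_rep_dW
  by (simp add: point_fun_def)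

lemma coeff_hdiff: "coeff (hdiff a i) a' a = (if a' = a then s_var i else 0)"
  by (simp add: hdiff_def coeff_diff coeff_hplus coeff_of_int)

lemma s_var_power:
  "(s_var i :: ('n::finite, 'k::field) s_poly) ^ k = Poly_Mapping.single (axis i k) 1"
proof (induction k)
  case (Suc k)
  have "axis i 1 + axis i k = (axis i (Suc k) :: nat ^ 'n)" by (simp add: vec_eq_iff axis_def)
  then show ?case using Suc by (simp add: s_var_def mult_single)
next
  case 0
  have "axis i 0 = (0 :: nat ^ 'n)" by (simp add: vec_eq_iff axis_def)
  then show ?case by (simp only: power_0 single_one)
qed

lemma monomial_eq_prod:
  "Poly_Mapping.single m 1 = (\<Prod>i\<in>UNIV. (s_var i :: ('n::finite, 'k::field) s_poly) ^ (m $ i))"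
proof -
  note pow = s_var_power
  have "(\<Prod>i\<in>I. Poly_Mapping.single (axis i (m $ i)) (1::'k)) = Poly_Mapping.single (\<Sum>i\<in>I. axis i (m $ i)) 1"
    if "finite I" for I
    using that by (induction I) (simp_all add: mult_single)
  moreover have "(\<Sum>i\<in>UNIV. axis i (m $ i)) = m"
    by (simp add: vec_eq_iff axis_def)
  ultimately show ?thesis by (simp add: pow)
qed

lemma coeff_hdiff_power: "coeff (hdiff a i ^ k) a a = (s_var i ^ k :: ('n::finite, 'k::field) s_poly)"
proof (induction k)
  case (Suc k)
  have "(hdiff a i ^ k :: ('n, 'k) weyl) \<in> weyl_weights {0}"
    using weyl_weights_power[OF hdiff_weight, of a i k] by simp
  from coeff_mult[OF this, of "hdiff a i" a a] Suc show ?case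
    by (simp add: coeff_hdiff)
qed (simp add: coeff_1)

lemma coeff_hmonom:
  "coeff (hmonom a m) a a = (Poly_Mapping.single m 1 :: ('n::finite, 'k::field) s_poly)"
proof -
  have "coeff (\<Prod>i\<leftarrow>is. hdiff a i ^ (m $ i)) a a = (\<Prod>i\<in>set is. (s_var i :: ('n, 'k) s_poly) ^ (m $ i))"
    if "distinct is" for "is"
    using that
  proof (induction "is")
    case (Cons i "is")
    have "(\<Prod>i\<leftarrow>is. hdiff a i ^ (m $ i) :: ('n, 'k) weyl) \<in> weyl_weights {\<Sum>i\<leftarrow>is. 0}"
      by (rule weyl_weights_prod_list) (use weyl_weights_power[OF hdiff_weight] in force)
    then have "(\<Prod>i\<leftarrow>is. hdiff a i ^ (m $ i) :: ('n, 'k) weyl) \<in> weyl_weights {0}" by simp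
    from coeff_mult[OF this, of "hdiff a i ^ (m $ i)" a a] show ?case
      using Cons by (simp add: coeff_hdiff_power)
  qed (simp add: coeff_1)
  from this[OF distinct_coords] show ?thesis by (simp add: hmonom_def monomial_eq_prod)
qed

lemma coeff_heval: "coeff (heval a f) a a = f"
proof (induction f rule: poly_mapping_induct_single)
  case (single m c)
  show ?case
    using coeff_mult[OF hmonom_weight[of a m], of "scal c" a a]
    by (simp add: coeff_scal coeff_hmonom s_const_def mult_single)
qed (simp add: heval_add coeff_add)

lemma coeff_mult_heval: "coeff (u * heval a f) a' a = coeff u a' a * f"
  using coeff_mult[OF heval_weight, of u a f a' a] by (simp add: coeff_heval)

subsection \<open>The matrix coefficients of the monomials\<close>

text \<open>The product of the factors \<open>s\<^sub>i + e\<^sub>i\<close> that the \<open>z\<^sub>i\<close> in \<open>m(b)\<close> collect on the way from \<open>a\<close> to \<open>a + b\<close>.\<close>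

definition rising :: "int ^ 'n \<Rightarrow> int ^ 'n \<Rightarrow> ('n::finite, 'k::field) s_poly" where
  "rising a b = (\<Prod>i\<in>UNIV. \<Prod>j\<in>{1..b $ i}. s_var i + of_int (a $ i + j))"

lemma axis_zero [simp]: "axis i 0 = (0 :: 'a::zero ^ 'n)"
  by (simp add: vec_eq_iff axis_def)

lemma coeff_zW_power:
  "coeff (zW i ^ r) (a + axis i (int r)) a
    = (\<Prod>j\<in>{1..int r}. (s_var i :: ('n::finite, 'k::field) s_poly) + of_int (a $ i + j))"
proof (induction r)
  case 0
  then show ?case by (simp add: coeff_1)
next
  case (Suc r)
  let ?c = "a + axis i (int r)"
  have "int r *s axis i 1 = axis i (int r)" by (simp add: vec_eq_iff axis_def)
  then have w: "(zW i ^ r :: ('n, 'k) weyl) \<in> weyl_weights {axis i (int r)}"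
    using weyl_weights_power[OF weyl_weights_zW, of i r] by simp
  have "coeff (zW i) (a + (axis i (int r) + axis i 1)) ?c = (s_var i + of_int (a $ i + int (Suc r)) :: ('n, 'k) s_poly)"
    by (simp add: coeff_def shift_rep_zW point_fun_def add.assoc)
  moreover have "a + axis i (int (Suc r)) = ?c + axis i 1" by (simp add: vec_eq_iff axis_def)
  moreover have "{1..int (Suc r)} = insert (int (Suc r)) {1..int r}" by auto
  ultimately show ?case
    using coeff_mult[OF w, of "zW i" "a + axis i (int (Suc r))" a] Suc by (simp add: add.assoc)
qed

lemma coeff_dW_power: "coeff (dW i ^ r) (a - axis i (int r)) a = (1 :: ('n::finite, 'k::field) s_poly)"
proof (induction r)
  case 0
  then show ?case by (simp add: coeff_1)
next
  case (Suc r)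
  have "int r *s - axis i 1 = - axis i (int r)" by (simp add: vec_eq_iff axis_def)
  then have w: "(dW i ^ r :: ('n, 'k) weyl) \<in> weyl_weights {- axis i (int r)}"
    using weyl_weights_power[OF weyl_weights_dW, of i r] by simp
  have e: "a - axis i (int (Suc r)) = a + - axis i (int r) - axis i 1" by (simp add: vec_eq_iff axis_def)
  have "coeff (dW i) (c - axis i 1) c = (1 :: ('n, 'k) s_poly)" for c
    by (simp add: coeff_def shift_rep_dW point_fun_def)
  then show ?case
    using coeff_mult[OF w, of "dW i" "a + - axis i (int r) - axis i 1" a] Suc unfolding e by simp
qed

lemma coeff_m_factor:
  "coeff (m_factor i k) (a + axis i k) a
    = (\<Prod>j\<in>{1..k}. (s_var i :: ('n::finite, 'k::field) s_poly) + of_int (a $ i + j))"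
proof (cases "k \<ge> 0")
  case True
  then show ?thesis using coeff_zW_power[of i "nat k" a] by (simp add: m_factor_def)
next
  case False
  have "coeff (dW i ^ nat (- k)) (a - axis i (- k)) a = (1 :: ('n, 'k) s_poly)"
    using coeff_dW_power[of i "nat (- k)" a] False by simp
  moreover have "a - axis i (- k) = a + axis i k" by (simp add: vec_eq_iff axis_def)
  ultimately show ?thesis using False by (simp add: m_factor_def)
qed

lemma coeff_m_elt: "coeff (m_elt b) (a + b) a = (rising a b :: ('n::finite, 'k::field) s_poly)"
proof -
  have "coeff (\<Prod>i\<leftarrow>is. m_factor i (b $ i)) (a + (\<Sum>i\<leftarrow>is. axis i (b $ i))) a
      = (\<Prod>i\<in>set is. \<Prod>j\<in>{1..b $ i}. (s_var i :: ('n, 'k) s_poly) + of_int (a $ i + j))"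
    if "distinct is" for "is"
    using that
  proof (induction "is")
    case (Cons i "is")
    let ?c = "\<Sum>i\<leftarrow>is. axis i (b $ i)" and ?u = "\<Prod>i\<leftarrow>is. m_factor i (b $ i) :: ('n, 'k) weyl"
    have w: "?u \<in> weyl_weights {?c}"
      by (rule weyl_weights_prod_list) (rule m_factor_weight)
    have c: "?c $ i = 0"
      using Cons.prems by (auto simp: sum_list_distinct_conv_sum_set axis_def intro!: sum.neutral)
    have "a + (\<Sum>i\<leftarrow>i # is. axis i (b $ i)) = a + ?c + axis i (b $ i)" by (simp add: ac_simps)
    then have "coeff (\<Prod>i\<leftarrow>i # is. m_factor i (b $ i)) (a + (\<Sum>i\<leftarrow>i # is. axis i (b $ i))) a
        = coeff (m_factor i (b $ i) * ?u) (a + ?c + axis i (b $ i)) a" by (simp only: list.map prod_list.Cons)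
    also have "\<dots> = coeff (m_factor i (b $ i)) (a + ?c + axis i (b $ i)) (a + ?c) * coeff ?u (a + ?c) a"
      by (rule coeff_mult[OF w])
    also have "\<dots> = (\<Prod>i\<in>set (i # is). \<Prod>j\<in>{1..b $ i}. s_var i + of_int (a $ i + j))"
      using Cons by (simp add: coeff_m_factor c)
    finally show ?case .
  qed (simp add: coeff_1)
  from this[OF distinct_coords] have "coeff (m_elt b) (a + (\<Sum>i\<leftarrow>coords. axis i (b $ i))) a
      = (rising a b :: ('n, 'k) s_poly)"
    by (simp add: m_elt_eq_prod rising_def)
  moreover have "(\<Sum>i\<leftarrow>coords. axis i (b $ i)) = b"
    by (simp add: sum_list_distinct_conv_sum_set vec_eq_iff axis_def)
  ultimately show ?thesis by simp
qed

subsection \<open>Cancelling monomials\<close>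

lemma lookup_single_mult:
  fixes k :: "'a::cancel_comm_monoid_add"
  shows "Poly_Mapping.lookup (Poly_Mapping.single k (1::'b::comm_ring_1) * f) (k + m) = Poly_Mapping.lookup f m"
  by (induction f rule: poly_mapping_induct_single)
    (simp_all add: mult_single lookup_single when_def distrib_left lookup_add)

definition s_monom :: "nat ^ 'n \<Rightarrow> ('n::finite, 'k::field) s_poly" where
  "s_monom m = (\<Prod>i\<in>UNIV. s_var i ^ (m $ i))"

lemma s_monom_add: "s_monom (m + m') = s_monom m * s_monom m'"
  by (simp add: s_monom_def power_add prod.distrib)

lemma s_monom_0 [simp]: "s_monom 0 = 1"
  by (simp add: s_monom_def)

text \<open>Multiplication by a monomial only shifts the exponents.\<close>

lemma s_monom_cancel: "s_monom m * f = s_monom m * g \<longleftrightarrow> f = g"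
proof
  assume "s_monom m * f = s_monom m * g"
  then have "Poly_Mapping.lookup f k = Poly_Mapping.lookup g k" for k
    using lookup_single_mult[of m f k] lookup_single_mult[of m g k]
    by (simp add: s_monom_def flip: monomial_eq_prod)
  then show "f = g" by (rule poly_mapping_eqI)
qed simp

section \<open>Alcoves and normalised matrix coefficients\<close>

definition alcove_of :: "nat \<Rightarrow> int ^ 'n \<Rightarrow> int ^ 'n" where
  "alcove_of p a = (\<chi> i. a $ i div int p)"

text \<open>For weights \<open>a'\<close> and \<open>a\<close> in the alcoves \<open>x'\<close> and \<open>x\<close> this counts, in each direction, the multiples of
  \<open>p\<close> passed on the way up from \<open>a\<close> to \<open>a'\<close>. Nothing is counted on the way down, because only the
  \<open>z\<^sub>i\<close> carry factors.\<close>

definition ascent :: "int ^ 'n \<Rightarrow> int ^ 'n \<Rightarrow> nat ^ 'n" where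
  "ascent x' x = (\<chi> i. nat (x' $ i - x $ i))"

text \<open>The factors of \<open>rising\<close> with a nonzero constant term: on nilpotent \<open>s\<^sub>i\<close> this is the inverse of the
  product of the \<open>q(s\<^sub>i, a\<^sub>i + j)\<close>.\<close>

definition unit_rising :: "int ^ 'n \<Rightarrow> int ^ 'n \<Rightarrow> ('n::finite, 'k::field) s_poly" where
  "unit_rising a b = (\<Prod>i\<in>UNIV. \<Prod>j\<in>{j\<in>{1..b $ i}. of_int (a $ i + j) \<noteq> (0 :: 'k)}. s_var i + of_int (a $ i + j))"

lemma div_step:
  assumes "(p::int) > 0" shows "(m + 1) div p = m div p + (if p dvd m + 1 then 1 else 0)"
proof (cases "p dvd m + 1")
  case True
  then obtain k where "m + 1 = p * k" by blast
  then have "m = p * (k - 1) + (p - 1)" by (simp add: algebra_simps)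
  then have "m div p = k - 1" by (rule int_div_pos_eq) (use assms in auto)
  then show ?thesis using True \<open>m + 1 = p * k\<close> assms by simp
next
  case False
  have "m mod p \<noteq> p - 1"
  proof
    assume "m mod p = p - 1"
    then have "m + 1 = p * (m div p + 1)" using mult_div_mod_eq[of p m] by (simp add: distrib_left)
    then show False using False by (metis dvd_triv_left)
  qed
  moreover have "m mod p < p" "0 \<le> m mod p" using assms by auto
  moreover have "m + 1 = p * (m div p) + (m mod p + 1)" using div_mult_mod_eq[of m p] by (simp add: algebra_simps)
  ultimately have "(m + 1) div p = m div p" by (intro int_div_pos_eq[where r = "m mod p + 1"]) auto
  then show ?thesis using False by simp
qed

lemma card_multiples:
  assumes "(p::int) > 0" shows "card {j\<in>{1..k}. p dvd a + j} = nat ((a + k) div p - a div p)"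
proof (cases "k \<ge> 0")
  case True
  have "int (card {j\<in>{1..int r}. p dvd a + j}) = (a + int r) div p - a div p" for r
  proof (induction r)
    case (Suc r)
    have "{j\<in>{1..int (Suc r)}. p dvd a + j}
        = (if p dvd a + int r + 1 then insert (int r + 1) else id) {j\<in>{1..int r}. p dvd a + j}"
      by (auto simp: ac_simps le_less)
    moreover have "finite {j\<in>{1..int r}. p dvd a + j}" by (rule finite_subset[of _ "{1..int r}"]) auto
    moreover have "int r + 1 \<notin> {j\<in>{1..int r}. p dvd a + j}" by auto
    ultimately have "int (card {j\<in>{1..int (Suc r)}. p dvd a + j})
        = int (card {j\<in>{1..int r}. p dvd a + j}) + (if p dvd a + int r + 1 then 1 else 0)" by simp
    then show ?case using Suc div_step[OF assms, of "a + int r"] by (simp add: ac_simps)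
  qed simp
  from this[of "nat k"] show ?thesis using True by simp
next
  case False
  then have "(a + k) div p \<le> a div p" using assms by (intro zdiv_mono1) auto
  moreover have e: "{j\<in>{1..k}. p dvd a + j} = {}" using False by auto
  ultimately show ?thesis unfolding e by simp
qed

lemma prod_partition: "finite A \<Longrightarrow> prod f A = prod f {j\<in>A. Q j} * prod f {j\<in>A. \<not> Q j}"
  by (subst prod.union_disjoint[symmetric]) (auto intro: arg_cong[where f = "prod f"])

text \<open>In characteristic \<open>p\<close> the factor \<open>s\<^sub>i + a\<^sub>i + j\<close> is \<open>s\<^sub>i\<close> itself when \<open>p\<close> divides \<open>a\<^sub>i + j\<close>.\<close>

lemma rising_split:
  assumes "CHAR('k::field) = p" "p > 0"
  shows "rising a b = (s_monom (ascent (alcove_of p (a + b)) (alcove_of p a)) * unit_rising a b :: ('n::finite, 'k) s_poly)"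
proof -
  have zero_iff: "of_int k = (0 :: 'k) \<longleftrightarrow> int p dvd k" for k
    using assms(1) by (simp add: of_int_eq_0_iff_char_dvd)
  have "(\<Prod>j\<in>{1..b $ i}. s_var i + of_int (a $ i + j))
      = s_var i ^ nat ((a $ i + b $ i) div int p - a $ i div int p) *
        (\<Prod>j\<in>{j\<in>{1..b $ i}. of_int (a $ i + j) \<noteq> (0 :: 'k)}. (s_var i :: ('n, 'k) s_poly) + of_int (a $ i + j))"
    for i
  proof -
    have "(s_var i :: ('n, 'k) s_poly) + of_int (a $ i + j) = s_var i" if "of_int (a $ i + j) = (0 :: 'k)" for j
      using that s_const_of_int[of "a $ i + j", where ?'b = 'k and ?'a = 'n] by simp
    then have "(\<Prod>j\<in>{j\<in>{1..b $ i}. of_int (a $ i + j) = (0 :: 'k)}. (s_var i :: ('n, 'k) s_poly) + of_int (a $ i + j))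
        = (\<Prod>j\<in>{j\<in>{1..b $ i}. of_int (a $ i + j) = (0 :: 'k)}. s_var i)"
      by (intro prod.cong) auto
    also have "\<dots> = s_var i ^ nat ((a $ i + b $ i) div int p - a $ i div int p)"
      using card_multiples[of "int p" "b $ i" "a $ i"] assms(2) unfolding zero_iff by simp
    finally show ?thesis
      by (subst prod_partition[of _ _ "\<lambda>j. of_int (a $ i + j) = (0 :: 'k)"]) simp_all
  qed
  then show ?thesis
    by (simp add: rising_def unit_rising_def s_monom_def ascent_def alcove_of_def prod.distrib)
qed

lemma unit_rising_0 [simp]: "unit_rising a 0 = 1"
  by (simp add: unit_rising_def)

text \<open>The exponents in the relations of \<open>H\<close> measure the failure of \<open>ascent\<close> to be additive.\<close>

lemma ascent_eta: "ascent x y + ascent y u = ascent x u + eta x y u"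
proof -
  have "nat (i - j) + nat (j - k) = nat (i - k) + nat ((\<bar>i - j\<bar> + \<bar>j - k\<bar> - \<bar>i - k\<bar>) div 2)" for i j k :: int
    by (cases "i \<le> j"; cases "j \<le> k"; cases "i \<le> k") auto
  then show ?thesis by (simp add: vec_eq_iff ascent_def eta_def)
qed

lemma ascent_self [simp]: "ascent x x = 0"
  by (simp add: vec_eq_iff ascent_def)

lemma eta_self [simp]: "eta x x u = 0" "eta x u u = 0"
  by (simp_all add: vec_eq_iff eta_def)

text \<open>The matrix coefficient without the power of \<open>s\<close> that is forced by the alcoves. The quotient is
  unique because monomials cancel, and it exists by \<open>coeff_eq_ncoeff\<close>.\<close>

definition ncoeff :: "nat \<Rightarrow> ('n, 'k) weyl \<Rightarrow> int ^ 'n \<Rightarrow> int ^ 'n \<Rightarrow> ('n::finite, 'k::field) s_poly" where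
  "ncoeff p u a' a = (THE f. coeff u a' a = s_monom (ascent (alcove_of p a') (alcove_of p a)) * f)"

lemma ncoeff_eqI:
  "coeff u a' a = s_monom (ascent (alcove_of p a') (alcove_of p a)) * f \<Longrightarrow> ncoeff p u a' a = f"
  unfolding ncoeff_def by (rule the_equality) (simp_all add: s_monom_cancel)

lemma weyl_word_weight: "weyl_word ws c \<in> weyl_weights {word_weight (Word ws)}"
  unfolding weyl_word_def by (rule weyl_weightsI) auto

locale char_p =
  fixes p :: nat and K :: "'k::field itself"
  assumes char_p: "CHAR('k) = p" and p_pos: "p > 0"
begin

lemma coeff_homogeneous:
  fixes u :: "('n::finite, 'k) weyl"
  assumes "u \<in> weyl_weights {b}"
  obtains r where "u = m_elt b * heval a r"
    and "coeff u (a + b) a = s_monom (ascent (alcove_of p (a + b)) (alcove_of p a)) * (unit_rising a b * r)"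
    and "ncoeff p u (a + b) a = unit_rising a b * r"
proof -
  obtain r where r: "u = m_elt b * heval a r" using homogeneous_span[OF assms] by blast
  then have "coeff u (a + b) a = s_monom (ascent (alcove_of p (a + b)) (alcove_of p a)) * (unit_rising a b * r)"
    by (simp add: coeff_mult_heval coeff_m_elt rising_split[OF char_p p_pos] mult.assoc)
  with r ncoeff_eqI show ?thesis using that by blast
qed

text \<open>By \<open>homogeneous_span\<close> the divisibility need only be known for the monomials \<open>m(b)\<close>.\<close>

lemma coeff_eq_ncoeff:
  fixes u :: "('n::finite, 'k) weyl"
  assumes "u \<in> weyl_weights B"
  shows "coeff u a' a = s_monom (ascent (alcove_of p a') (alcove_of p a)) * ncoeff p u a' a"
proof -
  have "\<exists>f. coeff u a' a = s_monom (ascent (alcove_of p a') (alcove_of p a)) * f"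
    using assms
  proof (induction rule: weyl_weights_induct)
    case zero
    then show ?case by (auto intro: exI[of _ 0])
  next
    case (word ws c)
    note w = weyl_word_weight[of ws c]
    show ?case
    proof (cases "a' = a + word_weight (Word ws)")
      case True
      then show ?thesis using coeff_homogeneous[OF w, of a] by metis
    next
      case False
      then show ?thesis using coeff_homogeneous_zero[OF w] by (auto intro: exI[of _ 0])
    qed
  next
    case (add u v)
    then show ?case by (metis coeff_add distrib_left)
  qed
  then show ?thesis using ncoeff_eqI by metis
qed

lemma ncoeff_add:
  fixes u v :: "('n::finite, 'k) weyl"
  assumes "u \<in> weyl_weights B" "v \<in> weyl_weights B"
  shows "ncoeff p (u + v) a' a = ncoeff p u a' a + ncoeff p v a' a"
  by (rule ncoeff_eqI)
    (simp add: coeff_add coeff_eq_ncoeff[OF assms(1), of a' a] coeff_eq_ncoeff[OF assms(2), of a' a] distrib_left)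

lemma ncoeff_zero [simp]: "ncoeff p 0 a' a = 0"
  by (rule ncoeff_eqI) simp

lemma ncoeff_homogeneous_zero:
  "u \<in> weyl_weights {b} \<Longrightarrow> a' \<noteq> a + b \<Longrightarrow> ncoeff p u a' a = 0"
  by (rule ncoeff_eqI) (simp add: coeff_homogeneous_zero)

lemma ncoeff_heval [simp]: "ncoeff p (heval a f) a a = f"
  by (rule ncoeff_eqI) (simp add: coeff_heval)

lemma ncoeff_m_elt: "ncoeff p (m_elt b) (a + b) a = (unit_rising a b :: ('n::finite, 'k) s_poly)"
  by (rule ncoeff_eqI) (simp add: coeff_m_elt rising_split[OF char_p p_pos])

text \<open>Matrix coefficients are multiplicative, and \<open>ascent_eta\<close> collects the powers of \<open>s\<close> that were split
  off. The outcome is the composition law of the \<open>c\<^sub>x\<^sub>,\<^sub>y\<close> in \<open>H\<close>.\<close>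

lemma ncoeff_mult:
  fixes u v :: "('n::finite, 'k) weyl"
  assumes "u \<in> weyl_weights B" "v \<in> weyl_weights {b}"
  shows "ncoeff p (u * v) a' a = s_monom (eta (alcove_of p a') (alcove_of p (a + b)) (alcove_of p a))
    * (ncoeff p u a' (a + b) * ncoeff p v (a + b) a)"
proof (rule ncoeff_eqI)
  let ?m = "\<lambda>a' a. s_monom (ascent (alcove_of p a') (alcove_of p a)) :: ('n, 'k) s_poly"
  have "coeff (u * v) a' a = (?m a' (a + b) * ?m (a + b) a) * (ncoeff p u a' (a + b) * ncoeff p v (a + b) a)"
    by (simp add: coeff_mult[OF assms(2)] coeff_eq_ncoeff[OF assms(1), of a' "a + b"]
        coeff_eq_ncoeff[OF assms(2), of "a + b" a])
  then show "coeff (u * v) a' a = ?m a' a * (s_monom (eta (alcove_of p a') (alcove_of p (a + b)) (alcove_of p a))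
    * (ncoeff p u a' (a + b) * ncoeff p v (a + b) a))"
    by (simp add: mult.assoc ascent_eta flip: s_monom_add) (simp add: s_monom_add mult.assoc)
qed

text \<open>A product of two monomials is a monomial times a polynomial by \<open>homogeneous_span\<close>; comparing
  matrix coefficients shows which polynomial.\<close>

lemma m_elt_mult:
  obtains r where "m_elt b' * m_elt b = (m_elt (b' + b) * heval a r :: ('n::finite, 'k) weyl)"
    and "unit_rising a (b' + b) * r = s_monom (eta (alcove_of p (a + b + b')) (alcove_of p (a + b)) (alcove_of p a))
      * (unit_rising (a + b) b' * unit_rising a b)"
proof -
  have w: "m_elt b' * m_elt b \<in> weyl_weights {b' + b}"
    by (rule weyl_weights_mult[OF m_elt_weight m_elt_weight]) auto
  obtain r where r: "m_elt b' * m_elt b = (m_elt (b' + b) * heval a r :: ('n, 'k) weyl)"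
    "ncoeff p (m_elt b' * m_elt b) (a + (b' + b)) a = unit_rising a (b' + b) * r"
    using coeff_homogeneous[OF w, of a] by metis
  moreover have "a + (b' + b) = a + b + b'" by (simp add: ac_simps)
  ultimately show ?thesis
    using that ncoeff_mult[OF m_elt_weight m_elt_weight, of b' b "a + b + b'" a]
    by (simp add: ncoeff_m_elt)
qed

end

subsection \<open>Units modulo powers of the variables\<close>

definition s_power_ideal :: "nat \<Rightarrow> ('n::finite, 'k::field) s_poly set" where
  "s_power_ideal N = {\<Sum>i\<in>UNIV. h i * s_var i ^ N | h. True}"

lemma s_power_ideal_mult: "f \<in> s_power_ideal N \<Longrightarrow> g * f \<in> s_power_ideal N"
proof -
  assume "f \<in> s_power_ideal N"
  then obtain h where "f = (\<Sum>i\<in>UNIV. h i * s_var i ^ N)" by (auto simp: s_power_ideal_def)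
  then have "g * f = (\<Sum>i\<in>UNIV. (g * h i) * s_var i ^ N)" by (simp add: sum_distrib_left mult.assoc)
  then show ?thesis by (auto simp: s_power_ideal_def)
qed

lemma s_power_ideal_add: "f \<in> s_power_ideal N \<Longrightarrow> g \<in> s_power_ideal N \<Longrightarrow> f + g \<in> s_power_ideal N"
proof -
  assume "f \<in> s_power_ideal N" "g \<in> s_power_ideal N"
  then obtain h k where "f = (\<Sum>i\<in>UNIV. h i * s_var i ^ N)" "g = (\<Sum>i\<in>UNIV. k i * s_var i ^ N)"
    by (auto simp: s_power_ideal_def)
  then have "f + g = (\<Sum>i\<in>UNIV. (h i + k i) * s_var i ^ N)" by (simp add: distrib_right sum.distrib)
  then show ?thesis by (auto simp: s_power_ideal_def intro!: exI[of _ "\<lambda>i. h i + k i"])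
qed

lemma s_power_ideal_zero: "0 \<in> s_power_ideal N"
  by (auto simp: s_power_ideal_def intro!: exI[of _ "\<lambda>_. 0"])

lemma s_power_ideal_var: "h * s_var i ^ N \<in> s_power_ideal N"
proof -
  have "h * s_var i ^ N = (\<Sum>j\<in>UNIV. (if j = i then h else 0) * s_var j ^ N)"
    by (simp add: if_distrib[of "\<lambda>x. x * _"] cong: if_cong)
  then show ?thesis unfolding s_power_ideal_def mem_Collect_eq by (intro exI conjI TrueI)
qed

text \<open>The induction builds up the finite geometric series for \<open>1 / (s + c)\<close>.\<close>

lemma unit_mod_power:
  fixes s c d :: "'a::comm_ring_1"
  assumes "c * d = 1" shows "\<exists>g h. (s + c) * g = 1 + h * s ^ N"
proof (induction N)
  case 0
  show ?case by (rule exI[of _ 0], rule exI[of _ "-1"]) simp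
next
  case (Suc N)
  then obtain g h where "(s + c) * g = 1 + h * s ^ N" by blast
  then have "(s + c) * (g - d * h * s ^ N) = 1 + h * s ^ N - d * h * s ^ N * s - (c * d) * h * s ^ N"
    by (simp add: algebra_simps)
  then have "(s + c) * (g - d * h * s ^ N) = 1 + (- d * h) * s ^ Suc N"
    by (simp add: assms algebra_simps)
  then show ?case by blast
qed

lemma linear_unit_mod:
  assumes "of_int k \<noteq> (0 :: 'k::field)"
  shows "\<exists>g. ((s_var i :: ('n::finite, 'k) s_poly) + of_int k) * g - 1 \<in> s_power_ideal N"
proof -
  have "of_int k * s_const (inverse (of_int k)) = (1 :: ('n, 'k) s_poly)"
    using assms by (simp flip: s_const_of_int s_const_simps)
  from unit_mod_power[OF this, of "s_var i" N] obtain g h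
    where "((s_var i :: ('n, 'k) s_poly) + of_int k) * g = 1 + h * s_var i ^ N" by blast
  then have "((s_var i :: ('n, 'k) s_poly) + of_int k) * g - 1 \<in> s_power_ideal N"
    using s_power_ideal_var by simp
  then show ?thesis by blast
qed

lemma unit_mod_mult:
  assumes "f * g - 1 \<in> s_power_ideal N" "f' * g' - 1 \<in> s_power_ideal N"
  shows "(f * f') * (g * g') - 1 \<in> s_power_ideal N"
proof -
  have "(f * f') * (g * g') - 1 = (f' * g') * (f * g - 1) + (f' * g' - 1)" by (simp add: algebra_simps)
  then show ?thesis using assms by (simp only: s_power_ideal_add s_power_ideal_mult)
qed

lemma unit_mod_prod:
  assumes "\<And>i. i \<in> I \<Longrightarrow> \<exists>g. f i * g - 1 \<in> s_power_ideal N"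
  shows "\<exists>g. (\<Prod>i\<in>I. f i) * g - 1 \<in> s_power_ideal N"
  using assms
proof (induction I rule: infinite_finite_induct)
  case (insert i I)
  then obtain g g' where "f i * g - 1 \<in> s_power_ideal N" "(\<Prod>i\<in>I. f i) * g' - 1 \<in> s_power_ideal N" by blast
  from unit_mod_mult[OF this] insert show ?case by auto
qed (auto intro!: exI[of _ 1] s_power_ideal_zero)

lemma unit_rising_unit:
  "\<exists>g. unit_rising a b * g - 1 \<in> (s_power_ideal N :: ('n::finite, 'k::field) s_poly set)"
  unfolding unit_rising_def by (intro unit_mod_prod linear_unit_mod) auto

section \<open>Actions of a subring and modules over its quotients\<close>

text \<open>Both algebras of the theorem are quotients of rings in which one can compute with elements instead
  of cosets. The acting ring is a subset \<open>S\<close> of a type since for \<open>A\<^sup>\<lambda>\<close> it consists of the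
  \<open>T\<close>-invariants of the Weyl algebra.\<close>

locale ring_act = abelian_group V for V (structure) +
  fixes S :: "'a::ring_1 set" and act :: "'a \<Rightarrow> 'v \<Rightarrow> 'v" (infixr "\<cdot>" 75)
  assumes S_one: "1 \<in> S" and S_diff: "\<lbrakk>x \<in> S; y \<in> S\<rbrakk> \<Longrightarrow> x - y \<in> S"
    and S_mult: "\<lbrakk>x \<in> S; y \<in> S\<rbrakk> \<Longrightarrow> x * y \<in> S"
    and act_closed [simp]: "\<lbrakk>x \<in> S; v \<in> carrier V\<rbrakk> \<Longrightarrow> x \<cdot> v \<in> carrier V"
    and act_add_left: "\<lbrakk>x \<in> S; y \<in> S; v \<in> carrier V\<rbrakk> \<Longrightarrow> (x + y) \<cdot> v = x \<cdot> v \<oplus>\<^bsub>V\<^esub> y \<cdot> v"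
    and act_add: "\<lbrakk>x \<in> S; v \<in> carrier V; w \<in> carrier V\<rbrakk> \<Longrightarrow> x \<cdot> (v \<oplus>\<^bsub>V\<^esub> w) = x \<cdot> v \<oplus>\<^bsub>V\<^esub> x \<cdot> w"
    and act_mult: "\<lbrakk>x \<in> S; y \<in> S; v \<in> carrier V\<rbrakk> \<Longrightarrow> (x * y) \<cdot> v = x \<cdot> (y \<cdot> v)"
    and act_one [simp]: "v \<in> carrier V \<Longrightarrow> 1 \<cdot> v = v"
begin

lemma S_zero: "0 \<in> S" using S_diff[OF S_one S_one] by simp

lemma S_uminus: "x \<in> S \<Longrightarrow> - x \<in> S" using S_diff[OF S_zero, of x] by simp

lemma S_add: "x \<in> S \<Longrightarrow> y \<in> S \<Longrightarrow> x + y \<in> S" using S_diff[of x "- y"] S_uminus[of y] by simp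

lemma S_sum: "(\<And>i. i \<in> I \<Longrightarrow> f i \<in> S) \<Longrightarrow> sum f I \<in> S"
  by (induction I rule: infinite_finite_induct) (auto intro: S_add S_zero)

lemma S_power: "x \<in> S \<Longrightarrow> x ^ k \<in> S"
  by (induction k) (auto intro: S_mult S_one)

lemma eq_zero_if_add_self: "v \<in> carrier V \<Longrightarrow> v \<oplus>\<^bsub>V\<^esub> v = v \<Longrightarrow> v = \<zero>\<^bsub>V\<^esub>"
  using add.r_cancel_one by blast

lemma act_zero [simp]: "x \<in> S \<Longrightarrow> x \<cdot> \<zero>\<^bsub>V\<^esub> = \<zero>\<^bsub>V\<^esub>"
  using act_add[of x "\<zero>\<^bsub>V\<^esub>" "\<zero>\<^bsub>V\<^esub>"] by (intro eq_zero_if_add_self) auto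

lemma act_zero_left [simp]: "v \<in> carrier V \<Longrightarrow> 0 \<cdot> v = \<zero>\<^bsub>V\<^esub>"
  using act_add_left[of 0 0 v] S_zero by (intro eq_zero_if_add_self) auto

lemma act_uminus: "x \<in> S \<Longrightarrow> v \<in> carrier V \<Longrightarrow> (- x) \<cdot> v = \<ominus>\<^bsub>V\<^esub> (x \<cdot> v)"
  using act_add_left[of x "- x" v] S_uminus[of x] by (intro minus_equality[symmetric]) (auto simp: a_comm)

lemma act_diff: "x \<in> S \<Longrightarrow> y \<in> S \<Longrightarrow> v \<in> carrier V \<Longrightarrow> (x - y) \<cdot> v = x \<cdot> v \<ominus>\<^bsub>V\<^esub> y \<cdot> v"
  using act_add_left[of x "- y" v] S_uminus[of y] by (simp add: act_uminus a_minus_def)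

lemma act_neg: "x \<in> S \<Longrightarrow> v \<in> carrier V \<Longrightarrow> x \<cdot> (\<ominus>\<^bsub>V\<^esub> v) = \<ominus>\<^bsub>V\<^esub> (x \<cdot> v)"
  using act_add[of x v "\<ominus>\<^bsub>V\<^esub> v"] by (intro minus_equality[symmetric]) (auto simp: r_neg l_neg a_comm)

lemma act_finsum: "x \<in> S \<Longrightarrow> f \<in> I \<rightarrow> carrier V \<Longrightarrow> x \<cdot> (\<Oplus>\<^bsub>V\<^esub>i\<in>I. f i) = (\<Oplus>\<^bsub>V\<^esub>i\<in>I. x \<cdot> f i)"
  by (induction I rule: infinite_finite_induct) (auto simp: act_add Pi_def)

lemma act_sum:
  "(\<And>i. i \<in> I \<Longrightarrow> f i \<in> S) \<Longrightarrow> finite I \<Longrightarrow> v \<in> carrier V \<Longrightarrow> sum f I \<cdot> v = (\<Oplus>\<^bsub>V\<^esub>i\<in>I. f i \<cdot> v)"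
proof (induction I rule: infinite_finite_induct)
  case (insert i I)
  then show ?case by (simp add: act_add_left S_sum)
qed auto

lemma act_power: "x \<in> S \<Longrightarrow> v \<in> carrier V \<Longrightarrow> ((\<lambda>w. x \<cdot> w) ^^ k) v = (x ^ k) \<cdot> v"
  by (induction k) (auto simp: act_mult S_power)

lemma power_act_zero:
  assumes "x \<in> S" "v \<in> carrier V" "(x ^ k) \<cdot> v = \<zero>\<^bsub>V\<^esub>" "k \<le> l" shows "(x ^ l) \<cdot> v = \<zero>\<^bsub>V\<^esub>"
proof -
  have "x ^ l = x ^ (l - k) * x ^ k" using assms(4) by (simp flip: power_add)
  then show ?thesis using assms by (simp add: act_mult S_power)
qed

end

lemma class_ring_is_ring:
  assumes "(1 :: 'a::ring_1) \<in> S" "\<And>x y. x \<in> S \<Longrightarrow> y \<in> S \<Longrightarrow> x - y \<in> S"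
    "\<And>x y. x \<in> S \<Longrightarrow> y \<in> S \<Longrightarrow> x * y \<in> S"
  shows "ring (class_ring S)"
proof -
  have z: "0 \<in> S" using assms(2)[OF assms(1) assms(1)] by simp
  have m: "- x \<in> S" if "x \<in> S" for x using assms(2)[OF z that] by simp
  have a: "x + y \<in> S" if "x \<in> S" "y \<in> S" for x y using assms(2)[OF that(1) m[OF that(2)]] by simp
  show ?thesis
  proof (rule ringI)
    show "abelian_group (class_ring S)"
      by (rule abelian_groupI) (auto simp: class_ring_def z a add.assoc add.commute intro!: bexI[of _ "- _"] m)
    show "monoid (class_ring S)"
      by (rule monoidI) (auto simp: class_ring_def assms mult.assoc)
  qed (auto simp: class_ring_def distrib_left distrib_right)
qed

text \<open>Modules over the quotient of \<open>S\<close> by the ideal generated by \<open>G\<close> are actions of \<open>S\<close> that kill \<open>G\<close>.\<close>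

locale class_quotient =
  fixes S G :: "'a::ring_1 set"
  assumes one_S: "1 \<in> S" and diff_S: "\<lbrakk>x \<in> S; y \<in> S\<rbrakk> \<Longrightarrow> x - y \<in> S"
    and mult_S: "\<lbrakk>x \<in> S; y \<in> S\<rbrakk> \<Longrightarrow> x * y \<in> S" and G_S: "G \<subseteq> S"
begin

definition qideal where "qideal = Idl\<^bsub>class_ring S\<^esub> G"

definition qring where "qring = class_ring S Quot qideal"

definition qcls where "qcls u = qideal +>\<^bsub>class_ring S\<^esub> u"

sublocale R0: ring "class_ring S"
  by (rule class_ring_is_ring) (fact one_S diff_S mult_S)+

lemma class_ring_simps [simp]:
  "carrier (class_ring S) = S" "x \<otimes>\<^bsub>class_ring S\<^esub> y = x * y" "x \<oplus>\<^bsub>class_ring S\<^esub> y = x + y"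
  "\<one>\<^bsub>class_ring S\<^esub> = 1" "\<zero>\<^bsub>class_ring S\<^esub> = 0"
  by (simp_all add: class_ring_def)

sublocale qideal: ideal qideal "class_ring S"
  unfolding qideal_def by (rule R0.genideal_ideal) (simp add: G_S)

lemma G_qideal: "G \<subseteq> qideal"
  unfolding qideal_def by (rule R0.genideal_self) (simp add: G_S)

sublocale qring: ring qring
  unfolding qring_def by (rule qideal.quotient_is_ring)

lemma qcls_hom: "qcls \<in> ring_hom (class_ring S) qring"
  unfolding qring_def qcls_def[abs_def] by (rule qideal.rcos_ring_hom)

lemma qcls_closed: "u \<in> S \<Longrightarrow> qcls u \<in> carrier qring"
  using ring_hom_closed[OF qcls_hom] by simp

lemma qcls_add: "u \<in> S \<Longrightarrow> v \<in> S \<Longrightarrow> qcls (u + v) = qcls u \<oplus>\<^bsub>qring\<^esub> qcls v"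
  using ring_hom_add[OF qcls_hom] by simp

lemma qcls_mult: "u \<in> S \<Longrightarrow> v \<in> S \<Longrightarrow> qcls (u * v) = qcls u \<otimes>\<^bsub>qring\<^esub> qcls v"
  using ring_hom_mult[OF qcls_hom] by simp

lemma qcls_one: "qcls 1 = \<one>\<^bsub>qring\<^esub>"
  using ring_hom_one[OF qcls_hom] by simp

lemma carrier_qring: "carrier qring = qcls ` S"
  by (auto simp: qring_def qcls_def FactRing_def A_RCOSETS_def')

lemma qideal_S: "qideal \<subseteq> S"
  using qideal.a_subset by simp

lemma mem_qcls: "u \<in> S \<Longrightarrow> f \<in> qcls u \<longleftrightarrow> f \<in> S \<and> f - u \<in> qideal"
proof -
  assume u: "u \<in> S"
  have add: "x + y \<in> S" if "x \<in> S" "y \<in> S" for x y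
    using R0.a_closed[of x y] that by simp
  show ?thesis
    using u qideal_S by (auto simp: qcls_def a_r_coset_def' intro!: add bexI[of _ "f - u"])
qed

lemma qcls_eq: "f \<in> S \<Longrightarrow> f - u \<in> qideal \<Longrightarrow> u \<in> S \<Longrightarrow> qcls f = qcls u"
  using mem_qcls[of u f] qideal.a_repr_independence'[of f u] by (simp add: qcls_def)

lemma left_module_act:
  assumes "left_module qring V"
  shows "ring_act V S (\<lambda>u v. qcls u \<odot>\<^bsub>V\<^esub> v)" and "\<And>g v. g \<in> G \<Longrightarrow> v \<in> carrier V \<Longrightarrow> qcls g \<odot>\<^bsub>V\<^esub> v = \<zero>\<^bsub>V\<^esub>"
proof -
  interpret V: left_module qring V by fact
  show ra: "ring_act V S (\<lambda>u v. qcls u \<odot>\<^bsub>V\<^esub> v)"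
    by unfold_locales
      (auto simp: qcls_closed qcls_add qcls_mult qcls_one one_S diff_S mult_S V.smult_closed V.smult_l_distr
        V.smult_r_distr V.smult_assoc V.smult_one)
  fix g v assume "g \<in> G" "v \<in> carrier V"
  then have g: "g \<in> S" "g - 0 \<in> qideal" using G_S G_qideal by auto
  interpret A: ring_act V S "\<lambda>u v. qcls u \<odot>\<^bsub>V\<^esub> v" by (rule ra)
  have "qcls g = qcls 0" by (rule qcls_eq) (use g A.S_zero in auto)
  then show "qcls g \<odot>\<^bsub>V\<^esub> v = \<zero>\<^bsub>V\<^esub>" using \<open>v \<in> carrier V\<close> by simp
qed

text \<open>The elements that act as zero form an ideal containing the relations, so any representative of a
  coset may be used.\<close>

lemma act_left_module:
  assumes "ring_act V S act" and kills: "\<And>g v. g \<in> G \<Longrightarrow> v \<in> carrier V \<Longrightarrow> act g v = \<zero>\<^bsub>V\<^esub>"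
    and smult: "\<And>h v. v \<in> carrier V \<Longrightarrow> h \<odot>\<^bsub>V\<^esub> v = act (SOME f. f \<in> h) v"
  shows "left_module qring V" and "\<And>u v. u \<in> S \<Longrightarrow> v \<in> carrier V \<Longrightarrow> qcls u \<odot>\<^bsub>V\<^esub> v = act u v"
proof -
  interpret A: ring_act V S act by fact
  have "ideal {u \<in> S. \<forall>v\<in>carrier V. act u v = \<zero>\<^bsub>V\<^esub>} (class_ring S)" (is "ideal ?I _")
  proof (rule idealI)
    show "subgroup ?I (add_monoid (class_ring S))"
    proof (rule R0.add.subgroupI)
      fix a assume "a \<in> ?I"
      then have "a \<oplus>\<^bsub>class_ring S\<^esub> (- a) = \<zero>\<^bsub>class_ring S\<^esub>" "a \<in> S" "- a \<in> S" by (auto simp: A.S_uminus)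
      then have "\<ominus>\<^bsub>class_ring S\<^esub> a = - a" by (intro R0.minus_equality) (auto simp: A.S_uminus)
      then show "\<ominus>\<^bsub>class_ring S\<^esub> a \<in> ?I"
        using \<open>a \<in> ?I\<close> by (auto simp: A.S_uminus A.act_uminus)
    qed (auto simp: A.S_zero A.S_add A.act_add_left intro!: exI[of _ 0])
  qed (auto simp: R0.ring_axioms A.S_mult A.act_mult)
  then have "qideal \<subseteq> ?I"
    unfolding qideal_def by (rule R0.genideal_minimal) (use G_S kills in auto)
  then have zero: "act u v = \<zero>\<^bsub>V\<^esub>" if "u \<in> qideal" "v \<in> carrier V" for u v using that by auto
  show eq: "qcls u \<odot>\<^bsub>V\<^esub> v = act u v" if "u \<in> S" "v \<in> carrier V" for u v
  proof -
    have "u \<in> qcls u" using that mem_qcls[of u u] qideal.additive_subgroup_axioms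
      by (simp add: additive_subgroup.zero_closed[of _ "class_ring S", simplified])
    then have "(SOME f. f \<in> qcls u) \<in> qcls u" by (rule someI)
    then have f: "(SOME f. f \<in> qcls u) \<in> S" "(SOME f. f \<in> qcls u) - u \<in> qideal"
      using mem_qcls[OF that(1)] by auto
    have "act ((SOME f. f \<in> qcls u) - u + u) v = act u v"
      by (subst A.act_add_left) (use f that zero A.S_diff in auto)
    then show ?thesis by (simp add: smult that)
  qed
  show "left_module qring V"
  proof (unfold_locales, goal_cases)
    case (1 r v) then show ?case by (auto simp: carrier_qring eq)
  next
    case (2 r s v) then show ?case by (auto simp: carrier_qring eq A.S_add A.act_add_left simp flip: qcls_add)
  next
    case (3 r v w) then show ?case by (auto simp: carrier_qring eq A.act_add)
  next
    case (4 r s v) then show ?case by (auto simp: carrier_qring eq A.S_mult A.act_mult simp flip: qcls_mult)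
  next
    case (5 v) then show ?case by (simp add: eq one_S flip: qcls_one)
  qed
qed

end

section \<open>Spans over the base field\<close>

locale scalar_act = ring_act V S act
  for V (structure) and S :: "'a::ring_1 set" and act :: "'a \<Rightarrow> 'v \<Rightarrow> 'v" (infixr "\<cdot>" 75) +
  fixes sc :: "'k::field \<Rightarrow> 'a"
  assumes sc_closed [simp]: "sc c \<in> S" and sc_add: "sc (c + d) = sc c + sc d"
    and sc_mult: "sc (c * d) = sc c * sc d" and sc_one [simp]: "sc 1 = 1"
begin

inductive_set kspan for B where
  zero: "\<zero>\<^bsub>V\<^esub> \<in> kspan B"
| base: "v \<in> B \<Longrightarrow> v \<in> kspan B"
| add: "v \<in> kspan B \<Longrightarrow> w \<in> kspan B \<Longrightarrow> v \<oplus>\<^bsub>V\<^esub> w \<in> kspan B"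
| scale: "v \<in> kspan B \<Longrightarrow> sc c \<cdot> v \<in> kspan B"

lemma sc_zero [simp]: "sc 0 = 0" using sc_add[of 0 0] by simp

lemma kspan_carrier: "B \<subseteq> carrier V \<Longrightarrow> v \<in> kspan B \<Longrightarrow> v \<in> carrier V"
  by (erule kspan.induct) auto

lemma kspan_finsum: "(\<And>i. i \<in> I \<Longrightarrow> f i \<in> kspan B) \<Longrightarrow> B \<subseteq> carrier V \<Longrightarrow> (\<Oplus>\<^bsub>V\<^esub>i\<in>I. f i) \<in> kspan B"
proof (induction I rule: infinite_finite_induct)
  case (insert i I)
  then have "f \<in> insert i I \<rightarrow> carrier V" using kspan_carrier by blast
  then show ?case using insert by (auto intro: kspan.add)
qed (auto intro: kspan.zero)

lemma kspan_coeffs: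
  assumes "finite B" "B \<subseteq> carrier V" "v \<in> kspan B"
  shows "\<exists>c. v = (\<Oplus>\<^bsub>V\<^esub>w\<in>B. sc (c w) \<cdot> w)"
  using assms(3)
proof induction
  case zero
  have "(\<Oplus>\<^bsub>V\<^esub>w\<in>B. sc 0 \<cdot> w) = (\<Oplus>\<^bsub>V\<^esub>w\<in>B. \<zero>\<^bsub>V\<^esub>)" by (rule finsum_cong') (use assms in auto)
  then show ?case by (intro exI[of _ "\<lambda>_. 0"]) simp
next
  case (base v)
  have "(\<Oplus>\<^bsub>V\<^esub>w\<in>B. sc (if w = v then 1 else 0) \<cdot> w) = (\<Oplus>\<^bsub>V\<^esub>w\<in>B. if v = w then v else \<zero>\<^bsub>V\<^esub>)"
    by (rule finsum_cong') (use assms in auto)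
  also have "\<dots> = v" using finsum_singleton[OF base assms(1), of "\<lambda>_. v"] assms base by auto
  finally show ?case by metis
next
  case (add v w)
  then obtain c d where "v = (\<Oplus>\<^bsub>V\<^esub>w\<in>B. sc (c w) \<cdot> w)" "w = (\<Oplus>\<^bsub>V\<^esub>w\<in>B. sc (d w) \<cdot> w)" by blast
  then have "v \<oplus>\<^bsub>V\<^esub> w = (\<Oplus>\<^bsub>V\<^esub>w\<in>B. sc (c w) \<cdot> w \<oplus>\<^bsub>V\<^esub> sc (d w) \<cdot> w)"
    using assms by (subst finsum_addf) auto
  also have "\<dots> = (\<Oplus>\<^bsub>V\<^esub>w\<in>B. sc (c w + d w) \<cdot> w)"
    by (rule finsum_cong') (use assms in \<open>auto simp: sc_add act_add_left\<close>)
  finally show ?case by metis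
next
  case (scale v c)
  then obtain d where "v = (\<Oplus>\<^bsub>V\<^esub>w\<in>B. sc (d w) \<cdot> w)" by blast
  then have "sc c \<cdot> v = (\<Oplus>\<^bsub>V\<^esub>w\<in>B. sc c \<cdot> (sc (d w) \<cdot> w))"
    using assms by (simp add: act_finsum Pi_def subset_iff)
  also have "\<dots> = (\<Oplus>\<^bsub>V\<^esub>w\<in>B. sc (c * d w) \<cdot> w)"
    by (rule finsum_cong') (use assms in \<open>auto simp: sc_mult act_mult\<close>)
  finally show ?case by metis
qed

lemma combination_kspan: "B \<subseteq> carrier V \<Longrightarrow> (\<Oplus>\<^bsub>V\<^esub>w\<in>B. sc (c w) \<cdot> w) \<in> kspan B"
  by (rule kspan_finsum) (auto intro: kspan.intros)

lemma kspan_mono: "v \<in> kspan B \<Longrightarrow> B \<subseteq> C \<Longrightarrow> v \<in> kspan C"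
  by (induction rule: kspan.induct) (auto intro: kspan.intros)

text \<open>The coefficients with respect to a finite spanning set encode vectors as lists. All lists have the
  same length, so that concatenations of codes can be decoded.\<close>

lemma kspan_injection:
  assumes "finite B" "B \<subseteq> carrier V" "carrier V \<subseteq> kspan B"
  obtains d and code :: "'v \<Rightarrow> 'k list"
  where "inj_on code (carrier V)" "\<And>v. v \<in> carrier V \<Longrightarrow> length (code v) = d"
proof -
  obtain bs where bs: "set bs = B" using finite_list[OF assms(1)] by blast
  have "\<forall>v\<in>carrier V. \<exists>c. v = (\<Oplus>\<^bsub>V\<^esub>w\<in>B. sc (c w) \<cdot> w)"
    using kspan_coeffs assms by blast
  then obtain c where c: "\<And>v. v \<in> carrier V \<Longrightarrow> v = (\<Oplus>\<^bsub>V\<^esub>w\<in>B. sc (c v w) \<cdot> w)" by metis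
  have "inj_on (\<lambda>v. map (c v) bs) (carrier V)"
  proof (rule inj_onI)
    fix v w assume vw: "v \<in> carrier V" "w \<in> carrier V" "map (c v) bs = map (c w) bs"
    then have "c v x = c w x" if "x \<in> B" for x using that bs by (auto simp: map_eq_conv)
    then have "(\<Oplus>\<^bsub>V\<^esub>x\<in>B. sc (c v x) \<cdot> x) = (\<Oplus>\<^bsub>V\<^esub>x\<in>B. sc (c w x) \<cdot> x)"
      by (intro finsum_cong') (use assms in auto)
    then show "v = w" using c[OF vw(1)] c[OF vw(2)] by simp
  qed
  then show ?thesis by (rule that[where d = "length bs"]) simp
qed

end

section \<open>Equivariant modules\<close>

lemma pairing_add: "pairing (a + b) x = pairing a x + pairing b x"
  by (simp add: pairing_def distrib_right sum.distrib)

lemma pairing_diff: "pairing (a - b) x = pairing a x - pairing b x"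
  by (simp add: pairing_def left_diff_distrib sum_subtractf)

lemma g_star_zero [simp]: "0 \<in> g_star t"
  by (simp add: lattice_fiber_def pairing_def)

lemma g_star_add: "a \<in> g_star t \<Longrightarrow> b \<in> g_star t \<Longrightarrow> a + b \<in> g_star t"
  by (simp add: lattice_fiber_def pairing_add)

lemma g_star_diff: "a \<in> g_star t \<Longrightarrow> b \<in> g_star t \<Longrightarrow> a - b \<in> g_star t"
  by (simp add: lattice_fiber_def pairing_diff)

lemma fiber_add: "a \<in> lattice_fiber t lam \<Longrightarrow> b \<in> g_star t \<Longrightarrow> a + b \<in> lattice_fiber t lam"
  by (simp add: lattice_fiber_def pairing_add)

lemma fiber_diff: "a \<in> lattice_fiber t lam \<Longrightarrow> b \<in> lattice_fiber t lam \<Longrightarrow> a - b \<in> g_star t"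
  by (simp add: lattice_fiber_def pairing_diff)

definition A_rels :: "(int ^ 'n) set \<Rightarrow> (int ^ 'n \<Rightarrow> int) \<Rightarrow> ('n::finite, 'k::field) weyl set" where
  "A_rels t lam = {(\<Sum>i\<in>UNIV. of_int (x $ i) * hplus i) - of_int (lam x) | x. x \<in> t}"

lemma weight_zero_subset: "u \<in> weyl_weights {0} \<Longrightarrow> u \<in> weyl_weights (g_star t)"
  by (rule weyl_weights_subsetD[OF _ g_star_zero])

lemma A_rels_weight: "A_rels t lam \<subseteq> weyl_weights {0}"
  unfolding A_rels_def
  by (auto intro!: weyl_weights_diff weyl_weights_sum weyl_weights_mult0 weyl_weights_of_int weyl_weights_hplus)

lemma class_quotient_A:
  "class_quotient (weyl_weights (g_star t)) (A_rels t lam :: ('n::finite, 'k::field) weyl set)"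
proof
  show "A_rels t lam \<subseteq> weyl_weights (g_star t)" using A_rels_weight weight_zero_subset by blast
qed (auto intro: weyl_weights_one weyl_weights_diff weyl_weights_mult g_star_add)

lemma A_lam_qring: "A_lam t lam = class_quotient.qring (weyl_weights (g_star t)) (A_rels t lam)"
  and A_cls_qcls: "A_cls t lam u = class_quotient.qcls (weyl_weights (g_star t)) (A_rels t lam) u"
  unfolding A_lam_def A_cls_def A_alg_def A_moment_def A_rels_def[symmetric]
      class_quotient.qring_def[OF class_quotient_A] class_quotient.qcls_def[OF class_quotient_A]
      class_quotient.qideal_def[OF class_quotient_A]
  by (rule refl)+

lemma carrier_A_lam: "carrier (A_lam t lam) = A_cls t lam ` weyl_weights (g_star t)"
  by (simp add: A_lam_qring A_cls_qcls class_quotient.carrier_qring[OF class_quotient_A] image_def)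

lemma T_invariants_induct [consumes 1, case_names zero homogeneous add]:
  assumes "u \<in> weyl_weights (g_star t)" "P 0"
    "\<And>u b. b \<in> g_star t \<Longrightarrow> u \<in> weyl_weights {b} \<Longrightarrow> P u"
    "\<And>u v. u \<in> weyl_weights (g_star t) \<Longrightarrow> v \<in> weyl_weights (g_star t) \<Longrightarrow> P u \<Longrightarrow> P v \<Longrightarrow> P (u + v)"
  shows "P u"
proof -
  have "u \<in> weyl_weights (g_star t) \<and> P u"
    using assms(1)
  proof (induction rule: weyl_weights_induct)
    case (word ws c)
    then show ?case using assms(3)[OF word weyl_word_weight] weyl_weights_subsetD[OF weyl_word_weight word] by blast
  next
    case (add u v)
    then show ?case using assms(4) weyl_weights_add by blast
  qed (use assms(2) in auto)
  then show ?thesis by blast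
qed

locale A_action = char_p p "TYPE('k)" for p and t :: "(int ^ 'n::finite) set"
    and lam :: "int ^ 'n \<Rightarrow> int" and M :: "('n, 'k::field, 'v) Dmod" +
  assumes left_module: "left_module (A_lam t lam) M"
begin

abbreviation S where "S \<equiv> weyl_weights (g_star t) :: ('n, 'k) weyl set"

abbreviation act (infixr "\<cdot>" 75) where "u \<cdot> v \<equiv> A_cls t lam u \<odot>\<^bsub>M\<^esub> v"

sublocale scalar_act M S "\<lambda>u v. u \<cdot> v" scal
proof -
  have "ring_act M S (\<lambda>u v. u \<cdot> v)"
    using class_quotient.left_module_act(1)[OF class_quotient_A] left_module
    by (simp add: A_lam_qring A_cls_qcls)
  then interpret ring_act M S "\<lambda>u v. u \<cdot> v" .
  show "scalar_act M S (\<lambda>u v. u \<cdot> v) scal"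
    by unfold_locales (auto simp: scal_add scal_mult intro: weyl_weights_scal)
qed

lemma A_rels_act: "g \<in> A_rels t lam \<Longrightarrow> v \<in> carrier M \<Longrightarrow> g \<cdot> v = \<zero>\<^bsub>M\<^esub>"
  using class_quotient.left_module_act(2)[OF class_quotient_A] left_module
  by (simp add: A_lam_qring A_cls_qcls)

lemma weight_zero_S: "u \<in> weyl_weights {0} \<Longrightarrow> u \<in> S"
  by (rule weight_zero_subset)

lemma heval_S [simp]: "heval a f \<in> S" by (rule weight_zero_S[OF heval_weight])

lemma hdiff_S [simp]: "hdiff a i \<in> S" by (rule weight_zero_S[OF hdiff_weight])

lemma hplus_S [simp]: "hplus i \<in> S" by (rule weyl_weights_hplus) simp

lemma of_int_S [simp]: "of_int k \<in> S" by (rule weyl_weights_of_int) simp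

lemma m_elt_S [simp]: "b \<in> g_star t \<Longrightarrow> m_elt b \<in> S"
  by (rule weyl_weights_subsetD[OF m_elt_weight])

lemma heval_act_mult: "v \<in> carrier M \<Longrightarrow> heval a (f * g) \<cdot> v = heval a f \<cdot> heval a g \<cdot> v"
  by (simp add: heval_mult act_mult)

lemma heval_act_add: "v \<in> carrier M \<Longrightarrow> heval a (f + g) \<cdot> v = heval a f \<cdot> v \<oplus>\<^bsub>M\<^esub> heval a g \<cdot> v"
  by (simp add: heval_add act_add_left)

lemma heval_act_commute: "v \<in> carrier M \<Longrightarrow> heval a f \<cdot> heval a g \<cdot> v = heval a g \<cdot> heval a f \<cdot> v"
  by (simp add: mult.commute flip: heval_act_mult)

lemma homogeneous_act_heval:
  assumes "u \<in> weyl_weights {b}" "b \<in> g_star t" "v \<in> carrier M"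
  shows "heval (a + b) f \<cdot> u \<cdot> v = u \<cdot> heval a f \<cdot> v"
  using heval_shift[OF assms(1), of a f] assms weyl_weights_subsetD[OF assms(1,2)]
  by (simp flip: act_mult)

end

locale weighted = A_action p t lam M for p t lam and M :: "('n::finite, 'k::field, 'v) Dmod" +
  assumes D_action: "is_D_action t lam M" and compatible: "compatible_D_action t lam M"
    and T_weight: "\<And>v. v \<in> carrier M \<Longrightarrow> coact_supp M v \<subseteq> lattice_fiber t lam"
begin

abbreviation W where "W a \<equiv> weight_space M a"

lemma coact_closed [simp]: "v \<in> carrier M \<Longrightarrow> coact M v a \<in> carrier M"
  and finite_coact_supp [simp]: "v \<in> carrier M \<Longrightarrow> finite (coact_supp M v)"
  and coact_add: "v \<in> carrier M \<Longrightarrow> w \<in> carrier M \<Longrightarrow> coact M (v \<oplus>\<^bsub>M\<^esub> w) a = coact M v a \<oplus>\<^bsub>M\<^esub> coact M w a"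
  and coact_sum: "v \<in> carrier M \<Longrightarrow> (\<Oplus>\<^bsub>M\<^esub>a\<in>coact_supp M v. coact M v a) = v"
  and coact_coact: "v \<in> carrier M \<Longrightarrow> coact M (coact M v a) b = (if a = b then coact M v a else \<zero>\<^bsub>M\<^esub>)"
  using D_action unfolding is_D_action_def by auto

lemma coact_act:
  "u \<in> weyl_weights {c} \<Longrightarrow> c \<in> g_star t \<Longrightarrow> v \<in> carrier M \<Longrightarrow> coact M (u \<cdot> v) (c + b) = u \<cdot> coact M v b"
  using compatible unfolding compatible_D_action_def by blast

lemma coact_act0: "u \<in> weyl_weights {0} \<Longrightarrow> v \<in> carrier M \<Longrightarrow> coact M (u \<cdot> v) b = u \<cdot> coact M v b"
  using coact_act[of u 0 v b] by simp

lemma coact_zero [simp]: "coact M \<zero>\<^bsub>M\<^esub> a = \<zero>\<^bsub>M\<^esub>"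
  using coact_add[of "\<zero>\<^bsub>M\<^esub>" "\<zero>\<^bsub>M\<^esub>" a] by (intro eq_zero_if_add_self) auto

lemma coact_neg: "v \<in> carrier M \<Longrightarrow> coact M (\<ominus>\<^bsub>M\<^esub> v) a = \<ominus>\<^bsub>M\<^esub> coact M v a"
  using coact_add[of v "\<ominus>\<^bsub>M\<^esub> v"] by (intro minus_equality[symmetric]) (auto simp: r_neg l_neg a_comm)

lemma coact_finsum: "f \<in> I \<rightarrow> carrier M \<Longrightarrow> coact M (\<Oplus>\<^bsub>M\<^esub>i\<in>I. f i) a = (\<Oplus>\<^bsub>M\<^esub>i\<in>I. coact M (f i) a)"
  by (induction I rule: infinite_finite_induct) (auto simp: coact_add Pi_def)

lemma W_carrier: "v \<in> W a \<Longrightarrow> v \<in> carrier M" by (simp add: weight_space_def)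

lemma W_iff: "v \<in> W a \<longleftrightarrow> v \<in> carrier M \<and> coact M v a = v"
proof
  assume "v \<in> carrier M \<and> coact M v a = v"
  then have v: "v \<in> carrier M" "coact M v a = v" by simp_all
  have "coact M v b = (if b = a then v else \<zero>\<^bsub>M\<^esub>)" for b
    using coact_coact[OF v(1), of a b] unfolding v(2) by (simp only: eq_commute[of a b])
  then show "v \<in> W a" unfolding weight_space_def using v(1) by blast
qed (simp add: weight_space_def)

lemma coact_W [simp]: "v \<in> carrier M \<Longrightarrow> coact M v a \<in> W a"
  by (simp add: W_iff coact_coact)

lemma coact_of_W: "v \<in> W a \<Longrightarrow> coact M v b = (if b = a then v else \<zero>\<^bsub>M\<^esub>)"
  by (simp add: weight_space_def)

lemma zero_W [simp]: "\<zero>\<^bsub>M\<^esub> \<in> W a" by (simp add: W_iff)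

lemma add_W: "v \<in> W a \<Longrightarrow> w \<in> W a \<Longrightarrow> v \<oplus>\<^bsub>M\<^esub> w \<in> W a"
  by (simp add: W_iff coact_add)

lemma act_W: "u \<in> weyl_weights {c} \<Longrightarrow> c \<in> g_star t \<Longrightarrow> v \<in> W a \<Longrightarrow> u \<cdot> v \<in> W (c + a)"
  using coact_act[of u c v a] weyl_weights_subsetD[of u c "g_star t"] by (simp add: W_iff)

lemma act0_W: "u \<in> weyl_weights {0} \<Longrightarrow> v \<in> W a \<Longrightarrow> u \<cdot> v \<in> W a"
  using act_W[of u 0 v a] by simp

lemma heval_W [simp]: "v \<in> W a \<Longrightarrow> heval c f \<cdot> v \<in> W a"
  by (rule act0_W[OF heval_weight])

lemma finsum_W: "(\<And>i. i \<in> I \<Longrightarrow> f i \<in> W a) \<Longrightarrow> (\<Oplus>\<^bsub>M\<^esub>i\<in>I. f i) \<in> W a"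
proof (induction I rule: infinite_finite_induct)
  case (insert i I)
  then have "f \<in> insert i I \<rightarrow> carrier M" using W_carrier by blast
  then show ?case using insert by (auto intro: add_W)
qed auto

lemma W_empty: "a \<notin> lattice_fiber t lam \<Longrightarrow> v \<in> W a \<Longrightarrow> v = \<zero>\<^bsub>M\<^esub>"
  using subsetD[OF T_weight[of v], of a] coact_of_W[of v a a] W_carrier[of v a]
  by (auto simp: coact_supp_def)

lemma eq_if_coact_eq:
  assumes "v \<in> carrier M" "w \<in> carrier M" "\<And>a. coact M v a = coact M w a"
  shows "v = w"
proof -
  have "coact M v = coact M w" using assms(3) by blast
  then have "(\<Oplus>\<^bsub>M\<^esub>a\<in>coact_supp M v. coact M v a) = (\<Oplus>\<^bsub>M\<^esub>a\<in>coact_supp M w. coact M w a)"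
    by (simp add: coact_supp_def)
  then show ?thesis by (simp add: coact_sum assms(1,2))
qed

text \<open>A vector is determined by its weight components, so additive maps are determined on weight
  vectors.\<close>

lemma additive_induct:
  assumes "v \<in> carrier M" "\<And>a v. v \<in> W a \<Longrightarrow> P v" "P \<zero>\<^bsub>M\<^esub>"
    "\<And>v w. v \<in> carrier M \<Longrightarrow> w \<in> carrier M \<Longrightarrow> P v \<Longrightarrow> P w \<Longrightarrow> P (v \<oplus>\<^bsub>M\<^esub> w)"
  shows "P v"
proof -
  have "P (\<Oplus>\<^bsub>M\<^esub>a\<in>A. coact M v a)" if "finite A" for A
    using that
  proof (induction A)
    case (insert a A)
    have "P (coact M v a)" by (rule assms(2)[OF coact_W[OF assms(1)]])
    then show ?case using insert assms(1) by (auto intro!: assms(4))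
  qed (simp add: assms(3))
  from this[of "coact_supp M v"] show ?thesis by (simp add: coact_sum assms(1))
qed

subsection \<open>The operators \<open>s\<^sub>i\<close> and \<open>q\<close>\<close>

lemma s_op_component:
  assumes v: "v \<in> carrier M"
  shows "s_op t lam M i v \<in> carrier M" and "coact M (s_op t lam M i v) b = hdiff b i \<cdot> coact M v b"
proof -
  let ?d = "\<Oplus>\<^bsub>M\<^esub>a\<in>coact_supp M v. of_int (a $ i) \<cdot> coact M v a"
  have f: "(\<lambda>a. of_int (a $ i) \<cdot> coact M v a) \<in> coact_supp M v \<rightarrow> carrier M" using v by auto
  have d: "?d \<in> carrier M" by (rule finsum_closed[OF f])
  then show "s_op t lam M i v \<in> carrier M" using v by (simp add: s_op_def)
  have "coact M ?d b = (\<Oplus>\<^bsub>M\<^esub>a\<in>coact_supp M v. if b = a then of_int (a $ i) \<cdot> coact M v a else \<zero>\<^bsub>M\<^esub>)"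
    unfolding coact_finsum[OF f]
    by (rule finsum_cong') (use v in \<open>auto simp: coact_act0 weyl_weights_of_int coact_coact\<close>)
  also have "\<dots> = of_int (b $ i) \<cdot> coact M v b"
  proof (cases "b \<in> coact_supp M v")
    case True
    then show ?thesis using finsum_singleton[OF True finite_coact_supp[OF v] f] by simp
  next
    case False
    then have "(\<Oplus>\<^bsub>M\<^esub>a\<in>coact_supp M v. if b = a then of_int (a $ i) \<cdot> coact M v a else \<zero>\<^bsub>M\<^esub>)
        = (\<Oplus>\<^bsub>M\<^esub>a\<in>coact_supp M v. \<zero>\<^bsub>M\<^esub>)" by (intro finsum_cong') auto
    then show ?thesis using False by (simp add: coact_supp_def)
  qed
  finally have db: "coact M ?d b = of_int (b $ i) \<cdot> coact M v b" .
  have "coact M (s_op t lam M i v) b = coact M (hplus i \<cdot> v) b \<ominus>\<^bsub>M\<^esub> coact M ?d b"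
    unfolding s_op_def a_minus_def using v d by (simp add: coact_add coact_neg)
  also have "\<dots> = hplus i \<cdot> coact M v b \<ominus>\<^bsub>M\<^esub> of_int (b $ i) \<cdot> coact M v b"
    unfolding db using v by (simp add: coact_act0 weyl_weights_hplus)
  finally show "coact M (s_op t lam M i v) b = hdiff b i \<cdot> coact M v b"
    using v by (simp add: hdiff_def act_diff)
qed

lemma s_op_W: "v \<in> W a \<Longrightarrow> s_op t lam M i v = hdiff a i \<cdot> v"
proof (rule eq_if_coact_eq)
  assume v: "v \<in> W a"
  then show "s_op t lam M i v \<in> carrier M" "hdiff a i \<cdot> v \<in> carrier M"
    by (simp_all add: s_op_component W_carrier)
  show "coact M (s_op t lam M i v) b = coact M (hdiff a i \<cdot> v) b" for b
    using v W_carrier[OF v] by (simp add: s_op_component coact_act0 hdiff_weight coact_of_W)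
qed

lemma s_op_power_W: "v \<in> W a \<Longrightarrow> (s_op t lam M i ^^ k) v = (hdiff a i ^ k) \<cdot> v"
proof (induction k)
  case (Suc k)
  have "(hdiff a i ^ k) \<cdot> v \<in> W a"
    by (rule act0_W) (use Suc.prems weyl_weights_power[OF hdiff_weight, of a i k] in auto)
  then show ?case using Suc W_carrier[OF Suc.prems] by (simp add: s_op_W act_mult S_power)
qed (simp add: W_carrier)

lemma s_op_power_component:
  assumes v: "v \<in> carrier M"
  shows "(s_op t lam M i ^^ k) v \<in> carrier M" "coact M ((s_op t lam M i ^^ k) v) b = (hdiff b i ^ k) \<cdot> coact M v b"
proof (induction k)
  case 0
  show "(s_op t lam M i ^^ 0) v \<in> carrier M" using v by simp
  show "coact M ((s_op t lam M i ^^ 0) v) b = (hdiff b i ^ 0) \<cdot> coact M v b" using v by simp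
next
  case (Suc k)
  show "(s_op t lam M i ^^ Suc k) v \<in> carrier M" using s_op_component(1)[OF Suc(1)] by simp
  show "coact M ((s_op t lam M i ^^ Suc k) v) b = (hdiff b i ^ Suc k) \<cdot> coact M v b"
    using s_op_component(2)[OF Suc(1)] Suc(2) v by (simp add: act_mult S_power)
qed

end

locale equivariant = weighted p t lam M for p t lam and M :: "('n::finite, 'k::field, 'v) Dmod" +
  assumes s_nilpotent: "\<And>i v. v \<in> carrier M \<Longrightarrow> \<exists>N. (s_op t lam M i ^^ N) v = \<zero>\<^bsub>M\<^esub>"
begin

text \<open>The factors \<open>s\<^sub>i + k\<close> are invertible only modulo powers of the \<open>s\<^sub>i\<close>, so computations with a vector
  take place modulo an ideal that annihilates it.\<close>

definition nilp where "nilp a N v \<longleftrightarrow> (\<forall>f\<in>s_power_ideal N. heval a f \<cdot> v = \<zero>\<^bsub>M\<^esub>)"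

lemma nilp_exists:
  assumes v: "v \<in> W a" shows "\<exists>N. nilp a N v"
proof -
  have vc: "v \<in> carrier M" using v by (rule W_carrier)
  have "\<forall>i. \<exists>N. (hdiff a i ^ N) \<cdot> v = \<zero>\<^bsub>M\<^esub>"
    using s_nilpotent[OF vc] s_op_power_W[OF v] by metis
  then obtain N where N: "\<And>i. (hdiff a i ^ N i) \<cdot> v = \<zero>\<^bsub>M\<^esub>" by metis
  define m where "m = Max (range N)"
  have m: "(hdiff a i ^ m) \<cdot> v = \<zero>\<^bsub>M\<^esub>" for i
    by (rule power_act_zero[OF _ vc N]) (auto simp: m_def)
  have "heval a f \<cdot> v = \<zero>\<^bsub>M\<^esub>" if fI: "f \<in> s_power_ideal m" for f :: "('n, 'k) s_poly"
  proof -
    obtain h where f: "f = (\<Sum>i\<in>UNIV. h i * s_var i ^ m)" using fI by (auto simp: s_power_ideal_def)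
    have "heval a f \<cdot> v = (\<Oplus>\<^bsub>M\<^esub>i\<in>UNIV. heval a (h i * s_var i ^ m) \<cdot> v)"
      unfolding f heval_sum by (rule act_sum) (use vc in auto)
    also have "\<dots> = (\<Oplus>\<^bsub>M\<^esub>i\<in>(UNIV :: 'n set). \<zero>\<^bsub>M\<^esub>)"
      by (rule finsum_cong') (use vc m in \<open>auto simp: heval_act_mult heval_power\<close>)
    finally show ?thesis by simp
  qed
  then show ?thesis unfolding nilp_def by blast
qed

lemma nilp_heval: "nilp a N v \<Longrightarrow> v \<in> carrier M \<Longrightarrow> nilp a N (heval a f \<cdot> v)"
  unfolding nilp_def by (metis act_zero heval_S heval_act_commute)

lemma nilp_act:
  assumes "nilp a N v" "u \<in> weyl_weights {b}" "b \<in> g_star t" "v \<in> carrier M"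
  shows "nilp (a + b) N (u \<cdot> v)"
  using assms weyl_weights_subsetD[OF assms(2,3)]
  by (auto simp: nilp_def homogeneous_act_heval)

lemma nilp_cong:
  assumes "nilp a N v" "v \<in> carrier M" "f - g \<in> s_power_ideal N"
  shows "heval a f \<cdot> v = heval a g \<cdot> v"
proof -
  have "heval a (g + (f - g)) \<cdot> v = heval a g \<cdot> v \<oplus>\<^bsub>M\<^esub> heval a (f - g) \<cdot> v"
    by (rule heval_act_add) fact
  then show ?thesis using assms by (simp add: nilp_def)
qed

text \<open>A one-sided inverse is enough: the polynomials in question are units modulo powers of the
  variables, hence injective on \<open>W\<^sub>a\<close>.\<close>

definition inverts where
  "inverts a P op \<longleftrightarrow> (\<forall>v\<in>W a. op v \<in> W a \<and> heval a P \<cdot> op v = v)"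

lemma inverts_unique:
  assumes "P * g - 1 \<in> s_power_ideal N" "nilp a N v" "nilp a N w" "v \<in> carrier M" "w \<in> carrier M"
    "heval a P \<cdot> v = heval a P \<cdot> w"
  shows "v = w"
proof -
  have "heval a (g * P) \<cdot> v = heval a (g * P) \<cdot> w" using assms by (simp add: heval_act_mult)
  then show ?thesis
    using nilp_cong[OF assms(2) assms(4), of "g * P" 1] nilp_cong[OF assms(3) assms(5), of "g * P" 1] assms
    by (simp add: mult.commute)
qed

lemma nilp_mono:
  assumes "nilp a N v" "N \<le> N'" shows "nilp a N' v"
proof -
  have "s_power_ideal N' \<subseteq> (s_power_ideal N :: ('n, 'k) s_poly set)"
  proof
    fix f :: "('n, 'k) s_poly" assume "f \<in> s_power_ideal N'"
    then obtain h where "f = (\<Sum>i\<in>UNIV. h i * s_var i ^ N')" by (auto simp: s_power_ideal_def)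
    also have "\<dots> = (\<Sum>i\<in>UNIV. (h i * s_var i ^ (N' - N)) * s_var i ^ N)"
      using assms(2) by (simp add: mult.assoc flip: power_add)
    finally show "f \<in> s_power_ideal N"
      unfolding s_power_ideal_def mem_Collect_eq by (intro exI[of _ "\<lambda>i. h i * s_var i ^ (N' - N)"]) simp
  qed
  then show ?thesis using assms(1) unfolding nilp_def by blast
qed

lemma nilp_exists2: "v \<in> W a \<Longrightarrow> w \<in> W a \<Longrightarrow> \<exists>N. nilp a N v \<and> nilp a N w"
  using nilp_exists[of v a] nilp_exists[of w a] nilp_mono by (metis max.cobounded1 max.cobounded2)

text \<open>The operator \<open>s\<^sub>i + k\<close> is injective because it is so on every weight space, and on a weight vector
  its inverse modulo a power of \<open>s\<^sub>i\<close> provides the preimage.\<close>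

lemma q_op_inverts: "inverts a (if of_int k = (0 :: 'k) then 1 else s_var i + of_int k) (q_op t lam M i k)"
  unfolding inverts_def
proof (intro ballI)
  fix v assume v: "v \<in> W a"
  then have vc: "v \<in> carrier M" by (rule W_carrier)
  show "q_op t lam M i k v \<in> W a \<and> heval a (if of_int k = (0 :: 'k) then 1 else s_var i + of_int k) \<cdot> q_op t lam M i k v = v"
  proof (cases "of_int k = (0 :: 'k)")
    case False
    let ?P = "s_var i + of_int k :: ('n, 'k) s_poly"
    let ?F = "\<lambda>v. s_op t lam M i v \<oplus>\<^bsub>M\<^esub> of_int k \<cdot> v"
    have F: "coact M (?F v) b = heval b ?P \<cdot> coact M v b" if "v \<in> carrier M" for v b
      using that by (simp add: coact_add s_op_component coact_act0 weyl_weights_of_int heval_add act_add_left)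
    have unit: "\<exists>g. ?P * g - 1 \<in> s_power_ideal N" for N
      using False by (rule linear_unit_mod)
    have inj: "inj_on ?F (carrier M)"
    proof (rule inj_onI)
      fix v w assume vw: "v \<in> carrier M" "w \<in> carrier M" "?F v = ?F w"
      show "v = w"
      proof (rule eq_if_coact_eq[OF vw(1,2)])
        fix b
        have e: "heval b ?P \<cdot> coact M v b = heval b ?P \<cdot> coact M w b"
          using F[OF vw(1), of b] F[OF vw(2), of b] vw(3) by simp
        obtain N where N: "nilp b N (coact M v b)" "nilp b N (coact M w b)"
          using nilp_exists2[of "coact M v b" b "coact M w b"] vw by auto
        obtain g where "?P * g - 1 \<in> s_power_ideal N" using unit by blast
        from inverts_unique[OF this N _ _ e] vw show "coact M v b = coact M w b" by simp
      qed
    qed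
    obtain N where N: "nilp a N v" using nilp_exists[OF v] by blast
    obtain g where g: "?P * g - 1 \<in> s_power_ideal N" using unit by blast
    define w where "w = heval a g \<cdot> v"
    have w: "w \<in> W a" unfolding w_def using v by simp
    then have wc: "w \<in> carrier M" by (rule W_carrier)
    have Pw: "heval a ?P \<cdot> w = v"
      using nilp_cong[OF N vc g[folded diff_0_right]] nilp_cong[OF N vc, of "?P * g" 1] g vc
      by (simp add: w_def heval_act_mult)
    have "?F w = heval a ?P \<cdot> w" using w wc by (simp add: s_op_W heval_add act_add_left)
    then have "q_op t lam M i k v = w"
      using the_inv_into_f_f[OF inj wc] False Pw by (simp add: q_op_def)
    then show ?thesis using w Pw False by simp
  qed (use v vc in \<open>auto simp: q_op_def\<close>)
qed

lemma fold_inverts: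
  assumes "\<And>x. x \<in> set xs \<Longrightarrow> inverts a (P x) (op x)"
  shows "inverts a (\<Prod>x\<leftarrow>xs. P x) (fold op xs)"
  using assms
proof (induction xs)
  case Nil
  show ?case by (auto simp: inverts_def W_carrier)
next
  case (Cons x xs)
  show ?case unfolding inverts_def
  proof (intro ballI)
    fix v assume v: "v \<in> W a"
    have 1: "op x v \<in> W a" "heval a (P x) \<cdot> op x v = v" using Cons.prems[of x] v by (auto simp: inverts_def)
    have 2: "fold op xs (op x v) \<in> W a" "heval a (\<Prod>x\<leftarrow>xs. P x) \<cdot> fold op xs (op x v) = op x v"
      using Cons 1(1) by (auto simp: inverts_def)
    show "fold op (x # xs) v \<in> W a \<and> heval a (\<Prod>x\<leftarrow>x # xs. P x) \<cdot> fold op (x # xs) v = v"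
      using 1 2 W_carrier[OF 2(1)] by (simp add: heval_act_mult)
  qed
qed

definition qfold where
  "qfold a b = fold (\<lambda>i. fold (\<lambda>j. q_op t lam M i (a $ i + j)) [1..b $ i]) coords"

lemma qfold_inverts: "inverts a (unit_rising a b) (qfold a b)"
proof -
  let ?f = "\<lambda>i j. if of_int (a $ i + j) = (0 :: 'k) then 1 else (s_var i + of_int (a $ i + j) :: ('n, 'k) s_poly)"
  have "unit_rising a b = (\<Prod>i\<in>UNIV. \<Prod>j\<in>{1..b $ i}. ?f i j)"
    unfolding unit_rising_def
    by (intro prod.cong refl prod.mono_neutral_cong_left) auto
  also have "\<dots> = (\<Prod>i\<leftarrow>coords. \<Prod>j\<leftarrow>[1..b $ i]. ?f i j)"
    by (simp add: prod.distinct_set_conv_list[symmetric])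
  also have "inverts a \<dots> (qfold a b)"
    unfolding qfold_def by (intro fold_inverts q_op_inverts)
  finally show ?thesis .
qed

lemma shift_op_qfold: "shift_op t lam M a b v = m_elt b \<cdot> qfold a b v"
  by (simp add: shift_op_def qfold_def)

subsection \<open>Transport between weight spaces\<close>

text \<open>\<open>tr a' a\<close> is the normalised operator from \<open>W\<^sub>a\<close> to \<open>W\<^sub>a\<^sub>'\<close>.\<close>

definition tr where "tr a' a v = shift_op t lam M a (a' - a) v"

text \<open>The product of the operators \<open>q\<close> may be replaced by any polynomial that inverts \<open>unit_rising\<close> modulo
  the annihilator of the vector.\<close>

lemma tr_eq:
  assumes v: "v \<in> W a" and N: "nilp a N v" and g: "unit_rising a (a' - a) * g - 1 \<in> s_power_ideal N"
  shows "tr a' a v = m_elt (a' - a) \<cdot> heval a g \<cdot> v"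
proof -
  let ?U = "unit_rising a (a' - a) :: ('n, 'k) s_poly"
  have vc: "v \<in> carrier M" using v by (rule W_carrier)
  have q: "qfold a (a' - a) v \<in> W a" "heval a ?U \<cdot> qfold a (a' - a) v = v"
    using qfold_inverts v by (auto simp: inverts_def)
  obtain N' where N': "nilp a N' (qfold a (a' - a) v)" "nilp a N' (heval a g \<cdot> v)"
    using nilp_exists2[OF q(1), of "heval a g \<cdot> v"] v by auto
  obtain g' where g': "?U * g' - 1 \<in> s_power_ideal N'" using unit_rising_unit by blast
  have "heval a ?U \<cdot> heval a g \<cdot> v = v"
    using nilp_cong[OF N vc g] vc by (simp add: heval_act_mult)
  then have "qfold a (a' - a) v = heval a g \<cdot> v"
    using q(2) W_carrier[OF q(1)] vc by (intro inverts_unique[OF g' N']) auto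
  then show ?thesis by (simp add: tr_def shift_op_qfold)
qed

lemma tr_obtain:
  assumes "v \<in> W a"
  obtains N g where "nilp a N v" "unit_rising a (a' - a) * g - 1 \<in> (s_power_ideal N :: ('n, 'k) s_poly set)"
    "tr a' a v = m_elt (a' - a) \<cdot> heval a g \<cdot> v"
  using nilp_exists[OF assms] unit_rising_unit tr_eq[OF assms] by metis

context
  fixes a a' assumes d: "a' - a \<in> g_star t"
begin

lemma tr_W: "v \<in> W a \<Longrightarrow> tr a' a v \<in> W a'"
proof -
  assume v: "v \<in> W a"
  obtain N g where "tr a' a v = m_elt (a' - a) \<cdot> heval a g \<cdot> v" using tr_obtain[OF v] by metis
  then show ?thesis using act_W[OF m_elt_weight d, of "heval a g \<cdot> v" a] v by simp
qed

lemma tr_add: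
  assumes "v \<in> W a" "w \<in> W a" shows "tr a' a (v \<oplus>\<^bsub>M\<^esub> w) = tr a' a v \<oplus>\<^bsub>M\<^esub> tr a' a w"
proof -
  obtain N where N: "nilp a N v" "nilp a N w" using nilp_exists2 assms by blast
  then have N': "nilp a N (v \<oplus>\<^bsub>M\<^esub> w)" using assms W_carrier by (auto simp: nilp_def act_add)
  obtain g where g: "unit_rising a (a' - a) * g - 1 \<in> (s_power_ideal N :: ('n, 'k) s_poly set)"
    using unit_rising_unit by blast
  show ?thesis
    using tr_eq[OF assms(1) N(1) g] tr_eq[OF assms(2) N(2) g] tr_eq[OF add_W[OF assms] N' g] assms W_carrier d
    by (simp add: act_add)
qed

lemma tr_heval:
  assumes "v \<in> W a" shows "tr a' a (heval a f \<cdot> v) = heval a' f \<cdot> tr a' a v"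
proof -
  have vc: "v \<in> carrier M" by (rule W_carrier) fact
  obtain N g where N: "nilp a N v" "unit_rising a (a' - a) * g - 1 \<in> (s_power_ideal N :: ('n, 'k) s_poly set)"
    "tr a' a v = m_elt (a' - a) \<cdot> heval a g \<cdot> v" using tr_obtain[OF assms] by metis
  have "tr a' a (heval a f \<cdot> v) = m_elt (a' - a) \<cdot> heval a g \<cdot> heval a f \<cdot> v"
    by (rule tr_eq[OF _ nilp_heval[OF N(1) vc] N(2)]) (use assms in simp)
  also have "\<dots> = m_elt (a' - a) \<cdot> heval a f \<cdot> heval a g \<cdot> v"
    using heval_act_commute[OF vc] by simp
  also have "\<dots> = heval a' f \<cdot> m_elt (a' - a) \<cdot> heval a g \<cdot> v"
    using homogeneous_act_heval[OF m_elt_weight d, of "heval a g \<cdot> v" a f] vc by simp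
  finally show ?thesis using N(3) by simp
qed

text \<open>Writing \<open>u\<close> as a monomial times a polynomial \<open>r\<close>, the unit part of \<open>ncoeff p u a' a\<close> cancels against the
  normalisation of \<open>tr\<close> and leaves \<open>r\<close>.\<close>

lemma act_eq_tr:
  assumes u: "u \<in> weyl_weights {a' - a}" and v: "v \<in> W a"
  shows "u \<cdot> v = tr a' a (heval a (ncoeff p u a' a) \<cdot> v)"
proof -
  have vc: "v \<in> carrier M" using v by (rule W_carrier)
  obtain r where r: "u = m_elt (a' - a) * heval a r" "ncoeff p u a' a = unit_rising a (a' - a) * r"
    using coeff_homogeneous[OF u, of a] by (metis add.commute diff_add_cancel)
  let ?w = "heval a (ncoeff p u a' a) \<cdot> v"
  obtain N where N: "nilp a N v" using nilp_exists[OF v] by blast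
  obtain g where g: "unit_rising a (a' - a) * g - 1 \<in> (s_power_ideal N :: ('n, 'k) s_poly set)"
    using unit_rising_unit by blast
  have "tr a' a ?w = m_elt (a' - a) \<cdot> heval a g \<cdot> ?w"
    by (rule tr_eq[OF _ nilp_heval[OF N vc] g]) (use v in simp)
  also have "heval a g \<cdot> ?w = heval a (r * (unit_rising a (a' - a) * g)) \<cdot> v"
    using vc by (simp add: r(2) ac_simps flip: heval_act_mult)
  also have "\<dots> = heval a r \<cdot> v"
    by (rule nilp_cong[OF N vc]) (use s_power_ideal_mult[OF g, of r] in \<open>simp add: right_diff_distrib\<close>)
  finally show ?thesis using vc d by (simp add: r(1) act_mult)
qed

end

lemma tr_self: "v \<in> W a \<Longrightarrow> tr a a v = v"
proof -
  assume v: "v \<in> W a"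
  have "ncoeff p (1 :: ('n, 'k) weyl) a a = 1" using ncoeff_heval[of a "1 :: ('n, 'k) s_poly"] by simp
  moreover have "(1 :: ('n, 'k) weyl) \<in> weyl_weights {a - a}" by (simp add: weyl_weights_one)
  ultimately show ?thesis using act_eq_tr[of a a 1 v] v W_carrier[OF v] by simp
qed

text \<open>Both sides are \<open>m(a'' - a)\<close> applied to a polynomial in the \<open>s\<^sub>i\<close>, and by \<open>m_elt_mult\<close> the polynomials
  agree on \<open>v\<close>.\<close>

lemma tr_tr:
  assumes v: "v \<in> W a" and d: "a' - a \<in> g_star t" "a'' - a' \<in> g_star t"
  shows "tr a'' a' (tr a' a v)
    = heval a'' (s_monom (eta (alcove_of p a'') (alcove_of p a') (alcove_of p a))) \<cdot> tr a'' a v"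
proof -
  let ?b = "a' - a" and ?b' = "a'' - a'"
  let ?s = "s_monom (eta (alcove_of p a'') (alcove_of p a') (alcove_of p a)) :: ('n, 'k) s_poly"
  have vc: "v \<in> carrier M" using v by (rule W_carrier)
  have d'': "a'' - a \<in> g_star t" using g_star_add[OF d(2,1)] by simp
  obtain N where N: "nilp a N v" using nilp_exists[OF v] by blast
  let ?I = "s_power_ideal N :: ('n, 'k) s_poly set"
  obtain g1 g2 g3 where g: "unit_rising a ?b * g1 - 1 \<in> ?I" "unit_rising a' ?b' * g2 - 1 \<in> ?I"
    "unit_rising a (a'' - a) * g3 - 1 \<in> ?I" using unit_rising_unit by metis
  obtain r where r: "m_elt ?b' * m_elt ?b = (m_elt (a'' - a) * heval a r :: ('n, 'k) weyl)"
    and U: "unit_rising a (a'' - a) * r = ?s * (unit_rising a' ?b' * unit_rising a ?b)"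
    using m_elt_mult[of ?b' ?b a] by (auto simp: algebra_simps)
  have 1: "tr a' a v = m_elt ?b \<cdot> heval a g1 \<cdot> v" by (rule tr_eq[OF v N g(1)])
  have "nilp (a + ?b) N (m_elt ?b \<cdot> heval a g1 \<cdot> v)"
    by (rule nilp_act[OF nilp_heval[OF N vc] m_elt_weight d(1)]) (use vc in simp)
  then have n: "nilp a' N (tr a' a v)" by (simp add: 1)
  have w: "heval a g1 \<cdot> v \<in> carrier M" using vc by simp
  have "tr a'' a' (tr a' a v) = m_elt ?b' \<cdot> heval a' g2 \<cdot> m_elt ?b \<cdot> heval a g1 \<cdot> v"
    using tr_eq[OF tr_W[OF d(1) v] n g(2)] by (simp only: 1)
  also have "\<dots> = m_elt ?b' \<cdot> m_elt ?b \<cdot> heval a g2 \<cdot> heval a g1 \<cdot> v"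
    using homogeneous_act_heval[OF m_elt_weight d(1) w, of a g2] by simp
  also have "\<dots> = (m_elt ?b' * m_elt ?b) \<cdot> heval a g2 \<cdot> heval a g1 \<cdot> v"
    using vc d by (simp add: act_mult)
  also have "\<dots> = m_elt (a'' - a) \<cdot> heval a (r * (g2 * g1)) \<cdot> v"
    unfolding r using vc d'' by (simp add: act_mult heval_act_mult)
  also have "heval a (r * (g2 * g1)) \<cdot> v = heval a (?s * g3) \<cdot> v"
  proof (rule nilp_cong[OF N vc])
    \<comment> \<open>After multiplication by the unit \<open>unit_rising a (a'' - a)\<close> both polynomials become \<open>?s\<close>.\<close>
    let ?X = "(unit_rising a' ?b' * unit_rising a ?b) * (g2 * g1) - 1"
    have X: "?X \<in> ?I" by (rule unit_mod_mult[OF g(2,1)])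
    have "r * (g2 * g1) - ?s * g3 = (- (r * (g2 * g1))) * (unit_rising a (a'' - a) * g3 - 1)
        + g3 * (unit_rising a (a'' - a) * r) * (g2 * g1) - ?s * g3" by (simp add: algebra_simps)
    also have "\<dots> = (- (r * (g2 * g1))) * (unit_rising a (a'' - a) * g3 - 1) + (g3 * ?s) * ?X"
      unfolding U by (simp add: algebra_simps)
    also have "\<dots> \<in> ?I" by (intro s_power_ideal_add s_power_ideal_mult X g(3))
    finally show "r * (g2 * g1) - ?s * g3 \<in> ?I" .
  qed
  also have "m_elt (a'' - a) \<cdot> heval a (?s * g3) \<cdot> v = heval a'' ?s \<cdot> m_elt (a'' - a) \<cdot> heval a g3 \<cdot> v"
    using homogeneous_act_heval[OF m_elt_weight d'', of "heval a g3 \<cdot> v" a ?s] vc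
    by (simp add: heval_act_mult)
  also have "\<dots> = heval a'' ?s \<cdot> tr a'' a v" using tr_eq[OF v N g(3)] by simp
  finally show ?thesis .
qed

lemma tr_inverse:
  assumes "v \<in> W a" "a' - a \<in> g_star t" "alcove_of p a' = alcove_of p a"
  shows "tr a a' (tr a' a v) = v"
  using tr_tr[OF assms(1,2), of a] g_star_diff[OF g_star_zero assms(2)] assms(3) W_carrier[OF assms(1)]
  by (simp add: tr_self assms(1))

end

section \<open>The pro-objects represent the weight spaces\<close>

context A_action
begin

text \<open>The left ideal that defines \<open>Q\<^sub>a\<close>, lifted to the Weyl algebra.\<close>

definition Q_rels where
  "Q_rels a N = {\<Sum>i\<in>UNIV. r i * hdiff a i ^ N | r. \<forall>i. r i \<in> S}"

definition Q_coset where
  "Q_coset a N u = {A_cls t lam (u + j) | j. j \<in> Q_rels a N}"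

lemma Q_relsI: "\<forall>i. r i \<in> S \<Longrightarrow> (\<Sum>i\<in>UNIV. r i * hdiff a i ^ N) \<in> Q_rels a N"
  by (auto simp: Q_rels_def)

lemma Q_rels_S: "j \<in> Q_rels a N \<Longrightarrow> j \<in> S"
  by (auto simp: Q_rels_def intro!: S_sum S_mult S_power)

lemma Q_rels_zero: "0 \<in> Q_rels a N"
  using Q_relsI[of "\<lambda>_. 0" a N] S_zero by simp

lemma Q_rels_add: "j \<in> Q_rels a N \<Longrightarrow> k \<in> Q_rels a N \<Longrightarrow> j + k \<in> Q_rels a N"
proof -
  assume "j \<in> Q_rels a N" "k \<in> Q_rels a N"
  then obtain r s where "j = (\<Sum>i\<in>UNIV. r i * hdiff a i ^ N)" "k = (\<Sum>i\<in>UNIV. s i * hdiff a i ^ N)"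
    "\<forall>i. r i \<in> S" "\<forall>i. s i \<in> S" by (auto simp: Q_rels_def)
  then show ?thesis using Q_relsI[of "\<lambda>i. r i + s i" a N] S_add
    by (simp add: distrib_right sum.distrib)
qed

lemma Q_rels_mult: "u \<in> S \<Longrightarrow> j \<in> Q_rels a N \<Longrightarrow> u * j \<in> Q_rels a N"
proof -
  assume "u \<in> S" "j \<in> Q_rels a N"
  then obtain r where "j = (\<Sum>i\<in>UNIV. r i * hdiff a i ^ N)" "\<forall>i. r i \<in> S" by (auto simp: Q_rels_def)
  then show ?thesis using Q_relsI[of "\<lambda>i. u * r i" a N] S_mult \<open>u \<in> S\<close>
    by (simp add: sum_distrib_left mult.assoc)
qed

lemma Q_rels_uminus: "j \<in> Q_rels a N \<Longrightarrow> - j \<in> Q_rels a N"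
  using Q_rels_mult[of "-1" j a N] S_uminus[OF S_one] by simp

lemma Q_rels_Suc: "j \<in> Q_rels a (Suc N) \<Longrightarrow> j \<in> Q_rels a N"
proof -
  assume "j \<in> Q_rels a (Suc N)"
  then obtain r where "j = (\<Sum>i\<in>UNIV. r i * hdiff a i ^ Suc N)" "\<forall>i. r i \<in> S" by (auto simp: Q_rels_def)
  then show ?thesis using Q_relsI[of "\<lambda>i. r i * hdiff a i" a N] S_mult by (simp add: mult.assoc)
qed

interpretation Q: class_quotient S "A_rels t lam"
  by (rule class_quotient_A)

lemma A_cls_add: "u \<in> S \<Longrightarrow> v \<in> S \<Longrightarrow> A_cls t lam (u + v) = A_cls t lam u \<oplus>\<^bsub>A_lam t lam\<^esub> A_cls t lam v"
  by (simp add: A_cls_qcls A_lam_qring Q.qcls_add)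

lemma A_cls_mult: "u \<in> S \<Longrightarrow> v \<in> S \<Longrightarrow> A_cls t lam (u * v) = A_cls t lam u \<otimes>\<^bsub>A_lam t lam\<^esub> A_cls t lam v"
  by (simp add: A_cls_qcls A_lam_qring Q.qcls_mult)

lemma A_cls_one: "A_cls t lam (1 :: ('n, 'k) weyl) = \<one>\<^bsub>A_lam t lam\<^esub>"
  using Q.qcls_one by (simp add: A_cls_qcls A_lam_qring)

lemma A_cls_closed: "u \<in> S \<Longrightarrow> A_cls t lam u \<in> carrier (A_lam t lam)"
  by (auto simp: carrier_A_lam)

lemma A_lam_ring: "ring (A_lam t lam :: ('n, 'k) weyl set ring)"
  unfolding A_lam_qring by (rule Q.qring.ring_axioms)

lemma A_cls_sum:
  "(\<And>i. i \<in> I \<Longrightarrow> f i \<in> S) \<Longrightarrow> finite I \<Longrightarrow>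
    A_cls t lam (sum f I) = (\<Oplus>\<^bsub>A_lam t lam\<^esub>i\<in>I. A_cls t lam (f i))"
proof (induction I rule: infinite_finite_induct)
  case empty
  interpret R: ring "A_lam t lam :: ('n, 'k) weyl set ring" by (rule A_lam_ring)
  have "A_cls t lam 0 \<oplus>\<^bsub>A_lam t lam\<^esub> A_cls t lam 0 = A_cls t lam (0 :: ('n, 'k) weyl)"
    using A_cls_add[OF S_zero S_zero] by simp
  then show ?case using R.add.r_cancel_one[of "A_cls t lam 0" "A_cls t lam 0"] A_cls_closed[OF S_zero] by simp
next
  case (insert i I)
  interpret R: ring "A_lam t lam :: ('n, 'k) weyl set ring" by (rule A_lam_ring)
  show ?case using insert by (simp add: A_cls_add S_sum A_cls_closed Pi_def)
qed auto

lemma Q_left_ideal_eq: "Q_left_ideal t lam a N = Q_coset a N 0"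
proof -
  interpret R: ring "A_lam t lam :: ('n, 'k) weyl set ring" by (rule A_lam_ring)
  have p: "hdiff a i ^ N \<in> S" for i by (simp add: S_power)
  have e: "(\<Oplus>\<^bsub>A_lam t lam\<^esub>i\<in>UNIV. A_cls t lam (r i) \<otimes>\<^bsub>A_lam t lam\<^esub> A_cls t lam (hdiff a i ^ N))
      = A_cls t lam (\<Sum>i\<in>UNIV. r i * hdiff a i ^ N)" if "\<forall>i. r i \<in> S" for r :: "'n \<Rightarrow> ('n, 'k) weyl"
    using that p by (subst A_cls_sum) (auto simp: A_cls_mult S_mult)
  show ?thesis
  proof (intro equalityI subsetI)
    fix x :: "('n, 'k) weyl set" assume "x \<in> Q_left_ideal t lam a N"
    then obtain R' :: "'n \<Rightarrow> ('n, 'k) weyl set" where x: "x = (\<Oplus>\<^bsub>A_lam t lam\<^esub>i\<in>UNIV. R' i \<otimes>\<^bsub>A_lam t lam\<^esub> A_cls t lam (hdiff a i ^ N))"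
      and "R' \<in> UNIV \<rightarrow> carrier (A_lam t lam)" by (auto simp: Q_left_ideal_def hdiff_def)
    then have "\<forall>i. \<exists>u\<in>S. R' i = A_cls t lam u" by (auto simp: carrier_A_lam Pi_iff)
    then obtain r where r: "\<forall>i. r i \<in> S" "R' = (\<lambda>i. A_cls t lam (r i))" by metis
    show "x \<in> Q_coset a N 0"
      unfolding x r(2) e[OF r(1)] Q_coset_def using Q_relsI[OF r(1)] by auto
  next
    fix x assume "x \<in> Q_coset a N 0"
    then obtain r where r: "\<forall>i. r i \<in> S" "x = A_cls t lam (\<Sum>i\<in>UNIV. r i * hdiff a i ^ N)"
      by (auto simp: Q_coset_def Q_rels_def)
    show "x \<in> Q_left_ideal t lam a N"
      unfolding Q_left_ideal_def hdiff_def[symmetric] mem_Collect_eq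
    proof (intro exI conjI)
      show "x = (\<Oplus>\<^bsub>A_lam t lam\<^esub>i\<in>UNIV. A_cls t lam (r i) \<otimes>\<^bsub>A_lam t lam\<^esub> A_cls t lam (hdiff a i ^ N))"
        using e[OF r(1)] r(2) by simp
      show "(\<lambda>i. A_cls t lam (r i)) \<in> UNIV \<rightarrow> carrier (A_lam t lam)" using r(1) A_cls_closed by auto
    qed
  qed
qed

lemma Q_coset_eq: "u \<in> S \<Longrightarrow> Q_left_ideal t lam a N +>\<^bsub>A_lam t lam\<^esub> A_cls t lam u = Q_coset a N u"
proof -
  assume u: "u \<in> S"
  have "A_cls t lam j \<oplus>\<^bsub>A_lam t lam\<^esub> A_cls t lam u = A_cls t lam (u + j)" if "j \<in> Q_rels a N" for j :: "('n, 'k) weyl"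
    using A_cls_add[OF Q_rels_S[OF that] u] by (simp add: add.commute)
  then show ?thesis
    unfolding Q_left_ideal_eq a_r_coset_def' Q_coset_def by auto
qed

lemma A_cls_in_Q_coset: "A_cls t lam u \<in> Q_coset a N u"
  unfolding Q_coset_def using Q_rels_zero[of a N] by force

lemma Q_coset_shift: "j \<in> Q_rels a N \<Longrightarrow> Q_coset a N (u + j) = Q_coset a N u"
proof -
  assume j: "j \<in> Q_rels a N"
  have "Q_coset a N (v + k) \<subseteq> Q_coset a N v" if "k \<in> Q_rels a N" for v k
    using that Q_rels_add[OF that] unfolding Q_coset_def by (auto simp: add.assoc)
  from this[OF j, of u] this[OF Q_rels_uminus[OF j], of "u + j"] show ?thesis by simp
qed

lemma Q_coset_cong: "A_cls t lam u = A_cls t lam v \<Longrightarrow> u \<in> S \<Longrightarrow> v \<in> S \<Longrightarrow> Q_coset a N u = Q_coset a N v"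
  using Q_coset_eq by metis

lemma in_Q_coset:
  assumes "A_cls t lam w \<in> Q_coset a N u" "u \<in> S" "w \<in> S"
  shows "Q_coset a N w = Q_coset a N u"
proof -
  obtain j where j: "j \<in> Q_rels a N" "A_cls t lam w = A_cls t lam (u + j)"
    using assms(1) by (auto simp: Q_coset_def)
  then show ?thesis
    using Q_coset_cong[OF j(2) assms(3)] S_add[OF assms(2) Q_rels_S[OF j(1)]] Q_coset_shift[OF j(1)] by metis
qed

lemma Q_cosets: "a_rcosets\<^bsub>A_lam t lam\<^esub> (Q_left_ideal t lam a N) = Q_coset a N ` S"
  unfolding A_RCOSETS_def' carrier_A_lam using Q_coset_eq[of _ a N] by force

abbreviation Q where "Q a \<equiv> Q_mod t lam a :: (('n, 'k) weyl set, ('n, 'k) Qelt) module"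

lemma Q_carrier:
  "q \<in> carrier (Q a) \<longleftrightarrow> (\<forall>N. (\<exists>u\<in>S. q N = Q_coset a N u) \<and> q (Suc N) \<subseteq> q N)"
  by (simp add: Q_mod_def Q_cosets image_def)

lemma Q_rep: "q \<in> carrier (Q a) \<Longrightarrow> \<exists>u\<in>S. q N = Q_coset a N u"
  by (simp add: Q_carrier)

lemma Q_decseq: "q \<in> carrier (Q a) \<Longrightarrow> N \<le> N' \<Longrightarrow> q N' \<subseteq> q N"
  using lift_Suc_antimono_le[of q N N'] by (simp add: Q_carrier)

lemma Q_lower:
  assumes "q \<in> carrier (Q a)" "N \<le> N'" "q N' = Q_coset a N' u" "u \<in> S"
  shows "q N = Q_coset a N u"
proof -
  obtain v where v: "v \<in> S" "q N = Q_coset a N v" using Q_rep[OF assms(1)] by blast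
  have "A_cls t lam u \<in> q N" using Q_decseq[OF assms(1,2)] A_cls_in_Q_coset assms(3) by blast
  then show ?thesis using in_Q_coset[of u a N v] v assms(4) by simp
qed

definition Q_elt where "Q_elt a u = (\<lambda>N. Q_coset a N u)"

lemma Q_coset_Suc: "Q_coset a (Suc N) u \<subseteq> Q_coset a N u"
  unfolding Q_coset_def using Q_rels_Suc by blast

lemma Q_elt_carrier: "u \<in> S \<Longrightarrow> Q_elt a u \<in> carrier (Q a)"
  unfolding Q_carrier Q_elt_def using Q_coset_Suc by blast

lemma Q_one_eq: "Q_one t lam a = Q_elt a 1"
  unfolding Q_one_def Q_elt_def using Q_coset_eq[OF S_one] by (simp add: A_cls_one)

lemma Q_coset_add:
  assumes "u \<in> S" "v \<in> S"
  shows "Q_coset a N u <+>\<^bsub>A_lam t lam\<^esub> Q_coset a N v = Q_coset a N (u + v)"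
proof -
  have e: "A_cls t lam (u + j) \<oplus>\<^bsub>A_lam t lam\<^esub> A_cls t lam (v + k) = A_cls t lam (u + v + (j + k))"
    if "j \<in> Q_rels a N" "k \<in> Q_rels a N" for j k
    using A_cls_add[of "u + j" "v + k"] assms Q_rels_S[OF that(1)] Q_rels_S[OF that(2)] S_add
    by (simp add: ac_simps)
  show ?thesis
  proof (intro equalityI subsetI)
    fix x assume "x \<in> Q_coset a N u <+>\<^bsub>A_lam t lam\<^esub> Q_coset a N v"
    then show "x \<in> Q_coset a N (u + v)"
      unfolding set_add_def' Q_coset_def using e Q_rels_add by blast
  next
    fix x assume "x \<in> Q_coset a N (u + v)"
    then obtain j where "j \<in> Q_rels a N" "x = A_cls t lam (u + v + (j + 0))" by (auto simp: Q_coset_def)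
    then show "x \<in> Q_coset a N u <+>\<^bsub>A_lam t lam\<^esub> Q_coset a N v"
      unfolding set_add_def' Q_coset_def using e[OF _ Q_rels_zero] Q_rels_zero by fastforce
  qed
qed

lemma Q_add: "q \<in> carrier (Q a) \<Longrightarrow> r \<in> carrier (Q a) \<Longrightarrow> q N = Q_coset a N u \<Longrightarrow> r N = Q_coset a N v \<Longrightarrow>
    u \<in> S \<Longrightarrow> v \<in> S \<Longrightarrow> (q \<oplus>\<^bsub>Q a\<^esub> r) N = Q_coset a N (u + v)"
  by (simp add: Q_mod_def Q_coset_add)

lemma Q_smult:
  assumes "u \<in> S" "q N = Q_coset a N v" "v \<in> S"
  shows "(A_cls t lam u \<odot>\<^bsub>Q a\<^esub> q) N = Q_coset a N (u * v)"
proof -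
  have e: "Q_left_ideal t lam a N +>\<^bsub>A_lam t lam\<^esub> (A_cls t lam u \<otimes>\<^bsub>A_lam t lam\<^esub> x) = Q_coset a N (u * v)"
    if x: "x \<in> Q_coset a N v" for x
  proof -
    obtain j where j: "j \<in> Q_rels a N" "x = A_cls t lam (v + j)" using x by (auto simp: Q_coset_def)
    have "v + j \<in> S" using S_add[OF assms(3) Q_rels_S[OF j(1)]] .
    then have "Q_left_ideal t lam a N +>\<^bsub>A_lam t lam\<^esub> (A_cls t lam u \<otimes>\<^bsub>A_lam t lam\<^esub> x) = Q_coset a N (u * (v + j))"
      using Q_coset_eq[OF S_mult[OF assms(1)]] A_cls_mult[OF assms(1)] j(2) by simp
    also have "\<dots> = Q_coset a N (u * v)"
      unfolding distrib_left by (rule Q_coset_shift[OF Q_rels_mult[OF assms(1) j(1)]])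
    finally show ?thesis .
  qed
  show ?thesis
    using e A_cls_in_Q_coset[of v a N] by (auto simp: Q_mod_def assms(2))
qed

lemma Q_closed:
  assumes "q \<in> carrier (Q a)"
  shows "r \<in> carrier (Q a) \<Longrightarrow> q \<oplus>\<^bsub>Q a\<^esub> r \<in> carrier (Q a)"
    and "u \<in> S \<Longrightarrow> A_cls t lam u \<odot>\<^bsub>Q a\<^esub> q \<in> carrier (Q a)"
proof -
  have *: "\<exists>u\<in>S. q N = Q_coset a N u \<and> q (Suc N) = Q_coset a (Suc N) u" if "q \<in> carrier (Q a)" for q N
    using that Q_lower[OF that, of N "Suc N"] unfolding Q_carrier by (metis le_add2 plus_1_eq_Suc)
  show "q \<oplus>\<^bsub>Q a\<^esub> r \<in> carrier (Q a)" if r: "r \<in> carrier (Q a)"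
    unfolding Q_carrier
  proof
    fix N
    obtain u v where uv: "u \<in> S" "q N = Q_coset a N u" "q (Suc N) = Q_coset a (Suc N) u"
      "v \<in> S" "r N = Q_coset a N v" "r (Suc N) = Q_coset a (Suc N) v" using *[OF assms] *[OF r] by metis
    then show "(\<exists>u\<in>S. (q \<oplus>\<^bsub>Q a\<^esub> r) N = Q_coset a N u) \<and> (q \<oplus>\<^bsub>Q a\<^esub> r) (Suc N) \<subseteq> (q \<oplus>\<^bsub>Q a\<^esub> r) N"
      using Q_add[OF assms r uv(2,5,1,4)] Q_add[OF assms r uv(3,6,1,4)] Q_coset_Suc S_add[OF uv(1,4)] by auto
  qed
  show "A_cls t lam u \<odot>\<^bsub>Q a\<^esub> q \<in> carrier (Q a)" if u: "u \<in> S"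
    unfolding Q_carrier
  proof
    fix N
    obtain v where v: "v \<in> S" "q N = Q_coset a N v" "q (Suc N) = Q_coset a (Suc N) v" using *[OF assms] by metis
    then show "(\<exists>w\<in>S. (A_cls t lam u \<odot>\<^bsub>Q a\<^esub> q) N = Q_coset a N w)
        \<and> (A_cls t lam u \<odot>\<^bsub>Q a\<^esub> q) (Suc N) \<subseteq> (A_cls t lam u \<odot>\<^bsub>Q a\<^esub> q) N"
      using Q_smult[of u q N a v, OF u v(2) v(1)] Q_smult[of u q "Suc N" a v, OF u v(3) v(1)] Q_coset_Suc S_mult[OF u v(1)] by auto
  qed
qed

lemma Q_topspace: "topspace (Q_topology t lam a :: ('n, 'k) Qelt topology) = carrier (Q a)"
  unfolding Q_topology_def Q_cosets topspace_subtopology topspace_product_topology topspace_discrete_topology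
  using Q_rep by (fastforce simp: PiE_UNIV_domain Pi_def)

text \<open>A basic open set of the product topology restricts only finitely many coordinates, and the
  codomain is discrete.\<close>

lemma Q_continuous_locally_constant:
  assumes c: "continuous_map (Q_topology t lam a) (discrete_topology Y) (\<phi> :: ('n, 'k) Qelt \<Rightarrow> _)"
    and q: "q \<in> carrier (Q a)"
  obtains N where "\<And>q'. q' \<in> carrier (Q a) \<Longrightarrow> (\<forall>k\<le>N. q' k = q k) \<Longrightarrow> \<phi> q' = \<phi> q"
proof -
  let ?T = "\<lambda>N. discrete_topology (a_rcosets\<^bsub>A_lam t lam\<^esub> (Q_left_ideal t lam a N)) :: ('n, 'k) weyl set set topology"
  have "\<phi> q \<in> Y" using c q by (auto simp: continuous_map_def Q_topspace)
  then have "openin (Q_topology t lam a) {x \<in> carrier (Q a). \<phi> x \<in> {\<phi> q}}"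
    using openin_continuous_map_preimage[OF c, of "{\<phi> q}"] by (simp add: Q_topspace)
  then obtain T where T: "openin (product_topology ?T UNIV) T"
    "{x \<in> carrier (Q a). \<phi> x \<in> {\<phi> q}} = T \<inter> carrier (Q a)"
    unfolding Q_topology_def openin_subtopology by blast
  have "q \<in> T" using T(2) q by blast
  then obtain U where U: "finite {i. U i \<noteq> topspace (?T i)}" "q \<in> Pi\<^sub>E UNIV U" "Pi\<^sub>E UNIV U \<subseteq> T"
    using T(1) unfolding openin_product_topology_alt by (auto 0 3)
  define N where "N = Max (insert 0 {i. U i \<noteq> topspace (?T i)})"
  have "\<phi> q' = \<phi> q" if "q' \<in> carrier (Q a)" "\<forall>k\<le>N. q' k = q k" for q'
  proof -
    have "q' k \<in> U k" for k
    proof (cases "U k = topspace (?T k)")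
      case True
      then show ?thesis using Q_rep[OF that(1), of k] by (auto simp: Q_cosets)
    next
      case False
      then have "k \<le> N" unfolding N_def using U(1) by (intro Max_ge) auto
      then show ?thesis using that(2) U(2) by (simp add: PiE_iff)
    qed
    then have "q' \<in> T" using U(3) by (auto simp: PiE_iff)
    then show ?thesis using T(2) that(1) by blast
  qed
  then show ?thesis using that by blast
qed

end

context equivariant
begin

abbreviation HomQ where "HomQ a \<equiv> Hom_Q t lam a M"

lemma HomQ_smult: "\<phi> \<in> HomQ a \<Longrightarrow> u \<in> S \<Longrightarrow> q \<in> carrier (Q a) \<Longrightarrow> \<phi> (A_cls t lam u \<odot>\<^bsub>Q a\<^esub> q) = u \<cdot> \<phi> q"
  by (auto simp: Hom_Q_def linear_maps_def A_cls_closed)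

lemma HomQ_elt: "\<phi> \<in> HomQ a \<Longrightarrow> u \<in> S \<Longrightarrow> \<phi> (Q_elt a u) = u \<cdot> \<phi> (Q_one t lam a)"
proof -
  assume \<phi>: "\<phi> \<in> HomQ a" and u: "u \<in> S"
  have "(A_cls t lam u \<odot>\<^bsub>Q a\<^esub> Q_elt a 1) = Q_elt a u"
  proof
    show "(A_cls t lam u \<odot>\<^bsub>Q a\<^esub> Q_elt a 1) N = Q_elt a u N" for N
      using Q_smult[OF u, of "Q_elt a 1" N a 1] S_one by (simp add: Q_elt_def)
  qed
  then show ?thesis using HomQ_smult[OF \<phi> u, of "Q_elt a 1"] Q_elt_carrier[OF S_one] by (simp add: Q_one_eq)
qed

text \<open>The multiples of \<open>1\<^sub>a\<close> are dense, so a continuous homomorphism is determined by its value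
  there.\<close>

lemma HomQ_eval:
  assumes \<phi>: "\<phi> \<in> HomQ a" and q: "q \<in> carrier (Q a)"
  obtains N where "\<And>u k. N \<le> k \<Longrightarrow> u \<in> S \<Longrightarrow> q k = Q_coset a k u \<Longrightarrow> \<phi> q = u \<cdot> \<phi> (Q_one t lam a)"
proof -
  have "continuous_map (Q_topology t lam a) (discrete_topology (carrier M)) \<phi>" using \<phi> by (simp add: Hom_Q_def)
  from Q_continuous_locally_constant[OF this q] obtain N
    where N: "\<And>q'. q' \<in> carrier (Q a) \<Longrightarrow> (\<forall>k\<le>N. q' k = q k) \<Longrightarrow> \<phi> q' = \<phi> q" by blast
  have "\<phi> q = u \<cdot> \<phi> (Q_one t lam a)" if u: "N \<le> k" "u \<in> S" "q k = Q_coset a k u" for u k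
  proof -
    have "\<forall>j\<le>N. Q_elt a u j = q j" using Q_lower[OF q _ u(3,2)] u(1) by (simp add: Q_elt_def)
    then show ?thesis using N[OF Q_elt_carrier[OF u(2)]] HomQ_elt[OF \<phi> u(2)] by simp
  qed
  then show ?thesis using that by blast
qed

lemma Q_one_carrier: "Q_one t lam a \<in> carrier (Q a)"
  unfolding Q_one_eq by (rule Q_elt_carrier[OF S_one])

lemma HomQ_one_W: "\<phi> \<in> HomQ a \<Longrightarrow> \<phi> (Q_one t lam a) \<in> W a"
proof -
  assume \<phi>: "\<phi> \<in> HomQ a"
  have "Q_one t lam a N = Q_left_ideal t lam a N +>\<^bsub>A_lam t lam\<^esub> A_cls t lam (1 :: ('n, 'k) weyl)" for N
    using Q_coset_eq[OF S_one, of a N] by (simp add: Q_one_eq Q_elt_def)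
  moreover have "(1 :: ('n, 'k) weyl) \<in> weyl_weights ({a - a} \<inter> g_star t)" by (rule weyl_weights_one) simp
  ultimately have "(Q_one t lam a :: ('n, 'k) Qelt) \<in> Q_weight_space t lam a a"
    unfolding Q_weight_space_def using Q_one_carrier[of a] by blast
  then show ?thesis using \<phi> by (auto simp: Hom_Q_def)
qed

lemma HomQ_inj:
  assumes "\<phi> \<in> HomQ a" "\<psi> \<in> HomQ a" "\<phi> (Q_one t lam a) = \<psi> (Q_one t lam a)"
  shows "\<phi> = \<psi>"
proof -
  have "\<phi> q = \<psi> q" if q: "q \<in> carrier (Q a)" for q
  proof -
    obtain N where N: "\<And>u k. N \<le> k \<Longrightarrow> u \<in> S \<Longrightarrow> q k = Q_coset a k u \<Longrightarrow> \<phi> q = u \<cdot> \<phi> (Q_one t lam a)"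
      using HomQ_eval[OF assms(1) q] by blast
    obtain N' where N': "\<And>u k. N' \<le> k \<Longrightarrow> u \<in> S \<Longrightarrow> q k = Q_coset a k u \<Longrightarrow> \<psi> q = u \<cdot> \<psi> (Q_one t lam a)"
      using HomQ_eval[OF assms(2) q] by blast
    obtain u where "u \<in> S" "q (max N N') = Q_coset a (max N N') u" using Q_rep[OF q] by blast
    then show ?thesis using N[of "max N N'" u] N'[of "max N N'" u] assms(3) by simp
  qed
  moreover have "\<phi> \<in> carrier (Q a) \<rightarrow>\<^sub>E carrier M" "\<psi> \<in> carrier (Q a) \<rightarrow>\<^sub>E carrier M"
    using assms(1,2) by (auto simp: Hom_Q_def linear_maps_def)
  ultimately show ?thesis by (intro PiE_ext)
qed

text \<open>Conversely a vector of weight \<open>a\<close> is killed by a power of each \<open>h\<^sub>i - a\<^sub>i\<close>, so acting on it is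
  well defined on \<open>Q\<^sub>a\<close>.\<close>

definition Q_map where
  "Q_map a v = (let N = SOME N. nilp a N v in
     (\<lambda>q\<in>carrier (Q a). (SOME u. u \<in> S \<and> q N = Q_coset a N u) \<cdot> v))"

lemma nilp_Q_rels: "nilp a N v \<Longrightarrow> v \<in> carrier M \<Longrightarrow> j \<in> Q_rels a N \<Longrightarrow> j \<cdot> v = \<zero>\<^bsub>M\<^esub>"
proof -
  assume N: "nilp a N v" and v: "v \<in> carrier M" and "j \<in> Q_rels a N"
  then obtain r where j: "j = (\<Sum>i\<in>UNIV. r i * hdiff a i ^ N)" and r: "\<forall>i. r i \<in> S" by (auto simp: Q_rels_def)
  have "(hdiff a i ^ N) \<cdot> v = \<zero>\<^bsub>M\<^esub>" for i
    using N s_power_ideal_var[of 1 i N] unfolding nilp_def by (auto simp: heval_power dest: bspec)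
  then have "(\<Oplus>\<^bsub>M\<^esub>i\<in>UNIV. (r i * hdiff a i ^ N) \<cdot> v) = (\<Oplus>\<^bsub>M\<^esub>i\<in>(UNIV::'n set). \<zero>\<^bsub>M\<^esub>)"
    using r v by (intro finsum_cong') (auto simp: act_mult S_power)
  then show ?thesis unfolding j using r v by (subst act_sum) (auto simp: S_mult S_power)
qed

lemma Q_coset_act:
  assumes "nilp a N v" "v \<in> carrier M" "Q_coset a N u = Q_coset a N w" "u \<in> S" "w \<in> S"
  shows "u \<cdot> v = w \<cdot> v"
proof -
  have "A_cls t lam u \<in> Q_coset a N w" using A_cls_in_Q_coset[of u a N] assms(3) by simp
  then obtain j where j: "j \<in> Q_rels a N" "A_cls t lam u = A_cls t lam (w + j)" by (auto simp: Q_coset_def)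
  have "(w + j) \<cdot> v = w \<cdot> v \<oplus>\<^bsub>M\<^esub> j \<cdot> v" by (rule act_add_left[OF assms(5) Q_rels_S[OF j(1)] assms(2)])
  then show ?thesis using j(2) nilp_Q_rels[OF assms(1,2) j(1)] assms by simp
qed

lemma Q_map_obtain:
  assumes v: "v \<in> W a"
  obtains N where "nilp a N v"
    "\<And>q u. q \<in> carrier (Q a) \<Longrightarrow> u \<in> S \<Longrightarrow> q N = Q_coset a N u \<Longrightarrow> Q_map a v q = u \<cdot> v"
proof -
  define N where "N = (SOME N. nilp a N v)"
  have N: "nilp a N v" unfolding N_def using nilp_exists[OF v] by (rule someI_ex)
  have "Q_map a v q = u \<cdot> v" if q: "q \<in> carrier (Q a)" "u \<in> S" "q N = Q_coset a N u" for q u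
  proof -
    let ?u = "SOME u. u \<in> S \<and> q N = Q_coset a N u"
    have "?u \<in> S \<and> q N = Q_coset a N ?u" by (rule someI[of _ u]) (use q in simp)
    then show ?thesis
      using Q_coset_act[OF N W_carrier[OF v], of ?u u] q by (simp add: Q_map_def Let_def flip: N_def)
  qed
  with N show ?thesis using that by blast
qed

lemma Q_map_HomQ:
  assumes v: "v \<in> W a" shows "Q_map a v \<in> HomQ a" and "Q_map a v (Q_one t lam a) = v"
proof -
  have vc: "v \<in> carrier M" using v by (rule W_carrier)
  obtain N where N: "nilp a N v"
    and ev: "\<And>q u. q \<in> carrier (Q a) \<Longrightarrow> u \<in> S \<Longrightarrow> q N = Q_coset a N u \<Longrightarrow> Q_map a v q = u \<cdot> v"
    using Q_map_obtain[OF v] by blast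
  have rep: "\<exists>u\<in>S. q N = Q_coset a N u" if "q \<in> carrier (Q a)" for q using that by (rule Q_rep)
  show "Q_map a v (Q_one t lam a) = v"
    using ev[OF Q_one_carrier S_one] vc by (simp add: Q_one_eq Q_elt_def)
  have lin: "Q_map a v \<in> linear_maps (A_lam t lam) (Q a) M"
    unfolding linear_maps_def
  proof (intro CollectI conjI ballI)
    have "Q_map a v q \<in> carrier M" if "q \<in> carrier (Q a)" for q
      using rep[OF that] ev[OF that] vc by auto
    then show "Q_map a v \<in> carrier (Q a) \<rightarrow>\<^sub>E carrier M"
      by (auto simp: Q_map_def Let_def)
    fix q r assume q: "q \<in> carrier (Q a)"
    obtain u where u: "u \<in> S" "q N = Q_coset a N u" using rep[OF q] by blast
    {
      assume r: "r \<in> carrier (Q a)"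
      then obtain w where w: "w \<in> S" "r N = Q_coset a N w" using rep by blast
      show "Q_map a v (q \<oplus>\<^bsub>Q a\<^esub> r) = Q_map a v q \<oplus>\<^bsub>M\<^esub> Q_map a v r"
        using ev[OF Q_closed(1)[OF q r] S_add[OF u(1) w(1)] Q_add[OF q r u(2) w(2) u(1) w(1)]]
          ev[OF q u] ev[OF r w] act_add_left[OF u(1) w(1) vc] by simp
    }
  next
    fix R q assume "R \<in> carrier (A_lam t lam :: ('n, 'k) weyl set ring)" and q: "q \<in> carrier (Q a)"
    then obtain w where w: "w \<in> S" "R = A_cls t lam w" by (auto simp: carrier_A_lam)
    obtain u where u: "u \<in> S" "q N = Q_coset a N u" using rep[OF q] by blast
    show "Q_map a v (R \<odot>\<^bsub>Q a\<^esub> q) = R \<odot>\<^bsub>M\<^esub> Q_map a v q"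
      unfolding w(2) ev[OF q u] using act_mult[OF w(1) u(1) vc]
        ev[OF Q_closed(2)[OF q w(1)] S_mult[OF w(1) u(1)] Q_smult[of w q N a u, OF w(1) u(2) u(1)]] by simp
  qed
  let ?T = "\<lambda>N. discrete_topology (a_rcosets\<^bsub>A_lam t lam\<^esub> (Q_left_ideal t lam a N)) :: ('n, 'k) weyl set set topology"
  let ?h = "\<lambda>c. (SOME u. u \<in> S \<and> c = Q_coset a N u) \<cdot> v"
  have h: "?h c \<in> carrier M" if "c \<in> Q_coset a N ` S" for c
  proof -
    have "(SOME u. u \<in> S \<and> c = Q_coset a N u) \<in> S \<and> c = Q_coset a N (SOME u. u \<in> S \<and> c = Q_coset a N u)"
      by (rule someI_ex) (use that in auto)
    then show ?thesis using vc by simp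
  qed
  have "continuous_map (product_topology ?T UNIV) (discrete_topology (carrier M)) (?h \<circ> (\<lambda>q. q N))"
    by (rule continuous_map_compose[OF continuous_map_product_projection[of N UNIV ?T]])
      (use h in \<open>auto simp: Q_cosets\<close>)
  then have "continuous_map (Q_topology t lam a) (discrete_topology (carrier M)) (?h \<circ> (\<lambda>q. q N))"
    unfolding Q_topology_def by (rule continuous_map_from_subtopology)
  moreover have "(?h \<circ> (\<lambda>q. q N)) q = Q_map a v q" if q: "q \<in> topspace (Q_topology t lam a)" for q
  proof -
    have qc: "q \<in> carrier (Q a)" using q by (simp add: Q_topspace)
    have "(SOME u. u \<in> S \<and> q N = Q_coset a N u) \<in> S \<and> q N = Q_coset a N (SOME u. u \<in> S \<and> q N = Q_coset a N u)"
      by (rule someI_ex) (use rep[OF qc] in auto)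
    then have "Q_map a v q = (SOME u. u \<in> S \<and> q N = Q_coset a N u) \<cdot> v" by (intro ev[OF qc]) auto
    then show ?thesis by simp
  qed
  ultimately have cont: "continuous_map (Q_topology t lam a) (discrete_topology (carrier M)) (Q_map a v)"
    by (rule continuous_map_eq)
  have "Q_map a v q \<in> W c" if q: "q \<in> Q_weight_space t lam a c" for q c
  proof -
    obtain u where u: "u \<in> weyl_weights ({c - a} \<inter> g_star t)" "q N = Q_left_ideal t lam a N +>\<^bsub>A_lam t lam\<^esub> A_cls t lam u"
      and qc: "q \<in> carrier (Q a)" using q by (auto simp: Q_weight_space_def)
    have uS: "u \<in> S" using u(1) weyl_weights_mono[of "{c - a} \<inter> g_star t" "g_star t"] by auto
    have "Q_map a v q = u \<cdot> v" using ev[OF qc uS] u(2) Q_coset_eq[OF uS] by simp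
    moreover have "u \<cdot> v \<in> W c"
    proof (cases "c - a \<in> g_star t")
      case True
      then show ?thesis using act_W[of u "c - a" v a] u(1) v by simp
    next
      case False
      then have "u \<in> weyl_weights {}" using u(1) by simp
      then have "u = 0" by (induction rule: weyl_weights_induct) auto
      then show ?thesis using vc by simp
    qed
    ultimately show ?thesis by simp
  qed
  with lin cont show "Q_map a v \<in> HomQ a" by (simp add: Hom_Q_def)
qed

end

section \<open>The algebra \<open>H\<close> and its modules\<close>

lemma class_quotient_H: "class_quotient UNIV (H_rels t L :: ('n::finite, 'k::field) Hfree set)"
  by unfold_locales auto

lemma H_alg_qring: "H_alg t L = class_quotient.qring UNIV (H_rels t L)"
  and H_cls_qcls: "H_cls t L f = class_quotient.qcls UNIV (H_rels t L) f"
  unfolding H_alg_def H_cls_def H_ideal_def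
      class_quotient.qring_def[OF class_quotient_H] class_quotient.qcls_def[OF class_quotient_H]
      class_quotient.qideal_def[OF class_quotient_H]
  by (rule refl)+

lemma H_rels_torus: "x \<in> t \<Longrightarrow> H_scal (\<Sum>i\<in>UNIV. of_int (x $ i) * s_var i) \<in> H_rels t L"
  unfolding H_rels_def by (intro UnI1 CollectI exI[of _ x]) simp

lemma H_rels_comp:
  "x \<in> L \<Longrightarrow> y \<in> L \<Longrightarrow> u \<in> L \<Longrightarrow>
    gen (x, y) * gen (y, u) - H_scal (s_monom (eta x y u)) * gen (x, u) \<in> H_rels t L"
  unfolding H_rels_def s_monom_def
  by (rule UnI1, rule UnI1, rule UnI2, intro CollectI exI[of _ x] exI[of _ y] exI[of _ u]) simp

lemma H_rels_orth:
  "x \<in> L \<Longrightarrow> y \<in> L \<Longrightarrow> y' \<in> L \<Longrightarrow> u \<in> L \<Longrightarrow> y \<noteq> y' \<Longrightarrow> gen (x, y) * gen (y', u) \<in> H_rels t L"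
  unfolding H_rels_def
  by (rule UnI1, rule UnI2, intro CollectI exI[of _ x] exI[of _ y] exI[of _ y'] exI[of _ u]) simp

lemma H_rels_outside: "x \<notin> L \<or> y \<notin> L \<Longrightarrow> gen (x, y) \<in> H_rels t L"
  unfolding H_rels_def by (rule UnI2, intro CollectI exI[of _ x] exI[of _ y]) simp

lemma H_rels_cases:
  assumes "g \<in> H_rels t L"
  obtains (torus) x where "g = H_scal (\<Sum>i\<in>UNIV. of_int (x $ i) * s_var i)" "x \<in> t"
    | (comp) x y u where "g = gen (x, y) * gen (y, u) - H_scal (s_monom (eta x y u)) * gen (x, u)" "x \<in> L" "y \<in> L" "u \<in> L"
    | (orth) x y y' u where "g = gen (x, y) * gen (y', u)" "x \<in> L" "y \<in> L" "y' \<in> L" "u \<in> L" "y \<noteq> y'"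
    | (outside) x y where "g = gen (x, y)" "\<not> (x \<in> L \<and> y \<in> L)"
  using assms unfolding H_rels_def s_monom_def[symmetric] Un_iff mem_Collect_eq de_Morgan_conj[symmetric]
  by (elim disjE exE conjE) (rule that; assumption)+

lemma carrier_H_alg: "carrier (H_alg t L) = range (H_cls t L)"
  by (simp add: H_alg_qring H_cls_qcls class_quotient.carrier_qring[OF class_quotient_H] image_def)

lemma H_scal_simps: "H_scal (f + g) = H_scal f + H_scal g" "H_scal (f * g) = H_scal f * H_scal g"
  "H_scal 1 = 1" "H_scal 0 = 0"
  by (simp_all add: H_scal_def single_add mult_single)

lemma H_scal_commute: "H_scal f * h = h * H_scal f"
  unfolding H_scal_def by (rule single_zero_commute)

lemma Hfree_induct [case_names scal gen add]:
  assumes "\<And>f. P (H_scal f)" "\<And>x y h. P h \<Longrightarrow> P (gen (x, y) * h)" "\<And>g h. P g \<Longrightarrow> P h \<Longrightarrow> P (g + h)"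
  shows "P (h :: ('n::finite, 'k::field) Hfree)"
proof (induction h rule: poly_mapping_induct_single)
  case (single w f)
  have "P (Poly_Mapping.single (Word ws) f)" for ws
  proof (induction ws)
    case Nil
    then show ?case using assms(1)[of f] by (simp add: H_scal_def zero_word_def)
  next
    case (Cons z ws)
    have "gen z * Poly_Mapping.single (Word ws) f = Poly_Mapping.single (Word (z # ws)) f"
      by (simp add: gen_def mult_single plus_word_def)
    then show ?case using assms(2)[OF Cons, of "fst z" "snd z"] by simp
  qed
  from this[of "letters w"] show ?case by simp
qed (rule assms(3))

locale H_action =
  fixes t :: "(int ^ 'n::finite) set" and L :: "(int ^ 'n) set"
    and N :: "(('n, 'k::field) Hfree set, 'w) module"
  assumes left_module_H: "left_module (H_alg t L) N"
begin

abbreviation hact (infixr "\<star>" 75) where "h \<star> v \<equiv> H_cls t L h \<odot>\<^bsub>N\<^esub> v"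

sublocale scalar_act N UNIV "\<lambda>h v. h \<star> v" "\<lambda>c. H_scal (s_const c)"
proof -
  have "ring_act N UNIV (\<lambda>h v. h \<star> v)"
    using class_quotient.left_module_act(1)[OF class_quotient_H] left_module_H
    by (simp add: H_alg_qring H_cls_qcls)
  then interpret ring_act N UNIV "\<lambda>h v. h \<star> v" .
  show "scalar_act N UNIV (\<lambda>h v. h \<star> v) (\<lambda>c. H_scal (s_const c))"
    by unfold_locales (auto simp: H_scal_simps)
qed

lemma eq_if_minus_zero: "v \<in> carrier N \<Longrightarrow> w \<in> carrier N \<Longrightarrow> v \<ominus>\<^bsub>N\<^esub> w = \<zero>\<^bsub>N\<^esub> \<Longrightarrow> v = w"
  using minus_equality[of v "\<ominus>\<^bsub>N\<^esub> w"] by (simp add: a_minus_def)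

lemma H_rels_act: "g \<in> H_rels t L \<Longrightarrow> v \<in> carrier N \<Longrightarrow> g \<star> v = \<zero>\<^bsub>N\<^esub>"
  using class_quotient.left_module_act(2)[OF class_quotient_H] left_module_H
  by (simp add: H_alg_qring H_cls_qcls)

abbreviation sact (infixr "\<bullet>" 75) where "f \<bullet> v \<equiv> H_scal f \<star> v"

abbreviation cact where "cact x y v \<equiv> gen (x, y) \<star> v"

lemma sact_closed: "v \<in> carrier N \<Longrightarrow> f \<bullet> v \<in> carrier N"
  and cact_closed: "v \<in> carrier N \<Longrightarrow> cact x y v \<in> carrier N"
  by simp_all

lemma sact_add_left: "v \<in> carrier N \<Longrightarrow> (f + g) \<bullet> v = f \<bullet> v \<oplus>\<^bsub>N\<^esub> g \<bullet> v"
  by (simp add: H_scal_simps act_add_left)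

lemma sact_mult: "v \<in> carrier N \<Longrightarrow> (f * g) \<bullet> v = f \<bullet> g \<bullet> v"
  by (simp add: H_scal_simps act_mult)

lemma sact_one: "v \<in> carrier N \<Longrightarrow> 1 \<bullet> v = v"
  by (simp add: H_scal_simps)

lemma sact_zero_left: "v \<in> carrier N \<Longrightarrow> 0 \<bullet> v = \<zero>\<^bsub>N\<^esub>"
  by (simp add: H_scal_simps)

lemma sact_hact: "v \<in> carrier N \<Longrightarrow> f \<bullet> h \<star> v = h \<star> f \<bullet> v"
  using act_mult[of "H_scal f" h v] act_mult[of h "H_scal f" v] by (simp add: H_scal_commute[of f h])

lemma cact_cact:
  assumes "x \<in> L" "y \<in> L" "u \<in> L" "v \<in> carrier N"
  shows "cact x y (cact y u v) = s_monom (eta x y u) \<bullet> cact x u v"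
proof -
  from H_rels_act[OF H_rels_comp[OF assms(1-3)] assms(4)] have "cact x y (cact y u v) \<ominus>\<^bsub>N\<^esub> s_monom (eta x y u) \<bullet> cact x u v = \<zero>\<^bsub>N\<^esub>"
    using assms(4) by (simp add: act_diff act_mult)
  then show ?thesis using assms(4) by (intro eq_if_minus_zero[OF cact_closed[OF cact_closed] sact_closed[OF cact_closed]])
qed

lemma cact_cact_neq:
  assumes "x \<in> L" "y \<in> L" "y' \<in> L" "u \<in> L" "y \<noteq> y'" "v \<in> carrier N"
  shows "cact x y (cact y' u v) = \<zero>\<^bsub>N\<^esub>"
proof -
  from H_rels_act[OF H_rels_orth[OF assms(1-5)] assms(6)] show ?thesis using assms(6) by (simp add: act_mult)
qed

lemma cact_outside: "x \<notin> L \<or> y \<notin> L \<Longrightarrow> v \<in> carrier N \<Longrightarrow> cact x y v = \<zero>\<^bsub>N\<^esub>"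
  by (rule H_rels_act[OF H_rels_outside])

lemma torus_relation: "x \<in> t \<Longrightarrow> v \<in> carrier N \<Longrightarrow> (\<Sum>i\<in>UNIV. of_int (x $ i) * s_var i) \<bullet> v = \<zero>\<^bsub>N\<^esub>"
  by (rule H_rels_act[OF H_rels_torus])

end

text \<open>The free algebra that surjects onto \<open>H\<close> is generated by its scalars and the \<open>c\<^sub>x\<^sub>,\<^sub>y\<close>.\<close>

lemma H_linear_mapsI:
  fixes N :: "(('n::finite, 'k::field) Hfree set, 'w) module" and N' :: "(('n, 'k) Hfree set, 'w2) module"
  assumes "left_module (H_alg t L) N" "left_module (H_alg t L) N'"
    and f: "f \<in> carrier N \<rightarrow>\<^sub>E carrier N'"
    and add: "\<And>v w. v \<in> carrier N \<Longrightarrow> w \<in> carrier N \<Longrightarrow> f (v \<oplus>\<^bsub>N\<^esub> w) = f v \<oplus>\<^bsub>N'\<^esub> f w"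
    and s: "\<And>v g. v \<in> carrier N \<Longrightarrow> f (H_cls t L (H_scal g) \<odot>\<^bsub>N\<^esub> v) = H_cls t L (H_scal g) \<odot>\<^bsub>N'\<^esub> f v"
    and c: "\<And>v x y. v \<in> carrier N \<Longrightarrow> f (H_cls t L (gen (x, y)) \<odot>\<^bsub>N\<^esub> v) = H_cls t L (gen (x, y)) \<odot>\<^bsub>N'\<^esub> f v"
  shows "f \<in> linear_maps (H_alg t L) N N'"
proof -
  interpret N: H_action t L N by (rule H_action.intro) fact
  interpret N': H_action t L N' by (rule H_action.intro) fact
  have fv: "f v \<in> carrier N'" if "v \<in> carrier N" for v using f that by auto
  have "\<forall>v\<in>carrier N. f (N.hact h v) = N'.hact h (f v)" for h
  proof (induction h rule: Hfree_induct)
    case (gen x y h)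
    then show ?case using c fv by (simp add: N.act_mult N'.act_mult)
  next
    case (add g h)
    then show ?case using assms(4) fv by (simp add: N.act_add_left N'.act_add_left)
  qed (use s in simp)
  then show ?thesis unfolding linear_maps_def carrier_H_alg using f add by auto
qed

section \<open>The functor\<close>

text \<open>Transport of structure. It turns the actions on families of vectors into actions on other sets in
  bijection with the families.\<close>

lemma ring_act_transport:
  assumes "ring_act V S act" and e: "bij_betw e (carrier V') (carrier V)"
    and zero: "\<zero>\<^bsub>V'\<^esub> \<in> carrier V'" "e \<zero>\<^bsub>V'\<^esub> = \<zero>\<^bsub>V\<^esub>"
    and add: "\<And>v w. v \<in> carrier V' \<Longrightarrow> w \<in> carrier V' \<Longrightarrow> v \<oplus>\<^bsub>V'\<^esub> w \<in> carrier V'"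
      "\<And>v w. v \<in> carrier V' \<Longrightarrow> w \<in> carrier V' \<Longrightarrow> e (v \<oplus>\<^bsub>V'\<^esub> w) = e v \<oplus>\<^bsub>V\<^esub> e w"
  shows "ring_act V' S (\<lambda>u v. the_inv_into (carrier V') e (act u (e v)))"
proof -
  interpret V: ring_act V S act by fact
  let ?i = "the_inv_into (carrier V') e"
  have inj: "inj_on e (carrier V')" and im: "e ` carrier V' = carrier V" using e by (auto simp: bij_betw_def)
  have ec: "e v \<in> carrier V" if "v \<in> carrier V'" for v using im that by blast
  have ic: "?i v \<in> carrier V'" if "v \<in> carrier V" for v using the_inv_into_into[OF inj] im that by auto
  have ei: "e (?i v) = v" if "v \<in> carrier V" for v using f_the_inv_into_f[OF inj] im that by auto
  have eq: "v = w" if "e v = e w" "v \<in> carrier V'" "w \<in> carrier V'" for v w using inj_onD[OF inj] that by blast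
  have grp: "abelian_group V'"
  proof (rule abelian_groupI)
    fix x assume x: "x \<in> carrier V'"
    show "\<exists>y\<in>carrier V'. y \<oplus>\<^bsub>V'\<^esub> x = \<zero>\<^bsub>V'\<^esub>"
    proof (intro bexI eq)
      show "e (?i (\<ominus>\<^bsub>V\<^esub> e x) \<oplus>\<^bsub>V'\<^esub> x) = e \<zero>\<^bsub>V'\<^esub>"
        using x ec ic by (simp add: add ei zero V.l_neg)
    qed (use x ec ic add zero in auto)
  qed (auto intro!: eq simp: add zero ec V.a_ac)
  interpret V': abelian_group V' by (rule grp)
  show ?thesis
    by unfold_locales
      (auto intro!: eq simp: V.S_one V.S_diff V.S_mult ic ec ei add V.act_add_left V.act_add V.act_mult)
qed

context char_p
begin

lemma alcove_of_alcove: "a \<in> alcove t lam p x \<Longrightarrow> alcove_of p a = x"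
proof -
  assume a: "a \<in> alcove t lam p x"
  have "a $ i div int p = x $ i" for i
  proof (rule int_div_pos_eq)
    show "a $ i = int p * x $ i + (a $ i - int p * x $ i)" by simp
    show "0 \<le> a $ i - int p * x $ i" using a by (simp add: alcove_def)
    have "a $ i < int p * x $ i + int p" using a by (simp add: alcove_def)
    then show "a $ i - int p * x $ i < int p" by linarith
  qed
  then show ?thesis by (simp add: alcove_of_def vec_eq_iff)
qed

lemma fiber_alcove: "a \<in> lattice_fiber t lam \<Longrightarrow> alcove_of p a \<in> alcove_labels t lam p"
proof -
  assume a: "a \<in> lattice_fiber t lam"
  have "int p * (a $ i div int p) \<le> a $ i \<and> a $ i < int p * (a $ i div int p) + int p" for i
  proof -
    have "int p > 0" using p_pos by simp
    then have "0 \<le> a $ i mod int p" "a $ i mod int p < int p" by simp_all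
    moreover have "int p * (a $ i div int p) + a $ i mod int p = a $ i" by (rule mult_div_mod_eq)
    ultimately show ?thesis by linarith
  qed
  then have "a \<in> alcove t lam p (alcove_of p a)"
    using a by (simp add: alcove_def alcove_of_def)
  then show ?thesis by (auto simp: alcove_labels_def)
qed

end

locale H_family = equivariant p t lam M for p t lam and M :: "('n::finite, 'k::field, 'v) Dmod" +
  fixes b :: "int ^ 'n \<Rightarrow> int ^ 'n"
  assumes b_alcove: "\<And>x. x \<in> alcove_labels t lam p \<Longrightarrow> b x \<in> alcove t lam p x"
begin

abbreviation L where "L \<equiv> alcove_labels t lam p"

lemma b_fiber: "x \<in> L \<Longrightarrow> b x \<in> lattice_fiber t lam"
  using b_alcove by (auto simp: alcove_def)

lemma alcove_of_b: "x \<in> L \<Longrightarrow> alcove_of p (b x) = x"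
  by (rule alcove_of_alcove[OF b_alcove])

lemma b_diff: "x \<in> L \<Longrightarrow> y \<in> L \<Longrightarrow> b x - b y \<in> g_star t"
  by (rule fiber_diff[OF b_fiber b_fiber])

subsection \<open>Families of weight vectors\<close>

text \<open>The direct sum of the weight spaces at the base points of the alcoves.\<close>

definition fam where
  "fam = {w \<in> (\<Pi>\<^sub>E x\<in>L. W (b x)). finite {x \<in> L. w x \<noteq> \<zero>\<^bsub>M\<^esub>}}"

definition fadd where "fadd w w' = (\<lambda>x\<in>L. w x \<oplus>\<^bsub>M\<^esub> w' x)"

definition fscale where "fscale f w = (\<lambda>x\<in>L. heval (b x) f \<cdot> w x)"

lemma fadd_apply [simp]: "x \<in> L \<Longrightarrow> fadd w w' x = w x \<oplus>\<^bsub>M\<^esub> w' x"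
  and fscale_apply [simp]: "x \<in> L \<Longrightarrow> fscale f w x = heval (b x) f \<cdot> w x"
  by (simp_all add: fadd_def fscale_def)

definition fam_mod :: "(int ^ 'n \<Rightarrow> 'v) ring" where
  "fam_mod = \<lparr>carrier = fam, mult = undefined, one = undefined, zero = (\<lambda>x\<in>L. \<zero>\<^bsub>M\<^esub>),
     add = fadd\<rparr>"

lemma fam_W: "w \<in> fam \<Longrightarrow> x \<in> L \<Longrightarrow> w x \<in> W (b x)"
  by (auto simp: fam_def)

lemma fam_carrier: "w \<in> fam \<Longrightarrow> x \<in> L \<Longrightarrow> w x \<in> carrier M"
  by (rule W_carrier[OF fam_W])

lemma fam_ext: "w \<in> fam \<Longrightarrow> w' \<in> fam \<Longrightarrow> (\<And>x. x \<in> L \<Longrightarrow> w x = w' x) \<Longrightarrow> w = w'"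
  unfolding fam_def by (auto intro: PiE_ext)

lemma famI:
  assumes "\<And>x. x \<in> L \<Longrightarrow> w x \<in> W (b x)" "finite X" "\<And>x. x \<in> L \<Longrightarrow> x \<notin> X \<Longrightarrow> w x = \<zero>\<^bsub>M\<^esub>"
  shows "(\<lambda>x\<in>L. w x) \<in> fam"
proof -
  have "{x \<in> L. (\<lambda>x\<in>L. w x) x \<noteq> \<zero>\<^bsub>M\<^esub>} \<subseteq> X" using assms(3) by auto
  then have "finite {x \<in> L. (\<lambda>x\<in>L. w x) x \<noteq> \<zero>\<^bsub>M\<^esub>}" using assms(2) by (rule finite_subset)
  moreover have "(\<lambda>x\<in>L. w x) \<in> (\<Pi>\<^sub>E x\<in>L. W (b x))" using assms(1) by auto
  ultimately show ?thesis unfolding fam_def by blast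
qed

lemma fam_finite: "w \<in> fam \<Longrightarrow> finite {x \<in> L. w x \<noteq> \<zero>\<^bsub>M\<^esub>}"
  by (simp add: fam_def)

lemma fam_zero: "(\<lambda>x\<in>L. \<zero>\<^bsub>M\<^esub>) \<in> fam"
  by (rule famI[of _ "{}"]) auto

lemma fam_add: "w \<in> fam \<Longrightarrow> w' \<in> fam \<Longrightarrow> fadd w w' \<in> fam"
proof -
  assume w: "w \<in> fam" "w' \<in> fam"
  show ?thesis unfolding fadd_def
    by (rule famI[of _ "{x \<in> L. w x \<noteq> \<zero>\<^bsub>M\<^esub>} \<union> {x \<in> L. w' x \<noteq> \<zero>\<^bsub>M\<^esub>}"])
      (use fam_W[OF w(1)] fam_W[OF w(2)] fam_finite[OF w(1)] fam_finite[OF w(2)] in \<open>auto intro: add_W\<close>)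
qed

lemma abelian_group_fam: "abelian_group fam_mod"
proof (rule abelian_groupI)
  fix w assume "w \<in> carrier fam_mod"
  then have w: "w \<in> fam" by (simp add: fam_mod_def)
  have neg: "(\<lambda>x\<in>L. \<ominus>\<^bsub>M\<^esub> w x) \<in> fam"
  proof (rule famI[OF _ fam_finite[OF w]])
    fix x assume "x \<in> L"
    then show "\<ominus>\<^bsub>M\<^esub> w x \<in> W (b x)" using fam_W[OF w, of x] by (simp add: W_iff coact_neg)
  qed auto
  show "\<exists>y\<in>carrier fam_mod. y \<oplus>\<^bsub>fam_mod\<^esub> w = \<zero>\<^bsub>fam_mod\<^esub>"
    by (rule bexI[of _ "\<lambda>x\<in>L. \<ominus>\<^bsub>M\<^esub> w x"])
      (use neg fam_carrier[OF w] in \<open>auto simp: fam_mod_def fadd_def l_neg intro!: restrict_ext\<close>)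
qed (auto simp: fam_mod_def fam_zero fam_add fam_carrier a_ac intro!: fam_ext)

lemma c_act_eq:
  "c_act t lam L b M (x, y) w = (\<lambda>u\<in>L. if u = x \<and> y \<in> L then tr (b x) (b y) (w y) else \<zero>\<^bsub>M\<^esub>)"
  by (auto simp: c_act_def tr_def)

lemma c_act_fam: "w \<in> fam \<Longrightarrow> c_act t lam L b M z w \<in> fam"
proof (cases z)
  case (Pair x y)
  assume "w \<in> fam"
  then have "y \<in> L \<Longrightarrow> w y \<in> W (b y)" by (rule fam_W)
  then show ?thesis unfolding Pair c_act_eq
    by (intro famI[where X = "{x}"]) (auto intro!: tr_W b_diff)
qed

abbreviation cw where "cw e w \<equiv> foldr (c_act t lam L b M) (letters e) w"

lemma cw_fam: "w \<in> fam \<Longrightarrow> cw e w \<in> fam"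
proof -
  assume w: "w \<in> fam"
  have "foldr (c_act t lam L b M) zs w \<in> fam" for zs by (induction zs) (auto simp: w c_act_fam)
  then show ?thesis .
qed

lemma s_poly_act_W:
  assumes v: "v \<in> W a" shows "s_poly_act t lam M f v = heval a f \<cdot> v"
proof -
  have "fold (\<lambda>i. s_op t lam M i ^^ (m $ i)) is v = (\<Prod>i\<leftarrow>is. hdiff a i ^ (m $ i)) \<cdot> v" if "v \<in> W a" for "is" m v
    using that
  proof (induction "is" arbitrary: v)
    case (Cons i "is")
    have p: "hdiff a i ^ (m $ i) \<in> weyl_weights {0}"
      using weyl_weights_power[OF hdiff_weight, of a i "m $ i"] by simp
    have P: "(\<Prod>i\<leftarrow>is. hdiff a i ^ (m $ i)) \<in> S"
      by (induction "is") (simp_all add: S_one S_mult S_power)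
    have "fold (\<lambda>i. s_op t lam M i ^^ (m $ i)) (i # is) v = (\<Prod>i\<leftarrow>is. hdiff a i ^ (m $ i)) \<cdot> (hdiff a i ^ (m $ i)) \<cdot> v"
      using Cons s_op_power_W[OF Cons.prems] act0_W[OF p Cons.prems] by simp
    also have "\<dots> = ((\<Prod>i\<leftarrow>is. hdiff a i ^ (m $ i)) * hdiff a i ^ (m $ i)) \<cdot> v"
      using P W_carrier[OF Cons.prems] by (simp add: act_mult S_power)
    also have "(\<Prod>i\<leftarrow>is. hdiff a i ^ (m $ i)) * hdiff a i ^ (m $ i) = (\<Prod>i\<leftarrow>i # is. hdiff a i ^ (m $ i) :: ('n, 'k) weyl)"
      using commute_prod_list[of "is" "hdiff a i ^ (m $ i) :: ('n, 'k) weyl" "\<lambda>i. hdiff a i ^ (m $ i)"]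
      by (simp add: commute_power2 hdiff_commute)
    finally show ?case .
  qed (simp add: W_carrier)
  then have e: "fold (\<lambda>i. s_op t lam M i ^^ (m $ i)) coords v = hmonom a m \<cdot> v" for m
    using v by (simp add: hmonom_def)
  have h: "hmonom a m \<in> S" for m by (rule weight_zero_S[OF hmonom_weight])
  have vc: "v \<in> carrier M" using v by (rule W_carrier)
  have "heval a f \<cdot> v = (\<Oplus>\<^bsub>M\<^esub>m\<in>Poly_Mapping.keys f. (scal (Poly_Mapping.lookup f m) * hmonom a m) \<cdot> v)"
    unfolding heval_def by (rule act_sum) (use vc h S_mult sc_closed in auto)
  then show ?thesis
    unfolding s_poly_act_def e using vc h by (simp add: act_mult)
qed

lemma H_act_eq:
  assumes "w \<in> fam" "finite X" "Poly_Mapping.keys f \<subseteq> X"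
  shows "H_act t lam L b M f w = (\<lambda>x\<in>L. \<Oplus>\<^bsub>M\<^esub>e\<in>X. heval (b x) (Poly_Mapping.lookup f e) \<cdot> cw e w x)"
  unfolding H_act_def
proof (rule restrict_ext)
  fix x assume x: "x \<in> L"
  have c: "cw e w x \<in> carrier M" for e using fam_carrier[OF cw_fam[OF assms(1)] x] .
  have "s_poly_act t lam M (Poly_Mapping.lookup f e) (cw e w x) = heval (b x) (Poly_Mapping.lookup f e) \<cdot> cw e w x" for e
    by (rule s_poly_act_W[OF fam_W[OF cw_fam[OF assms(1)] x]])
  then have "(\<Oplus>\<^bsub>M\<^esub>e\<in>Poly_Mapping.keys f. s_poly_act t lam M (Poly_Mapping.lookup f e) (cw e w x))
      = (\<Oplus>\<^bsub>M\<^esub>e\<in>Poly_Mapping.keys f. heval (b x) (Poly_Mapping.lookup f e) \<cdot> cw e w x)" by simp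
  also have "\<dots> = (\<Oplus>\<^bsub>M\<^esub>e\<in>X. heval (b x) (Poly_Mapping.lookup f e) \<cdot> cw e w x)"
    by (rule add.finprod_mono_neutral_cong_left) (use assms c in \<open>auto simp: in_keys_iff\<close>)
  finally show "(\<Oplus>\<^bsub>M\<^esub>e\<in>Poly_Mapping.keys f. s_poly_act t lam M (Poly_Mapping.lookup f e) (cw e w x))
      = (\<Oplus>\<^bsub>M\<^esub>e\<in>X. heval (b x) (Poly_Mapping.lookup f e) \<cdot> cw e w x)" .
qed

lemma H_act_single:
  assumes "w \<in> fam"
  shows "H_act t lam L b M (Poly_Mapping.single e f) w = (\<lambda>x\<in>L. heval (b x) f \<cdot> cw e w x)"
  using H_act_eq[OF assms, of "{e}" "Poly_Mapping.single e f"] fam_carrier[OF cw_fam[OF assms]]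
  by (auto intro!: restrict_ext)

lemma H_act_fam: "w \<in> fam \<Longrightarrow> H_act t lam L b M f w \<in> fam"
proof -
  assume w: "w \<in> fam"
  show ?thesis
    unfolding H_act_eq[OF w finite_keys order_refl]
  proof (rule famI)
    show "finite (\<Union>e\<in>Poly_Mapping.keys f. {x \<in> L. cw e w x \<noteq> \<zero>\<^bsub>M\<^esub>})"
      using fam_finite[OF cw_fam[OF w]] by auto
    fix x assume x: "x \<in> L"
    show "(\<Oplus>\<^bsub>M\<^esub>e\<in>Poly_Mapping.keys f. heval (b x) (Poly_Mapping.lookup f e) \<cdot> cw e w x) \<in> W (b x)"
      by (rule finsum_W) (use fam_W[OF cw_fam[OF w] x] in simp)
    assume "x \<notin> (\<Union>e\<in>Poly_Mapping.keys f. {x \<in> L. cw e w x \<noteq> \<zero>\<^bsub>M\<^esub>})"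
    then have "(\<Oplus>\<^bsub>M\<^esub>e\<in>Poly_Mapping.keys f. heval (b x) (Poly_Mapping.lookup f e) \<cdot> cw e w x)
        = (\<Oplus>\<^bsub>M\<^esub>e\<in>Poly_Mapping.keys f. \<zero>\<^bsub>M\<^esub>)" using x by (intro finsum_cong') auto
    then show "(\<Oplus>\<^bsub>M\<^esub>e\<in>Poly_Mapping.keys f. heval (b x) (Poly_Mapping.lookup f e) \<cdot> cw e w x) = \<zero>\<^bsub>M\<^esub>" by simp
  qed
qed

lemma H_act_add_left:
  assumes w: "w \<in> fam"
  shows "H_act t lam L b M (f + g) w = fadd (H_act t lam L b M f w) (H_act t lam L b M g w)"
proof -
  let ?X = "Poly_Mapping.keys f \<union> Poly_Mapping.keys g"
  have c: "x \<in> L \<Longrightarrow> cw e w x \<in> carrier M" for e x using fam_carrier[OF cw_fam[OF w]] .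
  have k: "Poly_Mapping.keys (f + g) \<subseteq> ?X" by (rule Poly_Mapping.keys_add)
  show ?thesis
    unfolding H_act_eq[OF w, of ?X f, simplified] H_act_eq[OF w, of ?X g, simplified] H_act_eq[OF w _ k, simplified] fadd_def
    by (rule restrict_ext)
      (use c in \<open>simp add: lookup_add heval_add act_add_left finsum_addf Pi_def\<close>)
qed

lemma c_act_add:
  assumes "w \<in> fam" "w' \<in> fam"
  shows "c_act t lam L b M z (fadd w w') = fadd (c_act t lam L b M z w) (c_act t lam L b M z w')"
proof (rule fam_ext)
  fix x assume x: "x \<in> L"
  show "c_act t lam L b M z (fadd w w') x = fadd (c_act t lam L b M z w) (c_act t lam L b M z w') x"
    unfolding fadd_apply[OF x]
    by (cases z) (use x fam_W[OF assms(1)] fam_W[OF assms(2)] in \<open>auto simp: c_act_eq tr_add b_diff\<close>)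
qed (intro c_act_fam fam_add assms)+

lemma cw_add:
  assumes "w \<in> fam" "w' \<in> fam"
  shows "cw e (fadd w w') = fadd (cw e w) (cw e w')"
proof -
  have "foldr (c_act t lam L b M) zs (fadd w w')
    = fadd (foldr (c_act t lam L b M) zs w) (foldr (c_act t lam L b M) zs w')" for zs
  proof (induction zs)
    case (Cons z zs)
    then show ?case using c_act_add[OF cw_fam[OF assms(1), of "Word zs"] cw_fam[OF assms(2), of "Word zs"]] by simp
  qed simp
  then show ?thesis .
qed

lemma heval_fam: "w \<in> fam \<Longrightarrow> fscale f w \<in> fam"
proof -
  assume w: "w \<in> fam"
  show ?thesis unfolding fscale_def by (rule famI[OF _ fam_finite[OF w]]) (use fam_W[OF w] in auto)
qed

lemma c_act_heval:
  assumes "w \<in> fam"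
  shows "c_act t lam L b M z (fscale f w) = fscale f (c_act t lam L b M z w)"
proof (rule fam_ext)
  fix x assume x: "x \<in> L"
  show "c_act t lam L b M z (fscale f w) x = fscale f (c_act t lam L b M z w) x"
    unfolding fscale_apply[OF x]
    by (cases z) (use x fam_W[OF assms] in \<open>auto simp: c_act_eq tr_heval b_diff\<close>)
qed (intro c_act_fam heval_fam assms)+

lemma cw_heval:
  assumes "w \<in> fam"
  shows "cw e (fscale f w) = fscale f (cw e w)"
proof -
  have "foldr (c_act t lam L b M) zs (fscale f w) = fscale f (foldr (c_act t lam L b M) zs w)" for zs
  proof (induction zs)
    case (Cons z zs)
    then show ?case using c_act_heval[OF cw_fam[OF assms, of "Word zs"]] by simp
  qed simp
  then show ?thesis .
qed

lemma H_act_add: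
  assumes w: "w \<in> fam" "w' \<in> fam"
  shows "H_act t lam L b M f (fadd w w') = fadd (H_act t lam L b M f w) (H_act t lam L b M f w')"
proof -
  have c: "x \<in> L \<Longrightarrow> cw e w x \<in> carrier M" "x \<in> L \<Longrightarrow> cw e w' x \<in> carrier M" for e x
    using fam_carrier[OF cw_fam] w by auto
  show ?thesis
  proof (rule fam_ext)
    fix x assume x: "x \<in> L"
    show "H_act t lam L b M f (fadd w w') x = fadd (H_act t lam L b M f w) (H_act t lam L b M f w') x"
      unfolding fadd_apply[OF x] H_act_eq[OF fam_add[OF w] finite_keys order_refl]
        H_act_eq[OF w(1) finite_keys order_refl] H_act_eq[OF w(2) finite_keys order_refl]
      using c x by (simp add: cw_add[OF w] act_add finsum_addf Pi_def)
  qed (intro H_act_fam fam_add w)+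
qed

lemma H_act_mult:
  assumes w: "w \<in> fam"
  shows "H_act t lam L b M (f * g) w = H_act t lam L b M f (H_act t lam L b M g w)"
proof (induction f rule: poly_mapping_induct_single)
  case (single e r)
  show ?case
  proof (induction g rule: poly_mapping_induct_single)
    case (single d s)
    have c: "x \<in> L \<Longrightarrow> cw d w x \<in> carrier M" "x \<in> L \<Longrightarrow> cw e (cw d w) x \<in> carrier M" for x
      using fam_carrier[OF cw_fam] w cw_fam by auto
    have e: "cw (e + d) w = cw e (cw d w)" by (simp add: plus_word_def)
    show ?case
      unfolding mult_single H_act_single[OF w] fscale_def[symmetric]
        H_act_single[OF heval_fam[OF cw_fam[OF w]]] e cw_heval[OF cw_fam[OF w]]
      unfolding fscale_def by (rule restrict_ext) (use c in \<open>simp add: heval_mult act_mult\<close>)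
  next
    case (add g1 g2)
    then show ?case using w by (simp add: distrib_left H_act_add_left H_act_add H_act_fam)
  qed
next
  case (add f1 f2)
  then show ?case using w by (simp add: distrib_right H_act_add_left H_act_fam)
qed

lemma H_act_one: "w \<in> fam \<Longrightarrow> H_act t lam L b M 1 w = w"
proof -
  assume w: "w \<in> fam"
  have "H_act t lam L b M (Poly_Mapping.single 0 1) w = (\<lambda>x\<in>L. w x)"
    unfolding H_act_single[OF w] by (rule restrict_ext) (use fam_carrier[OF w] in \<open>simp add: zero_word_def\<close>)
  also have "\<dots> = w" by (rule PiE_restrict[of _ _ "\<lambda>x. W (b x)"]) (use w in \<open>simp add: fam_def\<close>)
  finally show ?thesis by simp
qed

lemma ring_act_fam: "ring_act fam_mod UNIV (H_act t lam L b M)"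
proof -
  interpret abelian_group fam_mod by (rule abelian_group_fam)
  show ?thesis
    by unfold_locales
      (auto simp: fam_mod_def H_act_fam H_act_add_left H_act_add H_act_mult H_act_one)
qed

lemma H_act_scal: "w \<in> fam \<Longrightarrow> H_act t lam L b M (H_scal f) w = fscale f w"
  unfolding H_scal_def fscale_def by (subst H_act_single) (auto simp: zero_word_def)

lemma H_act_gen: "w \<in> fam \<Longrightarrow> H_act t lam L b M (gen z) w = c_act t lam L b M z w"
proof -
  assume w: "w \<in> fam"
  have "H_act t lam L b M (gen z) w = (\<lambda>x\<in>L. c_act t lam L b M z w x)"
    unfolding gen_def H_act_single[OF w] by (rule restrict_ext) (use fam_carrier[OF c_act_fam[OF w]] in simp)
  also have "\<dots> = c_act t lam L b M z w" by (rule PiE_restrict[of _ _ "\<lambda>x. W (b x)"]) (use c_act_fam[OF w, of z] in \<open>simp add: fam_def\<close>)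
  finally show ?thesis .
qed

text \<open>On weight vectors the torus relation of \<open>H\<close> is a moment map relation of \<open>A\<^sup>\<lambda>\<close>, and the composition
  law of the \<open>c\<^sub>x\<^sub>,\<^sub>y\<close> is \<open>tr_tr\<close> at the base points.\<close>

lemma H_act_rels:
  assumes "g \<in> H_rels t L" and w: "w \<in> fam" shows "H_act t lam L b M g w = (\<lambda>x\<in>L. \<zero>\<^bsub>M\<^esub>)"
proof -
  interpret F: ring_act fam_mod UNIV "H_act t lam L b M" by (rule ring_act_fam)
  have wc: "w \<in> carrier fam_mod" using w by (simp add: fam_mod_def)
  have zero: "\<zero>\<^bsub>fam_mod\<^esub> = (\<lambda>x\<in>L. \<zero>\<^bsub>M\<^esub>)" by (simp add: fam_mod_def)
  from assms(1) show ?thesis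
  proof (cases rule: H_rels_cases)
    case (torus x)
    have "heval (b y) (\<Sum>i\<in>UNIV. of_int (x $ i) * s_var i) \<cdot> w y = \<zero>\<^bsub>M\<^esub>" if y: "y \<in> L" for y
    proof -
      have "lam x = (\<Sum>i\<in>UNIV. x $ i * b y $ i)"
        using b_fiber[OF y] torus(2) by (auto simp: lattice_fiber_def pairing_def mult.commute)
      then have "heval (b y) (\<Sum>i\<in>UNIV. of_int (x $ i) * s_var i)
          = (\<Sum>i\<in>UNIV. of_int (x $ i) * hplus i) - (of_int (lam x) :: ('n, 'k) weyl)"
        by (simp add: heval_sum heval_mult hdiff_def right_diff_distrib sum_subtractf)
      also have "\<dots> \<in> A_rels t lam" using torus(2) by (auto simp: A_rels_def)
      finally show ?thesis using A_rels_act fam_carrier[OF w y] by blast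
    qed
    then show ?thesis unfolding torus(1) H_act_scal[OF w] fscale_def by (intro restrict_ext)
  next
    case (comp x y u)
    have "H_act t lam L b M (gen (x, y) * gen (y, u)) w = H_act t lam L b M (H_scal (s_monom (eta x y u)) * gen (x, u)) w"
      unfolding H_act_mult[OF w] H_act_gen[OF w] H_act_gen[OF c_act_fam[OF w]] H_act_scal[OF c_act_fam[OF w]]
      using tr_tr[OF fam_W[OF w comp(4)] b_diff[OF comp(3,4)] b_diff[OF comp(2,3)]] comp fam_carrier[OF w]
      by (auto simp: fscale_def c_act_eq alcove_of_b intro!: restrict_ext)
    then show ?thesis
      using F.act_diff[OF UNIV_I UNIV_I wc, of "gen (x, y) * gen (y, u)" "H_scal (s_monom (eta x y u)) * gen (x, u)"]
        F.act_closed[OF UNIV_I wc] by (simp add: comp(1) zero F.r_neg a_minus_def)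
  next
    case (orth x y y' u)
    have "tr (b x) (b y) \<zero>\<^bsub>M\<^esub> = \<zero>\<^bsub>M\<^esub>"
      using tr_add[OF b_diff[OF orth(2,3)] zero_W zero_W] W_carrier[OF tr_W[OF b_diff[OF orth(2,3)] zero_W]]
      by (intro eq_zero_if_add_self) auto
    then show ?thesis
      unfolding orth(1) H_act_mult[OF w] H_act_gen[OF w] H_act_gen[OF c_act_fam[OF w]]
      using orth by (auto simp: c_act_eq intro!: restrict_ext)
  next
    case (outside x y)
    then show ?thesis unfolding outside(1) H_act_gen[OF w] by (auto simp: c_act_eq intro!: restrict_ext)
  qed
qed

subsection \<open>The module \<open>\<Oplus>\<^sub>x Hom(P\<^sub>x, M)\<close>\<close>

abbreviation FM where "FM \<equiv> Hom_sum_module t lam L b M"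

abbreviation ev where "ev \<equiv> eval_one t lam L b :: (int ^ 'n \<Rightarrow> ('n, 'k) Qelt \<Rightarrow> 'v) \<Rightarrow> int ^ 'n \<Rightarrow> 'v"

lemma HomQ_restrict: "\<phi> \<in> HomQ a \<Longrightarrow> restrict \<phi> (carrier (Q a)) = \<phi>"
  by (rule PiE_restrict[of _ _ "\<lambda>_. carrier M"]) (simp add: Hom_Q_def linear_maps_def)

lemma zero_HomQ: "(\<lambda>q\<in>carrier (Q a). \<zero>\<^bsub>M\<^esub>) \<in> HomQ a"
proof -
  have "Q_map a \<zero>\<^bsub>M\<^esub> q = \<zero>\<^bsub>M\<^esub>" if q: "q \<in> carrier (Q a)" for q
  proof -
    obtain N where N: "\<And>q u. q \<in> carrier (Q a) \<Longrightarrow> u \<in> S \<Longrightarrow> q N = Q_coset a N u \<Longrightarrow> Q_map a \<zero>\<^bsub>M\<^esub> q = u \<cdot> \<zero>\<^bsub>M\<^esub>"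
      using Q_map_obtain[OF zero_W] by metis
    then show ?thesis using Q_rep[OF q, of N] q by auto
  qed
  then have "restrict (Q_map a \<zero>\<^bsub>M\<^esub>) (carrier (Q a)) = (\<lambda>q\<in>carrier (Q a). \<zero>\<^bsub>M\<^esub>)" by (rule restrict_ext)
  moreover have h: "Q_map a \<zero>\<^bsub>M\<^esub> \<in> HomQ a" by (rule Q_map_HomQ(1)[OF zero_W])
  ultimately have "(\<lambda>q\<in>carrier (Q a). \<zero>\<^bsub>M\<^esub>) = Q_map a \<zero>\<^bsub>M\<^esub>" by (simp only: HomQ_restrict)
  then show ?thesis using h by (simp only:)
qed

lemma HomQ_nonzero_iff: "\<phi> \<in> HomQ a \<Longrightarrow> (\<exists>q\<in>carrier (Q a). \<phi> q \<noteq> \<zero>\<^bsub>M\<^esub>) \<longleftrightarrow> \<phi> (Q_one t lam a) \<noteq> \<zero>\<^bsub>M\<^esub>"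
proof
  assume \<phi>: "\<phi> \<in> HomQ a" and ex: "\<exists>q\<in>carrier (Q a). \<phi> q \<noteq> \<zero>\<^bsub>M\<^esub>"
  show "\<phi> (Q_one t lam a) \<noteq> \<zero>\<^bsub>M\<^esub>"
  proof
    assume "\<phi> (Q_one t lam a) = \<zero>\<^bsub>M\<^esub>"
    then have "\<phi> = (\<lambda>q\<in>carrier (Q a). \<zero>\<^bsub>M\<^esub>)"
      by (intro HomQ_inj[OF \<phi> zero_HomQ]) (simp add: Q_one_carrier)
    then show False using ex by auto
  qed
qed (use Q_one_carrier in blast)

lemma ev_fam: "\<Phi> \<in> Hom_sum t lam L b M \<Longrightarrow> ev \<Phi> \<in> fam"
proof -
  assume \<Phi>: "\<Phi> \<in> Hom_sum t lam L b M"
  then have h: "\<And>x. x \<in> L \<Longrightarrow> \<Phi> x \<in> HomQ (b x)" by (auto simp: Hom_sum_def)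
  have "{x \<in> L. \<exists>q\<in>carrier (Q (b x)). \<Phi> x q \<noteq> \<zero>\<^bsub>M\<^esub>} = {x \<in> L. \<Phi> x (Q_one t lam (b x)) \<noteq> \<zero>\<^bsub>M\<^esub>}"
    using HomQ_nonzero_iff[OF h] by blast
  then have fin: "finite {x \<in> L. \<Phi> x (Q_one t lam (b x)) \<noteq> \<zero>\<^bsub>M\<^esub>}" using \<Phi> by (simp add: Hom_sum_def)
  show ?thesis unfolding eval_one_def by (rule famI[OF _ fin]) (use HomQ_one_W[OF h] in auto)
qed

lemma ev_bij: "bij_betw ev (Hom_sum t lam L b M) fam"
proof (rule bij_betwI[where g = "\<lambda>w. \<lambda>x\<in>L. Q_map (b x) (w x)"])
  show "ev \<in> Hom_sum t lam L b M \<rightarrow> fam" using ev_fam by auto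
  have inv: "(\<lambda>x\<in>L. Q_map (b x) (w x)) \<in> Hom_sum t lam L b M" if w: "w \<in> fam" for w
  proof -
    have h: "\<And>x. x \<in> L \<Longrightarrow> Q_map (b x) (w x) \<in> HomQ (b x)" using Q_map_HomQ(1)[OF fam_W[OF w]] .
    have "{x \<in> L. \<exists>q\<in>carrier (Q (b x)). (\<lambda>x\<in>L. Q_map (b x) (w x)) x q \<noteq> \<zero>\<^bsub>M\<^esub>} = {x \<in> L. w x \<noteq> \<zero>\<^bsub>M\<^esub>}"
      using HomQ_nonzero_iff[OF h] Q_map_HomQ(2)[OF fam_W[OF w]] by auto
    then show ?thesis using h fam_finite[OF w] by (auto simp: Hom_sum_def)
  qed
  then show "(\<lambda>w. \<lambda>x\<in>L. Q_map (b x) (w x)) \<in> fam \<rightarrow> Hom_sum t lam L b M" by auto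
  show "ev (\<lambda>x\<in>L. Q_map (b x) (w x)) = w" if w: "w \<in> fam" for w
    by (rule fam_ext[OF ev_fam[OF inv[OF w]] w]) (simp add: eval_one_def Q_map_HomQ(2)[OF fam_W[OF w]])
  show "(\<lambda>x\<in>L. Q_map (b x) (ev \<Phi> x)) = \<Phi>" if \<Phi>: "\<Phi> \<in> Hom_sum t lam L b M" for \<Phi>
  proof -
    have \<Phi>': "\<Phi> \<in> (\<Pi>\<^sub>E x\<in>L. HomQ (b x))" using \<Phi> by (simp add: Hom_sum_def)
    have "Q_map (b x) (ev \<Phi> x) = \<Phi> x" if x: "x \<in> L" for x
    proof -
      have h: "\<Phi> x \<in> HomQ (b x)" using \<Phi>' x by auto
      note w = HomQ_one_W[OF h]
      have "Q_map (b x) (\<Phi> x (Q_one t lam (b x))) = \<Phi> x"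
        by (rule HomQ_inj[OF Q_map_HomQ(1)[OF w] h Q_map_HomQ(2)[OF w]])
      then show ?thesis using x by (simp add: eval_one_def)
    qed
    then have "(\<lambda>x\<in>L. Q_map (b x) (ev \<Phi> x)) = restrict \<Phi> L" by (intro restrict_ext)
    also have "\<dots> = \<Phi>" using \<Phi>' by (rule PiE_restrict)
    finally show ?thesis .
  qed
qed

lemma HomQ_add:
  assumes "\<phi> \<in> HomQ a" "\<psi> \<in> HomQ a" shows "(\<lambda>q\<in>carrier (Q a). \<phi> q \<oplus>\<^bsub>M\<^esub> \<psi> q) \<in> HomQ a"
proof -
  let ?v = "\<phi> (Q_one t lam a)" and ?w = "\<psi> (Q_one t lam a)"
  have vw: "?v \<in> W a" "?w \<in> W a" using assms HomQ_one_W by auto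
  have "Q_map a (?v \<oplus>\<^bsub>M\<^esub> ?w) q = \<phi> q \<oplus>\<^bsub>M\<^esub> \<psi> q" if q: "q \<in> carrier (Q a)" for q
  proof -
    obtain N where N: "\<And>u k. N \<le> k \<Longrightarrow> u \<in> S \<Longrightarrow> q k = Q_coset a k u \<Longrightarrow> \<phi> q = u \<cdot> ?v"
      using HomQ_eval[OF assms(1) q] by blast
    obtain N' where N': "\<And>u k. N' \<le> k \<Longrightarrow> u \<in> S \<Longrightarrow> q k = Q_coset a k u \<Longrightarrow> \<psi> q = u \<cdot> ?w"
      using HomQ_eval[OF assms(2) q] by blast
    obtain N'' where N'': "\<And>u k. N'' \<le> k \<Longrightarrow> u \<in> S \<Longrightarrow> q k = Q_coset a k u \<Longrightarrow>
        Q_map a (?v \<oplus>\<^bsub>M\<^esub> ?w) q = u \<cdot> Q_map a (?v \<oplus>\<^bsub>M\<^esub> ?w) (Q_one t lam a)"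
      using HomQ_eval[OF Q_map_HomQ(1)[OF add_W[OF vw]] q] by blast
    let ?k = "max N (max N' N'')"
    obtain u where "u \<in> S" "q ?k = Q_coset a ?k u" using Q_rep[OF q] by blast
    then show ?thesis using N[of ?k u] N'[of ?k u] N''[of ?k u] vw W_carrier
      by (simp add: Q_map_HomQ(2)[OF add_W[OF vw]] act_add)
  qed
  then have "restrict (Q_map a (?v \<oplus>\<^bsub>M\<^esub> ?w)) (carrier (Q a)) = (\<lambda>q\<in>carrier (Q a). \<phi> q \<oplus>\<^bsub>M\<^esub> \<psi> q)"
    by (rule restrict_ext)
  then show ?thesis using Q_map_HomQ(1)[OF add_W[OF vw]] HomQ_restrict[OF Q_map_HomQ(1)[OF add_W[OF vw]]] by simp
qed

lemma FM_simps:
  "carrier FM = Hom_sum t lam L b M"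
  "\<zero>\<^bsub>FM\<^esub> = (\<lambda>x\<in>L. \<lambda>q\<in>carrier (Q (b x)). \<zero>\<^bsub>M\<^esub>)"
  "\<Phi> \<oplus>\<^bsub>FM\<^esub> \<Psi> = (\<lambda>x\<in>L. \<lambda>q\<in>carrier (Q (b x)). \<Phi> x q \<oplus>\<^bsub>M\<^esub> \<Psi> x q)"
  "h \<odot>\<^bsub>FM\<^esub> \<Phi> = the_inv_into (Hom_sum t lam L b M) ev (H_act t lam L b M (SOME f. f \<in> h) (ev \<Phi>))"
  by (simp_all add: Hom_sum_module_def)

lemma ev_zero: "ev \<zero>\<^bsub>FM\<^esub> = (\<lambda>x\<in>L. \<zero>\<^bsub>M\<^esub>)"
  by (auto simp: FM_simps eval_one_def Q_one_carrier intro!: restrict_ext)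

lemma ev_add: "ev (\<Phi> \<oplus>\<^bsub>FM\<^esub> \<Psi>) = fadd (ev \<Phi>) (ev \<Psi>)"
  by (auto simp: fadd_def FM_simps eval_one_def Q_one_carrier intro!: restrict_ext)

lemma FM_zero_closed: "\<zero>\<^bsub>FM\<^esub> \<in> Hom_sum t lam L b M"
  by (auto simp: FM_simps Hom_sum_def zero_HomQ cong: conj_cong)

lemma FM_add_closed:
  assumes "\<Phi> \<in> Hom_sum t lam L b M" "\<Psi> \<in> Hom_sum t lam L b M"
  shows "\<Phi> \<oplus>\<^bsub>FM\<^esub> \<Psi> \<in> Hom_sum t lam L b M"
proof -
  let ?s = "\<lambda>\<Phi>. {x \<in> L. \<exists>q\<in>carrier (Q (b x)). \<Phi> x q \<noteq> \<zero>\<^bsub>M\<^esub>}"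
  have "?s (\<Phi> \<oplus>\<^bsub>FM\<^esub> \<Psi>) \<subseteq> ?s \<Phi> \<union> ?s \<Psi>"
  proof
    fix x assume "x \<in> ?s (\<Phi> \<oplus>\<^bsub>FM\<^esub> \<Psi>)"
    then show "x \<in> ?s \<Phi> \<union> ?s \<Psi>" by (intro ccontr[of "x \<in> _"]) (auto simp: FM_simps)
  qed
  moreover have "finite (?s \<Phi> \<union> ?s \<Psi>)" using assms by (simp add: Hom_sum_def)
  ultimately have "finite (?s (\<Phi> \<oplus>\<^bsub>FM\<^esub> \<Psi>))" by (rule finite_subset)
  moreover have "\<Phi> \<oplus>\<^bsub>FM\<^esub> \<Psi> \<in> (\<Pi>\<^sub>E x\<in>L. HomQ (b x))"
    using assms by (auto simp: FM_simps Hom_sum_def intro!: HomQ_add)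
  ultimately show ?thesis by (simp add: Hom_sum_def)
qed

lemma FM_module: "left_module (H_alg t L) FM"
  and ev_smult: "\<Phi> \<in> Hom_sum t lam L b M \<Longrightarrow> ev (H_cls t L f \<odot>\<^bsub>FM\<^esub> \<Phi>) = H_act t lam L b M f (ev \<Phi>)"
proof -
  let ?act = "\<lambda>u v. the_inv_into (carrier FM) ev (H_act t lam L b M u (ev v))"
  have inj: "inj_on ev (Hom_sum t lam L b M)" and im: "ev ` Hom_sum t lam L b M = fam"
    using ev_bij by (auto simp: bij_betw_def)
  have ra: "ring_act FM UNIV ?act"
  proof (rule ring_act_transport[OF ring_act_fam])
    show "bij_betw ev (carrier FM) (carrier fam_mod)" using ev_bij by (simp add: FM_simps(1) fam_mod_def)
  qed (use FM_zero_closed FM_add_closed in \<open>simp_all add: FM_simps(1) ev_zero ev_add, simp_all add: fam_mod_def\<close>)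
  have kills: "?act g \<Phi> = \<zero>\<^bsub>FM\<^esub>" if "g \<in> H_rels t L" "\<Phi> \<in> carrier FM" for g \<Phi>
    using H_act_rels[OF that(1) ev_fam] that(2) the_inv_into_f_f[OF inj FM_zero_closed]
    by (simp add: FM_simps(1) ev_zero)
  have sm: "h \<odot>\<^bsub>FM\<^esub> \<Phi> = ?act (SOME f. f \<in> h) \<Phi>" for h \<Phi> by (simp add: FM_simps)
  show "left_module (H_alg t L) FM"
    unfolding H_alg_qring by (rule class_quotient.act_left_module(1)[OF class_quotient_H ra kills sm])
  show "ev (H_cls t L f \<odot>\<^bsub>FM\<^esub> \<Phi>) = H_act t lam L b M f (ev \<Phi>)" if \<Phi>: "\<Phi> \<in> Hom_sum t lam L b M"
  proof -
    have "H_cls t L f \<odot>\<^bsub>FM\<^esub> \<Phi> = ?act f \<Phi>"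
      unfolding H_cls_qcls
      by (rule class_quotient.act_left_module(2)[OF class_quotient_H ra kills sm UNIV_I])
        (use \<Phi> in \<open>simp_all add: FM_simps(1)\<close>)
    then show ?thesis
      using f_the_inv_into_f[OF inj] im H_act_fam[OF ev_fam[OF \<Phi>]] by (simp add: FM_simps(1))
  qed
qed

end

section \<open>Objects are finite-dimensional\<close>

text \<open>No cancellation takes place in \<open>x + y\<close>, which makes \<open>m(x + y)\<close> the product of \<open>m(x)\<close> and \<open>m(y)\<close>.\<close>

definition conformal :: "int ^ 'n \<Rightarrow> int ^ 'n \<Rightarrow> bool" where
  "conformal x y \<longleftrightarrow> (\<forall>i. 0 \<le> x $ i * y $ i)"

lemma m_factor_add:
  assumes "0 \<le> k * l" shows "m_factor i (k + l) = (m_factor i k * m_factor i l :: ('n, 'k::field) weyl)"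
proof (cases "0 \<le> k \<and> 0 \<le> l")
  case True
  then show ?thesis by (simp add: m_factor_def nat_add_distrib power_add)
next
  case False
  then have "k \<le> 0" "l \<le> 0" using assms by (auto simp: zero_le_mult_iff)
  then have "nat (- (k + l)) = nat (- k) + nat (- l)" "nat (k + l) = 0" "nat k = 0" "nat l = 0" by auto
  then show ?thesis unfolding m_factor_def by (simp only: power_add power_0 mult_1_left)
qed

lemma m_elt_conformal:
  assumes "conformal x y" shows "m_elt (x + y) = (m_elt x * m_elt y :: ('n::finite, 'k::field) weyl)"
proof -
  have f: "m_factor i (x $ i + y $ i) = (m_factor i (x $ i) * m_factor i (y $ i) :: ('n, 'k) weyl)" for i
    using assms by (intro m_factor_add) (simp add: conformal_def)
  have g: "m_factor i (x $ i + y $ i) = (m_factor i (y $ i) * m_factor i (x $ i) :: ('n, 'k) weyl)" for i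
    using m_factor_add[of "y $ i" "x $ i" i] assms by (simp add: conformal_def mult.commute add.commute)
  have "(\<Prod>i\<leftarrow>coords. m_factor i (x $ i) * m_factor i (y $ i))
      = (\<Prod>i\<leftarrow>coords. m_factor i (x $ i)) * (\<Prod>i\<leftarrow>coords. m_factor i (y $ i) :: ('n, 'k) weyl)"
  proof (rule prod_list_mult_commuting)
    show "m_factor i (x $ i) * m_factor j (y $ j) = (m_factor j (y $ j) * m_factor i (x $ i) :: ('n, 'k) weyl)" for i j
    proof (cases "i = j")
      case True
      then show ?thesis using f[of i] g[of i] by metis
    next
      case False
      then show ?thesis by (rule m_factor_commute)
    qed
  qed
  then show ?thesis by (simp add: m_elt_eq_prod f)
qed

lemma m_elt_power: "m_elt c ^ N = (m_elt (int N *s c) :: ('n::finite, 'k::field) weyl)"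
proof (induction N)
  case (Suc N)
  have "conformal c (int N *s c)" by (auto simp: conformal_def zero_le_mult_iff mult_le_0_iff)
  from m_elt_conformal[OF this] have "m_elt (c + int N *s c) = (m_elt c * m_elt (int N *s c) :: ('n, 'k) weyl)" .
  moreover have "c + int N *s c = int (Suc N) *s c" by (simp add: vec_eq_iff algebra_simps)
  ultimately show ?case using Suc by simp
next
  case 0
  have "int 0 *s c = 0" by (simp add: vec_eq_iff)
  then show ?case by simp
qed

subsection \<open>A Dickson-type lemma\<close>

lemma nat_incseq_subseq: "\<exists>r. strict_mono r \<and> incseq (\<lambda>k. (f :: nat \<Rightarrow> nat) (r k))"
proof -
  obtain r where r: "strict_mono r" "monoseq (\<lambda>k. f (r k))" using seq_monosub[of f] by (auto simp: comp_def)
  show ?thesis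
  proof (cases "incseq (\<lambda>k. f (r k))")
    case False
    then have d: "decseq (\<lambda>k. f (r k))" using r(2) by (simp add: monoseq_iff)
    \<comment> \<open>A decreasing sequence of natural numbers is constant once it has reached its minimum.\<close>
    define m where "m = (LEAST v. \<exists>k. v = f (r k))"
    have "\<exists>k. m = f (r k)" unfolding m_def by (rule LeastI_ex) auto
    then obtain k0 where k0: "m = f (r k0)" by blast
    have "f (r (k + k0)) = m" for k
    proof (rule antisym)
      show "f (r (k + k0)) \<le> m" using d k0 by (auto simp: decseq_def)
      show "m \<le> f (r (k + k0))" unfolding m_def by (rule Least_le) auto
    qed
    then have "incseq (\<lambda>k. f (r (k + k0)))" by (simp add: incseq_def)
    moreover have "strict_mono (\<lambda>k. r (k + k0))" using r(1) by (auto simp: strict_mono_def)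
    ultimately show ?thesis by (intro exI[of _ "\<lambda>k. r (k + k0)"]) simp
  qed (use r in blast)
qed

lemma dickson_subseq:
  assumes "finite I" shows "\<exists>r. strict_mono r \<and> (\<forall>i\<in>I. incseq (\<lambda>k. (f :: nat \<Rightarrow> 'i \<Rightarrow> nat) (r k) i))"
  using assms
proof (induction I)
  case empty
  show ?case by (intro exI[of _ id]) (simp add: strict_mono_def)
next
  case (insert j I)
  then obtain r where r: "strict_mono r" "\<forall>i\<in>I. incseq (\<lambda>k. f (r k) i)" by blast
  obtain s where s: "strict_mono s" "incseq (\<lambda>k. f (r (s k)) j)"
    using nat_incseq_subseq[of "\<lambda>k. f (r k) j"] by blast
  have "incseq (\<lambda>k. f (r (s k)) i)" if "i \<in> I" for i
    unfolding incseq_def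
  proof (intro allI impI)
    fix m n :: nat assume "m \<le> n"
    then have "s m \<le> s n" using s(1) by (simp add: strict_mono_less_eq)
    then show "f (r (s m)) i \<le> f (r (s n)) i" using r(2) that by (simp add: incseq_def)
  qed
  moreover have "strict_mono (\<lambda>k. r (s k))" using r(1) s(1) by (simp add: strict_mono_def)
  ultimately show ?case using s(2) by (intro exI[of _ "\<lambda>k. r (s k)"]) auto
qed

text \<open>Positive and negative parts embed \<open>B\<close> into \<open>\<nat>\<^sup>2\<^sup>n\<close>, where Dickson's lemma yields an infinite increasing
  sequence. From some index on, every coordinate of the sequence is constant or unbounded, so the
  difference of two consecutive terms can be added any number of times while staying below a later
  term.\<close>

lemma conformal_growth:
  fixes B :: "(int ^ 'n::finite) set"
  assumes "infinite B"
  obtains x y where "x \<in> B" "y \<in> B" "x \<noteq> y" "conformal x (y - x)"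
    "\<And>m. \<exists>z\<in>B. conformal (int m *s (y - x) + x) (z - (int m *s (y - x) + x))"
proof -
  obtain e :: "nat \<Rightarrow> int ^ 'n" where e: "inj e" "range e \<subseteq> B" using infinite_countable_subset[OF assms] by blast
  \<comment> \<open>Index \<open>(i, True)\<close> is the positive part of coordinate \<open>i\<close>, and \<open>(i, False)\<close> the negative part.\<close>
  define f where "f k i = (if snd i then nat (e k $ fst i) else nat (- e k $ fst i))" for k and i :: "'n \<times> bool"
  obtain r where r: "strict_mono r" "\<And>i. incseq (\<lambda>k. f (r k) i)"
    using dickson_subseq[of "UNIV :: ('n \<times> bool) set" f] by auto
  define g where "g k i = f (r k) i" for k i
  have mono: "k \<le> l \<Longrightarrow> g k i \<le> g l i" for k l i using r(2) by (simp add: g_def incseq_def)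
  have eg: "e (r k) $ i = int (g k (i, True)) - int (g k (i, False))" for k i by (simp add: g_def f_def)
  have disj: "g k (i, True) = 0 \<or> g k (i, False) = 0" for k i by (auto simp: g_def f_def)
  have "\<exists>K. \<forall>i. (\<forall>k\<ge>K. g k i = g K i) \<or> (\<forall>m. \<exists>k. g k i \<ge> m)"
  proof -
    have "\<exists>K. (\<forall>k\<ge>K. g k i = g K i) \<or> (\<forall>m. \<exists>k. g k i \<ge> m)" for i
    proof (cases "\<forall>m. \<exists>k. g k i \<ge> m")
      case False
      then obtain m where m: "\<And>k. g k i < m" by (meson not_le)
      define M where "M = Max (range (\<lambda>k. g k i))"
      have fin: "finite (range (\<lambda>k. g k i))" by (rule finite_subset[of _ "{..<m}"]) (use m in auto)
      have "M \<in> range (\<lambda>k. g k i)" unfolding M_def by (rule Max_in) (use fin in auto)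
      then obtain K where "M = g K i" by blast
      moreover have "g k i \<le> M" for k unfolding M_def using fin by simp
      ultimately have le: "g k i \<le> g K i" for k by simp
      have "g k i = g K i" if "k \<ge> K" for k by (rule antisym[OF le mono[OF that]])
      then show ?thesis by blast
    qed blast
    then obtain K where K: "\<And>i. (\<forall>k\<ge>K i. g k i = g (K i) i) \<or> (\<forall>m. \<exists>k. g k i \<ge> m)" by metis
    have "(\<forall>k\<ge>Max (range K). g k i = g (Max (range K)) i) \<or> (\<forall>m. \<exists>k. g k i \<ge> m)" for i
    proof -
      have "K i \<le> Max (range K)" by simp
      from K[of i] show ?thesis
      proof
        assume c: "\<forall>k\<ge>K i. g k i = g (K i) i"
        have "g k i = g (Max (range K)) i" if "k \<ge> Max (range K)" for k
          using c \<open>K i \<le> _\<close> order_trans[OF \<open>K i \<le> _\<close> that] by metis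
        then show ?thesis by blast
      qed (rule disjI2)
    qed
    then show ?thesis by blast
  qed
  then obtain K where K: "\<And>i. (\<forall>k\<ge>K. g k i = g K i) \<or> (\<forall>m. \<exists>k. g k i \<ge> m)" by blast
  let ?x = "e (r K)" and ?y = "e (r (Suc K))"
  have xB: "?x \<in> B" "?y \<in> B" using e(2) by auto
  have "r K \<noteq> r (Suc K)" using r(1) by (simp add: strict_mono_eq)
  then have ne: "?x \<noteq> ?y" using e(1) by (simp add: inj_eq)
  have cf: "conformal u v"
    if "\<And>i. u $ i > 0 \<Longrightarrow> v $ i \<ge> 0" "\<And>i. u $ i < 0 \<Longrightarrow> v $ i \<le> 0" for u v :: "int ^ 'n"
    unfolding conformal_def
  proof
    fix i
    consider "u $ i > 0" | "u $ i < 0" | "u $ i = 0" by linarith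
    then show "0 \<le> u $ i * v $ i"
    proof cases
      case 1
      then show ?thesis using that(1)[OF 1] by simp
    next
      case 2
      then show ?thesis using that(2)[OF 2] by (simp add: mult_nonpos_nonpos)
    qed simp
  qed
  have c1: "conformal ?x (?y - ?x)"
  proof (rule cf)
    fix i
    have m: "g K (i, True) \<le> g (Suc K) (i, True)" "g K (i, False) \<le> g (Suc K) (i, False)" by (auto intro: mono)
    show "(?y - ?x) $ i \<ge> 0" if "?x $ i > 0"
      using m disj[of K i] disj[of "Suc K" i] that unfolding vector_minus_component eg by linarith
    show "(?y - ?x) $ i \<le> 0" if "?x $ i < 0"
      using m disj[of K i] disj[of "Suc K" i] that unfolding vector_minus_component eg by linarith
  qed
  have "\<exists>z\<in>B. conformal (int m *s (?y - ?x) + ?x) (z - (int m *s (?y - ?x) + ?x))" for m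
  proof -
    have "\<exists>k. \<forall>l\<ge>k. g K i + m * (g (Suc K) i - g K i) \<le> g l i" for i
    proof (cases "\<forall>k\<ge>K. g k i = g K i")
      case True
      have "g K i + m * (g (Suc K) i - g K i) \<le> g l i" if "K \<le> l" for l
        unfolding True[rule_format, OF that] True[rule_format, of "Suc K", simplified] by simp
      then show ?thesis by (intro exI[of _ K] allI impI)
    next
      case False
      then obtain k where "g K i + m * (g (Suc K) i - g K i) \<le> g k i" using K[of i] by blast
      then have "g K i + m * (g (Suc K) i - g K i) \<le> g l i" if "k \<le> l" for l
        using mono[OF that, of i] by (rule order_trans)
      then show ?thesis by (intro exI[of _ k] allI impI)
    qed
    then obtain k where k: "\<And>i l. l \<ge> k i \<Longrightarrow> g K i + m * (g (Suc K) i - g K i) \<le> g l i" by metis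
    define l where "l = Max (insert (Suc K) (range k))"
    have l: "g K i + m * (g (Suc K) i - g K i) \<le> g l i" for i
    by (rule k, unfold l_def, rule Max_ge) auto
    have lK: "Suc K \<le> l" by (simp add: l_def)
    have "conformal (int m *s (?y - ?x) + ?x) (e (r l) - (int m *s (?y - ?x) + ?x))"
    proof (rule cf)
      fix i
      let ?w = "int m *s (?y - ?x) + ?x"
      have m: "g K (i, s) \<le> g (Suc K) (i, s)" "g (Suc K) (i, s) \<le> g l (i, s)" for s using lK by (auto intro: mono)
      have bound: "int (g K (i, s)) + int m * (int (g (Suc K) (i, s)) - int (g K (i, s))) \<le> int (g l (i, s))" for s
      proof -
        have "int (g K (i, s) + m * (g (Suc K) (i, s) - g K (i, s))) \<le> int (g l (i, s))"
          using l[of "(i, s)"] by (simp only: of_nat_le_iff)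
        then show ?thesis by (simp only: of_nat_add of_nat_mult of_nat_diff[OF m(1)])
      qed
      have w: "?w $ i = (int (g K (i, True)) + int m * (int (g (Suc K) (i, True)) - int (g K (i, True))))
          - (int (g K (i, False)) + int m * (int (g (Suc K) (i, False)) - int (g K (i, False))))"
        unfolding vector_add_component vector_smult_component vector_minus_component eg
        by (simp only: right_diff_distrib)
      have nn: "0 \<le> int m * (int (g (Suc K) (i, s)) - int (g K (i, s)))" for s using m(1)[of s] by simp
      show "(e (r l) - ?w) $ i \<ge> 0" if "?w $ i > 0"
      proof (cases "g l (i, False) = 0")
        case True
        then have "g K (i, False) = 0" "g (Suc K) (i, False) = 0" using m[of False] by auto
        then show ?thesis using bound[of True] w True by (simp add: eg)
      next
        case False
        then have "g l (i, True) = 0" using disj[of l i] by simp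
        then have "g K (i, True) = 0" "g (Suc K) (i, True) = 0" using m[of True] by auto
        then have False using that w nn[of False] by simp
        then show ?thesis ..
      qed
      show "(e (r l) - ?w) $ i \<le> 0" if "?w $ i < 0"
      proof (cases "g l (i, True) = 0")
        case True
        then have "g K (i, True) = 0" "g (Suc K) (i, True) = 0" using m[of True] by auto
        then show ?thesis using bound[of False] w True by (simp add: eg)
      next
        case False
        then have "g l (i, False) = 0" using disj[of l i] by simp
        then have "g K (i, False) = 0" "g (Suc K) (i, False) = 0" using m[of False] by auto
        then have False using that w nn[of True] by simp
        then show ?thesis ..
      qed
    qed
    moreover have "e (r l) \<in> B" using e(2) by blast
    ultimately show ?thesis by (rule bexI)
  qed
  then show ?thesis by (rule that[OF xB ne c1])
qed

lemma finite_vec_box: "(\<And>i. finite (A i)) \<Longrightarrow> finite {x :: 'a ^ 'n::finite. \<forall>i. x $ i \<in> A i}"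
proof -
  assume "\<And>i. finite (A i)"
  then have "finite (Pi\<^sub>E UNIV A)" by (intro finite_PiE) auto
  moreover have "{x :: 'a ^ 'n. \<forall>i. x $ i \<in> A i} \<subseteq> vec_lambda ` Pi\<^sub>E UNIV A"
  proof
    fix x :: "'a ^ 'n" assume "x \<in> {x. \<forall>i. x $ i \<in> A i}"
    then have "vec_nth x \<in> Pi\<^sub>E UNIV A" by auto
    then show "x \<in> vec_lambda ` Pi\<^sub>E UNIV A" by (metis image_eqI vec_nth_inverse)
  qed
  ultimately show ?thesis by (meson finite_imageI finite_subset)
qed

subsection \<open>Frobenius monomials\<close>

lemma frobenius_sub_single: "frobenius_sub p (Poly_Mapping.single m 1)
    = (\<Prod>i\<leftarrow>coords. (zW i ^ p) ^ (fst m $ i)) * (\<Prod>i\<leftarrow>coords. (dW i ^ p) ^ (snd m $ i))"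
  by (simp add: frobenius_sub_def)

lemma m_elt_frobenius:
  "m_elt (int p *s c) = (frobenius_sub p (Poly_Mapping.single (\<chi> i. nat (c $ i), \<chi> i. nat (- c $ i)) 1) :: ('n::finite, 'k::field) weyl)"
  by (simp add: frobenius_sub_single m_elt_def nat_mult_distrib flip: power_mult mult_minus_right)

lemma o_ideal_monomial:
  assumes "c \<in> g_star t" "c \<noteq> 0"
  shows "Poly_Mapping.single (\<chi> i. nat (c $ i), \<chi> i. nat (- c $ i)) 1 \<in> (o_ideal t :: ('n::finite, 'k::field) zw_poly set)"
proof -
  obtain i where "c $ i \<noteq> 0" using assms(2) by (auto simp: vec_eq_iff)
  have "((\<chi> i. nat (c $ i)), (\<chi> i. nat (- c $ i))) \<noteq> (0 :: (nat ^ 'n) \<times> (nat ^ 'n))"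
  proof
    assume "((\<chi> i. nat (c $ i)), (\<chi> i. nat (- c $ i))) = (0 :: (nat ^ 'n) \<times> (nat ^ 'n))"
    then have "c $ i \<le> 0" "- c $ i \<le> 0" by (simp_all add: zero_prod_def vec_eq_iff)
    then show False using \<open>c $ i \<noteq> 0\<close> by simp
  qed
  moreover have "(\<chi> i. int (nat (c $ i)) - int (nat (- c $ i))) = c" by (simp add: vec_eq_iff)
  ultimately show ?thesis using assms(1) by (simp add: o_ideal_def lookup_single)
qed

locale D_module = equivariant p t lam M for p t lam and M :: "('n::finite, 'k::field, 'v) Dmod" +
  assumes object_o: "M \<in> A_modules_o t lam p"
begin

lemma finitely_generated:
  obtains G where "finite G" "G \<subseteq> carrier M"
    "\<And>v. v \<in> carrier M \<Longrightarrow> \<exists>r. (\<forall>s\<in>G. r s \<in> S) \<and> v = (\<Oplus>\<^bsub>M\<^esub>s\<in>G. r s \<cdot> s)"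
proof -
  obtain G where G: "finite G" "G \<subseteq> carrier M"
    "\<forall>v\<in>carrier M. \<exists>r\<in>G \<rightarrow> carrier (A_lam t lam). v = (\<Oplus>\<^bsub>M\<^esub>s\<in>G. r s \<odot>\<^bsub>M\<^esub> s)"
    using object_o unfolding A_modules_o_def by blast
  have "\<exists>r. (\<forall>s\<in>G. r s \<in> S) \<and> v = (\<Oplus>\<^bsub>M\<^esub>s\<in>G. r s \<cdot> s)" if v: "v \<in> carrier M" for v
  proof -
    obtain R where R: "R \<in> G \<rightarrow> carrier (A_lam t lam)" "v = (\<Oplus>\<^bsub>M\<^esub>s\<in>G. R s \<odot>\<^bsub>M\<^esub> s)" using G(3) v by blast
    then have "\<forall>s\<in>G. \<exists>u\<in>S. R s = A_cls t lam u" by (auto simp: carrier_A_lam)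
    then obtain r where r: "\<forall>s\<in>G. r s \<in> S \<and> R s = A_cls t lam (r s)" by metis
    then have "(\<Oplus>\<^bsub>M\<^esub>s\<in>G. R s \<odot>\<^bsub>M\<^esub> s) = (\<Oplus>\<^bsub>M\<^esub>s\<in>G. r s \<cdot> s)" by (intro finsum_cong') (use G(2) in auto)
    then show ?thesis using r R(2) by blast
  qed
  with G(1,2) show ?thesis using that by blast
qed

lemma frobenius_nilpotent:
  assumes c: "c \<in> g_star t" "c \<noteq> 0" and v: "v \<in> carrier M"
  shows "\<exists>N. m_elt (int N *s (int p *s c)) \<cdot> v = \<zero>\<^bsub>M\<^esub>"
proof -
  have pc: "int p *s c \<in> g_star t"
    using c(1) by (simp add: lattice_fiber_def pairing_def mult.assoc flip: sum_distrib_left)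
  let ?f = "Poly_Mapping.single (\<chi> i. nat (c $ i), \<chi> i. nat (- c $ i)) 1 :: ('n, 'k) zw_poly"
  obtain N where "((\<lambda>w. frobenius_sub p ?f \<cdot> w) ^^ N) v = \<zero>\<^bsub>M\<^esub>"
    using object_o o_ideal_monomial[OF c] v unfolding A_modules_o_def by blast
  then have "(m_elt (int p *s c) ^ N) \<cdot> v = \<zero>\<^bsub>M\<^esub>"
    using act_power[OF m_elt_S[OF pc] v] by (simp add: m_elt_frobenius)
  then show ?thesis unfolding m_elt_power by blast
qed

lemma g_star_scale: "c \<in> g_star t \<Longrightarrow> k *s c \<in> g_star t"
  by (simp add: lattice_fiber_def pairing_def mult.assoc flip: sum_distrib_left)

lemma m_elt_conformal_act:
  "conformal x y \<Longrightarrow> x \<in> g_star t \<Longrightarrow> y \<in> g_star t \<Longrightarrow> v \<in> carrier M \<Longrightarrow> m_elt (x + y) \<cdot> v = m_elt x \<cdot> m_elt y \<cdot> v"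
  by (simp add: m_elt_conformal act_mult)

lemma conformal_sym: "conformal x y \<Longrightarrow> conformal y x"
  by (simp add: conformal_def mult.commute)

text \<open>If infinitely many monomials acted nontrivially on \<open>v\<close>, some direction \<open>c\<close> would occur with
  arbitrarily large multiples, contradicting the nilpotence of the Frobenius monomial of \<open>c\<close>.\<close>

lemma finite_monomials:
  assumes v: "v \<in> carrier M" shows "finite {b \<in> g_star t. m_elt b \<cdot> v \<noteq> \<zero>\<^bsub>M\<^esub>}"
proof (rule ccontr)
  assume "infinite {b \<in> g_star t. m_elt b \<cdot> v \<noteq> \<zero>\<^bsub>M\<^esub>}" (is "infinite ?B")
  then obtain x y where xy: "x \<in> ?B" "y \<in> ?B" "x \<noteq> y" "conformal x (y - x)"
    and grow: "\<And>m. \<exists>z\<in>?B. conformal (int m *s (y - x) + x) (z - (int m *s (y - x) + x))"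
    using conformal_growth by blast
  let ?c = "y - x"
  have x: "x \<in> g_star t" and c: "?c \<in> g_star t" "?c \<noteq> 0" using xy g_star_diff by auto
  obtain N where N: "m_elt (int N *s (int p *s ?c)) \<cdot> m_elt x \<cdot> v = \<zero>\<^bsub>M\<^esub>"
    using frobenius_nilpotent[OF c, of "m_elt x \<cdot> v"] x v by auto
  let ?m = "N * p" and ?d = "int (N * p) *s ?c"
  have e: "int N *s (int p *s ?c) = ?d" by (simp add: vec_eq_iff mult.assoc)
  obtain z where z: "z \<in> ?B" "conformal (?d + x) (z - (?d + x))" using grow[of ?m] by blast
  have d: "?d \<in> g_star t" by (rule g_star_scale[OF c(1)])
  have "conformal ?d x"
    unfolding conformal_def
  proof
    fix i
    have "0 \<le> x $ i * ?c $ i" using xy(4) unfolding conformal_def by (rule spec)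
    then have "0 \<le> int (N * p) * (x $ i * ?c $ i)" by (rule mult_nonneg_nonneg[OF of_nat_0_le_iff])
    moreover have "?d $ i * x $ i = int (N * p) * (x $ i * ?c $ i)" by (simp add: algebra_simps)
    ultimately show "0 \<le> ?d $ i * x $ i" by (simp only:)
  qed
  then have 0: "m_elt (?d + x) \<cdot> v = \<zero>\<^bsub>M\<^esub>"
    using m_elt_conformal_act[OF _ d x v] N e by simp
  have "m_elt (z - (?d + x) + (?d + x)) \<cdot> v = m_elt (z - (?d + x)) \<cdot> m_elt (?d + x) \<cdot> v"
    by (rule m_elt_conformal_act[OF conformal_sym[OF z(2)]])
      (use z(1) v g_star_add[OF d x] in \<open>auto intro!: g_star_diff simp del: of_nat_mult\<close>)
  then have "m_elt z \<cdot> v = \<zero>\<^bsub>M\<^esub>"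
    using 0 z(1) d x g_star_diff[of z t "?d + x"] g_star_add[OF d x] by simp
  then show False using z(1) by simp
qed

text \<open>Applied to \<open>s\<close>, the algebra is spanned by the elements \<open>m(b) (h - a)\<^sup>e\<close>; of these only finitely many
  act nontrivially, by \<open>finite_monomials\<close> for \<open>b\<close> and by nilpotence for \<open>e\<close>.\<close>

lemma weight_generator_span:
  assumes s: "s \<in> W a"
  obtains B where "finite B" "B \<subseteq> carrier M" "\<And>r. r \<in> S \<Longrightarrow> r \<cdot> s \<in> kspan B"
proof -
  have sc: "s \<in> carrier M" using s by (rule W_carrier)
  obtain N where N: "nilp a N s" using nilp_exists[OF s] by blast
  let ?E = "{e :: nat ^ 'n. \<forall>i. e $ i \<in> {..<N}}" and ?X = "{b \<in> g_star t. m_elt b \<cdot> s \<noteq> \<zero>\<^bsub>M\<^esub>}"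
  let ?B = "(\<lambda>(b, e). m_elt b \<cdot> hmonom a e \<cdot> s) ` (?X \<times> ?E)"
  have h: "hmonom c e \<in> S" for c e by (rule weight_zero_S[OF hmonom_weight])
  have fin: "finite ?B"
    by (intro finite_imageI finite_cartesian_product finite_vec_box finite_monomials sc) simp
  have Bc: "?B \<subseteq> carrier M" using h sc by auto
  have mono: "m_elt b \<cdot> hmonom a e \<cdot> s \<in> kspan ?B" if b: "b \<in> g_star t" for b e
  proof (cases "e \<in> ?E \<and> b \<in> ?X")
    case True
    then show ?thesis by (intro kspan.base) force
  next
    case False
    then consider i where "N \<le> e $ i" | "b \<notin> ?X" by (auto simp: not_less)
    then have "m_elt b \<cdot> hmonom a e \<cdot> s = \<zero>\<^bsub>M\<^esub>"
    proof cases
      case 1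
      have "Poly_Mapping.single e 1 = Poly_Mapping.single (e - axis i N) 1 * (s_var i ^ N :: ('n, 'k) s_poly)"
      proof -
        have "e - axis i N + axis i N = e" using 1 by (simp add: vec_eq_iff axis_def)
        then show ?thesis by (simp add: s_var_power mult_single)
      qed
      then have "heval a (Poly_Mapping.single e 1) \<cdot> s = \<zero>\<^bsub>M\<^esub>"
        using N s_power_ideal_var unfolding nilp_def by metis
      then show ?thesis using b by simp
    next
      case 2
      have "m_elt b \<cdot> heval a (Poly_Mapping.single e 1) \<cdot> s = heval (a + b) (Poly_Mapping.single e 1) \<cdot> m_elt b \<cdot> s"
        by (rule homogeneous_act_heval[OF m_elt_weight b sc, symmetric])
      then show ?thesis using 2 b by (simp add: h)
    qed
    then show ?thesis by (simp add: kspan.zero)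
  qed
  have "r \<cdot> s \<in> kspan ?B" if "r \<in> S" for r
    using that
  proof (induction rule: T_invariants_induct)
    case zero
    then show ?case using sc by (simp add: kspan.zero)
  next
    case (homogeneous u b)
    obtain f where u: "u = m_elt b * heval a f" using homogeneous_span[OF homogeneous(2)] by blast
    have "heval a f \<cdot> s = (\<Oplus>\<^bsub>M\<^esub>e\<in>Poly_Mapping.keys f. (scal (Poly_Mapping.lookup f e) * hmonom a e) \<cdot> s)"
      unfolding heval_def by (rule act_sum) (use sc h S_mult sc_closed in auto)
    then have "u \<cdot> s = (\<Oplus>\<^bsub>M\<^esub>e\<in>Poly_Mapping.keys f. m_elt b \<cdot> (scal (Poly_Mapping.lookup f e) * hmonom a e) \<cdot> s)"
      unfolding u using sc homogeneous(1) h S_mult sc_closed by (simp add: act_mult act_finsum)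
    moreover have "m_elt b \<cdot> (scal c * hmonom a e) \<cdot> s = scal c \<cdot> m_elt b \<cdot> hmonom a e \<cdot> s" for c e
    proof -
      have "m_elt b \<cdot> (scal c * hmonom a e) \<cdot> s = (m_elt b * (scal c * hmonom a e)) \<cdot> s"
        using homogeneous(1) h sc by (simp add: act_mult S_mult)
      also have "m_elt b * (scal c * hmonom a e) = scal c * (m_elt b * hmonom a e :: ('n, 'k) weyl)"
        by (simp only: mult.assoc[symmetric] scal_commute[of c "m_elt b"])
      also have "(scal c * (m_elt b * hmonom a e)) \<cdot> s = scal c \<cdot> m_elt b \<cdot> hmonom a e \<cdot> s"
        using homogeneous(1) h sc by (simp add: act_mult S_mult)
      finally show ?thesis .
    qed
    ultimately show ?case
      using mono[OF homogeneous(1)] Bc by (simp add: kspan_finsum kspan.scale)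
  next
    case (add u v)
    then show ?case using sc by (simp add: act_add_left kspan.add)
  qed
  with fin Bc show ?thesis using that by blast
qed

theorem finite_dimensional:
  obtains B where "finite B" "B \<subseteq> carrier M" "carrier M \<subseteq> kspan B"
proof -
  obtain G where G: "finite G" "G \<subseteq> carrier M"
    "\<And>v. v \<in> carrier M \<Longrightarrow> \<exists>r. (\<forall>s\<in>G. r s \<in> S) \<and> v = (\<Oplus>\<^bsub>M\<^esub>s\<in>G. r s \<cdot> s)"
    using finitely_generated by blast
  have "\<exists>B. finite B \<and> B \<subseteq> carrier M \<and> (\<forall>r\<in>S. r \<cdot> coact M s a \<in> kspan B)" if "s \<in> carrier M" for s a
    using weight_generator_span[OF coact_W[OF that, of a]] by metis
  then obtain B where B: "\<And>s a. s \<in> carrier M \<Longrightarrow> finite (B s a) \<and> B s a \<subseteq> carrier M \<and> (\<forall>r\<in>S. r \<cdot> coact M s a \<in> kspan (B s a))"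
    by metis
  define C where "C = (\<Union>s\<in>G. \<Union>a\<in>coact_supp M s. B s a)"
  have fin: "finite C" unfolding C_def using G(1,2) B by (intro finite_UN_I) (auto intro: finite_coact_supp)
  have Cc: "C \<subseteq> carrier M" unfolding C_def using G(2) B by blast
  have "r \<cdot> s \<in> kspan C" if s: "s \<in> G" and r: "r \<in> S" for r s
  proof -
    have sc: "s \<in> carrier M" using s G(2) by blast
    have "r \<cdot> s = r \<cdot> (\<Oplus>\<^bsub>M\<^esub>a\<in>coact_supp M s. coact M s a)" by (simp add: coact_sum sc)
    also have "\<dots> = (\<Oplus>\<^bsub>M\<^esub>a\<in>coact_supp M s. r \<cdot> coact M s a)" by (rule act_finsum[OF r]) (use sc in auto)
    also have "\<dots> \<in> kspan C"
    proof (rule kspan_finsum[OF _ Cc])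
      fix a assume "a \<in> coact_supp M s"
      then have "B s a \<subseteq> C" using s unfolding C_def by blast
      then show "r \<cdot> coact M s a \<in> kspan C" using kspan_mono B[OF sc] r by blast
    qed
    finally show ?thesis .
  qed
  then have "carrier M \<subseteq> kspan C"
    using G(3) kspan_finsum[OF _ Cc] by (metis (no_types, lifting) subsetI)
  with fin Cc show ?thesis using that by blast
qed

end

locale D_family = H_family p t lam M b + D_module p t lam M
  for p t lam and M :: "('n::finite, 'k::field, 'v) Dmod" and b
begin

sublocale F: H_action t L FM
  by (rule H_action.intro) (rule FM_module)

lemma FM_carrier: "carrier FM = Hom_sum t lam L b M" by (rule FM_simps(1))

lemma ev_FM: "\<Phi> \<in> carrier FM \<Longrightarrow> ev \<Phi> \<in> fam" by (simp add: FM_carrier ev_fam)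

lemma ev_FM_bij: "bij_betw ev (carrier FM) fam" unfolding FM_carrier by (rule ev_bij)

lemma ev_hact: "\<Phi> \<in> carrier FM \<Longrightarrow> ev (F.hact f \<Phi>) = H_act t lam L b M f (ev \<Phi>)"
  by (rule ev_smult) (simp add: FM_carrier)

lemma ev_sact: "\<Phi> \<in> carrier FM \<Longrightarrow> x \<in> L \<Longrightarrow> ev (F.sact f \<Phi>) x = heval (b x) f \<cdot> ev \<Phi> x"
  using ev_FM by (simp add: ev_hact H_act_scal)

lemma ev_cact: "\<Phi> \<in> carrier FM \<Longrightarrow> u \<in> L \<Longrightarrow>
    ev (F.cact x y \<Phi>) u = (if u = x \<and> y \<in> L then tr (b x) (b y) (ev \<Phi> y) else \<zero>\<^bsub>M\<^esub>)"
  using ev_FM by (simp add: ev_hact H_act_gen c_act_eq)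

lemma ev_eqI:
  assumes "\<Phi> \<in> carrier FM" "\<Psi> \<in> carrier FM" "\<And>x. x \<in> L \<Longrightarrow> ev \<Phi> x = ev \<Psi> x" shows "\<Phi> = \<Psi>"
proof -
  have "ev \<Phi> = ev \<Psi>" by (rule fam_ext) (use assms ev_FM in auto)
  then show ?thesis using ev_FM_bij assms(1,2) by (simp add: bij_betw_def inj_on_def)
qed

definition single where
  "single x v = the_inv_into (carrier FM) ev (\<lambda>y\<in>L. if y = x then v else \<zero>\<^bsub>M\<^esub>)"

lemma single_FM:
  assumes "v \<in> W (b x)" shows "single x v \<in> carrier FM"
    and "y \<in> L \<Longrightarrow> ev (single x v) y = (if y = x then v else \<zero>\<^bsub>M\<^esub>)"
proof -
  have f: "(\<lambda>y\<in>L. if y = x then v else \<zero>\<^bsub>M\<^esub>) \<in> fam"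
    by (rule famI[of _ "{x}"]) (use assms in auto)
  have inj: "inj_on ev (carrier FM)" and im: "ev ` carrier FM = fam" using ev_FM_bij by (auto simp: bij_betw_def)
  show "single x v \<in> carrier FM" unfolding single_def by (rule the_inv_into_into[OF inj]) (use f im in auto)
  have "ev (single x v) = (\<lambda>y\<in>L. if y = x then v else \<zero>\<^bsub>M\<^esub>)"
    unfolding single_def by (rule f_the_inv_into_f[OF inj]) (use f im in auto)
  then show "y \<in> L \<Longrightarrow> ev (single x v) y = (if y = x then v else \<zero>\<^bsub>M\<^esub>)" by simp
qed

lemma ev_W: "\<Phi> \<in> carrier FM \<Longrightarrow> x \<in> L \<Longrightarrow> ev \<Phi> x \<in> W (b x)"
  by (rule fam_W[OF ev_FM])

lemma cact_single: "\<Phi> \<in> carrier FM \<Longrightarrow> x \<in> L \<Longrightarrow> F.cact x x \<Phi> = single x (ev \<Phi> x)"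
  using ev_W[of \<Phi> x]
  by (intro ev_eqI) (simp_all add: single_FM ev_cact tr_self F.cact_closed)

lemma single_add: "v \<in> W (b x) \<Longrightarrow> w \<in> W (b x) \<Longrightarrow> single x (v \<oplus>\<^bsub>M\<^esub> w) = single x v \<oplus>\<^bsub>FM\<^esub> single x w"
  using F.add.m_closed[OF single_FM(1) single_FM(1), of v x w x]
  by (intro ev_eqI) (simp_all add: single_FM add_W ev_add)

lemma single_heval: "v \<in> W (b x) \<Longrightarrow> single x (heval (b x) f \<cdot> v) = F.sact f (single x v)"
  using F.sact_closed[OF single_FM(1), of v x f]
  by (intro ev_eqI) (simp_all add: single_FM ev_sact)

lemma single_zero: "single x \<zero>\<^bsub>M\<^esub> = \<zero>\<^bsub>FM\<^esub>"
  using F.zero_closed by (intro ev_eqI) (simp_all add: single_FM ev_zero)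

lemma FM_sum_singles:
  assumes "\<Phi> \<in> carrier FM" "finite X" "X \<subseteq> L" "\<And>x. x \<in> L \<Longrightarrow> x \<notin> X \<Longrightarrow> ev \<Phi> x = \<zero>\<^bsub>M\<^esub>"
  shows "\<Phi> = (\<Oplus>\<^bsub>FM\<^esub>x\<in>X. F.cact x x \<Phi>)"
proof -
  have c: "(\<lambda>x. F.cact x x \<Phi>) \<in> X \<rightarrow> carrier FM" using assms(1) F.cact_closed by auto
  have "ev (\<Oplus>\<^bsub>FM\<^esub>x\<in>Y. F.cact x x \<Phi>) y = (if y \<in> Y then ev \<Phi> y else \<zero>\<^bsub>M\<^esub>)" if "finite Y" "Y \<subseteq> X" "y \<in> L" for Y y
    using that
  proof (induction Y)
    case empty
    then show ?case by (simp add: ev_zero)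
  next
    case (insert x Y)
    then have x: "x \<in> L" using assms(3) by auto
    have "(\<Oplus>\<^bsub>FM\<^esub>x\<in>insert x Y. F.cact x x \<Phi>) = F.cact x x \<Phi> \<oplus>\<^bsub>FM\<^esub> (\<Oplus>\<^bsub>FM\<^esub>x\<in>Y. F.cact x x \<Phi>)"
      by (rule F.finsum_insert) (use insert c assms(1) F.cact_closed in auto)
    then show ?case
      using insert x assms(1) W_carrier[OF ev_W[OF assms(1)]]
      by (auto simp: ev_add cact_single single_FM ev_W)
  qed
  note sum = this[OF assms(2) order_refl]
  show ?thesis
  proof (rule ev_eqI[OF assms(1) F.finsum_closed[OF c]])
    show "ev \<Phi> y = ev (\<Oplus>\<^bsub>FM\<^esub>x\<in>X. F.cact x x \<Phi>) y" if "y \<in> L" for y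
      using sum[OF that] assms(4)[OF that] by simp
  qed
qed

text \<open>If \<open>B\<close> spans \<open>M\<close>, the components of the elements of \<open>B\<close> at the base points of the alcoves span the
  direct sum, and only finitely many of them are nonzero.\<close>

theorem FM_object: "FM \<in> H_modules_o t L"
proof -
  obtain B where B: "finite B" "B \<subseteq> carrier M" "carrier M \<subseteq> kspan B" using finite_dimensional by blast
  define X where "X = {x \<in> L. \<exists>w\<in>B. coact M w (b x) \<noteq> \<zero>\<^bsub>M\<^esub>}"
  define C where "C = (\<lambda>(x, w). single x (coact M w (b x))) ` (X \<times> B)"
  have injb: "inj_on b L" by (rule inj_onI) (metis alcove_of_b)
  have "b ` X \<subseteq> (\<Union>w\<in>B. coact_supp M w)" unfolding X_def coact_supp_def by auto
  moreover have "finite (\<Union>w\<in>B. coact_supp M w)" using B(1,2) by (auto intro: finite_coact_supp)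
  ultimately have "finite (b ` X)" by (rule finite_subset)
  then have finX: "finite X" by (rule finite_imageD) (rule inj_on_subset[OF injb], auto simp: X_def)
  have finC: "finite C" unfolding C_def using finX B(1) by simp
  have Cc: "C \<subseteq> carrier FM" unfolding C_def using B(2) single_FM(1) by auto
  have kw: "single x (coact M v (b x)) \<in> F.kspan C" if x: "x \<in> L" and v: "v \<in> kspan B" for x v
    using v
  proof (induction rule: kspan.induct)
    case zero
    show ?case by (simp add: single_zero F.kspan.zero)
  next
    case (base w)
    then have "coact M w (b x) = \<zero>\<^bsub>M\<^esub> \<or> single x (coact M w (b x)) \<in> C"
      using x unfolding C_def X_def by auto
    then show ?case by (auto simp: single_zero F.kspan.zero intro: F.kspan.base)
  next
    case (add v w)
    then show ?case using kspan_carrier[OF B(2)] by (simp add: coact_add single_add F.kspan.add)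
  next
    case (scale v c)
    have "scal c = heval (b x) (s_const c)" by (simp add: s_const_def)
    then have "single x (coact M (scal c \<cdot> v) (b x)) = F.sact (s_const c) (single x (coact M v (b x)))"
      using kspan_carrier[OF B(2) scale(1)] by (simp add: coact_act0 heval_weight single_heval)
    then show ?case using F.kspan.scale[OF scale(2)] by simp
  qed
  have zero_outside: "ev \<Phi> x = \<zero>\<^bsub>M\<^esub>" if "\<Phi> \<in> carrier FM" "x \<in> L" "x \<notin> X" for \<Phi> x
  proof -
    have "coact M v (b x) = \<zero>\<^bsub>M\<^esub>" if "v \<in> kspan B" for v
      using that
    proof (induction rule: kspan.induct)
      case (base w)
      then show ?case using \<open>x \<notin> X\<close> \<open>x \<in> L\<close> unfolding X_def by blast
    next
      case (add v w)
      then show ?case using kspan_carrier[OF B(2)] by (simp add: coact_add)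
    next
      case (scale v c)
      have "(scal c :: ('n, 'k) weyl) \<in> weyl_weights {0}" by (rule weyl_weights_scal) simp
      then show ?case using scale kspan_carrier[OF B(2)] by (simp add: coact_act0)
    qed simp
    note z = this
    have w: "ev \<Phi> x \<in> W (b x)" by (rule ev_W[OF that(1,2)])
    have "ev \<Phi> x \<in> kspan B" using B(3) W_carrier[OF w] by blast
    from z[OF this] show ?thesis using coact_of_W[OF w, of "b x"] by simp
  qed
  have span: "\<Phi> \<in> F.kspan C" if \<Phi>: "\<Phi> \<in> carrier FM" for \<Phi>
  proof -
    have XL: "X \<subseteq> L" by (auto simp: X_def)
    have "F.cact x x \<Phi> \<in> F.kspan C" if x: "x \<in> X" for x
    proof -
      have xL: "x \<in> L" using x XL by blast
      note w = ev_W[OF \<Phi> xL]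
      have "coact M (ev \<Phi> x) (b x) = ev \<Phi> x" using w by (simp add: W_iff)
      then show ?thesis using kw[OF xL, of "ev \<Phi> x"] B(3) W_carrier[OF w] cact_single[OF \<Phi> xL] by auto
    qed
    then have "(\<Oplus>\<^bsub>FM\<^esub>x\<in>X. F.cact x x \<Phi>) \<in> F.kspan C" by (rule F.kspan_finsum[OF _ Cc])
    then show ?thesis by (subst FM_sum_singles[OF \<Phi> finX XL zero_outside[OF \<Phi>]])
  qed
  have local_unit: "\<exists>X. finite X \<and> X \<subseteq> L \<and> \<Phi> = (\<Oplus>\<^bsub>FM\<^esub>x\<in>X. F.cact x x \<Phi>)" if "\<Phi> \<in> carrier FM" for \<Phi>
  proof (intro exI conjI)
    show "finite X" "X \<subseteq> L" using finX by (auto simp: X_def)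
    then show "\<Phi> = (\<Oplus>\<^bsub>FM\<^esub>x\<in>X. F.cact x x \<Phi>)" by (rule FM_sum_singles[OF that _ _ zero_outside[OF that]])
  qed
  have fin_span: "\<exists>c. \<Phi> = (\<Oplus>\<^bsub>FM\<^esub>w\<in>C. F.hact (H_scal (Poly_Mapping.single 0 (c w))) w)" if "\<Phi> \<in> carrier FM" for \<Phi>
    using F.kspan_coeffs[OF finC Cc span[OF that]] unfolding s_const_def .
  have nil: "\<exists>m. \<forall>\<Phi>\<in>carrier FM. ((\<lambda>w. F.sact (s_var i) w) ^^ m) \<Phi> = \<zero>\<^bsub>FM\<^esub>" for i
  proof -
    have one: "\<exists>m. F.hact (H_scal (s_var i) ^ m) \<Phi> = \<zero>\<^bsub>FM\<^esub>" if \<Phi>: "\<Phi> \<in> carrier FM" for \<Phi>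
    proof -
      have "\<exists>m. (hdiff (b x) i ^ m) \<cdot> ev \<Phi> x = \<zero>\<^bsub>M\<^esub>" if "x \<in> L" for x
        using s_nilpotent[OF W_carrier[OF ev_W[OF \<Phi> that]], of i] unfolding s_op_power_W[OF ev_W[OF \<Phi> that]] .
      then obtain m where m: "\<And>x. x \<in> L \<Longrightarrow> (hdiff (b x) i ^ m x) \<cdot> ev \<Phi> x = \<zero>\<^bsub>M\<^esub>" by metis
      define k where "k = Max (insert 0 (m ` X))"
      have "ev (F.sact (s_var i ^ k) \<Phi>) x = \<zero>\<^bsub>M\<^esub>" if x: "x \<in> L" for x
      proof (cases "x \<in> X")
        case True
        then have mk: "m x \<le> k" unfolding k_def using finX by auto
        have "(hdiff (b x) i ^ k) \<cdot> ev \<Phi> x = \<zero>\<^bsub>M\<^esub>"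
          by (rule power_act_zero[OF hdiff_S W_carrier[OF ev_W[OF \<Phi> x]] m[OF x] mk])
        then show ?thesis by (simp add: ev_sact[OF \<Phi> x] heval_power)
      next
        case False
        then show ?thesis using zero_outside[OF \<Phi> x] by (simp add: ev_sact[OF \<Phi> x])
      qed
      then have "F.sact (s_var i ^ k) \<Phi> = \<zero>\<^bsub>FM\<^esub>"
        using F.sact_closed[OF \<Phi>] F.zero_closed by (intro ev_eqI) (simp_all add: ev_zero)
      moreover have "H_scal (s_var i ^ k) = (H_scal (s_var i) ^ k :: ('n, 'k) Hfree)"
        by (induction k) (simp_all add: H_scal_simps)
      ultimately show ?thesis by (intro exI[of _ k]) simp
    qed
    then have "\<forall>\<Phi>\<in>carrier FM. \<exists>m. F.hact (H_scal (s_var i) ^ m) \<Phi> = \<zero>\<^bsub>FM\<^esub>" by (intro ballI)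
    from bchoice[OF this] obtain m where "\<forall>\<Phi>\<in>carrier FM. F.hact (H_scal (s_var i) ^ m \<Phi>) \<Phi> = \<zero>\<^bsub>FM\<^esub>" ..
    then have m: "\<And>\<Phi>. \<Phi> \<in> carrier FM \<Longrightarrow> F.hact (H_scal (s_var i) ^ m \<Phi>) \<Phi> = \<zero>\<^bsub>FM\<^esub>" by (rule bspec)
    define k where "k = Max (insert 0 (m ` C))"
    have "F.hact (H_scal (s_var i) ^ k) \<Phi> = \<zero>\<^bsub>FM\<^esub>" if "\<Phi> \<in> F.kspan C" for \<Phi>
      using that
    proof (induction rule: F.kspan.induct)
      case (base w)
      then have mk: "m w \<le> k" and w: "w \<in> carrier FM" unfolding k_def using finC Cc by auto
      show ?case by (rule F.power_act_zero[OF UNIV_I w m[OF w] mk])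
    next
      case (add v w)
      then show ?case using F.kspan_carrier[OF Cc] by (simp add: F.act_add)
    next
      case (scale v c)
      have vc: "v \<in> carrier FM" using F.kspan_carrier[OF Cc scale(1)] .
      have "F.hact (H_scal (s_var i) ^ k) (F.sact (s_const c) v) = F.sact (s_const c) (F.hact (H_scal (s_var i) ^ k) v)"
        by (rule F.sact_hact[OF vc, symmetric])
      then show ?case using scale(2) by simp
    qed simp
    then have "((\<lambda>w. F.sact (s_var i) w) ^^ k) \<Phi> = \<zero>\<^bsub>FM\<^esub>" if "\<Phi> \<in> carrier FM" for \<Phi>
      unfolding F.act_power[OF UNIV_I that] using span[OF that] .
    then show ?thesis by (intro exI[of _ k] ballI)
  qed
  show ?thesis
    unfolding H_modules_o_def mem_Collect_eq
  proof (intro conjI ballI allI exI[of _ C])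
    show "\<exists>m. \<forall>\<Phi>\<in>carrier FM. ((\<lambda>w. F.sact (s_var i) w) ^^ m) \<Phi> = \<zero>\<^bsub>FM\<^esub>" for i by (rule nil)
  qed (fact FM_module local_unit fin_span finC Cc)+
qed

end

section \<open>The two categories and the functor\<close>

lemma linear_maps_id: "left_module R M \<Longrightarrow> restrict id (carrier M) \<in> linear_maps R M M"
proof -
  assume "left_module R M"
  then interpret left_module R M .
  show ?thesis by (auto simp: linear_maps_def smult_closed)
qed

lemma linear_maps_compose:
  assumes "left_module R M" "f \<in> linear_maps R M N" "g \<in> linear_maps R N P"
  shows "compose (carrier M) g f \<in> linear_maps R M P"
proof -
  interpret left_module R M by fact
  show ?thesis using assms(2,3) by (auto simp: linear_maps_def smult_closed compose_def Pi_iff PiE_iff)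
qed

lemma linear_maps_funcset: "f \<in> linear_maps R M N \<Longrightarrow> f \<in> carrier M \<rightarrow>\<^sub>E carrier N"
  by (simp add: linear_maps_def)

lemma linear_maps_ext: "f \<in> linear_maps R M N \<Longrightarrow> g \<in> linear_maps R M N \<Longrightarrow>
    (\<And>v. v \<in> carrier M \<Longrightarrow> f v = g v) \<Longrightarrow> f = g"
  by (rule PiE_ext[OF linear_maps_funcset linear_maps_funcset])

lemma linear_maps_category:
  assumes "\<And>M. M \<in> Os \<Longrightarrow> left_module R M"
    and "\<And>M N. M \<in> Os \<Longrightarrow> N \<in> Os \<Longrightarrow> A M N \<subseteq> linear_maps R M N"
    and "\<And>M. M \<in> Os \<Longrightarrow> restrict id (carrier M) \<in> A M M"
    and "\<And>M N P f g. M \<in> Os \<Longrightarrow> N \<in> Os \<Longrightarrow> P \<in> Os \<Longrightarrow> f \<in> A M N \<Longrightarrow> g \<in> A N P \<Longrightarrow> compose (carrier M) g f \<in> A M P"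
  shows "is_category \<lparr>Ob = Os, Arr = A, Idt = (\<lambda>M. restrict id (carrier M)), Comp = (\<lambda>L M N g f. compose (carrier L) g f)\<rparr>"
proof -
  have fs: "f \<in> carrier M \<rightarrow>\<^sub>E carrier N" if "M \<in> Os" "N \<in> Os" "f \<in> A M N" for M N f
    using assms(2)[OF that(1,2)] that(3) linear_maps_funcset by blast
  show ?thesis
    unfolding is_category_def category.simps
  proof (intro conjI ballI)
    fix M N f assume *: "M \<in> Os" "N \<in> Os" "f \<in> A M N"
    note f = fs[OF this]
    show "compose (carrier M) f (restrict id (carrier M)) = f" "compose (carrier M) (restrict id (carrier N)) f = f"
      using f by (auto simp: compose_def fun_eq_iff PiE_iff extensional_def)
  next
    fix W X Y Z f g h assume *: "W \<in> Os" "X \<in> Os" "Y \<in> Os" "Z \<in> Os" "f \<in> A W X" "g \<in> A X Y" "h \<in> A Y Z"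
    have "f v \<in> carrier X" if "v \<in> carrier W" for v using fs[OF *(1,2,5)] that by auto
    then show "compose (carrier W) (compose (carrier X) h g) f = compose (carrier W) h (compose (carrier W) g f)"
      by (auto simp: compose_def fun_eq_iff)
  qed (use assms(3,4) in blast)+
qed

lemma D_familyI:
  assumes "CHAR('k::field) = p" "p > 0" "M \<in> A_modules_D_o t lam p"
    "\<And>x. x \<in> alcove_labels t lam p \<Longrightarrow> b x \<in> alcove t lam p x"
  shows "D_family p t lam (M :: ('n::finite, 'k, 'v) Dmod) b"
proof -
  have "left_module (A_lam t lam) M" "M \<in> A_modules_o t lam p"
    using assms(3) by (auto simp: A_modules_D_o_def A_modules_o_def)
  then show ?thesis
    using assms
    by (intro D_family.intro H_family.intro H_family_axioms.intro equivariant.intro equivariant_axioms.intro weighted.intro weighted_axioms.intro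
        A_action.intro A_action_axioms.intro char_p.intro D_module.intro D_module_axioms.intro)
      (auto simp: A_modules_D_o_def)
qed

definition D_arrows where
  "D_arrows t lam M N = {f \<in> linear_maps (A_lam t lam) M N. \<forall>v\<in>carrier M. \<forall>a. f (coact M v a) = coact N (f v) a}"

lemma A_mod_D_o_simps:
  "Ob (A_mod_D_o t lam p) = A_modules_D_o t lam p" "Arr (A_mod_D_o t lam p) M N = D_arrows t lam M N"
  "Idt (A_mod_D_o t lam p) M = restrict id (carrier M)" "Comp (A_mod_D_o t lam p) L' M N g f = compose (carrier L') g f"
  by (simp_all add: A_mod_D_o_def D_arrows_def)

lemma H_mod_o_simps:
  "Ob (H_mod_o t L) = H_modules_o t L" "Arr (H_mod_o t L) M N = linear_maps (H_alg t L) M N"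
  "Idt (H_mod_o t L) M = restrict id (carrier M)" "Comp (H_mod_o t L) L' M N g f = compose (carrier L') g f"
  by (simp_all add: H_mod_o_def)

lemma H_mod_o_category: "is_category (H_mod_o t L)"
  unfolding H_mod_o_def
  by (rule linear_maps_category) (auto simp: H_modules_o_def intro: linear_maps_id linear_maps_compose)

locale D_arrow = M: D_family p t lam M b + M': D_family p t lam M' b
  for p t lam and M M' :: "('n::finite, 'k::field, 'v) Dmod" and b +
  fixes f assumes arrow: "f \<in> D_arrows t lam M M'"
begin

lemma f_closed: "v \<in> carrier M \<Longrightarrow> f v \<in> carrier M'"
  using arrow by (auto simp: D_arrows_def linear_maps_def)

lemma f_add: "v \<in> carrier M \<Longrightarrow> w \<in> carrier M \<Longrightarrow> f (v \<oplus>\<^bsub>M\<^esub> w) = f v \<oplus>\<^bsub>M'\<^esub> f w"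
  using arrow by (auto simp: D_arrows_def linear_maps_def)

lemma f_act: "u \<in> M.S \<Longrightarrow> v \<in> carrier M \<Longrightarrow> f (M.act u v) = M'.act u (f v)"
  using arrow M.A_cls_closed by (auto simp: D_arrows_def linear_maps_def)

lemma f_coact: "v \<in> carrier M \<Longrightarrow> f (coact M v a) = coact M' (f v) a"
  using arrow by (auto simp: D_arrows_def)

lemma f_zero: "f \<zero>\<^bsub>M\<^esub> = \<zero>\<^bsub>M'\<^esub>"
  using f_add[of "\<zero>\<^bsub>M\<^esub>" "\<zero>\<^bsub>M\<^esub>"] f_closed[of "\<zero>\<^bsub>M\<^esub>"] by (intro M'.eq_zero_if_add_self) auto

lemma f_W: "v \<in> M.W a \<Longrightarrow> f v \<in> M'.W a"
  using f_coact[of v a] by (auto simp: M.W_iff M'.W_iff f_closed)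

lemma f_nilp: "v \<in> carrier M \<Longrightarrow> M.nilp a N v \<Longrightarrow> M'.nilp a N (f v)"
  unfolding M.nilp_def M'.nilp_def using f_act[OF M.heval_S] f_zero by metis

text \<open>The operators \<open>tr\<close> act through elements of the algebra, with which arrows commute.\<close>

lemma f_tr:
  assumes v: "v \<in> M.W a" and d: "a' - a \<in> g_star t" shows "f (M.tr a' a v) = M'.tr a' a (f v)"
proof -
  have vc: "v \<in> carrier M" using v by (rule M.W_carrier)
  obtain N g where N: "M.nilp a N v" and g: "unit_rising a (a' - a) * g - 1 \<in> (s_power_ideal N :: ('n, 'k) s_poly set)"
    and e: "M.tr a' a v = M.act (m_elt (a' - a)) (M.act (heval a g) v)" using M.tr_obtain[OF v] by metis
  have "M'.tr a' a (f v) = M'.act (m_elt (a' - a)) (M'.act (heval a g) (f v))"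
    by (rule M'.tr_eq[OF f_W[OF v] f_nilp[OF vc N] g])
  then show ?thesis unfolding e using f_act[OF M.m_elt_S[OF d] M.act_closed[OF M.heval_S vc]] f_act[OF M.heval_S vc] by simp
qed

abbreviation Farr where "Farr \<equiv> FArr (Hom_P_functor t lam M.L b) M M' f"

lemma HomQ_compose:
  assumes \<phi>: "\<phi> \<in> M.HomQ a" shows "(\<lambda>q\<in>carrier (M.Q a). f (\<phi> q)) \<in> M'.HomQ a"
proof -
  have lin: "\<phi> \<in> linear_maps (A_lam t lam) (M.Q a) M"
    and cont: "continuous_map (Q_topology t lam a) (discrete_topology (carrier M)) \<phi>"
    and wt: "\<And>c q. q \<in> Q_weight_space t lam a c \<Longrightarrow> \<phi> q \<in> M.W c"
    using \<phi> by (auto simp: Hom_Q_def)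
  have pc: "\<phi> q \<in> carrier M" if "q \<in> carrier (M.Q a)" for q using linear_maps_funcset[OF lin] that by auto
  have "(\<lambda>q\<in>carrier (M.Q a). f (\<phi> q)) \<in> linear_maps (A_lam t lam) (M.Q a) M'"
    unfolding linear_maps_def
  proof (intro CollectI conjI ballI)
    show "(\<lambda>q\<in>carrier (M.Q a). f (\<phi> q)) \<in> carrier (M.Q a) \<rightarrow>\<^sub>E carrier M'" using pc f_closed by auto
  next
    fix q r assume q: "q \<in> carrier (M.Q a)" and r: "r \<in> carrier (M.Q a)"
    have "\<phi> (q \<oplus>\<^bsub>M.Q a\<^esub> r) = \<phi> q \<oplus>\<^bsub>M\<^esub> \<phi> r" using lin q r by (auto simp: linear_maps_def)
    then show "(\<lambda>q\<in>carrier (M.Q a). f (\<phi> q)) (q \<oplus>\<^bsub>M.Q a\<^esub> r)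
        = (\<lambda>q\<in>carrier (M.Q a). f (\<phi> q)) q \<oplus>\<^bsub>M'\<^esub> (\<lambda>q\<in>carrier (M.Q a). f (\<phi> q)) r"
      using q r M.Q_closed(1)[OF q r] pc by (simp add: f_add)
  next
    fix u q assume u: "u \<in> carrier (A_lam t lam :: ('n, 'k) weyl set ring)" and q: "q \<in> carrier (M.Q a)"
    obtain u' where u': "u' \<in> M.S" "u = A_cls t lam u'" using u by (auto simp: carrier_A_lam)
    have "\<phi> (u \<odot>\<^bsub>M.Q a\<^esub> q) = u \<odot>\<^bsub>M\<^esub> \<phi> q" using lin u q by (auto simp: linear_maps_def)
    then show "(\<lambda>q\<in>carrier (M.Q a). f (\<phi> q)) (u \<odot>\<^bsub>M.Q a\<^esub> q) = u \<odot>\<^bsub>M'\<^esub> (\<lambda>q\<in>carrier (M.Q a). f (\<phi> q)) q"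
      using q M.Q_closed(2)[OF q u'(1)] f_act[OF u'(1) pc[OF q]] by (simp add: u'(2))
  qed
  moreover have "continuous_map (Q_topology t lam a) (discrete_topology (carrier M')) (\<lambda>q\<in>carrier (M.Q a). f (\<phi> q))"
  proof (rule continuous_map_eq)
    show "continuous_map (Q_topology t lam a) (discrete_topology (carrier M')) (f \<circ> \<phi>)"
      by (rule continuous_map_compose[OF cont]) (use f_closed in auto)
  qed (simp add: M.Q_topspace)
  moreover have "\<forall>c. \<forall>q\<in>Q_weight_space t lam a c. (\<lambda>q\<in>carrier (M.Q a). f (\<phi> q)) q \<in> M'.W c"
    using wt f_W by (auto simp: Q_weight_space_def)
  ultimately show ?thesis by (simp add: Hom_Q_def)
qed

lemma Farr_eq: "Farr = (\<lambda>\<Phi>\<in>carrier M.FM. \<lambda>x\<in>M.L. \<lambda>q\<in>carrier (M.Q (b x)). f (\<Phi> x q))"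
  by (simp add: Hom_P_functor_def M.FM_carrier)

lemma Farr_closed: "\<Phi> \<in> carrier M.FM \<Longrightarrow> Farr \<Phi> \<in> carrier M'.FM"
proof -
  assume \<Phi>: "\<Phi> \<in> carrier M.FM"
  then have h: "\<And>x. x \<in> M.L \<Longrightarrow> \<Phi> x \<in> M.HomQ (b x)" and
    fin: "finite {x \<in> M.L. \<exists>q\<in>carrier (M.Q (b x)). \<Phi> x q \<noteq> \<zero>\<^bsub>M\<^esub>}"
    by (auto simp: M.FM_carrier Hom_sum_def)
  have "{x \<in> M.L. \<exists>q\<in>carrier (M.Q (b x)). Farr \<Phi> x q \<noteq> \<zero>\<^bsub>M'\<^esub>}
      \<subseteq> {x \<in> M.L. \<exists>q\<in>carrier (M.Q (b x)). \<Phi> x q \<noteq> \<zero>\<^bsub>M\<^esub>}"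
  proof
    fix x assume x: "x \<in> {x \<in> M.L. \<exists>q\<in>carrier (M.Q (b x)). Farr \<Phi> x q \<noteq> \<zero>\<^bsub>M'\<^esub>}"
    then obtain q where q: "x \<in> M.L" "q \<in> carrier (M.Q (b x))" "Farr \<Phi> x q \<noteq> \<zero>\<^bsub>M'\<^esub>" by blast
    then have "\<Phi> x q \<noteq> \<zero>\<^bsub>M\<^esub>" using \<Phi> f_zero by (auto simp: Farr_eq)
    then show "x \<in> {x \<in> M.L. \<exists>q\<in>carrier (M.Q (b x)). \<Phi> x q \<noteq> \<zero>\<^bsub>M\<^esub>}" using q by blast
  qed
  then have "finite {x \<in> M.L. \<exists>q\<in>carrier (M.Q (b x)). Farr \<Phi> x q \<noteq> \<zero>\<^bsub>M'\<^esub>}" using fin by (rule finite_subset)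
  moreover have "Farr \<Phi> \<in> (\<Pi>\<^sub>E x\<in>M.L. M'.HomQ (b x))"
    using \<Phi> HomQ_compose[OF h] by (auto simp: Farr_eq)
  ultimately show ?thesis by (simp add: M'.FM_carrier Hom_sum_def)
qed

lemma ev_Farr: "\<Phi> \<in> carrier M.FM \<Longrightarrow> x \<in> M.L \<Longrightarrow> M'.ev (Farr \<Phi>) x = f (M.ev \<Phi> x)"
  by (simp add: Farr_eq eval_one_def M.Q_one_carrier)

lemma Farr_linear: "Farr \<in> linear_maps (H_alg t M.L) M.FM M'.FM"
proof (rule H_linear_mapsI)
  show "left_module (H_alg t M.L) M.FM" "left_module (H_alg t M.L) M'.FM" by (rule M.FM_module, rule M'.FM_module)
  show "Farr \<in> carrier M.FM \<rightarrow>\<^sub>E carrier M'.FM" using Farr_closed by (auto simp: Farr_eq)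
  fix \<Phi> assume \<Phi>: "\<Phi> \<in> carrier M.FM"
  have evc: "M.ev \<Phi> x \<in> carrier M" if "x \<in> M.L" for x using M.W_carrier[OF M.ev_W[OF \<Phi> that]] .
  {
    fix \<Psi> assume \<Psi>: "\<Psi> \<in> carrier M.FM"
    have evc': "M.ev \<Psi> x \<in> carrier M" if "x \<in> M.L" for x using M.W_carrier[OF M.ev_W[OF \<Psi> that]] .
    show "Farr (\<Phi> \<oplus>\<^bsub>M.FM\<^esub> \<Psi>) = Farr \<Phi> \<oplus>\<^bsub>M'.FM\<^esub> Farr \<Psi>"
    proof (rule M'.ev_eqI)
      fix x assume x: "x \<in> M.L"
      show "M'.ev (Farr (\<Phi> \<oplus>\<^bsub>M.FM\<^esub> \<Psi>)) x = M'.ev (Farr \<Phi> \<oplus>\<^bsub>M'.FM\<^esub> Farr \<Psi>) x"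
        unfolding ev_Farr[OF M.F.add.m_closed[OF \<Phi> \<Psi>] x] M'.ev_add M.ev_add M'.fadd_apply[OF x] M.fadd_apply[OF x]
          ev_Farr[OF \<Phi> x] ev_Farr[OF \<Psi> x] by (rule f_add[OF evc[OF x] evc'[OF x]])
    qed (intro Farr_closed M.F.add.m_closed M'.F.add.m_closed \<Phi> \<Psi>)+
  }
  show "Farr (M.F.sact g \<Phi>) = M'.F.sact g (Farr \<Phi>)" for g
  proof (rule M'.ev_eqI)
    fix x assume x: "x \<in> M.L"
    show "M'.ev (Farr (M.F.sact g \<Phi>)) x = M'.ev (M'.F.sact g (Farr \<Phi>)) x"
      unfolding ev_Farr[OF M.F.sact_closed[OF \<Phi>] x] M'.ev_sact[OF Farr_closed[OF \<Phi>] x] M.ev_sact[OF \<Phi> x] ev_Farr[OF \<Phi> x]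
      by (rule f_act[OF M.heval_S evc[OF x]])
  qed (intro Farr_closed M.F.sact_closed M'.F.sact_closed \<Phi>)+
  show "Farr (M.F.cact y z \<Phi>) = M'.F.cact y z (Farr \<Phi>)" for y z
  proof (rule M'.ev_eqI)
    fix x assume x: "x \<in> M.L"
    show "M'.ev (Farr (M.F.cact y z \<Phi>)) x = M'.ev (M'.F.cact y z (Farr \<Phi>)) x"
      unfolding ev_Farr[OF M.F.cact_closed[OF \<Phi>] x] M'.ev_cact[OF Farr_closed[OF \<Phi>] x] M.ev_cact[OF \<Phi> x]
      using x by (auto simp: f_zero ev_Farr[OF \<Phi>] f_tr[OF M.ev_W[OF \<Phi>] M.b_diff])
  qed (intro Farr_closed M.F.cact_closed M'.F.cact_closed \<Phi>)+
qed

end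

lemma D_arrow_ext:
  assumes "D_arrow p t lam M M' b f" "D_arrow p t lam M M' b g"
    and W: "\<And>a v. v \<in> weight_space M a \<Longrightarrow> f v = g v"
  shows "f = g"
proof -
  interpret f: D_arrow p t lam M M' b f by fact
  interpret g: D_arrow p t lam M M' b g by fact
  have "f v = g v" if "v \<in> carrier M" for v
    using that by (rule f.M.additive_induct) (simp_all add: W f.f_add g.f_add f.f_zero g.f_zero)
  then show ?thesis using f.arrow g.arrow linear_maps_ext unfolding D_arrows_def by blast
qed

text \<open>Every weight space is isomorphic, through \<open>tr\<close>, to the one at the base point of its alcove, and on
  the latter the values of an arrow can be read off from the functor.\<close>

lemma Farr_faithful:
  assumes "D_arrow p t lam M M' b f" "D_arrow p t lam M M' b g"
    and eq: "FArr (Hom_P_functor t lam (alcove_labels t lam p) b) M M' f = FArr (Hom_P_functor t lam (alcove_labels t lam p) b) M M' g"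
  shows "f = g"
proof (rule D_arrow_ext[OF assms(1,2)])
  interpret f: D_arrow p t lam M M' b f by fact
  interpret g: D_arrow p t lam M M' b g by fact
  fix a v assume v: "v \<in> f.M.W a"
  have base: "f w = g w" if x: "x \<in> f.M.L" and w: "w \<in> f.M.W (b x)" for x w
    using f.ev_Farr[OF f.M.single_FM(1)[OF w] x] g.ev_Farr[OF f.M.single_FM(1)[OF w] x] eq f.M.single_FM(2)[OF w x] by simp
  show "f v = g v"
  proof (cases "a \<in> lattice_fiber t lam")
    case False
    then show ?thesis using f.M.W_empty[OF False v] f.f_zero g.f_zero by simp
  next
    case True
    let ?x = "alcove_of p a"
    have x: "?x \<in> f.M.L" by (rule f.M.fiber_alcove[OF True])
    have d: "b ?x - a \<in> g_star t" "a - b ?x \<in> g_star t"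
      using fiber_diff[OF f.M.b_fiber[OF x] True] fiber_diff[OF True f.M.b_fiber[OF x]] by auto
    let ?w = "f.M.tr (b ?x) a v"
    have w: "?w \<in> f.M.W (b ?x)" by (rule f.M.tr_W[OF d(1) v])
    have "v = f.M.tr a (b ?x) ?w" using f.M.tr_inverse[OF v d(1) f.M.alcove_of_b[OF x]] by simp
    then show ?thesis using f.f_tr[OF w d(2)] g.f_tr[OF w d(2)] base[OF x w] by metis
  qed
qed

subsection \<open>Fullness\<close>

context equivariant
begin

text \<open>No power of \<open>s\<close> appears if one of the two steps stays inside an alcove.\<close>

lemma tr_tr_left:
  assumes "v \<in> W a" "a' - a \<in> g_star t" "a'' - a' \<in> g_star t" "alcove_of p a'' = alcove_of p a' \<or> alcove_of p a' = alcove_of p a"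
  shows "tr a'' a' (tr a' a v) = tr a'' a v"
proof -
  have "eta (alcove_of p a'') (alcove_of p a') (alcove_of p a) = 0" using assms(4) by auto
  moreover have "a'' - a \<in> g_star t" using g_star_add[OF assms(3,2)] by simp
  ultimately show ?thesis using tr_tr[OF assms(1-3)] W_carrier[OF tr_W[of a'' a v]] assms(1) by simp
qed

end

locale H_arrow = M: D_family p t lam M b + M': D_family p t lam M' b
  for p t lam and M M' :: "('n::finite, 'k::field, 'v) Dmod" and b +
  fixes g assumes g_linear: "g \<in> linear_maps (H_alg t M.L) M.FM M'.FM"
begin

lemma g_closed: "\<Phi> \<in> carrier M.FM \<Longrightarrow> g \<Phi> \<in> carrier M'.FM"
  using linear_maps_funcset[OF g_linear] by auto

lemma g_add: "\<Phi> \<in> carrier M.FM \<Longrightarrow> \<Psi> \<in> carrier M.FM \<Longrightarrow> g (\<Phi> \<oplus>\<^bsub>M.FM\<^esub> \<Psi>) = g \<Phi> \<oplus>\<^bsub>M'.FM\<^esub> g \<Psi>"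
  using g_linear by (simp add: linear_maps_def)

lemma g_hact: "\<Phi> \<in> carrier M.FM \<Longrightarrow> g (M.F.hact h \<Phi>) = M'.F.hact h (g \<Phi>)"
  using g_linear by (simp add: linear_maps_def carrier_H_alg)

definition component_map where "component_map x v = M'.ev (g (M.single x v)) x"

lemma component_map_W: "x \<in> M.L \<Longrightarrow> v \<in> M.W (b x) \<Longrightarrow> component_map x v \<in> M'.W (b x)"
  unfolding component_map_def by (rule M'.ev_W[OF g_closed[OF M.single_FM(1)]])

lemma component_map_add: "x \<in> M.L \<Longrightarrow> v \<in> M.W (b x) \<Longrightarrow> w \<in> M.W (b x) \<Longrightarrow> component_map x (v \<oplus>\<^bsub>M\<^esub> w) = component_map x v \<oplus>\<^bsub>M'\<^esub> component_map x w"
  unfolding component_map_def by (simp add: M.single_add g_add M.single_FM(1) M'.ev_add)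

lemma component_map_heval: "x \<in> M.L \<Longrightarrow> v \<in> M.W (b x) \<Longrightarrow> component_map x (M.act (heval (b x) f) v) = M'.act (heval (b x) f) (component_map x v)"
  unfolding component_map_def by (simp add: M.single_heval g_hact M.single_FM(1) M'.ev_sact g_closed)

lemma component_map_tr:
  assumes x: "x \<in> M.L" and y: "y \<in> M.L" and v: "v \<in> M.W (b y)"
  shows "component_map x (M.tr (b x) (b y) v) = M'.tr (b x) (b y) (component_map y v)"
proof -
  have s: "M.single y v \<in> carrier M.FM" by (rule M.single_FM(1)[OF v])
  have t: "M.tr (b x) (b y) v \<in> M.W (b x)" by (rule M.tr_W[OF M.b_diff[OF x y] v])
  have "M.F.cact x y (M.single y v) = M.single x (M.tr (b x) (b y) v)"
    by (rule M.ev_eqI[OF M.F.cact_closed[OF s] M.single_FM(1)[OF t]])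
      (use x y in \<open>simp add: M.ev_cact[OF s] M.single_FM(2)[OF v] M.single_FM(2)[OF t]\<close>)
  then show ?thesis
    unfolding component_map_def using g_hact[OF s, of "gen (x, y)"] M'.ev_cact[OF g_closed[OF s] x, of x y] y by simp
qed

lemma ev_g:
  assumes \<Phi>: "\<Phi> \<in> carrier M.FM" and x: "x \<in> M.L" shows "M'.ev (g \<Phi>) x = component_map x (M.ev \<Phi> x)"
proof -
  have "component_map x (M.ev \<Phi> x) = M'.ev (M'.F.cact x x (g \<Phi>)) x"
    unfolding component_map_def M.cact_single[OF \<Phi> x, symmetric] g_hact[OF \<Phi>] by (rule refl)
  also have "\<dots> = M'.ev (g \<Phi>) x"
    using M'.ev_cact[OF g_closed[OF \<Phi>] x, of x x] M'.tr_self[OF M'.ev_W[OF g_closed[OF \<Phi>] x]] x by simp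
  finally show ?thesis by simp
qed

text \<open>On \<open>W\<^sub>a\<close> the lift is obtained by transport to the base point of the alcove of \<open>a\<close> and back.\<close>

definition weight_map where
  "weight_map a v = (let x = alcove_of p a in M'.tr a (b x) (component_map x (M.tr (b x) a v)))"

lemma fiber_facts:
  assumes "a \<in> lattice_fiber t lam"
  shows "alcove_of p a \<in> M.L" "b (alcove_of p a) - a \<in> g_star t" "a - b (alcove_of p a) \<in> g_star t"
    "alcove_of p (b (alcove_of p a)) = alcove_of p a"
  using M.fiber_alcove[OF assms] fiber_diff[OF M.b_fiber assms] fiber_diff[OF assms M.b_fiber] M.alcove_of_b
  by auto

lemma weight_map_W: "a \<in> lattice_fiber t lam \<Longrightarrow> v \<in> M.W a \<Longrightarrow> weight_map a v \<in> M'.W a"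
  unfolding weight_map_def Let_def by (intro M'.tr_W component_map_W M.tr_W fiber_facts)

lemma weight_map_add:
  assumes a: "a \<in> lattice_fiber t lam" and vw: "v \<in> M.W a" "w \<in> M.W a"
  shows "weight_map a (v \<oplus>\<^bsub>M\<^esub> w) = weight_map a v \<oplus>\<^bsub>M'\<^esub> weight_map a w"
  unfolding weight_map_def Let_def M.tr_add[OF fiber_facts(2)[OF a] vw]
    component_map_add[OF fiber_facts(1)[OF a] M.tr_W[OF fiber_facts(2)[OF a] vw(1)] M.tr_W[OF fiber_facts(2)[OF a] vw(2)]]
  by (rule M'.tr_add[OF fiber_facts(3)[OF a]]) (intro component_map_W M.tr_W fiber_facts a vw)+

lemma weight_map_zero: "a \<in> lattice_fiber t lam \<Longrightarrow> weight_map a \<zero>\<^bsub>M\<^esub> = \<zero>\<^bsub>M'\<^esub>"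
  using weight_map_add[of a "\<zero>\<^bsub>M\<^esub>" "\<zero>\<^bsub>M\<^esub>"] M'.W_carrier[OF weight_map_W[of a "\<zero>\<^bsub>M\<^esub>"]]
  by (intro M'.eq_zero_if_add_self) auto

text \<open>By \<open>act_eq_tr\<close> the element \<open>u\<close> acts as a polynomial followed by a transport. The polynomial commutes
  with everything, and the detours through base points stay inside alcoves and so cost nothing.\<close>

lemma weight_map_act:
  assumes a: "a \<in> lattice_fiber t lam" and v: "v \<in> M.W a" and c: "c \<in> g_star t" and u: "u \<in> weyl_weights {c}"
  shows "weight_map (a + c) (M.act u v) = M'.act u (weight_map a v)"
proof -
  let ?a' = "a + c" let ?x = "alcove_of p a" and ?x' = "alcove_of p (a + c)" and ?n = "ncoeff p u (a + c) a"
  have a': "?a' \<in> lattice_fiber t lam" by (rule fiber_add[OF a c])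
  note F = fiber_facts[OF a] and F' = fiber_facts[OF a']
  have d: "?a' - a \<in> g_star t" using c by simp
  have u': "u \<in> weyl_weights {?a' - a}" using u by simp
  have e: "b ?x' - a \<in> g_star t" "b ?x' - b ?x \<in> g_star t" "?a' - b ?x \<in> g_star t"
    using fiber_diff[OF M.b_fiber[OF F'(1)] a] M.b_diff[OF F'(1) F(1)] fiber_diff[OF a' M.b_fiber[OF F(1)]] by auto
  let ?w = "M.act (heval a ?n) v"
  have w: "?w \<in> M.W a" using v by (rule M.heval_W)
  let ?z = "component_map ?x (M.tr (b ?x) a ?w)"
  have tw: "M.tr (b ?x) a ?w \<in> M.W (b ?x)" by (rule M.tr_W[OF F(2) w])
  have z: "?z \<in> M'.W (b ?x)" by (rule component_map_W[OF F(1) tw])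
  have "M.tr (b ?x') ?a' (M.tr ?a' a ?w) = M.tr (b ?x') a ?w"
    by (rule M.tr_tr_left[OF w d F'(2)]) (simp add: F'(4))
  also have "\<dots> = M.tr (b ?x') (b ?x) (M.tr (b ?x) a ?w)"
    by (rule M.tr_tr_left[OF w F(2) e(2), symmetric]) (simp add: F(4))
  finally have 1: "weight_map ?a' (M.act u v) = M'.tr ?a' (b ?x') (M'.tr (b ?x') (b ?x) ?z)"
    unfolding weight_map_def Let_def M.act_eq_tr[OF d u' v] by (simp only: component_map_tr[OF F'(1) F(1) tw])
  have 2: "M'.tr ?a' (b ?x') (M'.tr (b ?x') (b ?x) ?z) = M'.tr ?a' (b ?x) ?z"
    by (rule M'.tr_tr_left[OF z e(2) F'(3)]) (simp add: F'(4))
  have v': "M.tr (b ?x) a v \<in> M.W (b ?x)" by (rule M.tr_W[OF F(2) v])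
  have g': "component_map ?x (M.tr (b ?x) a v) \<in> M'.W (b ?x)" by (rule component_map_W[OF F(1) v'])
  have "M'.act (heval a ?n) (weight_map a v) = M'.tr a (b ?x) ?z"
    unfolding weight_map_def Let_def M.tr_heval[OF F(2) v] component_map_heval[OF F(1) v'] M'.tr_heval[OF F(3) g'] by (rule refl)
  then have "M'.act u (weight_map a v) = M'.tr ?a' a (M'.tr a (b ?x) ?z)"
    by (simp only: M'.act_eq_tr[OF d u' weight_map_W[OF a v]])
  also have "\<dots> = M'.tr ?a' (b ?x) ?z"
    by (rule M'.tr_tr_left[OF z F(3) d]) (simp add: F(4))
  finally show ?thesis using 1 2 by simp
qed

definition lift where
  "lift = (\<lambda>v\<in>carrier M. \<Oplus>\<^bsub>M'\<^esub>a\<in>coact_supp M v. weight_map a (coact M v a))"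

lemma lift_superset:
  assumes v: "v \<in> carrier M" and A: "finite A" "coact_supp M v \<subseteq> A" "A \<subseteq> lattice_fiber t lam"
  shows "lift v = (\<Oplus>\<^bsub>M'\<^esub>a\<in>A. weight_map a (coact M v a))"
proof -
  have "(\<Oplus>\<^bsub>M'\<^esub>a\<in>coact_supp M v. weight_map a (coact M v a)) = (\<Oplus>\<^bsub>M'\<^esub>a\<in>A. weight_map a (coact M v a))"
  proof (rule M'.add.finprod_mono_neutral_cong_left)
    show "\<And>i. i \<in> A - coact_supp M v \<Longrightarrow> weight_map i (coact M v i) = \<zero>\<^bsub>M'\<^esub>"
      using A(3) weight_map_zero by (auto simp: coact_supp_def)
    show "(\<lambda>a. weight_map a (coact M v a)) \<in> A \<rightarrow> carrier M'"
      using A(3) M'.W_carrier[OF weight_map_W[OF _ M.coact_W[OF v]]] by blast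
  qed (use A in auto)
  then show ?thesis using v by (simp add: lift_def)
qed

lemma lift_closed: "v \<in> carrier M \<Longrightarrow> lift v \<in> carrier M'"
  unfolding lift_def using M.T_weight M'.W_carrier[OF weight_map_W[OF _ M.coact_W]]
  by (auto intro!: M'.finsum_closed)

lemma lift_add:
  assumes "v \<in> carrier M" "w \<in> carrier M" shows "lift (v \<oplus>\<^bsub>M\<^esub> w) = lift v \<oplus>\<^bsub>M'\<^esub> lift w"
proof -
  let ?A = "coact_supp M v \<union> coact_supp M w"
  have A: "finite ?A" "?A \<subseteq> lattice_fiber t lam" using assms M.T_weight by auto
  have s: "coact_supp M (v \<oplus>\<^bsub>M\<^esub> w) \<subseteq> ?A" using assms by (auto simp: coact_supp_def M.coact_add)
  have c: "(\<lambda>a. weight_map a (coact M v a)) \<in> ?A \<rightarrow> carrier M'" "(\<lambda>a. weight_map a (coact M w a)) \<in> ?A \<rightarrow> carrier M'"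
    using A(2) M'.W_carrier[OF weight_map_W[OF _ M.coact_W]] assms by blast+
  have "lift (v \<oplus>\<^bsub>M\<^esub> w) = (\<Oplus>\<^bsub>M'\<^esub>a\<in>?A. weight_map a (coact M (v \<oplus>\<^bsub>M\<^esub> w) a))"
    by (rule lift_superset[OF _ A(1) s A(2)]) (use assms in simp)
  also have "\<dots> = (\<Oplus>\<^bsub>M'\<^esub>a\<in>?A. weight_map a (coact M v a) \<oplus>\<^bsub>M'\<^esub> weight_map a (coact M w a))"
    by (rule M'.finsum_cong') (use A(2) c assms in \<open>auto simp: M.coact_add weight_map_add Pi_def\<close>)
  also have "\<dots> = (\<Oplus>\<^bsub>M'\<^esub>a\<in>?A. weight_map a (coact M v a)) \<oplus>\<^bsub>M'\<^esub> (\<Oplus>\<^bsub>M'\<^esub>a\<in>?A. weight_map a (coact M w a))"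
    by (rule M'.finsum_addf[OF c])
  finally show ?thesis
    using lift_superset[OF assms(1) A(1) _ A(2)] lift_superset[OF assms(2) A(1) _ A(2)] by simp
qed

lemma lift_W: "v \<in> M.W a \<Longrightarrow> a \<in> lattice_fiber t lam \<Longrightarrow> lift v = weight_map a v"
proof -
  assume v: "v \<in> M.W a" and a: "a \<in> lattice_fiber t lam"
  have s: "coact_supp M v \<subseteq> {a}" using M.coact_of_W[OF v] by (auto simp: coact_supp_def)
  have "lift v = (\<Oplus>\<^bsub>M'\<^esub>c\<in>{a}. weight_map c (coact M v c))"
    by (rule lift_superset[OF M.W_carrier[OF v] _ s]) (use a in auto)
  then show ?thesis using M.coact_of_W[OF v, of a] M'.W_carrier[OF weight_map_W[OF a v]] by simp
qed

lemma lift_zero: "lift \<zero>\<^bsub>M\<^esub> = \<zero>\<^bsub>M'\<^esub>"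
  using lift_add[of "\<zero>\<^bsub>M\<^esub>" "\<zero>\<^bsub>M\<^esub>"] lift_closed[of "\<zero>\<^bsub>M\<^esub>"] by (intro M'.eq_zero_if_add_self) auto

lemma lift_W_closed: "v \<in> M.W a \<Longrightarrow> lift v \<in> M'.W a"
  using lift_W[of v a] weight_map_W[of a v] M.W_empty[of a v] lift_zero by (cases "a \<in> lattice_fiber t lam") auto

lemma lift_act:
  assumes "u \<in> M.S" "v \<in> carrier M" shows "lift (M.act u v) = M'.act u (lift v)"
  using assms(2)
proof (rule M.additive_induct)
  fix a v assume v: "v \<in> M.W a"
  then have vc: "v \<in> carrier M" by (rule M.W_carrier)
  show "lift (M.act u v) = M'.act u (lift v)"
  proof (cases "a \<in> lattice_fiber t lam")
    case False
    then show ?thesis using M.W_empty[OF False v] assms(1) lift_zero by simp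
  next
    case a: True
    show ?thesis
      using assms(1)
    proof (induction rule: T_invariants_induct)
      case zero
      then show ?case using vc lift_closed[OF vc] by (simp add: lift_zero)
    next
      case (homogeneous u c)
      have "M.act u v \<in> M.W (a + c)" using M.act_W[OF homogeneous(2,1) v] by (simp add: add.commute)
      then show ?case
        using lift_W[OF _ fiber_add[OF a homogeneous(1)]] weight_map_act[OF a v homogeneous] lift_W[OF v a] by simp
    next
      case (add u u')
      then show ?case using vc lift_closed[OF vc] by (simp add: M.act_add_left M'.act_add_left lift_add)
    qed
  qed
next
  show "lift (M.act u \<zero>\<^bsub>M\<^esub>) = M'.act u (lift \<zero>\<^bsub>M\<^esub>)" using assms(1) by (simp add: lift_zero)
next
  fix v w assume "v \<in> carrier M" "w \<in> carrier M" "lift (M.act u v) = M'.act u (lift v)" "lift (M.act u w) = M'.act u (lift w)"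
  then show "lift (M.act u (v \<oplus>\<^bsub>M\<^esub> w)) = M'.act u (lift (v \<oplus>\<^bsub>M\<^esub> w))"
    using assms(1) by (simp add: M.act_add lift_add M'.act_add lift_closed)
qed

lemma lift_coact:
  assumes "v \<in> carrier M" shows "lift (coact M v c) = coact M' (lift v) c"
  using assms
proof (rule M.additive_induct)
  fix a v assume v: "v \<in> M.W a"
  show "lift (coact M v c) = coact M' (lift v) c"
    using M.coact_of_W[OF v, of c] M'.coact_of_W[OF lift_W_closed[OF v], of c] lift_zero by simp
next
  fix v w assume "v \<in> carrier M" "w \<in> carrier M" "lift (coact M v c) = coact M' (lift v) c" "lift (coact M w c) = coact M' (lift w) c"
  then show "lift (coact M (v \<oplus>\<^bsub>M\<^esub> w) c) = coact M' (lift (v \<oplus>\<^bsub>M\<^esub> w)) c"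
    by (simp add: M.coact_add lift_add M'.coact_add lift_closed)
qed (simp add: lift_zero)

lemma lift_arrow: "lift \<in> D_arrows t lam M M'"
proof -
  have "lift \<in> carrier M \<rightarrow>\<^sub>E carrier M'" using lift_closed by (auto simp: lift_def)
  moreover have "lift (r \<odot>\<^bsub>M\<^esub> v) = r \<odot>\<^bsub>M'\<^esub> lift v" if "r \<in> carrier (A_lam t lam)" "v \<in> carrier M" for r v
    using that lift_act by (auto simp: carrier_A_lam)
  ultimately show ?thesis by (simp add: D_arrows_def linear_maps_def lift_add lift_coact)
qed

theorem Farr_lift: "FArr (Hom_P_functor t lam M.L b) M M' lift = g"
proof -
  interpret l: D_arrow p t lam M M' b lift by unfold_locales (rule lift_arrow)
  show ?thesis
  proof (rule linear_maps_ext[OF l.Farr_linear g_linear])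
    fix \<Phi> assume \<Phi>: "\<Phi> \<in> carrier M.FM"
    show "l.Farr \<Phi> = g \<Phi>"
    proof (rule M'.ev_eqI[OF l.Farr_closed[OF \<Phi>] g_closed[OF \<Phi>]])
      fix x assume x: "x \<in> M.L"
      note w = M.ev_W[OF \<Phi> x]
      have "lift (M.ev \<Phi> x) = component_map x (M.ev \<Phi> x)"
        using lift_W[OF w M.b_fiber[OF x]] M.tr_self[OF w] M'.tr_self[OF component_map_W[OF x w]]
        by (simp add: weight_map_def M.alcove_of_b[OF x])
      then show "M'.ev (l.Farr \<Phi>) x = M'.ev (g \<Phi>) x"
        by (simp only: l.ev_Farr[OF \<Phi> x] ev_g[OF \<Phi> x])
    qed
  qed
qed

end

section \<open>Reconstructing a module from its alcove components\<close>

locale H_object = H_action t "alcove_labels t lam p" N + char_p p "TYPE('k)"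
  for p and t :: "(int ^ 'n::finite) set" and lam and N :: "(('n, 'k::field) Hfree set, 'w) module" +
  assumes object: "N \<in> H_modules_o t (alcove_labels t lam p)"
begin

abbreviation L where "L \<equiv> alcove_labels t lam p"

abbreviation fiber where "fiber \<equiv> lattice_fiber t lam"

abbreviation move where "move a' a v \<equiv> cact (alcove_of p a') (alcove_of p a) v"

lemma cact_idem: "x \<in> L \<Longrightarrow> y \<in> L \<Longrightarrow> v \<in> carrier N \<Longrightarrow> cact x x (cact x y v) = cact x y v"
  by (simp add: cact_cact sact_one cact_closed)

lemma cact_idem_right: "x \<in> L \<Longrightarrow> y \<in> L \<Longrightarrow> v \<in> carrier N \<Longrightarrow> cact x y (cact y y v) = cact x y v"
  by (simp add: cact_cact sact_one cact_closed)

lemma finite_span: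
  obtains B where "finite B" "B \<subseteq> carrier N" "carrier N \<subseteq> kspan B"
proof -
  obtain B where B: "finite B" "B \<subseteq> carrier N"
    "\<forall>v\<in>carrier N. \<exists>c :: 'w \<Rightarrow> 'k. v = (\<Oplus>\<^bsub>N\<^esub>w\<in>B. H_cls t L (H_scal (Poly_Mapping.single 0 (c w))) \<odot>\<^bsub>N\<^esub> w)"
    using object unfolding H_modules_o_def by blast
  have "carrier N \<subseteq> kspan B"
  proof
    fix v assume "v \<in> carrier N"
    then obtain c :: "'w \<Rightarrow> 'k" where c: "v = (\<Oplus>\<^bsub>N\<^esub>w\<in>B. hact (H_scal (s_const (c w))) w)"
      using B(3) unfolding s_const_def by blast
    show "v \<in> kspan B" unfolding c by (rule combination_kspan[OF B(2)])
  qed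
  with B(1,2) show ?thesis by (rule that)
qed

definition supp where "supp = {x \<in> L. \<exists>v\<in>carrier N. cact x x v \<noteq> \<zero>\<^bsub>N\<^esub>}"

lemma supp_L: "x \<in> supp \<Longrightarrow> x \<in> L" by (simp add: supp_def)

lemma local_unit:
  assumes "v \<in> carrier N"
  obtains X where "finite X" "X \<subseteq> L" "v = (\<Oplus>\<^bsub>N\<^esub>x\<in>X. cact x x v)"
proof -
  have "\<exists>X. finite X \<and> X \<subseteq> L \<and> v = (\<Oplus>\<^bsub>N\<^esub>x\<in>X. cact x x v)"
    using object assms unfolding H_modules_o_def by blast
  then show ?thesis using that by (elim exE conjE)
qed

text \<open>A spanning vector is fixed by a local unit with finitely many labels, and so it is killed by the
  idempotents of all other labels.\<close>

lemma finite_supp: "finite supp"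
proof -
  obtain B where B: "finite B" "B \<subseteq> carrier N" "carrier N \<subseteq> kspan B" by (rule finite_span)
  have "\<forall>w\<in>B. \<exists>X. finite X \<and> X \<subseteq> L \<and> w = (\<Oplus>\<^bsub>N\<^esub>x\<in>X. cact x x w)"
  proof
    fix w assume "w \<in> B"
    then have "w \<in> carrier N" using B(2) by (rule rev_subsetD)
    then obtain X where "finite X" "X \<subseteq> L" "w = (\<Oplus>\<^bsub>N\<^esub>x\<in>X. cact x x w)" by (rule local_unit)
    then show "\<exists>X. finite X \<and> X \<subseteq> L \<and> w = (\<Oplus>\<^bsub>N\<^esub>x\<in>X. cact x x w)" by (intro exI conjI)
  qed
  from bchoice[OF this] obtain X where
    X: "\<And>w. w \<in> B \<Longrightarrow> finite (X w)" "\<And>w. w \<in> B \<Longrightarrow> X w \<subseteq> L" "\<And>w. w \<in> B \<Longrightarrow> w = (\<Oplus>\<^bsub>N\<^esub>x\<in>X w. cact x x w)"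
    by auto
  have "supp \<subseteq> \<Union> (X ` B)"
  proof
    fix x assume "x \<in> supp"
    then obtain v where x: "x \<in> L" and v: "v \<in> carrier N" "cact x x v \<noteq> \<zero>\<^bsub>N\<^esub>" by (auto simp: supp_def)
    show "x \<in> \<Union> (X ` B)"
    proof (rule ccontr)
      assume nx: "x \<notin> \<Union> (X ` B)"
      have base: "cact x x w = \<zero>\<^bsub>N\<^esub>" if w: "w \<in> B" for w
      proof -
        have wc: "w \<in> carrier N" using w B(2) by blast
        have f: "(\<lambda>y. cact y y w) \<in> X w \<rightarrow> carrier N" using cact_closed[OF wc] by blast
        have "cact x x (\<Oplus>\<^bsub>N\<^esub>y\<in>X w. cact y y w) = (\<Oplus>\<^bsub>N\<^esub>y\<in>X w. cact x x (cact y y w))"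
          by (rule act_finsum[OF UNIV_I f])
        also have "\<dots> = (\<Oplus>\<^bsub>N\<^esub>y\<in>X w. \<zero>\<^bsub>N\<^esub>)"
        proof (rule finsum_cong')
          fix y assume "y \<in> X w"
          then have "y \<in> L" "x \<noteq> y" using X(2)[OF w] nx w by auto
          then show "cact x x (cact y y w) = \<zero>\<^bsub>N\<^esub>" by (intro cact_cact_neq x wc)
        qed auto
        finally have "cact x x (\<Oplus>\<^bsub>N\<^esub>y\<in>X w. cact y y w) = \<zero>\<^bsub>N\<^esub>" by simp
        then show ?thesis by (simp only: X(3)[OF w, symmetric])
      qed
      have "v \<in> kspan B" using v(1) B(3) by blast
      then have "cact x x v = \<zero>\<^bsub>N\<^esub>"
      proof (induction rule: kspan.induct)
        case (add v w)
        then show ?case using kspan_carrier[OF B(2)] by (simp add: act_add)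
      next
        case (scale v c)
        have "cact x x (sact (s_const c) v) = sact (s_const c) (cact x x v)"
          by (rule sact_hact[OF kspan_carrier[OF B(2) scale(1)], symmetric])
        then show ?case using scale(2) by simp
      qed (simp_all add: base)
      with v(2) show False ..
    qed
  qed
  moreover have "finite (\<Union> (X ` B))" using B(1) X(1) by blast
  ultimately show ?thesis by (rule finite_subset)
qed

lemma cact_outside_supp:
  assumes "x \<in> L" "x \<notin> supp" "y \<in> L" "v \<in> carrier N" shows "cact x y v = \<zero>\<^bsub>N\<^esub>"
proof -
  have "cact x x (cact x y v) = \<zero>\<^bsub>N\<^esub>" using assms cact_closed[OF assms(4)] by (auto simp: supp_def)
  then show ?thesis using cact_idem[OF assms(1,3,4)] by simp
qed

lemma sum_components:
  assumes v: "v \<in> carrier N" shows "(\<Oplus>\<^bsub>N\<^esub>x\<in>supp. cact x x v) = v"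
proof -
  obtain X where X: "finite X" "X \<subseteq> L" "v = (\<Oplus>\<^bsub>N\<^esub>x\<in>X. cact x x v)" using v by (rule local_unit)
  have c: "(\<lambda>x. cact x x v) \<in> A \<rightarrow> carrier N" for A using cact_closed[OF v] by blast
  have "(\<Oplus>\<^bsub>N\<^esub>x\<in>supp. cact x x v) = (\<Oplus>\<^bsub>N\<^esub>x\<in>X \<union> supp. cact x x v)"
    by (rule add.finprod_mono_neutral_cong_left)
      (use X(1,2) v finite_supp c cact_outside_supp in auto)
  also have "\<dots> = (\<Oplus>\<^bsub>N\<^esub>x\<in>X. cact x x v)"
  proof (rule add.finprod_mono_neutral_cong_right)
    fix x assume x: "x \<in> X \<union> supp - X"
    then have xL: "x \<in> L" and nX: "x \<notin> X" using supp_L by auto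
    have "cact x x (\<Oplus>\<^bsub>N\<^esub>y\<in>X. cact y y v) = (\<Oplus>\<^bsub>N\<^esub>y\<in>X. cact x x (cact y y v))"
      by (rule act_finsum[OF UNIV_I c])
    also have "\<dots> = (\<Oplus>\<^bsub>N\<^esub>y\<in>X. \<zero>\<^bsub>N\<^esub>)"
    proof (rule finsum_cong')
      fix y assume "y \<in> X"
      then have "y \<in> L" "x \<noteq> y" using X(2) nX by auto
      then show "cact x x (cact y y v) = \<zero>\<^bsub>N\<^esub>" by (intro cact_cact_neq xL v)
    qed auto
    finally have "cact x x (\<Oplus>\<^bsub>N\<^esub>y\<in>X. cact y y v) = \<zero>\<^bsub>N\<^esub>" by simp
    then show "cact x x v = \<zero>\<^bsub>N\<^esub>" by (simp only: X(3)[symmetric])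
  qed (use X(1) finite_supp c in auto)
  finally show ?thesis by (simp only: X(3)[symmetric])
qed

lemma H_scal_power: "H_scal (f ^ k) = (H_scal f ^ k :: ('n, 'k) Hfree)"
  by (induction k) (simp_all add: H_scal_simps)

lemma nilpotent_ideal:
  obtains m where "\<And>f v. f \<in> s_power_ideal m \<Longrightarrow> v \<in> carrier N \<Longrightarrow> sact f v = \<zero>\<^bsub>N\<^esub>"
proof -
  have "\<forall>i. \<exists>m. \<forall>v\<in>carrier N. ((\<lambda>w. H_cls t L (H_scal (s_var i)) \<odot>\<^bsub>N\<^esub> w) ^^ m) v = \<zero>\<^bsub>N\<^esub>"
    using object unfolding H_modules_o_def by blast
  from choice[OF this] obtain k where
    k: "\<forall>i. \<forall>v\<in>carrier N. ((\<lambda>w. H_cls t L (H_scal (s_var i)) \<odot>\<^bsub>N\<^esub> w) ^^ k i) v = \<zero>\<^bsub>N\<^esub>" ..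
  define m where "m = Max (range k)"
  have var: "sact (s_var i ^ m) v = \<zero>\<^bsub>N\<^esub>" if v: "v \<in> carrier N" for i v
  proof -
    have "((\<lambda>w. sact (s_var i) w) ^^ k i) v = \<zero>\<^bsub>N\<^esub>" using k v by blast
    then have "hact (H_scal (s_var i) ^ k i) v = \<zero>\<^bsub>N\<^esub>" by (simp only: act_power[OF UNIV_I v])
    then have "hact (H_scal (s_var i) ^ m) v = \<zero>\<^bsub>N\<^esub>" by (rule power_act_zero[OF UNIV_I v]) (simp add: m_def)
    then show ?thesis by (simp only: H_scal_power)
  qed
  have "sact f v = \<zero>\<^bsub>N\<^esub>" if f: "f \<in> s_power_ideal m" and v: "v \<in> carrier N" for f v
  proof -
    obtain h where h: "f = (\<Sum>i\<in>UNIV. h i * s_var i ^ m)" using f by (auto simp: s_power_ideal_def)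
    have "sact (\<Sum>i\<in>I. h i * s_var i ^ m) v = \<zero>\<^bsub>N\<^esub>" for I
      by (induction I rule: infinite_finite_induct)
        (simp_all add: v sact_add_left sact_zero_left sact_mult var cact_closed)
    then show ?thesis unfolding h .
  qed
  then show ?thesis by (rule that)
qed

definition nilpotency_bound where
  "nilpotency_bound = (SOME m. \<forall>f\<in>(s_power_ideal m :: ('n, 'k) s_poly set). \<forall>v\<in>carrier N. sact f v = \<zero>\<^bsub>N\<^esub>)"

lemma sact_nil: "f \<in> s_power_ideal nilpotency_bound \<Longrightarrow> v \<in> carrier N \<Longrightarrow> sact f v = \<zero>\<^bsub>N\<^esub>"
proof -
  have "\<exists>m. \<forall>f\<in>(s_power_ideal m :: ('n, 'k) s_poly set). \<forall>v\<in>carrier N. sact f v = \<zero>\<^bsub>N\<^esub>"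
    using nilpotent_ideal by metis
  from someI_ex[OF this] show "f \<in> s_power_ideal nilpotency_bound \<Longrightarrow> v \<in> carrier N \<Longrightarrow> sact f v = \<zero>\<^bsub>N\<^esub>"
    unfolding nilpotency_bound_def by blast
qed

definition weights where "weights = {a \<in> fiber. alcove_of p a \<in> supp}"

lemma finite_weights: "finite weights"
proof -
  have "weights \<subseteq> (\<Union>x\<in>supp. {a. \<forall>i. a $ i \<in> {int p * x $ i..<int p * x $ i + int p}})"
  proof
    fix a assume "a \<in> weights"
    then have s: "alcove_of p a \<in> supp" by (simp add: weights_def)
    have "int p > 0" using p_pos by simp
    have "a $ i \<in> {int p * alcove_of p a $ i..<int p * alcove_of p a $ i + int p}" for i
    proof -
      have "int p * (a $ i div int p) + a $ i mod int p = a $ i" "0 \<le> a $ i mod int p" "a $ i mod int p < int p"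
        using \<open>int p > 0\<close> by simp_all
      then show ?thesis unfolding alcove_of_def vec_lambda_beta atLeastLessThan_iff by linarith
    qed
    with s show "a \<in> (\<Union>x\<in>supp. {a. \<forall>i. a $ i \<in> {int p * x $ i..<int p * x $ i + int p}})" by blast
  qed
  moreover have "finite (\<Union>x\<in>supp. {a. \<forall>i. a $ i \<in> {int p * x $ i..<int p * x $ i + int p}})"
    by (intro finite_UN_I finite_supp finite_vec_box) simp
  ultimately show ?thesis by (rule finite_subset)
qed

subsection \<open>Families over the weights\<close>

text \<open>A family has its component of weight \<open>a\<close> in \<open>1\<^sub>x N\<close> for the alcove \<open>x\<close> of \<open>a\<close>: in an object, the weight
  spaces of all weights in an alcove are isomorphic.\<close>

definition families where
  "families = {n. (\<forall>a\<in>fiber. n a \<in> carrier N \<and> move a a (n a) = n a) \<and> (\<forall>a. a \<notin> fiber \<longrightarrow> n a = \<zero>\<^bsub>N\<^esub>)}"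

definition families_mod :: "(int ^ 'n \<Rightarrow> 'w) ring" where
  "families_mod = \<lparr>carrier = families, mult = undefined, one = undefined, zero = (\<lambda>_. \<zero>\<^bsub>N\<^esub>), add = (\<lambda>n n' a. n a \<oplus>\<^bsub>N\<^esub> n' a)\<rparr>"

lemma families_carrier: "n \<in> families \<Longrightarrow> n a \<in> carrier N"
  by (cases "a \<in> fiber") (simp_all add: families_def)

lemma families_idem: "n \<in> families \<Longrightarrow> a \<in> fiber \<Longrightarrow> move a a (n a) = n a"
  by (simp add: families_def)

lemma families_outside_fiber: "n \<in> families \<Longrightarrow> a \<notin> fiber \<Longrightarrow> n a = \<zero>\<^bsub>N\<^esub>"
  by (simp add: families_def)

lemma families_outside:
  assumes "n \<in> families" "a \<notin> weights" shows "n a = \<zero>\<^bsub>N\<^esub>"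
proof (cases "a \<in> fiber")
  case True
  have "move a a (n a) = \<zero>\<^bsub>N\<^esub>"
    by (rule cact_outside_supp) (use True assms fiber_alcove families_carrier in \<open>auto simp: weights_def\<close>)
  then show ?thesis using families_idem[OF assms(1) True] by simp
qed (rule families_outside_fiber[OF assms(1)])

lemma fibI:
  assumes "\<And>a. a \<in> fiber \<Longrightarrow> n a \<in> carrier N" "\<And>a. a \<in> fiber \<Longrightarrow> move a a (n a) = n a" "\<And>a. a \<notin> fiber \<Longrightarrow> n a = \<zero>\<^bsub>N\<^esub>"
  shows "n \<in> families"
  using assms by (simp add: families_def)

lemma families_ext: "n \<in> families \<Longrightarrow> n' \<in> families \<Longrightarrow> (\<And>a. a \<in> fiber \<Longrightarrow> n a = n' a) \<Longrightarrow> n = n'"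
  by (rule ext) (metis families_outside_fiber)

lemma families_zero: "(\<lambda>_. \<zero>\<^bsub>N\<^esub>) \<in> families" by (rule fibI) auto

lemma families_add: "n \<in> families \<Longrightarrow> n' \<in> families \<Longrightarrow> (\<lambda>a. n a \<oplus>\<^bsub>N\<^esub> n' a) \<in> families"
  by (rule fibI) (simp_all add: families_carrier families_outside_fiber families_idem act_add)

lemma families_neg: "n \<in> families \<Longrightarrow> (\<lambda>a. \<ominus>\<^bsub>N\<^esub> n a) \<in> families"
  by (rule fibI) (simp_all add: families_carrier families_outside_fiber families_idem act_neg)

lemma abelian_group_families: "abelian_group families_mod"
proof (rule abelian_groupI)
  fix n assume n: "n \<in> carrier families_mod"
  then have "n \<in> families" by (simp add: families_mod_def)
  then show "\<exists>n'\<in>carrier families_mod. n' \<oplus>\<^bsub>families_mod\<^esub> n = \<zero>\<^bsub>families_mod\<^esub>"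
    by (intro bexI[of _ "\<lambda>a. \<ominus>\<^bsub>N\<^esub> n a"]) (simp_all add: families_mod_def families_neg families_carrier l_neg)
qed (auto simp: families_mod_def families_zero families_add families_carrier a_ac)

definition concentrated where "concentrated a v = (\<lambda>a'. if a' = a then v else \<zero>\<^bsub>N\<^esub>)"

lemma concentrated_families: "n \<in> families \<Longrightarrow> concentrated a (n a) \<in> families"
  by (rule fibI) (auto simp: concentrated_def families_carrier families_idem families_outside_fiber)

lemma concentrated_fib': "a \<in> fiber \<Longrightarrow> v \<in> carrier N \<Longrightarrow> move a a v = v \<Longrightarrow> concentrated a v \<in> families"
  by (rule fibI) (auto simp: concentrated_def)

lemma move_carrier: "v \<in> carrier N \<Longrightarrow> move a' a v \<in> carrier N" by (rule cact_closed)

lemma move_idem: "a' \<in> fiber \<Longrightarrow> a \<in> fiber \<Longrightarrow> v \<in> carrier N \<Longrightarrow> move a' a' (move a' a v) = move a' a v"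
  by (intro cact_idem fiber_alcove)

subsection \<open>The action of the Weyl algebra on families\<close>

text \<open>In every object a homogeneous \<open>u\<close> acts from weight \<open>a\<close> to weight \<open>a'\<close> as \<open>tr a' a\<close> after the polynomial
  \<open>ncoeff p u a' a\<close>, see \<open>act_eq_tr\<close>; here \<open>c\<^sub>x\<^sub>,\<^sub>y\<close> takes the place of \<open>tr\<close>. Weights in alcoves outside of
  the support have zero components.\<close>

definition weyl_act where
  "weyl_act u n = (\<lambda>a'. if a' \<in> fiber then \<Oplus>\<^bsub>N\<^esub>a\<in>weights. sact (ncoeff p u a' a) (move a' a (n a)) else \<zero>\<^bsub>N\<^esub>)"

lemma weyl_act_terms: "n \<in> families \<Longrightarrow> (\<lambda>a. sact (f a) (move a' a (n a))) \<in> A \<rightarrow> carrier N"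
  by (intro funcsetI sact_closed move_carrier families_carrier)

lemma weyl_act_families: assumes n: "n \<in> families" shows "weyl_act u n \<in> families"
proof (rule fibI)
  fix a' assume a': "a' \<in> fiber"
  show "weyl_act u n a' \<in> carrier N" using a' finsum_closed[OF weyl_act_terms[OF n]] by (simp add: weyl_act_def)
  have "move a' a' (\<Oplus>\<^bsub>N\<^esub>a\<in>weights. sact (ncoeff p u a' a) (move a' a (n a)))
      = (\<Oplus>\<^bsub>N\<^esub>a\<in>weights. move a' a' (sact (ncoeff p u a' a) (move a' a (n a))))"
    by (rule act_finsum[OF UNIV_I weyl_act_terms[OF n]])
  also have "\<dots> = (\<Oplus>\<^bsub>N\<^esub>a\<in>weights. sact (ncoeff p u a' a) (move a' a (n a)))"
  proof (rule finsum_cong'[OF refl weyl_act_terms[OF n]])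
    fix a assume a: "a \<in> weights"
    then have af: "a \<in> fiber" by (simp add: weights_def)
    have "move a' a' (sact (ncoeff p u a' a) (move a' a (n a))) = sact (ncoeff p u a' a) (move a' a' (move a' a (n a)))"
      by (rule sact_hact[OF move_carrier[OF families_carrier[OF n]], symmetric])
    then show "move a' a' (sact (ncoeff p u a' a) (move a' a (n a))) = sact (ncoeff p u a' a) (move a' a (n a))"
      by (simp only: move_idem[OF a' af families_carrier[OF n]])
  qed
  finally show "move a' a' (weyl_act u n a') = weyl_act u n a'" using a' by (simp add: weyl_act_def)
qed (simp add: weyl_act_def)

lemma weyl_act_homogeneous:
  assumes u: "u \<in> weyl_weights {c}" and c: "c \<in> g_star t" and n: "n \<in> families" and a: "a \<in> fiber"
  shows "weyl_act u n (a + c) = sact (ncoeff p u (a + c) a) (move (a + c) a (n a))"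
proof -
  let ?f = "\<lambda>e. sact (ncoeff p u (a + c) e) (move (a + c) e (n e))"
  have f: "?f \<in> weights \<rightarrow> carrier N" by (rule weyl_act_terms[OF n])
  have z: "?f e = \<zero>\<^bsub>N\<^esub>" if "e \<noteq> a" for e
  proof -
    have "ncoeff p u (a + c) e = 0" by (rule ncoeff_homogeneous_zero[OF u]) (use that in simp)
    then show ?thesis using sact_zero_left[OF move_carrier[OF families_carrier[OF n]]] by simp
  qed
  have "(\<Oplus>\<^bsub>N\<^esub>e\<in>weights. ?f e) = ?f a"
  proof (cases "a \<in> weights")
    case True
    have "(\<Oplus>\<^bsub>N\<^esub>e\<in>weights. ?f e) = (\<Oplus>\<^bsub>N\<^esub>e\<in>weights. if a = e then ?f e else \<zero>\<^bsub>N\<^esub>)"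
      by (rule finsum_cong') (use f z in auto)
    also have "\<dots> = ?f a" by (rule finsum_singleton[OF True finite_weights f])
    finally show ?thesis .
  next
    case False
    have "(\<Oplus>\<^bsub>N\<^esub>e\<in>weights. ?f e) = (\<Oplus>\<^bsub>N\<^esub>e\<in>weights. \<zero>\<^bsub>N\<^esub>)"
      by (rule finsum_cong') (use False in \<open>auto intro!: z\<close>)
    also have "\<dots> = ?f a" using families_outside[OF n False] by simp
    finally show ?thesis .
  qed
  then show ?thesis using fiber_add[OF a c] by (simp add: weyl_act_def)
qed

lemma families_shift_ext:
  assumes "n \<in> families" "n' \<in> families" "c \<in> g_star t" "\<And>a. a \<in> fiber \<Longrightarrow> n (a + c) = n' (a + c)" shows "n = n'"
proof (rule families_ext[OF assms(1,2)])
  fix a assume "a \<in> fiber"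
  moreover have "- c \<in> g_star t" using g_star_diff[OF g_star_zero assms(3)] by simp
  ultimately have "a - c \<in> fiber" using fiber_add[of a t lam "- c"] by simp
  from assms(4)[OF this] show "n a = n' a" by simp
qed

abbreviation S where "S \<equiv> weyl_weights (g_star t) :: ('n, 'k) weyl set"

lemma weyl_act_add_left:
  assumes "u \<in> S" "v \<in> S" and n: "n \<in> families" shows "weyl_act (u + v) n = (\<lambda>a. weyl_act u n a \<oplus>\<^bsub>N\<^esub> weyl_act v n a)"
proof
  fix a'
  show "weyl_act (u + v) n a' = weyl_act u n a' \<oplus>\<^bsub>N\<^esub> weyl_act v n a'"
  proof (cases "a' \<in> fiber")
    case True
    have "(\<Oplus>\<^bsub>N\<^esub>a\<in>weights. sact (ncoeff p (u + v) a' a) (move a' a (n a)))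
        = (\<Oplus>\<^bsub>N\<^esub>a\<in>weights. sact (ncoeff p u a' a) (move a' a (n a)) \<oplus>\<^bsub>N\<^esub> sact (ncoeff p v a' a) (move a' a (n a)))"
      by (rule finsum_cong')
        (simp_all add: ncoeff_add[OF assms(1,2)] sact_add_left families_carrier[OF n])
    also have "\<dots> = (\<Oplus>\<^bsub>N\<^esub>a\<in>weights. sact (ncoeff p u a' a) (move a' a (n a))) \<oplus>\<^bsub>N\<^esub> (\<Oplus>\<^bsub>N\<^esub>a\<in>weights. sact (ncoeff p v a' a) (move a' a (n a)))"
      by (rule finsum_addf[OF weyl_act_terms[OF n] weyl_act_terms[OF n]])
    finally show ?thesis using True by (simp add: weyl_act_def)
  qed (simp add: weyl_act_def)
qed

lemma weyl_act_add:
  assumes n: "n \<in> families" and n': "n' \<in> families"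
  shows "weyl_act u (\<lambda>a. n a \<oplus>\<^bsub>N\<^esub> n' a) = (\<lambda>a. weyl_act u n a \<oplus>\<^bsub>N\<^esub> weyl_act u n' a)"
proof
  fix a'
  show "weyl_act u (\<lambda>a. n a \<oplus>\<^bsub>N\<^esub> n' a) a' = weyl_act u n a' \<oplus>\<^bsub>N\<^esub> weyl_act u n' a'"
  proof (cases "a' \<in> fiber")
    case True
    have "(\<Oplus>\<^bsub>N\<^esub>a\<in>weights. sact (ncoeff p u a' a) (move a' a (n a \<oplus>\<^bsub>N\<^esub> n' a)))
        = (\<Oplus>\<^bsub>N\<^esub>a\<in>weights. sact (ncoeff p u a' a) (move a' a (n a)) \<oplus>\<^bsub>N\<^esub> sact (ncoeff p u a' a) (move a' a (n' a)))"
      by (rule finsum_cong')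
        (simp_all add: act_add families_carrier[OF n] families_carrier[OF n'])
    also have "\<dots> = (\<Oplus>\<^bsub>N\<^esub>a\<in>weights. sact (ncoeff p u a' a) (move a' a (n a))) \<oplus>\<^bsub>N\<^esub> (\<Oplus>\<^bsub>N\<^esub>a\<in>weights. sact (ncoeff p u a' a) (move a' a (n' a)))"
      by (rule finsum_addf[OF weyl_act_terms[OF n] weyl_act_terms[OF n']])
    finally show ?thesis using True by (simp add: weyl_act_def)
  qed (simp add: weyl_act_def)
qed

lemma weyl_act_zero_left: "n \<in> families \<Longrightarrow> weyl_act 0 n = (\<lambda>_. \<zero>\<^bsub>N\<^esub>)"
proof -
  assume n: "n \<in> families"
  have "(\<Oplus>\<^bsub>N\<^esub>a\<in>weights. sact (ncoeff p 0 a' a) (move a' a (n a))) = (\<Oplus>\<^bsub>N\<^esub>a\<in>weights. \<zero>\<^bsub>N\<^esub>)" for a'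
    by (rule finsum_cong') (simp_all add: sact_zero_left families_carrier[OF n])
  then show ?thesis by (auto simp: weyl_act_def fun_eq_iff)
qed

lemma weyl_act_zero: "weyl_act u (\<lambda>_. \<zero>\<^bsub>N\<^esub>) = (\<lambda>_. \<zero>\<^bsub>N\<^esub>)"
  by (auto simp: weyl_act_def fun_eq_iff)

text \<open>For homogeneous elements the two composition laws, \<open>ncoeff_mult\<close> and the one of the \<open>c\<^sub>x\<^sub>,\<^sub>y\<close>, contribute
  the same power of \<open>s\<close>. The general case follows by additivity.\<close>

lemma weyl_act_mult:
  assumes "u \<in> S" "v \<in> S" and n: "n \<in> families" shows "weyl_act (u * v) n = weyl_act u (weyl_act v n)"
  using assms(1)
proof (induction rule: T_invariants_induct)
  case zero
  show ?case using weyl_act_zero_left n weyl_act_families by simp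
next
  case (homogeneous u d)
  have uS: "u \<in> S" by (rule weyl_weights_subsetD[OF homogeneous(2,1)])
  show ?case
    using assms(2)
  proof (induction rule: T_invariants_induct)
    case zero
    show ?case using n by (simp add: weyl_act_zero_left weyl_act_zero)
  next
    case (homogeneous v c)
    note u = \<open>u \<in> weyl_weights {d}\<close> \<open>d \<in> g_star t\<close>
    have w: "u * v \<in> weyl_weights {d + c}" by (rule weyl_weights_mult[OF u(1) homogeneous(2)]) simp
    show ?case
    proof (rule families_shift_ext[OF weyl_act_families[OF n] weyl_act_families[OF weyl_act_families[OF n]] g_star_add[OF u(2) homogeneous(1)]])
      fix a assume a: "a \<in> fiber"
      have ac: "a + c \<in> fiber" by (rule fiber_add[OF a homogeneous(1)])
      have acd: "a + (d + c) = a + c + d" by (simp add: ac_simps)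
      have acd': "a + c + d \<in> fiber" by (rule fiber_add[OF ac u(2)])
      note L = fiber_alcove[OF a] fiber_alcove[OF ac] fiber_alcove[OF acd']
      have nc: "n a \<in> carrier N" by (rule families_carrier[OF n])
      let ?U = "ncoeff p u (a + c + d) (a + c)" and ?V = "ncoeff p v (a + c) a"
      let ?e = "s_monom (eta (alcove_of p (a + c + d)) (alcove_of p (a + c)) (alcove_of p a)) :: ('n, 'k) s_poly"
      have "weyl_act (u * v) n (a + (d + c)) = sact (?e * (?U * ?V)) (move (a + c + d) a (n a))"
        using weyl_act_homogeneous[OF w g_star_add[OF u(2) homogeneous(1)] n a] ncoeff_mult[OF u(1) homogeneous(2), of "a + c + d" a]
        unfolding acd by simp
      also have "?e * (?U * ?V) = ?U * (?V * ?e)" by (simp add: ac_simps)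
      also have "sact (?U * (?V * ?e)) (move (a + c + d) a (n a)) = sact ?U (sact ?V (sact ?e (move (a + c + d) a (n a))))"
        using nc by (simp add: sact_mult)
      also have "sact ?e (move (a + c + d) a (n a)) = move (a + c + d) (a + c) (move (a + c) a (n a))"
        by (rule cact_cact[OF L(3,2,1) nc, symmetric])
      also have "sact ?V (move (a + c + d) (a + c) (move (a + c) a (n a))) = move (a + c + d) (a + c) (sact ?V (move (a + c) a (n a)))"
        by (rule sact_hact[OF move_carrier[OF nc]])
      also have "sact ?V (move (a + c) a (n a)) = weyl_act v n (a + c)"
        by (rule weyl_act_homogeneous[OF homogeneous(2,1) n a, symmetric])
      also have "sact ?U (move (a + c + d) (a + c) (weyl_act v n (a + c))) = weyl_act u (weyl_act v n) (a + c + d)"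
        by (rule weyl_act_homogeneous[OF u weyl_act_families[OF n] ac, symmetric])
      finally show "weyl_act (u * v) n (a + (d + c)) = weyl_act u (weyl_act v n) (a + (d + c))" unfolding acd .
    qed
  next
    case (add v1 v2)
    have "u * v1 \<in> S" "u * v2 \<in> S" using uS add(1,2) by (auto intro: weyl_weights_mult g_star_add)
    then show ?case using add n by (simp add: distrib_left weyl_act_add_left weyl_act_add weyl_act_families)
  qed
next
  case (add u1 u2)
  have "u1 * v \<in> S" "u2 * v \<in> S" using assms(2) add(1,2) by (auto intro: weyl_weights_mult g_star_add)
  then show ?case using add n by (simp add: distrib_right weyl_act_add_left weyl_act_families)
qed

lemma weyl_act_heval: "n \<in> families \<Longrightarrow> a \<in> fiber \<Longrightarrow> weyl_act (heval a f) n a = sact f (n a)"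
  using weyl_act_homogeneous[OF heval_weight g_star_zero, of n a a f] by (simp add: families_idem ncoeff_heval[of a f])

lemma weyl_act_one: "n \<in> families \<Longrightarrow> weyl_act 1 n = n"
proof (rule families_ext[OF weyl_act_families])
  fix a assume n: "n \<in> families" and a: "a \<in> fiber"
  show "weyl_act 1 n a = n a" using weyl_act_heval[OF n a, of 1] families_carrier[OF n] by (simp add: sact_one)
qed

lemma weyl_act_A_rels:
  assumes "g \<in> A_rels t lam" and n: "n \<in> families" shows "weyl_act g n = (\<lambda>_. \<zero>\<^bsub>N\<^esub>)"
proof (rule families_ext[OF weyl_act_families[OF n] families_zero])
  fix a assume a: "a \<in> fiber"
  obtain x where x: "x \<in> t" "g = (\<Sum>i\<in>UNIV. of_int (x $ i) * hplus i) - of_int (lam x)"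
    using assms(1) by (auto simp: A_rels_def)
  have "lam x = (\<Sum>i\<in>UNIV. x $ i * a $ i)"
    using a x(1) by (auto simp: lattice_fiber_def pairing_def mult.commute)
  then have "heval a (\<Sum>i\<in>UNIV. of_int (x $ i) * s_var i) = g"
    unfolding x(2) by (simp add: heval_sum heval_mult hdiff_def right_diff_distrib sum_subtractf)
  then show "weyl_act g n a = \<zero>\<^bsub>N\<^esub>"
    using weyl_act_heval[OF n a, of "\<Sum>i\<in>UNIV. of_int (x $ i) * s_var i"] torus_relation[OF x(1) families_carrier[OF n]] by simp
qed

lemma ring_act_weyl_act: "ring_act families_mod S weyl_act"
proof -
  interpret abelian_group families_mod by (rule abelian_group_families)
  show ?thesis
    by unfold_locales
      (auto simp: families_mod_def weyl_act_families weyl_act_add_left weyl_act_add weyl_act_mult weyl_act_one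
        intro: weyl_weights_one weyl_weights_diff weyl_weights_mult g_star_add)
qed

end

section \<open>Products of Frobenius monomials\<close>

definition frob :: "nat \<Rightarrow> (nat ^ 'n) \<times> (nat ^ 'n) \<Rightarrow> ('n::finite, 'k::field) weyl" where
  "frob p m = (\<Prod>i\<leftarrow>coords. (zW i ^ p) ^ (fst m $ i)) * (\<Prod>i\<leftarrow>coords. (dW i ^ p) ^ (snd m $ i))"

lemma frobenius_sub_frob: "frobenius_sub p f = (\<Sum>m\<in>Poly_Mapping.keys f. scal (Poly_Mapping.lookup f m) * frob p m)"
  by (simp add: frobenius_sub_def frob_def mult.assoc)

text \<open>In characteristic \<open>p\<close> the last term vanishes for \<open>k = p\<close>, so that Frobenius monomials commute.\<close>

lemma dW_power_zW: "dW i ^ k * zW j = (zW j * dW i ^ k + (if i = j then of_nat k * dW i ^ (k - 1) else 0) :: ('n, 'k::field) weyl)"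
proof (induction k)
  case (Suc k)
  have "dW i ^ Suc k * zW j = dW i * (dW i ^ k * zW j :: ('n, 'k) weyl)" by (simp add: mult.assoc)
  also have "\<dots> = (dW i * zW j) * dW i ^ k + (if i = j then dW i * (of_nat k * dW i ^ (k - 1)) else 0)"
    unfolding Suc.IH by (simp add: distrib_left mult.assoc)
  also have "dW i * zW j = (zW j * dW i + (if i = j then 1 else 0) :: ('n, 'k) weyl)"
    using dW_zW_commutator[of i j] by (simp add: algebra_simps)
  also have "(zW j * dW i + (if i = j then 1 else 0)) * dW i ^ k + (if i = j then dW i * (of_nat k * dW i ^ (k - 1)) else 0)
      = (zW j * dW i ^ Suc k + (if i = j then of_nat (Suc k) * dW i ^ (Suc k - 1) else 0) :: ('n, 'k) weyl)"
  proof -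
    have "dW i * (of_nat k * dW i ^ (k - 1)) = (of_nat k * dW i ^ k :: ('n, 'k) weyl)"
    proof (cases k)
      case (Suc l)
      have "dW i * (of_nat k * dW i ^ l) = (of_nat k * (dW i * dW i ^ l) :: ('n, 'k) weyl)"
        by (simp only: mult.assoc[symmetric] mult_of_nat_commute[of k "dW i"])
      then show ?thesis using Suc by simp
    qed simp
    then show ?thesis by (auto simp: distrib_right mult.assoc)
  qed
  finally show ?case .
qed simp

context char_p begin

lemma weyl_of_nat_p: "(of_nat p :: ('n::finite, 'k) weyl) = 0"
proof -
  have "(of_nat p :: 'k) = 0" using char_p of_nat_CHAR by metis
  then show ?thesis using scal_of_nat[of p, where ?'a = 'n and ?'b = 'k] by simp
qed

lemma dW_p_zW_p: "dW i ^ p * zW j ^ p = (zW j ^ p * dW i ^ p :: ('n::finite, 'k) weyl)"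
proof -
  have "dW i ^ p * zW j = (zW j * dW i ^ p :: ('n, 'k) weyl)"
    using dW_power_zW[of i p j, where ?'k = 'k] weyl_of_nat_p[where ?'n = 'n] by simp
  from commute_power2[OF this, of 1 p] show ?thesis by simp
qed

lemma frob_add: "frob p m * frob p m' = (frob p (m + m') :: ('n::finite, 'k) weyl)"
proof -
  let ?z = "\<lambda>m :: (nat ^ 'n) \<times> (nat ^ 'n). \<Prod>i\<leftarrow>coords. (zW i ^ p) ^ (fst m $ i) :: ('n, 'k) weyl"
  let ?d = "\<lambda>m :: (nat ^ 'n) \<times> (nat ^ 'n). \<Prod>i\<leftarrow>coords. (dW i ^ p) ^ (snd m $ i) :: ('n, 'k) weyl"
  have z: "?z m * ?z m' = ?z (m + m')"
    by (subst prod_list_mult_commuting[symmetric])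
      (intro commute_power2 zW_commute, simp add: power_add)
  have d: "?d m * ?d m' = ?d (m + m')"
    by (subst prod_list_mult_commuting[symmetric])
      (intro commute_power2 dW_commute, simp add: power_add)
  have "?d m * (zW i ^ p) ^ k = (zW i ^ p) ^ k * ?d m" for i k
    by (rule commute_prod_list[symmetric]) (intro commute_power2 dW_p_zW_p[symmetric])
  then have zd: "?d m * ?z m' = ?z m' * ?d m"
    by (intro commute_prod_list)
  have "frob p m * frob p m' = ?z m * (?d m * ?z m') * ?d m'" by (simp only: frob_def mult.assoc)
  also have "\<dots> = (?z m * ?z m') * (?d m * ?d m')" unfolding zd by (simp only: mult.assoc)
  finally show ?thesis unfolding z d frob_def .
qed

lemma s_var_dvd_s_monom: "k \<le> e $ i \<Longrightarrow> s_var i ^ k dvd (s_monom e :: ('n::finite, 'k) s_poly)"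
  unfolding s_monom_def by (rule dvd_trans[OF le_imp_power_dvd[of k "e $ i"] dvd_prodI[of UNIV i "\<lambda>i. s_var i ^ (e $ i)"]]) auto

lemma z_power_weight: "((zW i ^ p) ^ k :: ('n::finite, 'k) weyl) \<in> weyl_weights {axis i (int (p * k))}"
proof -
  have "(zW i ^ (p * k) :: ('n, 'k) weyl) \<in> weyl_weights {int (p * k) *s axis i 1}"
    by (rule weyl_weights_power[OF weyl_weights_zW])
  moreover have "int (p * k) *s axis i 1 = (axis i (int (p * k)) :: int ^ 'n)" by (simp add: vec_eq_iff axis_def)
  ultimately show ?thesis by (simp only: power_mult)
qed

lemma d_power_weight: "((dW i ^ p) ^ k :: ('n::finite, 'k) weyl) \<in> weyl_weights {axis i (- int (p * k))}"
proof -
  have "(dW i ^ (p * k) :: ('n, 'k) weyl) \<in> weyl_weights {int (p * k) *s (- axis i 1)}"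
    by (rule weyl_weights_power[OF weyl_weights_dW])
  moreover have "int (p * k) *s (- axis i 1) = (axis i (- int (p * k)) :: int ^ 'n)" by (simp add: vec_eq_iff axis_def)
  ultimately show ?thesis by (simp only: power_mult)
qed

lemma coords_weight:
  assumes "\<And>i. f i \<in> weyl_weights {axis i (w $ i)}"
  shows "(\<Prod>i\<leftarrow>coords. f i :: ('n::finite, 'k) weyl) \<in> weyl_weights {w}"
proof -
  have "(\<Prod>i\<leftarrow>is. f i) \<in> weyl_weights {\<Sum>i\<in>set is. axis i (w $ i)}" if "distinct is" for "is"
    using that
  proof (induction "is")
    case Nil
    show ?case by (simp add: weyl_weights_one)
  next
    case (Cons i "is")
    then show ?case by (auto intro!: weyl_weights_mult[OF assms])
  qed
  from this[of coords] have "(\<Prod>i\<leftarrow>coords. f i) \<in> weyl_weights {\<Sum>i\<in>UNIV. axis i (w $ i)}"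
    by (simp add: set_coords distinct_coords)
  moreover have "(\<Sum>i\<in>UNIV. axis i (w $ i)) = w" by (simp add: vec_eq_iff axis_def)
  ultimately show ?thesis by simp
qed

lemma frob_weight: "(frob p m :: ('n::finite, 'k) weyl) \<in> weyl_weights {int p *s (\<chi> i. int (fst m $ i) - int (snd m $ i))}"
  unfolding frob_def
proof (rule weyl_weights_mult[OF coords_weight coords_weight])
  show "((zW i ^ p) ^ (fst m $ i) :: ('n, 'k) weyl) \<in> weyl_weights {axis i ((\<chi> i. int (p * (fst m $ i))) $ i)}" for i
    using z_power_weight[of i "fst m $ i"] by simp
  show "((dW i ^ p) ^ (snd m $ i) :: ('n, 'k) weyl) \<in> weyl_weights {axis i ((\<chi> i. - int (p * (snd m $ i))) $ i)}" for i
    using d_power_weight[of i "snd m $ i"] by simp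
qed (simp add: vec_eq_iff algebra_simps)

text \<open>A Frobenius monomial divisible by \<open>(z\<^sub>i \<partial>\<^sub>i)\<^sup>p\<^sup>k\<close> passes through the alcove \<open>k\<close> steps away in
  direction \<open>i\<close> and back, which costs the factor \<open>s\<^sub>i\<^sup>k\<close>.\<close>

lemma frob_ncoeff_dvd:
  assumes k: "k \<le> fst m $ i" "k \<le> snd m $ i"
  shows "s_var i ^ k dvd ncoeff p (frob p m :: ('n::finite, 'k) weyl) a' a"
proof -
  let ?zk = "(zW i ^ p) ^ k :: ('n, 'k) weyl" and ?dk = "(dW i ^ p) ^ k :: ('n, 'k) weyl"
  let ?Z = "\<Prod>j\<leftarrow>coords. (zW j ^ p) ^ (if j = i then fst m $ j - k else fst m $ j) :: ('n, 'k) weyl"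
  let ?D = "\<Prod>j\<leftarrow>coords. (dW j ^ p) ^ (if j = i then snd m $ j - k else snd m $ j) :: ('n, 'k) weyl"
  have "(\<Prod>j\<leftarrow>coords. (zW j ^ p) ^ (fst m $ j)) = ?zk * ?Z"
  proof (rule prod_list_extract[where i = i])
    show "(zW i ^ p) ^ (fst m $ i) = ?zk * (zW i ^ p) ^ (if i = i then fst m $ i - k else fst m $ i)"
      using k(1) by (simp flip: power_add)
  qed (auto simp: distinct_coords set_coords intro!: commute_power2 zW_commute)
  also have "?zk * ?Z = ?Z * ?zk" by (rule commute_prod_list) (intro commute_power2 zW_commute)
  finally have z: "(\<Prod>j\<leftarrow>coords. (zW j ^ p) ^ (fst m $ j)) = ?Z * ?zk" .
  have d: "(\<Prod>j\<leftarrow>coords. (dW j ^ p) ^ (snd m $ j)) = ?dk * ?D"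
  proof (rule prod_list_extract[where i = i])
    show "(dW i ^ p) ^ (snd m $ i) = ?dk * (dW i ^ p) ^ (if i = i then snd m $ i - k else snd m $ i)"
      using k(2) by (simp flip: power_add)
  qed (auto simp: distinct_coords set_coords intro!: commute_power2 dW_commute)
  have F: "frob p m = (?Z * (?zk * ?dk)) * ?D" unfolding frob_def z d by (simp only: mult.assoc)
  obtain w where Z: "?Z \<in> weyl_weights {w}"
  proof (rule that)
    show "?Z \<in> weyl_weights {\<chi> j. int (p * (if j = i then fst m $ j - k else fst m $ j))}"
    proof (rule coords_weight)
      fix j show "((zW j ^ p) ^ (if j = i then fst m $ j - k else fst m $ j) :: ('n, 'k) weyl) \<in>
        weyl_weights {axis j ((\<chi> j. int (p * (if j = i then fst m $ j - k else fst m $ j))) $ j)}"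
        unfolding vec_lambda_beta by (rule z_power_weight)
    qed
  qed
  obtain v where D: "?D \<in> weyl_weights {v}"
  proof (rule that)
    show "?D \<in> weyl_weights {\<chi> j. - int (p * (if j = i then snd m $ j - k else snd m $ j))}"
    proof (rule coords_weight)
      fix j show "((dW j ^ p) ^ (if j = i then snd m $ j - k else snd m $ j) :: ('n, 'k) weyl) \<in>
        weyl_weights {axis j ((\<chi> j. - int (p * (if j = i then snd m $ j - k else snd m $ j))) $ j)}"
        unfolding vec_lambda_beta by (rule d_power_weight)
    qed
  qed
  have E: "?zk * ?dk \<in> weyl_weights {0}"
    by (rule weyl_weights_mult[OF z_power_weight d_power_weight]) (simp add: vec_eq_iff axis_def)
  have ZE: "?Z * (?zk * ?dk) \<in> weyl_weights {w}" by (rule weyl_weights_mult[OF Z E]) simp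
  have "s_var i ^ k dvd ncoeff p (?zk * ?dk) c c" for c
  proof -
    have "(c $ i - int (p * k)) div int p = c $ i div int p - int k"
    proof -
      have "c $ i - int (p * k) = c $ i + (- int k) * int p" by simp
      then show ?thesis using p_pos by (simp only: div_mult_self1[of "int p" "c $ i" "- int k"])
    qed
    then have "alcove_of p (c + axis i (- int (p * k))) $ i = alcove_of p c $ i - int k"
      by (simp add: alcove_of_def axis_def)
    then have "k \<le> eta (alcove_of p c) (alcove_of p (c + axis i (- int (p * k)))) (alcove_of p c) $ i"
      by (simp add: eta_def)
    from s_var_dvd_s_monom[OF this] show ?thesis
      unfolding ncoeff_mult[OF z_power_weight d_power_weight] by (rule dvd_mult2)
  qed
  then have "s_var i ^ k dvd ncoeff p (?Z * (?zk * ?dk)) a' c" for c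
    unfolding ncoeff_mult[OF Z E] by (simp add: dvd_mult)
  then show ?thesis unfolding F ncoeff_mult[OF ZE D] by (simp add: dvd_mult dvd_mult2)
qed

end

definition frob_degree :: "(nat ^ 'n::finite) \<times> (nat ^ 'n) \<Rightarrow> nat" where
  "frob_degree m = (\<Sum>i\<in>UNIV. fst m $ i + snd m $ i)"

inductive_set frob_span :: "nat \<Rightarrow> (int ^ 'n) set \<Rightarrow> nat \<Rightarrow> ('n::finite, 'k::field) weyl set" for p t K where
  zero: "0 \<in> frob_span p t K"
| mono: "(\<chi> i. int (fst m $ i) - int (snd m $ i)) \<in> g_star t \<Longrightarrow> K \<le> frob_degree m \<Longrightarrow> scal c * frob p m \<in> frob_span p t K"
| add: "u \<in> frob_span p t K \<Longrightarrow> v \<in> frob_span p t K \<Longrightarrow> u + v \<in> frob_span p t K"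

lemma frob_span_sum: "(\<And>i. i \<in> I \<Longrightarrow> f i \<in> frob_span p t K) \<Longrightarrow> sum f I \<in> frob_span p t K"
  by (induction I rule: infinite_finite_induct) (auto intro: frob_span.intros)

context char_p begin

text \<open>The monomials in \<open>o_ideal\<close> have positive degree, so each factor raises the degree.\<close>

lemma frobenius_power_span:
  assumes f: "f \<in> o_ideal t"
  shows "frobenius_sub p f ^ k \<in> (frob_span p t k :: ('n::finite, 'k) weyl set)"
proof (induction k)
  case 0
  have "(\<chi> i. int (fst (0 :: (nat ^ 'n) \<times> (nat ^ 'n)) $ i) - int (snd (0 :: (nat ^ 'n) \<times> (nat ^ 'n)) $ i)) \<in> g_star t"
    by (simp add: lattice_fiber_def pairing_def)
  moreover have "(\<Prod>i\<leftarrow>is. 1) = (1 :: ('n, 'k) weyl)" for "is" :: "'n list" by (induction "is") simp_all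
  then have "frob p 0 = (1 :: ('n, 'k) weyl)" by (simp add: frob_def)
  ultimately show ?case using frob_span.mono[of 0 t 0 "1 :: 'k" p] by (simp add: scal_1)
next
  case (Suc k)
  have "(scal (Poly_Mapping.lookup f m) * frob p m) * u \<in> frob_span p t (Suc k)"
    if m: "m \<in> Poly_Mapping.keys f" and u: "u \<in> frob_span p t k" for m and u :: "('n, 'k) weyl"
    using u
  proof (induction rule: frob_span.induct)
    case (mono m' c)
    have w: "(\<chi> i. int (fst m $ i) - int (snd m $ i)) \<in> g_star t" and "m \<noteq> 0"
      using f m by (auto simp: o_ideal_def in_keys_iff)
    have "frob_degree m \<noteq> 0"
    proof
      assume "frob_degree m = 0"
      then have "fst m = 0" "snd m = 0" by (simp_all add: frob_degree_def vec_eq_iff)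
      then show False using \<open>m \<noteq> 0\<close> by (simp add: prod_eq_iff)
    qed
    moreover have "frob_degree (m + m') = frob_degree m + frob_degree m'"
      by (simp add: frob_degree_def sum.distrib)
    ultimately have d: "Suc k \<le> frob_degree (m + m')" using mono(2) by simp
    have "(\<chi> i. int (fst (m + m') $ i) - int (snd (m + m') $ i))
        = (\<chi> i. int (fst m $ i) - int (snd m $ i)) + (\<chi> i. int (fst m' $ i) - int (snd m' $ i))"
      by (simp add: vec_eq_iff)
    then have w': "(\<chi> i. int (fst (m + m') $ i) - int (snd (m + m') $ i)) \<in> g_star t"
      using g_star_add[OF w mono(1)] by simp
    have "(scal (Poly_Mapping.lookup f m) * frob p m) * (scal c * frob p m')
        = scal (Poly_Mapping.lookup f m * c) * (frob p (m + m') :: ('n, 'k) weyl)"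
    proof -
      have "(scal (Poly_Mapping.lookup f m) * frob p m) * (scal c * frob p m')
          = scal (Poly_Mapping.lookup f m) * ((frob p m * scal c) * frob p m')" by (simp only: mult.assoc)
      also have "frob p m * scal c = (scal c * frob p m :: ('n, 'k) weyl)" by (rule scal_commute[symmetric])
      finally show ?thesis by (simp only: mult.assoc scal_mult frob_add)
    qed
    then show ?case using frob_span.mono[OF w' d] by simp
  qed (auto simp: distrib_left intro: frob_span.intros)
  then have "frobenius_sub p f * frobenius_sub p f ^ k \<in> frob_span p t (Suc k)"
    unfolding frobenius_sub_frob sum_distrib_right[of _ _ "_ ^ k"]
    by (intro frob_span_sum) (use Suc in \<open>simp add: frobenius_sub_frob\<close>)
  then show ?case by simp
qed

end

context H_object begin

lemma both_large: "\<bar>int x - int y\<bar> \<le> 2 * int R \<Longrightarrow> 2 * (2 * R + k) < x + y \<Longrightarrow> k \<le> x \<and> k \<le> y"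
  by presburger

lemma weights_bound:
  obtains R where "\<And>a i. a \<in> weights \<Longrightarrow> \<bar>a $ i\<bar> \<le> int R"
proof -
  have "finite ((\<lambda>(a, i). nat \<bar>a $ i\<bar>) ` (weights \<times> (UNIV :: 'n set)))" using finite_weights by simp
  then obtain R where R: "\<forall>x\<in>(\<lambda>(a, i). nat \<bar>a $ i\<bar>) ` (weights \<times> (UNIV :: 'n set)). x \<le> R"
    unfolding finite_nat_set_iff_bounded_le by (rule exE)
  have "\<bar>a $ i\<bar> \<le> int R" if "a \<in> weights" for a i
  proof -
    have "nat \<bar>a $ i\<bar> \<in> (\<lambda>(a, i). nat \<bar>a $ i\<bar>) ` (weights \<times> (UNIV :: 'n set))"
      using that by (intro image_eqI[of _ _ "(a, i)"]) auto
    then have "nat \<bar>a $ i\<bar> \<le> R" using R by blast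
    then show ?thesis by linarith
  qed
  then show ?thesis by (rule that)
qed

lemma dvd_sact_nil: "s_var i ^ k dvd f \<Longrightarrow> nilpotency_bound \<le> k \<Longrightarrow> v \<in> carrier N \<Longrightarrow> sact f v = \<zero>\<^bsub>N\<^esub>"
proof -
  assume "s_var i ^ k dvd f" "nilpotency_bound \<le> k" and v: "v \<in> carrier N"
  then have "s_var i ^ nilpotency_bound dvd f" using le_imp_power_dvd dvd_trans by blast
  then obtain h where "f = h * s_var i ^ nilpotency_bound" by (auto simp: dvd_def mult.commute)
  then show ?thesis using sact_nil[OF s_power_ideal_var v] by simp
qed

text \<open>A Frobenius monomial of high degree has a high exponent in some coordinate \<open>i\<close>. If only one of \<open>z\<^sub>i\<close> and
  \<open>\<partial>\<^sub>i\<close> has a high exponent, the weight is so large that it leads out of the finite set of weights;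
  otherwise \<open>frob_ncoeff_dvd\<close> provides a vanishing power of \<open>s\<^sub>i\<close>.\<close>

lemma weyl_act_frob:
  "\<exists>K. \<forall>m c. \<forall>n\<in>families. (\<chi> i. int (fst m $ i) - int (snd m $ i)) \<in> g_star t \<longrightarrow> K \<le> frob_degree m \<longrightarrow>
    weyl_act (scal c * frob p m) n = (\<lambda>_. \<zero>\<^bsub>N\<^esub>)"
proof -
  obtain R where R: "\<And>a i. a \<in> weights \<Longrightarrow> \<bar>a $ i\<bar> \<le> int R" using weights_bound by blast
  \<comment> \<open>Weights in the finite set differ by at most \<open>2 * R\<close> in each coordinate. If the exponents of \<open>z\<^sub>i\<close>
    and \<open>\<partial>\<^sub>i\<close> add up to more than \<open>T\<close> and differ by at most \<open>2 * R\<close>, both exceed the nilpotency bound.\<close>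
  define T where "T = 2 * (2 * R + nilpotency_bound)"
  have "weyl_act (scal c * frob p m) n = (\<lambda>_. \<zero>\<^bsub>N\<^esub>)"
    if w: "(\<chi> i. int (fst m $ i) - int (snd m $ i)) \<in> g_star t" and K: "Suc (CARD('n) * T) \<le> frob_degree m" and n: "n \<in> families"
    for m :: "(nat ^ 'n) \<times> (nat ^ 'n)" and n c
  proof -
    let ?w = "\<chi> i. int (fst m $ i) - int (snd m $ i)"
    have "\<exists>i. T < fst m $ i + snd m $ i"
    proof (rule ccontr)
      assume "\<nexists>i. T < fst m $ i + snd m $ i"
      then have "frob_degree m \<le> CARD('n) * T"
        unfolding frob_degree_def using sum_bounded_above[of UNIV "\<lambda>i. fst m $ i + snd m $ i" T] by (simp add: not_less)
      then show False using K by simp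
    qed
    then obtain i where i: "T < fst m $ i + snd m $ i" ..
    have c: "int p *s ?w \<in> g_star t"
      using w by (simp add: lattice_fiber_def pairing_def mult.assoc flip: sum_distrib_left)
    have sc: "(scal c :: ('n, 'k) weyl) \<in> weyl_weights {0}" by (rule weyl_weights_scal) simp
    have u: "(scal c * frob p m :: ('n, 'k) weyl) \<in> weyl_weights {int p *s ?w}"
      by (rule weyl_weights_mult[OF sc frob_weight]) simp
    show ?thesis
    proof (rule families_shift_ext[OF weyl_act_families[OF n] families_zero c])
      fix a assume a: "a \<in> fiber"
      let ?a' = "a + int p *s ?w"
      have a': "?a' \<in> fiber" by (rule fiber_add[OF a c])
      note nc = families_carrier[OF n, of a]
      show "weyl_act (scal c * frob p m) n ?a' = \<zero>\<^bsub>N\<^esub>"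
      proof (cases "a \<in> weights \<and> ?a' \<in> weights")
        case False
        then have "move ?a' a (n a) = \<zero>\<^bsub>N\<^esub>"
          using families_outside[OF n, of a] cact_outside_supp[OF fiber_alcove[OF a'] _ fiber_alcove[OF a] nc] a'
          by (auto simp: weights_def)
        then show ?thesis by (simp add: weyl_act_homogeneous[OF u c n a])
      next
        case True
        then have "\<bar>?a' $ i\<bar> \<le> int R" "\<bar>a $ i\<bar> \<le> int R" by (auto intro: R simp del: vector_add_component)
        then have "\<bar>int p * (int (fst m $ i) - int (snd m $ i))\<bar> \<le> 2 * int R" by simp
        moreover have "\<bar>int (fst m $ i) - int (snd m $ i)\<bar> \<le> \<bar>int p * (int (fst m $ i) - int (snd m $ i))\<bar>"
          using p_pos mult_right_mono[of 1 "int p" "\<bar>int (fst m $ i) - int (snd m $ i)\<bar>"] by (simp add: abs_mult)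
        ultimately have "\<bar>int (fst m $ i) - int (snd m $ i)\<bar> \<le> 2 * int R" by (rule order_trans[rotated])
        from both_large[OF this i[unfolded T_def]]
        have dvd: "s_var i ^ nilpotency_bound dvd ncoeff p (frob p m :: ('n, 'k) weyl) ?a' a" by (intro frob_ncoeff_dvd) simp_all
        have "s_var i ^ nilpotency_bound dvd ncoeff p (scal c * frob p m :: ('n, 'k) weyl) ?a' a"
          unfolding ncoeff_mult[OF sc frob_weight] using dvd by (simp add: dvd_mult)
        then show ?thesis
          unfolding weyl_act_homogeneous[OF u c n a] by (rule dvd_sact_nil[OF _ order_refl move_carrier[OF nc]])
      qed
    qed
  qed
  then show ?thesis by (intro exI allI ballI impI)
qed

end

section \<open>The reconstructed module\<close>

context H_object begin

text \<open>Only finitely many components of a family can be nonzero, and each is a vector of the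
  finite-dimensional space \<open>N\<close>.\<close>

lemma families_injection:
  obtains e :: "(int ^ 'n \<Rightarrow> 'w) \<Rightarrow> 'k list" where "inj_on e families"
proof -
  obtain B where B: "finite B" "B \<subseteq> carrier N" "carrier N \<subseteq> kspan B" by (rule finite_span)
  obtain d and code :: "'w \<Rightarrow> 'k list" where code: "inj_on code (carrier N)" "\<And>v. v \<in> carrier N \<Longrightarrow> length (code v) = d"
    using kspan_injection[OF B] by blast
  obtain as where as: "set as = weights" using finite_list[OF finite_weights] by blast
  have "inj_on (\<lambda>n. concat (map (\<lambda>a. code (n a)) as)) families"
  proof (rule inj_onI)
    fix n n' assume n: "n \<in> families" "n' \<in> families"
      and eq: "concat (map (\<lambda>a. code (n a)) as) = concat (map (\<lambda>a. code (n' a)) as)"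
    have "map (\<lambda>a. code (n a)) as = map (\<lambda>a. code (n' a)) as"
      by (rule concat_injective[OF eq])
        (auto simp: zip_map_map zip_same_conv_map code(2) families_carrier[OF n(1)] families_carrier[OF n(2)])
    then have c: "code (n a) = code (n' a)" if "a \<in> weights" for a using that as by (simp add: map_eq_conv)
    show "n = n'"
    proof (rule families_ext[OF n])
      fix a show "n a = n' a"
      proof (cases "a \<in> weights")
        case True
        show ?thesis by (rule inj_onD[OF code(1) c[OF True] families_carrier[OF n(1)] families_carrier[OF n(2)]])
      qed (simp add: families_outside n)
    qed
  qed
  then show ?thesis by (rule that)
qed

lemma weyl_act_concentrated:
  assumes u: "u \<in> weyl_weights {c}" and c: "c \<in> g_star t" and n: "n \<in> families"
  shows "weyl_act u (concentrated a (n a)) = concentrated (c + a) (weyl_act u n (c + a))"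
proof (rule families_shift_ext[OF weyl_act_families[OF concentrated_families[OF n]] concentrated_families[OF weyl_act_families[OF n]] c])
  fix e assume e: "e \<in> fiber"
  show "weyl_act u (concentrated a (n a)) (e + c) = concentrated (c + a) (weyl_act u n (c + a)) (e + c)"
    unfolding weyl_act_homogeneous[OF u c concentrated_families[OF n] e]
    using weyl_act_homogeneous[OF u c n e] by (auto simp: concentrated_def add.commute)
qed

lemma weyl_act_heval_concentrated:
  assumes "a \<in> fiber" "n \<in> families" shows "weyl_act (heval a f) (concentrated a (n a)) = concentrated a (sact f (n a))"
  using weyl_act_concentrated[OF heval_weight g_star_zero assms(2), of a f a] weyl_act_heval[OF assms(2,1), of f] by simp

end

locale coded_H_object = H_object p t lam N for p t lam and N :: "(('n::finite, 'k::field) Hfree set, 'w) module" +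
  fixes code :: "(int ^ 'n \<Rightarrow> 'w) \<Rightarrow> 'v"
  assumes code_inj: "inj_on code families"
begin

definition decode where "decode = the_inv_into families code"

text \<open>The families, carried by a set of codes in the type \<open>'v\<close>. A coset acts through any of its
  representatives.\<close>

definition Rec :: "('n, 'k, 'v) Dmod" where
  "Rec = \<lparr>carrier = code ` families, mult = undefined, one = undefined, zero = code (\<lambda>_. \<zero>\<^bsub>N\<^esub>),
     add = (\<lambda>v w. code (\<lambda>a. decode v a \<oplus>\<^bsub>N\<^esub> decode w a)),
     smult = (\<lambda>h v. the_inv_into (code ` families) decode (weyl_act (SOME f. f \<in> h) (decode v))),
     coact = (\<lambda>v a. code (concentrated a (decode v a)))\<rparr>"

lemma decode_code: "n \<in> families \<Longrightarrow> decode (code n) = n"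
  unfolding decode_def by (rule the_inv_into_f_f[OF code_inj])

lemma Rec_carrier: "carrier Rec = code ` families" by (simp add: Rec_def)

lemma code_closed: "n \<in> families \<Longrightarrow> code n \<in> carrier Rec" by (simp add: Rec_carrier)

lemma decode_families: "v \<in> carrier Rec \<Longrightarrow> decode v \<in> families" by (auto simp: Rec_carrier decode_code)

lemma code_decode: "v \<in> carrier Rec \<Longrightarrow> code (decode v) = v" by (auto simp: Rec_carrier decode_code)

lemma decode_eqI: "v \<in> carrier Rec \<Longrightarrow> w \<in> carrier Rec \<Longrightarrow> decode v = decode w \<Longrightarrow> v = w"
  by (metis code_decode)

lemma decode_bij: "bij_betw decode (carrier Rec) families"
  by (rule bij_betwI[where g = code]) (auto simp: decode_families code_closed code_decode decode_code)

lemma inv_decode: "n \<in> families \<Longrightarrow> the_inv_into (code ` families) decode n = code n"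
  using decode_bij by (intro the_inv_into_f_eq) (auto simp: decode_code bij_betw_def Rec_carrier)

lemma decode_zero: "decode \<zero>\<^bsub>Rec\<^esub> = (\<lambda>_. \<zero>\<^bsub>N\<^esub>)" by (simp add: Rec_def decode_code families_zero)

lemma decode_add:
  assumes "v \<in> carrier Rec" "w \<in> carrier Rec" shows "decode (v \<oplus>\<^bsub>Rec\<^esub> w) = (\<lambda>a. decode v a \<oplus>\<^bsub>N\<^esub> decode w a)"
proof -
  have "v \<oplus>\<^bsub>Rec\<^esub> w = code (\<lambda>a. decode v a \<oplus>\<^bsub>N\<^esub> decode w a)" by (simp add: Rec_def)
  then show ?thesis by (simp only: decode_code[OF families_add[OF decode_families[OF assms(1)] decode_families[OF assms(2)]]])
qed

lemma coact_Rec: "coact Rec v a = code (concentrated a (decode v a))" by (simp add: Rec_def)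

lemma decode_coact: "v \<in> carrier Rec \<Longrightarrow> decode (coact Rec v a) = concentrated a (decode v a)"
  unfolding coact_Rec by (rule decode_code[OF concentrated_families[OF decode_families]])

lemma Rec_module: "left_module (A_lam t lam) Rec"
  and Rec_act: "u \<in> S \<Longrightarrow> v \<in> carrier Rec \<Longrightarrow> A_cls t lam u \<odot>\<^bsub>Rec\<^esub> v = code (weyl_act u (decode v))"
proof -
  let ?act = "\<lambda>u v. the_inv_into (carrier Rec) decode (weyl_act u (decode v))"
  have add_closed: "v \<oplus>\<^bsub>Rec\<^esub> w \<in> carrier Rec" if "v \<in> carrier Rec" "w \<in> carrier Rec" for v w
    using code_closed[OF families_add[OF decode_families[OF that(1)] decode_families[OF that(2)]]] by (simp add: Rec_def)
  have zero_closed: "\<zero>\<^bsub>Rec\<^esub> \<in> carrier Rec" by (simp add: Rec_def families_zero)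
  have ra: "ring_act Rec S ?act"
  proof (rule ring_act_transport[OF ring_act_weyl_act])
    show "bij_betw decode (carrier Rec) (carrier families_mod)" using decode_bij by (simp add: families_mod_def)
  qed (simp_all add: zero_closed add_closed decode_zero decode_add families_mod_def)
  have kills: "?act g v = \<zero>\<^bsub>Rec\<^esub>" if "g \<in> A_rels t lam" "v \<in> carrier Rec" for g v
  proof -
    have "?act g v = code (\<lambda>_. \<zero>\<^bsub>N\<^esub>)"
      unfolding weyl_act_A_rels[OF that(1) decode_families[OF that(2)]] Rec_carrier by (rule inv_decode[OF families_zero])
    then show ?thesis by (simp add: Rec_def)
  qed
  have sm: "h \<odot>\<^bsub>Rec\<^esub> v = ?act (SOME f. f \<in> h) v" for h v by (simp add: Rec_def)
  show "left_module (A_lam t lam) Rec"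
    unfolding A_lam_qring by (rule class_quotient.act_left_module(1)[OF class_quotient_A ra kills sm])
  show "A_cls t lam u \<odot>\<^bsub>Rec\<^esub> v = code (weyl_act u (decode v))" if "u \<in> S" "v \<in> carrier Rec" for u v
  proof -
    have "A_cls t lam u \<odot>\<^bsub>Rec\<^esub> v = ?act u v"
      unfolding A_cls_qcls
      by (rule class_quotient.act_left_module(2)[OF class_quotient_A ra kills sm that])
    then show ?thesis using inv_decode[OF weyl_act_families[OF decode_families[OF that(2)]]] by (simp add: Rec_carrier)
  qed
qed

sublocale A: A_action p t lam Rec
  by (intro A_action.intro A_action_axioms.intro char_p_axioms Rec_module)

lemma decode_act: "u \<in> S \<Longrightarrow> v \<in> carrier Rec \<Longrightarrow> decode (A_cls t lam u \<odot>\<^bsub>Rec\<^esub> v) = weyl_act u (decode v)"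
  by (simp add: Rec_act decode_code weyl_act_families decode_families)

lemma decode_finsum: "f \<in> I \<rightarrow> carrier Rec \<Longrightarrow> decode (\<Oplus>\<^bsub>Rec\<^esub>i\<in>I. f i) a = (\<Oplus>\<^bsub>N\<^esub>i\<in>I. decode (f i) a)"
proof (induction I rule: infinite_finite_induct)
  case (insert i I)
  then have f: "f j \<in> carrier Rec" if "j \<in> insert i I" for j using that by blast
  have c: "decode (f j) a \<in> carrier N" if "j \<in> insert i I" for j
    by (rule families_carrier[OF decode_families[OF f[OF that]]])
  have I: "f \<in> I \<rightarrow> carrier Rec" using f by blast
  have "decode (\<Oplus>\<^bsub>Rec\<^esub>j\<in>insert i I. f j) a = decode (f i) a \<oplus>\<^bsub>N\<^esub> decode (\<Oplus>\<^bsub>Rec\<^esub>j\<in>I. f j) a"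
    using insert.hyps by (simp add: A.finsum_insert[OF _ _ I f] decode_add[OF f A.finsum_closed[OF I]])
  also have "\<dots> = (\<Oplus>\<^bsub>N\<^esub>j\<in>insert i I. decode (f j) a)"
    unfolding insert.IH[OF I] by (rule finsum_insert[symmetric]) (use insert.hyps c in auto)
  finally show ?case .
qed (simp_all add: decode_zero)

lemma coact_Rec_closed: "v \<in> carrier Rec \<Longrightarrow> coact Rec v a \<in> carrier Rec"
  unfolding coact_Rec by (intro code_closed concentrated_families decode_families)

lemma coact_supp_Rec: "v \<in> carrier Rec \<Longrightarrow> coact_supp Rec v = {a. decode v a \<noteq> \<zero>\<^bsub>N\<^esub>}"
proof -
  assume v: "v \<in> carrier Rec"
  have "coact Rec v a = \<zero>\<^bsub>Rec\<^esub> \<longleftrightarrow> decode v a = \<zero>\<^bsub>N\<^esub>" for a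
  proof
    assume "coact Rec v a = \<zero>\<^bsub>Rec\<^esub>"
    then have "concentrated a (decode v a) = (\<lambda>_. \<zero>\<^bsub>N\<^esub>)" by (simp only: decode_coact[OF v, symmetric] decode_zero)
    then have "concentrated a (decode v a) a = \<zero>\<^bsub>N\<^esub>" by (rule fun_cong)
    then show "decode v a = \<zero>\<^bsub>N\<^esub>" by (simp add: concentrated_def)
  next
    assume "decode v a = \<zero>\<^bsub>N\<^esub>"
    then have "decode (coact Rec v a) = decode \<zero>\<^bsub>Rec\<^esub>"
      by (simp add: decode_coact[OF v] decode_zero concentrated_def fun_eq_iff)
    then show "coact Rec v a = \<zero>\<^bsub>Rec\<^esub>" by (rule decode_eqI[OF coact_Rec_closed[OF v] A.zero_closed])
  qed
  then show ?thesis by (simp add: coact_supp_def)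
qed

lemma coact_supp_weights: "v \<in> carrier Rec \<Longrightarrow> coact_supp Rec v \<subseteq> weights"
  using families_outside[OF decode_families] by (auto simp: coact_supp_Rec)

lemma compatible_Rec: "compatible_D_action t lam Rec"
  unfolding compatible_D_action_def
proof (intro ballI allI)
  fix c b v and u :: "('n, 'k) weyl"
  assume c: "c \<in> g_star t" and u: "u \<in> weyl_weights {c}" and v: "v \<in> carrier Rec"
  have uS: "u \<in> S" by (rule weyl_weights_subsetD[OF u c])
  have "decode (coact Rec (A_cls t lam u \<odot>\<^bsub>Rec\<^esub> v) (c + b)) = concentrated (c + b) (weyl_act u (decode v) (c + b))"
    by (simp add: decode_coact decode_act uS v)
  also have "\<dots> = weyl_act u (concentrated b (decode v b))" by (rule weyl_act_concentrated[OF u c decode_families[OF v], symmetric])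
  also have "\<dots> = decode (A_cls t lam u \<odot>\<^bsub>Rec\<^esub> coact Rec v b)"
    by (simp add: decode_act uS v coact_Rec_closed decode_coact)
  finally show "coact Rec (A_cls t lam u \<odot>\<^bsub>Rec\<^esub> v) (c + b) = A_cls t lam u \<odot>\<^bsub>Rec\<^esub> coact Rec v b"
    by (intro decode_eqI coact_Rec_closed A.act_closed v uS)
qed

lemma D_action_Rec: "is_D_action t lam Rec"
  unfolding is_D_action_def
proof (intro conjI ballI allI)
  fix v a assume v: "v \<in> carrier Rec"
  show "coact Rec v a \<in> carrier Rec" by (rule coact_Rec_closed[OF v])
  show "finite (coact_supp Rec v)" by (rule finite_subset[OF coact_supp_weights[OF v] finite_weights])
  show "coact Rec (v \<oplus>\<^bsub>Rec\<^esub> w) a = coact Rec v a \<oplus>\<^bsub>Rec\<^esub> coact Rec w a" if w: "w \<in> carrier Rec" for w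
    by (rule decode_eqI)
      (auto simp: v w coact_Rec_closed decode_coact decode_add concentrated_def)
  show "coact Rec (A_cls t lam (scal c) \<odot>\<^bsub>Rec\<^esub> v) a = A_cls t lam (scal c) \<odot>\<^bsub>Rec\<^esub> coact Rec v a" for c
  proof -
    have "(scal c :: ('n, 'k) weyl) \<in> weyl_weights {0}" by (rule weyl_weights_scal) simp
    then have "coact Rec (A_cls t lam (scal c) \<odot>\<^bsub>Rec\<^esub> v) (0 + a) = A_cls t lam (scal c) \<odot>\<^bsub>Rec\<^esub> coact Rec v a"
      using compatible_Rec v g_star_zero unfolding compatible_D_action_def by blast
    then show ?thesis by simp
  qed
  show "(\<Oplus>\<^bsub>Rec\<^esub>a\<in>coact_supp Rec v. coact Rec v a) = v"
  proof (rule decode_eqI)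
    have c: "(\<lambda>a. coact Rec v a) \<in> coact_supp Rec v \<rightarrow> carrier Rec" using coact_Rec_closed[OF v] by blast
    then show "(\<Oplus>\<^bsub>Rec\<^esub>a\<in>coact_supp Rec v. coact Rec v a) \<in> carrier Rec" by (rule A.finsum_closed)
    show "decode (\<Oplus>\<^bsub>Rec\<^esub>a\<in>coact_supp Rec v. coact Rec v a) = decode v"
    proof
      fix e
      let ?A = "coact_supp Rec v"
      have fin: "finite ?A" by (rule finite_subset[OF coact_supp_weights[OF v] finite_weights])
      have f: "decode v \<in> ?A \<rightarrow> carrier N" using families_carrier[OF decode_families[OF v]] by blast
      have "decode (\<Oplus>\<^bsub>Rec\<^esub>a\<in>?A. coact Rec v a) e = (\<Oplus>\<^bsub>N\<^esub>a\<in>?A. if e = a then decode v a else \<zero>\<^bsub>N\<^esub>)"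
        unfolding decode_finsum[OF c] by (rule finsum_cong') (use f in \<open>auto simp: decode_coact[OF v] concentrated_def\<close>)
      also have "\<dots> = decode v e"
      proof (cases "e \<in> ?A")
        case True
        show ?thesis by (rule finsum_singleton[OF True fin f])
      next
        case False
        then have "(\<Oplus>\<^bsub>N\<^esub>a\<in>?A. if e = a then decode v a else \<zero>\<^bsub>N\<^esub>) = (\<Oplus>\<^bsub>N\<^esub>a\<in>?A. \<zero>\<^bsub>N\<^esub>)"
          by (intro finsum_cong') auto
        then show ?thesis using False by (simp add: coact_supp_Rec[OF v])
      qed
      finally show "decode (\<Oplus>\<^bsub>Rec\<^esub>a\<in>?A. coact Rec v a) e = decode v e" .
    qed
  qed (rule v)
  show "coact Rec (coact Rec v a) b = (if a = b then coact Rec v a else \<zero>\<^bsub>Rec\<^esub>)" for b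
    by (rule decode_eqI) (auto simp: coact_Rec_closed v decode_coact decode_zero concentrated_def fun_eq_iff)
qed

sublocale M: weighted p t lam Rec
  by (intro weighted.intro weighted_axioms.intro A.A_action_axioms D_action_Rec compatible_Rec)
    (use coact_supp_weights in \<open>auto simp: weights_def\<close>)

lemma s_op_Rec: "v \<in> carrier Rec \<Longrightarrow> (s_op t lam Rec i ^^ nilpotency_bound) v = \<zero>\<^bsub>Rec\<^esub>"
proof -
  assume v: "v \<in> carrier Rec"
  show ?thesis
  proof (rule M.eq_if_coact_eq[OF M.s_op_power_component(1)[OF v] A.zero_closed])
    fix a
    let ?w = "coact Rec v a"
    have w: "?w \<in> carrier Rec" by (rule coact_Rec_closed[OF v])
    have e: "hdiff a i ^ nilpotency_bound = (heval a (s_var i ^ nilpotency_bound) :: ('n, 'k) weyl)" by (simp add: heval_power)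
    have "A_cls t lam (hdiff a i ^ nilpotency_bound) \<odot>\<^bsub>Rec\<^esub> ?w = \<zero>\<^bsub>Rec\<^esub>"
    proof (rule decode_eqI[OF _ A.zero_closed])
      show "A_cls t lam (hdiff a i ^ nilpotency_bound) \<odot>\<^bsub>Rec\<^esub> ?w \<in> carrier Rec"
        unfolding e by (rule A.act_closed[OF A.heval_S w])
      have "weyl_act (heval a (s_var i ^ nilpotency_bound)) (concentrated a (decode v a)) = (\<lambda>_. \<zero>\<^bsub>N\<^esub>)"
      proof (cases "a \<in> fiber")
        case True
        have "sact (s_var i ^ nilpotency_bound) (decode v a) = \<zero>\<^bsub>N\<^esub>"
          using sact_nil[OF s_power_ideal_var[of 1] families_carrier[OF decode_families[OF v]]] by simp
        then show ?thesis unfolding weyl_act_heval_concentrated[OF True decode_families[OF v]] by (simp add: concentrated_def)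
      next
        case False
        then have "concentrated a (decode v a) = (\<lambda>_. \<zero>\<^bsub>N\<^esub>)"
          using families_outside_fiber[OF decode_families[OF v] False] by (simp add: concentrated_def fun_eq_iff)
        then show ?thesis by (simp add: weyl_act_zero)
      qed
      then show "decode (A_cls t lam (hdiff a i ^ nilpotency_bound) \<odot>\<^bsub>Rec\<^esub> ?w) = decode \<zero>\<^bsub>Rec\<^esub>"
        unfolding e by (simp add: decode_act[OF A.heval_S w] decode_coact[OF v] decode_zero)
    qed
    then show "coact Rec ((s_op t lam Rec i ^^ nilpotency_bound) v) a = coact Rec \<zero>\<^bsub>Rec\<^esub> a"
      unfolding M.s_op_power_component(2)[OF v] M.coact_zero .
  qed
qed

lemma concentrated_kspan:
  assumes B: "finite B" "B \<subseteq> carrier N" "carrier N \<subseteq> kspan B" and a: "a \<in> fiber"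
    and C: "\<And>w. w \<in> B \<Longrightarrow> code (concentrated a (move a a w)) \<in> C" "C \<subseteq> carrier Rec" and y: "y \<in> kspan B"
  shows "code (concentrated a (move a a y)) \<in> A.kspan C"
  using y
proof (induction rule: kspan.induct)
  have sf: "concentrated a (move a a v) \<in> families" if "v \<in> carrier N" for v
    using that by (intro concentrated_fib' a move_carrier move_idem)
  {
    case zero
    have "code (concentrated a (move a a \<zero>\<^bsub>N\<^esub>)) = \<zero>\<^bsub>Rec\<^esub>" by (simp add: concentrated_def Rec_def)
    then show ?case by (simp add: A.kspan.zero)
  next
    case (base v)
    then show ?case by (intro A.kspan.base C)
  next
    case (add v w)
    have v: "v \<in> carrier N" "w \<in> carrier N" using add(1,2) kspan_carrier[OF B(2)] by auto
    have "code (concentrated a (move a a (v \<oplus>\<^bsub>N\<^esub> w))) = code (concentrated a (move a a v)) \<oplus>\<^bsub>Rec\<^esub> code (concentrated a (move a a w))"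
    proof (rule decode_eqI)
      show "decode (code (concentrated a (move a a (v \<oplus>\<^bsub>N\<^esub> w)))) = decode (code (concentrated a (move a a v)) \<oplus>\<^bsub>Rec\<^esub> code (concentrated a (move a a w)))"
        using v by (simp add: decode_code sf decode_add code_closed) (simp add: concentrated_def act_add fun_eq_iff)
    qed (use v in \<open>auto intro!: code_closed sf A.add.m_closed\<close>)
    then show ?case using add(3,4) by (simp add: A.kspan.add)
  next
    case (scale v c)
    have v: "v \<in> carrier N" using scale(1) kspan_carrier[OF B(2)] by auto
    have h: "scal c = (heval a (s_const c) :: ('n, 'k) weyl)" by (simp add: s_const_def)
    have "code (concentrated a (move a a (sact (s_const c) v))) = A_cls t lam (scal c) \<odot>\<^bsub>Rec\<^esub> code (concentrated a (move a a v))"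
    proof (rule decode_eqI)
      have "weyl_act (heval a (s_const c)) (concentrated a (move a a v)) = concentrated a (sact (s_const c) (move a a v))"
        using weyl_act_heval_concentrated[OF a sf[OF v], of "s_const c"] by (simp add: concentrated_def)
      then show "decode (code (concentrated a (move a a (sact (s_const c) v)))) = decode (A_cls t lam (scal c) \<odot>\<^bsub>Rec\<^esub> code (concentrated a (move a a v)))"
        unfolding h using v sact_hact[OF v] by (simp add: decode_code sf decode_act code_closed)
    qed (use v in \<open>auto intro!: code_closed sf A.act_closed A.sc_closed\<close>)
    then show ?case using scale(2) by (simp add: A.kspan.scale)
  }
qed

lemma Rec_finitely_generated:
  "\<exists>C. finite C \<and> C \<subseteq> carrier Rec \<and>
    (\<forall>v\<in>carrier Rec. \<exists>r\<in>C \<rightarrow> carrier (A_lam t lam). v = (\<Oplus>\<^bsub>Rec\<^esub>w\<in>C. r w \<odot>\<^bsub>Rec\<^esub> w))"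
proof -
  obtain B where B: "finite B" "B \<subseteq> carrier N" "carrier N \<subseteq> kspan B" by (rule finite_span)
  define C where "C = (\<lambda>(a, w). code (concentrated a (move a a w))) ` (weights \<times> B)"
  have finC: "finite C" unfolding C_def using B(1) finite_weights by simp
  have Cc: "C \<subseteq> carrier Rec"
  proof
    fix c assume "c \<in> C"
    then obtain a w where c: "a \<in> weights" "w \<in> B" "c = code (concentrated a (move a a w))" by (auto simp: C_def)
    then have "a \<in> fiber" "w \<in> carrier N" using B(2) by (auto simp: weights_def)
    then show "c \<in> carrier Rec" unfolding c(3) by (intro code_closed concentrated_fib' move_carrier move_idem)
  qed
  have CI: "code (concentrated a (move a a w)) \<in> C" if "a \<in> weights" "w \<in> B" for a w
    unfolding C_def by (rule image_eqI[of _ _ "(a, w)"]) (use that in simp_all)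
  have span: "v \<in> A.kspan C" if v: "v \<in> carrier Rec" for v
  proof -
    have "coact Rec v a \<in> A.kspan C" if a: "a \<in> coact_supp Rec v" for a
    proof -
      have aw: "a \<in> weights" using coact_supp_weights[OF v] a by blast
      then have af: "a \<in> fiber" by (simp add: weights_def)
      have "code (concentrated a (move a a (decode v a))) \<in> A.kspan C"
      proof (rule concentrated_kspan[OF B af _ Cc])
        show "decode v a \<in> kspan B" by (rule subsetD[OF B(3) families_carrier[OF decode_families[OF v]]])
      qed (rule CI[OF aw])
      then show ?thesis by (simp add: coact_Rec families_idem[OF decode_families[OF v] af])
    qed
    then have "(\<Oplus>\<^bsub>Rec\<^esub>a\<in>coact_supp Rec v. coact Rec v a) \<in> A.kspan C" by (rule A.kspan_finsum[OF _ Cc])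
    then show ?thesis by (simp only: M.coact_sum[OF v])
  qed
  have "\<exists>r\<in>C \<rightarrow> carrier (A_lam t lam). v = (\<Oplus>\<^bsub>Rec\<^esub>w\<in>C. r w \<odot>\<^bsub>Rec\<^esub> w)" if v: "v \<in> carrier Rec" for v
  proof -
    obtain c where c: "v = (\<Oplus>\<^bsub>Rec\<^esub>w\<in>C. A_cls t lam (scal (c w)) \<odot>\<^bsub>Rec\<^esub> w)"
      using A.kspan_coeffs[OF finC Cc span[OF v]] by (rule exE)
    show ?thesis
    proof (rule bexI)
      show "(\<lambda>w. A_cls t lam (scal (c w))) \<in> C \<rightarrow> carrier (A_lam t lam)"
        unfolding carrier_A_lam by (intro funcsetI imageI A.sc_closed)
    qed (rule c)
  qed
  then show ?thesis by (intro exI[of _ C] conjI ballI finC Cc)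
qed

lemma Rec_supported:
  "\<exists>k. \<forall>f\<in>o_ideal t. \<forall>v\<in>carrier Rec. ((\<lambda>w. A_cls t lam (frobenius_sub p f) \<odot>\<^bsub>Rec\<^esub> w) ^^ k) v = \<zero>\<^bsub>Rec\<^esub>"
proof -
  from weyl_act_frob obtain k where k: "\<forall>m c. \<forall>n\<in>families. (\<chi> i. int (fst m $ i) - int (snd m $ i)) \<in> g_star t \<longrightarrow> k \<le> frob_degree m \<longrightarrow>
    weyl_act (scal c * frob p m) n = (\<lambda>_. \<zero>\<^bsub>N\<^esub>)" ..
  have "((\<lambda>w. A_cls t lam (frobenius_sub p f) \<odot>\<^bsub>Rec\<^esub> w) ^^ k) v = \<zero>\<^bsub>Rec\<^esub>"
    if f: "f \<in> o_ideal t" and v: "v \<in> carrier Rec" for f v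
  proof -
    note dv = decode_families[OF v]
    have monoS: "scal c * frob p m \<in> S" if "(\<chi> i. int (fst m $ i) - int (snd m $ i)) \<in> g_star t" for c m
    proof -
      have "int p *s (\<chi> i. int (fst m $ i) - int (snd m $ i)) \<in> g_star t"
        using that by (simp add: lattice_fiber_def pairing_def mult.assoc flip: sum_distrib_left)
      then have "frob p m \<in> S" by (rule weyl_weights_subsetD[OF frob_weight])
      then show ?thesis by (rule A.S_mult[OF A.sc_closed])
    qed
    have z: "u \<in> S \<and> weyl_act u (decode v) = (\<lambda>_. \<zero>\<^bsub>N\<^esub>)" if "u \<in> frob_span p t k" for u :: "('n, 'k) weyl"
      using that
    proof (induction rule: frob_span.induct)
      case zero
      show ?case by (rule conjI[OF A.S_zero weyl_act_zero_left[OF dv]])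
    next
      case (mono m c)
      show ?case by (rule conjI[OF monoS[OF mono(1)] k[rule_format, OF dv mono]])
    next
      case (add u u')
      then show ?case by (simp add: A.S_add weyl_act_add_left[OF _ _ dv])
    qed
    have fS: "frobenius_sub p f \<in> S"
      unfolding frobenius_sub_frob by (rule A.S_sum, rule monoS) (use f in \<open>auto simp: o_ideal_def\<close>)
    have "weyl_act (frobenius_sub p f ^ k) (decode v) = (\<lambda>_. \<zero>\<^bsub>N\<^esub>)"
      by (rule conjunct2[OF z[OF frobenius_power_span[OF f]]])
    then have "A_cls t lam (frobenius_sub p f ^ k) \<odot>\<^bsub>Rec\<^esub> v = code (\<lambda>_. \<zero>\<^bsub>N\<^esub>)"
      by (simp only: Rec_act[OF A.S_power[OF fS] v])
    then show ?thesis unfolding A.act_power[OF fS v] by (simp add: Rec_def)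
  qed
  then show ?thesis by (intro exI ballI)
qed

lemma Rec_object: "Rec \<in> A_modules_D_o t lam p"
proof -
  from Rec_supported obtain k where
    k: "\<forall>f\<in>o_ideal t. \<forall>v\<in>carrier Rec. ((\<lambda>w. A_cls t lam (frobenius_sub p f) \<odot>\<^bsub>Rec\<^esub> w) ^^ k) v = \<zero>\<^bsub>Rec\<^esub>" ..
  have "\<exists>k. ((\<lambda>w. A_cls t lam (frobenius_sub p f) \<odot>\<^bsub>Rec\<^esub> w) ^^ k) v = \<zero>\<^bsub>Rec\<^esub>"
    if "v \<in> carrier Rec" "f \<in> o_ideal t" for v f
    by (rule exI[of _ k]) (rule k[rule_format, OF that(2,1)])
  then have "Rec \<in> A_modules_o t lam p"
    unfolding A_modules_o_def mem_Collect_eq by (intro conjI Rec_module Rec_finitely_generated ballI)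
  moreover have "\<exists>k. (s_op t lam Rec i ^^ k) v = \<zero>\<^bsub>Rec\<^esub>" if "v \<in> carrier Rec" for i v
    by (rule exI[of _ nilpotency_bound]) (rule s_op_Rec[OF that])
  moreover have "coact_supp Rec v \<subseteq> fiber" if "v \<in> carrier Rec" for v by (rule M.T_weight[OF that])
  ultimately show ?thesis
    unfolding A_modules_D_o_def mem_Collect_eq
    by (intro conjI allI ballI D_action_Rec compatible_Rec)
qed

end

section \<open>Fully faithful and essentially surjective functors\<close>

text \<open>The inverse functor selects a preimage of every object up to isomorphism, and sends an arrow to the
  unique preimage of its conjugate by the selected isomorphisms.\<close>

lemma equivalenceI:
  assumes C: "is_category C" and D: "is_category D" and F: "is_functor C D F"
    and full: "\<And>X Y g. X \<in> Ob C \<Longrightarrow> Y \<in> Ob C \<Longrightarrow> g \<in> Arr D (FOb F X) (FOb F Y) \<Longrightarrow>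
      \<exists>f\<in>Arr C X Y. FArr F X Y f = g"
    and faithful: "\<And>X Y f f'. X \<in> Ob C \<Longrightarrow> Y \<in> Ob C \<Longrightarrow> f \<in> Arr C X Y \<Longrightarrow> f' \<in> Arr C X Y \<Longrightarrow>
      FArr F X Y f = FArr F X Y f' \<Longrightarrow> f = f'"
    and surj: "\<And>Y. Y \<in> Ob D \<Longrightarrow> \<exists>X\<in>Ob C. \<exists>\<theta>. is_iso D (FOb F X) Y \<theta>"
  shows "is_equivalence C D F"
proof -
  let ?F = "FOb F"
  have idC: "X \<in> Ob C \<Longrightarrow> Idt C X \<in> Arr C X X"
    and compC: "\<lbrakk>X \<in> Ob C; Y \<in> Ob C; Z \<in> Ob C; f \<in> Arr C X Y; g \<in> Arr C Y Z\<rbrakk> \<Longrightarrow> Comp C X Y Z g f \<in> Arr C X Z"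
    for X Y Z f g using C unfolding is_category_def by blast+
  have idD: "X \<in> Ob D \<Longrightarrow> Idt D X \<in> Arr D X X"
    and compD: "\<lbrakk>X \<in> Ob D; Y \<in> Ob D; Z \<in> Ob D; f \<in> Arr D X Y; g \<in> Arr D Y Z\<rbrakk> \<Longrightarrow> Comp D X Y Z g f \<in> Arr D X Z"
    and idrD: "\<lbrakk>X \<in> Ob D; Y \<in> Ob D; f \<in> Arr D X Y\<rbrakk> \<Longrightarrow> Comp D X X Y f (Idt D X) = f"
    and idlD: "\<lbrakk>X \<in> Ob D; Y \<in> Ob D; f \<in> Arr D X Y\<rbrakk> \<Longrightarrow> Comp D X Y Y (Idt D Y) f = f"
    for X Y Z f g using D unfolding is_category_def by blast+
  have assocD: "\<lbrakk>W \<in> Ob D; X \<in> Ob D; Y \<in> Ob D; Z \<in> Ob D; f \<in> Arr D W X; g \<in> Arr D X Y; h \<in> Arr D Y Z\<rbrakk> \<Longrightarrow>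
      Comp D W X Z (Comp D X Y Z h g) f = Comp D W Y Z h (Comp D W X Y g f)" for W X Y Z f g h
    using D unfolding is_category_def by blast
  have FO: "X \<in> Ob C \<Longrightarrow> ?F X \<in> Ob D"
    and FA: "\<lbrakk>X \<in> Ob C; Y \<in> Ob C; f \<in> Arr C X Y\<rbrakk> \<Longrightarrow> FArr F X Y f \<in> Arr D (?F X) (?F Y)"
    and Fid: "X \<in> Ob C \<Longrightarrow> FArr F X X (Idt C X) = Idt D (?F X)"
    for X Y f using F unfolding is_functor_def by blast+
  have Fcomp: "\<lbrakk>X \<in> Ob C; Y \<in> Ob C; Z \<in> Ob C; f \<in> Arr C X Y; g \<in> Arr C Y Z\<rbrakk> \<Longrightarrow> FArr F X Z (Comp C X Y Z g f) =
      Comp D (?F X) (?F Y) (?F Z) (FArr F Y Z g) (FArr F X Y f)" for X Y Z f g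
    using F unfolding is_functor_def by blast
  have "\<forall>Y. \<exists>X \<theta> \<theta>'. Y \<in> Ob D \<longrightarrow> X \<in> Ob C \<and> \<theta> \<in> Arr D (?F X) Y \<and> \<theta>' \<in> Arr D Y (?F X) \<and>
      Comp D (?F X) Y (?F X) \<theta>' \<theta> = Idt D (?F X) \<and> Comp D Y (?F X) Y \<theta> \<theta>' = Idt D Y"
    using surj unfolding is_iso_def by meson
  then obtain G \<theta> \<theta>' where all: "\<And>Y. Y \<in> Ob D \<Longrightarrow> G Y \<in> Ob C \<and> \<theta> Y \<in> Arr D (?F (G Y)) Y \<and>
      \<theta>' Y \<in> Arr D Y (?F (G Y)) \<and> Comp D (?F (G Y)) Y (?F (G Y)) (\<theta>' Y) (\<theta> Y) = Idt D (?F (G Y)) \<and>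
      Comp D Y (?F (G Y)) Y (\<theta> Y) (\<theta>' Y) = Idt D Y" by metis
  have G: "Y \<in> Ob D \<Longrightarrow> G Y \<in> Ob C" and \<theta>: "Y \<in> Ob D \<Longrightarrow> \<theta> Y \<in> Arr D (?F (G Y)) Y"
    and \<theta>': "Y \<in> Ob D \<Longrightarrow> \<theta>' Y \<in> Arr D Y (?F (G Y))"
    and \<theta>'\<theta>: "Y \<in> Ob D \<Longrightarrow> Comp D (?F (G Y)) Y (?F (G Y)) (\<theta>' Y) (\<theta> Y) = Idt D (?F (G Y))"
    and \<theta>\<theta>': "Y \<in> Ob D \<Longrightarrow> Comp D Y (?F (G Y)) Y (\<theta> Y) (\<theta>' Y) = Idt D Y" for Y
    using all by blast+
  have FG: "Y \<in> Ob D \<Longrightarrow> ?F (G Y) \<in> Ob D" for Y using FO G by blast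
  have c1: "Comp D X (?F (G Y)) Y (\<theta> Y) (Comp D X Y (?F (G Y)) (\<theta>' Y) f) = f"
    if "X \<in> Ob D" "Y \<in> Ob D" "f \<in> Arr D X Y" for X Y f
    using assocD[OF that(1,2) FG[OF that(2)] that(2,3) \<theta>'[OF that(2)] \<theta>[OF that(2)]] idlD[OF that] \<theta>\<theta>'[OF that(2)]
    by simp
  \<comment> \<open>The inverse of the arrow map, which is injective and surjective.\<close>
  define P where "P X Y g = (SOME f. f \<in> Arr C X Y \<and> FArr F X Y f = g)" for X Y g
  have P: "P X Y g \<in> Arr C X Y" "FArr F X Y (P X Y g) = g"
    if "X \<in> Ob C" "Y \<in> Ob C" "g \<in> Arr D (?F X) (?F Y)" for X Y g
    using someI_ex[of "\<lambda>f. f \<in> Arr C X Y \<and> FArr F X Y f = g"] full[OF that] unfolding P_def by blast+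
  define GA where "GA Y Y' g = P (G Y) (G Y') (Comp D (?F (G Y)) Y' (?F (G Y')) (\<theta>' Y') (Comp D (?F (G Y)) Y Y' g (\<theta> Y)))"
    for Y Y' g
  have GA: "GA Y Y' g \<in> Arr C (G Y) (G Y')"
    "FArr F (G Y) (G Y') (GA Y Y' g) = Comp D (?F (G Y)) Y' (?F (G Y')) (\<theta>' Y') (Comp D (?F (G Y)) Y Y' g (\<theta> Y))"
    if "Y \<in> Ob D" "Y' \<in> Ob D" "g \<in> Arr D Y Y'" for Y Y' g
  proof -
    have "Comp D (?F (G Y)) Y' (?F (G Y')) (\<theta>' Y') (Comp D (?F (G Y)) Y Y' g (\<theta> Y)) \<in> Arr D (?F (G Y)) (?F (G Y'))"
      using that by (intro compD \<theta>' \<theta> FG)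
    from P[OF G[OF that(1)] G[OF that(2)] this]
    show "GA Y Y' g \<in> Arr C (G Y) (G Y')"
      "FArr F (G Y) (G Y') (GA Y Y' g) = Comp D (?F (G Y)) Y' (?F (G Y')) (\<theta>' Y') (Comp D (?F (G Y)) Y Y' g (\<theta> Y))"
      by (simp_all add: GA_def)
  qed
  let ?G = "\<lparr>FOb = G, FArr = GA\<rparr>"
  have Gfun: "is_functor D C ?G"
    unfolding is_functor_def cfunctor.simps
  proof (intro conjI ballI)
    fix Y assume Y: "Y \<in> Ob D"
    show "GA Y Y (Idt D Y) = Idt C (G Y)"
      by (rule faithful[OF G[OF Y] G[OF Y] GA(1)[OF Y Y idD[OF Y]] idC[OF G[OF Y]]])
        (simp add: GA(2)[OF Y Y idD[OF Y]] Fid[OF G[OF Y]] idlD[OF FG[OF Y] Y \<theta>[OF Y]] \<theta>'\<theta>[OF Y])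
  next
    fix X Y Z f g assume X: "X \<in> Ob D" and Y: "Y \<in> Ob D" and Z: "Z \<in> Ob D" and f: "f \<in> Arr D X Y" and g: "g \<in> Arr D Y Z"
    note gf = compD[OF X Y Z f g]
    note X' = FG[OF X] and Y' = FG[OF Y] and Z' = FG[OF Z]
    note f\<theta> = compD[OF X' X Y \<theta>[OF X] f]
    note g\<theta> = compD[OF Y' Y Z \<theta>[OF Y] g]
    show "GA X Z (Comp D X Y Z g f) = Comp C (G X) (G Y) (G Z) (GA Y Z g) (GA X Y f)"
    proof (rule faithful[OF G[OF X] G[OF Z] GA(1)[OF X Z gf] compC[OF G[OF X] G[OF Y] G[OF Z] GA(1)[OF X Y f] GA(1)[OF Y Z g]]])
      have "FArr F (G X) (G Z) (Comp C (G X) (G Y) (G Z) (GA Y Z g) (GA X Y f)) =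
        Comp D (?F (G X)) (?F (G Y)) (?F (G Z)) (Comp D (?F (G Y)) Z (?F (G Z)) (\<theta>' Z) (Comp D (?F (G Y)) Y Z g (\<theta> Y)))
          (Comp D (?F (G X)) Y (?F (G Y)) (\<theta>' Y) (Comp D (?F (G X)) X Y f (\<theta> X)))"
        by (simp add: Fcomp[OF G[OF X] G[OF Y] G[OF Z] GA(1)[OF X Y f] GA(1)[OF Y Z g]] GA(2)[OF X Y f] GA(2)[OF Y Z g])
      also have "\<dots> = Comp D (?F (G X)) Z (?F (G Z)) (\<theta>' Z) (Comp D (?F (G X)) (?F (G Y)) Z (Comp D (?F (G Y)) Y Z g (\<theta> Y))
          (Comp D (?F (G X)) Y (?F (G Y)) (\<theta>' Y) (Comp D (?F (G X)) X Y f (\<theta> X))))"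
        by (rule assocD[OF X' Y' Z Z' compD[OF X' Y Y' f\<theta> \<theta>'[OF Y]] g\<theta> \<theta>'[OF Z]])
      also have "Comp D (?F (G X)) (?F (G Y)) Z (Comp D (?F (G Y)) Y Z g (\<theta> Y))
          (Comp D (?F (G X)) Y (?F (G Y)) (\<theta>' Y) (Comp D (?F (G X)) X Y f (\<theta> X)))
          = Comp D (?F (G X)) Y Z g (Comp D (?F (G X)) X Y f (\<theta> X))"
        by (simp only: assocD[OF X' Y' Y Z compD[OF X' Y Y' f\<theta> \<theta>'[OF Y]] \<theta>[OF Y] g] c1[OF X' Y f\<theta>])
      also have "\<dots> = Comp D (?F (G X)) X Z (Comp D X Y Z g f) (\<theta> X)"
        by (rule assocD[OF X' X Y Z \<theta>[OF X] f g, symmetric])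
      finally show "FArr F (G X) (G Z) (GA X Z (Comp D X Y Z g f)) =
          FArr F (G X) (G Z) (Comp C (G X) (G Y) (G Z) (GA Y Z g) (GA X Y f))"
        by (simp add: GA(2)[OF X Z gf])
    qed
  qed (auto simp: G GA)
  have eps: "naturally_isomorphic D D (comp_functor F ?G) id_functor"
    unfolding naturally_isomorphic_def comp_functor_def id_functor_def cfunctor.simps
  proof (intro exI[of _ \<theta>] conjI ballI)
    fix Y assume Y: "Y \<in> Ob D"
    show "is_iso D (?F (G Y)) Y (\<theta> Y)"
      unfolding is_iso_def using \<theta>[OF Y] \<theta>'[OF Y] \<theta>\<theta>'[OF Y] \<theta>'\<theta>[OF Y] by blast
  next
    fix X Y f assume X: "X \<in> Ob D" and Y: "Y \<in> Ob D" and f: "f \<in> Arr D X Y"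
    show "Comp D (?F (G X)) (?F (G Y)) Y (\<theta> Y) (FArr F (G X) (G Y) (GA X Y f)) = Comp D (?F (G X)) X Y f (\<theta> X)"
      by (simp only: GA(2)[OF X Y f] c1[OF FG[OF X] Y compD[OF FG[OF X] X Y \<theta>[OF X] f]])
  qed
  have eta: "naturally_isomorphic C C id_functor (comp_functor ?G F)"
    unfolding naturally_isomorphic_def comp_functor_def id_functor_def cfunctor.simps
  proof (intro exI[of _ "\<lambda>X. P X (G (?F X)) (\<theta>' (?F X))"] conjI ballI)
    fix X assume X: "X \<in> Ob C"
    note Y = FO[OF X] and GX = G[OF FO[OF X]]
    note p = P[OF X GX \<theta>'[OF Y]] and q = P[OF GX X \<theta>[OF Y]]
    show "is_iso C X (G (?F X)) (P X (G (?F X)) (\<theta>' (?F X)))"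
      unfolding is_iso_def
    proof (intro conjI bexI)
      show "Comp C X (G (?F X)) X (P (G (?F X)) X (\<theta> (?F X))) (P X (G (?F X)) (\<theta>' (?F X))) = Idt C X"
        by (rule faithful[OF X X compC[OF X GX X p(1) q(1)] idC[OF X]])
          (simp add: Fcomp[OF X GX X p(1) q(1)] p(2) q(2) Fid[OF X] \<theta>\<theta>'[OF Y])
      show "Comp C (G (?F X)) X (G (?F X)) (P X (G (?F X)) (\<theta>' (?F X))) (P (G (?F X)) X (\<theta> (?F X))) = Idt C (G (?F X))"
        by (rule faithful[OF GX GX compC[OF GX X GX q(1) p(1)] idC[OF GX]])
          (simp add: Fcomp[OF GX X GX q(1) p(1)] p(2) q(2) Fid[OF GX] \<theta>'\<theta>[OF Y])
    qed (rule p(1), rule q(1))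
  next
    fix X Y f assume X: "X \<in> Ob C" and Y: "Y \<in> Ob C" and f: "f \<in> Arr C X Y"
    note X' = FO[OF X] and Y' = FO[OF Y] and f' = FA[OF X Y f]
    note GX = G[OF X'] and GY = G[OF Y']
    note pX = P[OF X GX \<theta>'[OF X']] and pY = P[OF Y GY \<theta>'[OF Y']]
    note g = GA[OF X' Y' f']
    show "Comp C X Y (G (?F Y)) (P Y (G (?F Y)) (\<theta>' (?F Y))) f
        = Comp C X (G (?F X)) (G (?F Y)) (GA (?F X) (?F Y) (FArr F X Y f)) (P X (G (?F X)) (\<theta>' (?F X)))"
    proof (rule faithful[OF X GY compC[OF X Y GY f pY(1)] compC[OF X GX GY pX(1) g(1)]])
      have "FArr F X (G (?F Y)) (Comp C X (G (?F X)) (G (?F Y)) (GA (?F X) (?F Y) (FArr F X Y f)) (P X (G (?F X)) (\<theta>' (?F X))))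
        = Comp D (?F X) (?F (G (?F X))) (?F (G (?F Y))) (Comp D (?F (G (?F X))) (?F Y) (?F (G (?F Y))) (\<theta>' (?F Y))
            (Comp D (?F (G (?F X))) (?F X) (?F Y) (FArr F X Y f) (\<theta> (?F X)))) (\<theta>' (?F X))"
        by (simp only: Fcomp[OF X GX GY pX(1) g(1)] pX(2) g(2))
      also have "\<dots> = Comp D (?F X) (?F Y) (?F (G (?F Y))) (\<theta>' (?F Y))
          (Comp D (?F X) (?F (G (?F X))) (?F Y) (Comp D (?F (G (?F X))) (?F X) (?F Y) (FArr F X Y f) (\<theta> (?F X))) (\<theta>' (?F X)))"
        by (rule assocD[OF X' FG[OF X'] Y' FG[OF Y'] \<theta>'[OF X'] compD[OF FG[OF X'] X' Y' \<theta>[OF X'] f'] \<theta>'[OF Y']])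
      also have "Comp D (?F X) (?F (G (?F X))) (?F Y) (Comp D (?F (G (?F X))) (?F X) (?F Y) (FArr F X Y f) (\<theta> (?F X))) (\<theta>' (?F X))
          = FArr F X Y f"
        by (simp only: assocD[OF X' FG[OF X'] X' Y' \<theta>'[OF X'] \<theta>[OF X'] f'] \<theta>\<theta>'[OF X'] idrD[OF X' Y' f'])
      finally show "FArr F X (G (?F Y)) (Comp C X Y (G (?F Y)) (P Y (G (?F Y)) (\<theta>' (?F Y))) f)
        = FArr F X (G (?F Y)) (Comp C X (G (?F X)) (G (?F Y)) (GA (?F X) (?F Y) (FArr F X Y f)) (P X (G (?F X)) (\<theta>' (?F X))))"
        by (simp only: Fcomp[OF X Y GY f pY(1)] pY(2))
    qed
  qed
  show ?thesis
    unfolding is_equivalence_def using C D F Gfun eps eta by blast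
qed

section \<open>Essential surjectivity\<close>

lemma linear_bij_inverse:
  assumes "left_module R M" "f \<in> linear_maps R M N" and f: "bij_betw f (carrier M) (carrier N)"
  shows "restrict (the_inv_into (carrier M) f) (carrier N) \<in> linear_maps R N M"
    and "compose (carrier M) (restrict (the_inv_into (carrier M) f) (carrier N)) f = restrict id (carrier M)"
    and "compose (carrier N) f (restrict (the_inv_into (carrier M) f) (carrier N)) = restrict id (carrier N)"
proof -
  interpret left_module R M by fact
  let ?g = "the_inv_into (carrier M) f"
  have inj: "inj_on f (carrier M)" and im: "f ` carrier M = carrier N" using f by (auto simp: bij_betw_def)
  have gc: "?g w \<in> carrier M" if "w \<in> carrier N" for w using the_inv_into_into[OF inj] im that by auto
  have fg: "f (?g w) = w" if "w \<in> carrier N" for w by (rule f_the_inv_into_f[OF inj]) (use im that in simp)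
  have gf: "?g (f v) = v" if "v \<in> carrier M" for v by (rule the_inv_into_f_f[OF inj that])
  have fc: "f v \<in> carrier N" if "v \<in> carrier M" for v using im that by blast
  have add: "f (v \<oplus>\<^bsub>M\<^esub> w) = f v \<oplus>\<^bsub>N\<^esub> f w" if "v \<in> carrier M" "w \<in> carrier M" for v w
    using assms(2) that by (simp add: linear_maps_def)
  have smult: "f (r \<odot>\<^bsub>M\<^esub> v) = r \<odot>\<^bsub>N\<^esub> f v" if "r \<in> carrier R" "v \<in> carrier M" for r v
    using assms(2) that by (simp add: linear_maps_def)
  have gadd: "?g (v \<oplus>\<^bsub>N\<^esub> w) = ?g v \<oplus>\<^bsub>M\<^esub> ?g w" and nadd: "v \<oplus>\<^bsub>N\<^esub> w \<in> carrier N"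
    if "v \<in> carrier N" "w \<in> carrier N" for v w
  proof -
    have c: "?g v \<oplus>\<^bsub>M\<^esub> ?g w \<in> carrier M" by (intro M.add.m_closed gc that)
    have e: "f (?g v \<oplus>\<^bsub>M\<^esub> ?g w) = v \<oplus>\<^bsub>N\<^esub> w"
      unfolding add[OF gc[OF that(1)] gc[OF that(2)]] fg[OF that(1)] fg[OF that(2)] ..
    show "?g (v \<oplus>\<^bsub>N\<^esub> w) = ?g v \<oplus>\<^bsub>M\<^esub> ?g w" using gf[OF c] unfolding e .
    show "v \<oplus>\<^bsub>N\<^esub> w \<in> carrier N" using fc[OF c] unfolding e .
  qed
  have gsm: "?g (r \<odot>\<^bsub>N\<^esub> v) = r \<odot>\<^bsub>M\<^esub> ?g v" and nsm: "r \<odot>\<^bsub>N\<^esub> v \<in> carrier N"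
    if "r \<in> carrier R" "v \<in> carrier N" for r v
  proof -
    have c: "r \<odot>\<^bsub>M\<^esub> ?g v \<in> carrier M" by (rule smult_closed[OF that(1) gc[OF that(2)]])
    have e: "f (r \<odot>\<^bsub>M\<^esub> ?g v) = r \<odot>\<^bsub>N\<^esub> v" unfolding smult[OF that(1) gc[OF that(2)]] fg[OF that(2)] ..
    show "?g (r \<odot>\<^bsub>N\<^esub> v) = r \<odot>\<^bsub>M\<^esub> ?g v" using gf[OF c] unfolding e .
    show "r \<odot>\<^bsub>N\<^esub> v \<in> carrier N" using fc[OF c] unfolding e .
  qed
  show "restrict ?g (carrier N) \<in> linear_maps R N M"
    unfolding linear_maps_def by (auto simp: gc gadd nadd gsm nsm)
  show "compose (carrier M) (restrict ?g (carrier N)) f = restrict id (carrier M)"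
    unfolding compose_def by (rule restrict_ext) (simp add: fc gf)
  show "compose (carrier N) f (restrict ?g (carrier N)) = restrict id (carrier N)"
    unfolding compose_def by (rule restrict_ext) (simp add: fg)
qed

locale surjectivity = coded_H_object p t lam N code for p t lam
    and N :: "(('n::finite, 'k::field) Hfree set, 'w) module" and code :: "(int ^ 'n \<Rightarrow> 'w) \<Rightarrow> 'v" +
  fixes b :: "int ^ 'n \<Rightarrow> int ^ 'n"
  assumes b_labels: "\<And>x. x \<in> alcove_labels t lam p \<Longrightarrow> b x \<in> alcove t lam p x"
begin

sublocale R: D_family p t lam Rec b
  by (rule D_familyI[OF char_p p_pos Rec_object b_labels])

lemma Rec_W_iff: "v \<in> M.W a \<longleftrightarrow> v \<in> carrier Rec \<and> decode v = concentrated a (decode v a)"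
proof
  assume v: "v \<in> M.W a"
  then have vc: "v \<in> carrier Rec" by (rule M.W_carrier)
  have "coact Rec v a = v" using v by (simp add: M.W_iff)
  then show "v \<in> carrier Rec \<and> decode v = concentrated a (decode v a)" using decode_coact[OF vc, of a] vc by metis
next
  assume v: "v \<in> carrier Rec \<and> decode v = concentrated a (decode v a)"
  then have vc: "v \<in> carrier Rec" and e: "decode v = concentrated a (decode v a)" by simp_all
  have "coact Rec v a = v"
    by (rule decode_eqI[OF coact_Rec_closed[OF vc] vc]) (simp only: decode_coact[OF vc] e[symmetric])
  then show "v \<in> M.W a" using vc by (simp add: M.W_iff)
qed

context
  fixes a y assumes a: "a \<in> fiber" and y: "y \<in> carrier N" "move a a y = y"
begin

lemma code_concentrated_families: "concentrated a y \<in> families" by (rule concentrated_fib'[OF a y])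

lemma code_concentrated_W: "code (concentrated a y) \<in> M.W a"
  unfolding Rec_W_iff decode_code[OF code_concentrated_families] using code_closed[OF code_concentrated_families] by (simp add: concentrated_def)

lemma act_heval_code_concentrated: "A.act (heval a f) (code (concentrated a y)) = code (concentrated a (sact f y))"
proof -
  have "weyl_act (heval a f) (concentrated a (concentrated a y a)) = concentrated a (sact f (concentrated a y a))" by (rule weyl_act_heval_concentrated[OF a code_concentrated_families])
  then have "weyl_act (heval a f) (concentrated a y) = concentrated a (sact f y)" by (simp add: concentrated_def)
  then show ?thesis by (simp only: Rec_act[OF A.heval_S code_closed[OF code_concentrated_families]] decode_code[OF code_concentrated_families])
qed

end

text \<open>The monomial \<open>m(a' - a)\<close> acts as \<open>c\<^sub>x'\<^sub>,\<^sub>x\<close> times the unit \<open>unit_rising a (a' - a)\<close>, and the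
  normalisation in \<open>tr\<close> divides by this unit.\<close>

lemma tr_code_concentrated:
  assumes a: "a \<in> fiber" and a': "a' \<in> fiber" and y: "y \<in> carrier N" "move a a y = y"
  shows "R.tr a' a (code (concentrated a y)) = code (concentrated a' (move a' a y))"
proof -
  let ?U = "unit_rising a (a' - a) :: ('n, 'k) s_poly"
  have d: "a' - a \<in> g_star t" by (rule fiber_diff[OF a' a])
  note W = code_concentrated_W[OF a y]
  have nil: "R.nilp a nilpotency_bound (code (concentrated a y))"
    unfolding R.nilp_def
  proof
    fix f :: "('n, 'k) s_poly" assume "f \<in> s_power_ideal nilpotency_bound"
    then have "sact f y = \<zero>\<^bsub>N\<^esub>" by (rule sact_nil[OF _ y(1)])
    then have "concentrated a (sact f y) = (\<lambda>_. \<zero>\<^bsub>N\<^esub>)" by (simp add: concentrated_def fun_eq_iff)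
    then show "A.act (heval a f) (code (concentrated a y)) = \<zero>\<^bsub>Rec\<^esub>"
      unfolding act_heval_code_concentrated[OF a y] by (simp add: Rec_def)
  qed
  obtain g where g: "?U * g - 1 \<in> s_power_ideal nilpotency_bound" using unit_rising_unit by blast
  have gy: "sact g y \<in> carrier N" "move a a (sact g y) = sact g y"
    using y sact_hact[OF y(1), of g "gen (alcove_of p a, alcove_of p a)"] by simp_all
  note f = code_concentrated_families[OF a gy]
  have "R.tr a' a (code (concentrated a y)) = A.act (m_elt (a' - a)) (A.act (heval a g) (code (concentrated a y)))"
    by (rule R.tr_eq[OF W nil g])
  also have "\<dots> = code (weyl_act (m_elt (a' - a)) (concentrated a (sact g y)))"
    unfolding act_heval_code_concentrated[OF a y] Rec_act[OF A.m_elt_S[OF d] code_closed[OF f]] decode_code[OF f] ..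
  also have "weyl_act (m_elt (a' - a)) (concentrated a (sact g y)) = concentrated a' (move a' a y)"
  proof -
    have "weyl_act (m_elt (a' - a)) (concentrated a (concentrated a (sact g y) a)) = concentrated (a' - a + a) (weyl_act (m_elt (a' - a)) (concentrated a (sact g y)) (a' - a + a))"
      by (rule weyl_act_concentrated[OF m_elt_weight d f])
    then have e: "weyl_act (m_elt (a' - a)) (concentrated a (sact g y)) = concentrated a' (weyl_act (m_elt (a' - a)) (concentrated a (sact g y)) a')"
      by (simp add: concentrated_def)
    have "weyl_act (m_elt (a' - a)) (concentrated a (sact g y)) (a + (a' - a))
        = sact (ncoeff p (m_elt (a' - a) :: ('n, 'k) weyl) (a + (a' - a)) a) (move (a + (a' - a)) a (concentrated a (sact g y) a))"
      by (rule weyl_act_homogeneous[OF m_elt_weight d f a])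
    then have "weyl_act (m_elt (a' - a)) (concentrated a (sact g y)) a' = sact ?U (move a' a (sact g y))"
      unfolding ncoeff_m_elt by (simp add: concentrated_def)
    also have "\<dots> = sact (?U * g) (move a' a y)"
      using sact_hact[OF y(1), of g] y(1) by (simp add: sact_mult)
    also have "?U * g = 1 + (?U * g - 1)" by simp
    also have "sact (1 + (?U * g - 1)) (move a' a y) = move a' a y"
      using y(1) sact_nil[OF g, of "move a' a y"] sact_add_left[of "move a' a y" 1 "?U * g - 1"] by (simp add: sact_one)
    finally show ?thesis using e by simp
  qed
  finally show ?thesis .
qed

text \<open>The isomorphism from \<open>N\<close> to the value of the functor on \<open>Rec\<close>.\<close>

definition unit_map where
  "unit_map = (\<lambda>n\<in>carrier N. the_inv_into (carrier R.FM) R.ev (\<lambda>x\<in>L. code (concentrated (b x) (cact x x n))))"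

lemma component_idem:
  assumes "x \<in> L" "n \<in> carrier N"
  shows "b x \<in> fiber" "alcove_of p (b x) = x" "cact x x n \<in> carrier N" "move (b x) (b x) (cact x x n) = cact x x n"
  using R.b_fiber[OF assms(1)] R.alcove_of_b[OF assms(1)] cact_idem[OF assms(1,1,2)] assms(2) by simp_all

lemma unit_map:
  assumes n: "n \<in> carrier N"
  shows "unit_map n \<in> carrier R.FM" and "x \<in> L \<Longrightarrow> R.ev (unit_map n) x = code (concentrated (b x) (cact x x n))"
proof -
  have f: "(\<lambda>x\<in>L. code (concentrated (b x) (cact x x n))) \<in> R.fam"
  proof (rule R.famI[OF _ finite_supp])
    fix x assume x: "x \<in> L"
    show "code (concentrated (b x) (cact x x n)) \<in> M.W (b x)" by (rule code_concentrated_W) (fact component_idem[OF x n])+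
    assume "x \<notin> supp"
    then have "cact x x n = \<zero>\<^bsub>N\<^esub>" by (rule cact_outside_supp[OF x _ x n])
    then show "code (concentrated (b x) (cact x x n)) = \<zero>\<^bsub>Rec\<^esub>" by (simp add: concentrated_def Rec_def)
  qed
  have inj: "inj_on R.ev (carrier R.FM)" and im: "R.ev ` carrier R.FM = R.fam"
    using R.ev_FM_bij by (auto simp: bij_betw_def)
  show "unit_map n \<in> carrier R.FM"
    unfolding unit_map_def restrict_apply'[OF n] by (rule the_inv_into_into[OF inj]) (use f im in simp_all)
  have "R.ev (unit_map n) = (\<lambda>x\<in>L. code (concentrated (b x) (cact x x n)))"
    unfolding unit_map_def restrict_apply'[OF n] by (rule f_the_inv_into_f[OF inj]) (use f im in simp)
  then show "x \<in> L \<Longrightarrow> R.ev (unit_map n) x = code (concentrated (b x) (cact x x n))" by simp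
qed

lemma code_concentrated_add:
  assumes "x \<in> L" "n \<in> carrier N" "n' \<in> carrier N"
  shows "code (concentrated (b x) (cact x x (n \<oplus>\<^bsub>N\<^esub> n'))) = code (concentrated (b x) (cact x x n)) \<oplus>\<^bsub>Rec\<^esub> code (concentrated (b x) (cact x x n'))"
proof -
  have f: "concentrated (b x) (cact x x m) \<in> families" if "m \<in> carrier N" for m
    by (rule code_concentrated_families) (fact component_idem[OF assms(1) that])+
  have "code (concentrated (b x) (cact x x n)) \<oplus>\<^bsub>Rec\<^esub> code (concentrated (b x) (cact x x n'))
      = code (\<lambda>a. concentrated (b x) (cact x x n) a \<oplus>\<^bsub>N\<^esub> concentrated (b x) (cact x x n') a)"
    by (simp add: Rec_def decode_code f assms(2,3))
  also have "(\<lambda>a. concentrated (b x) (cact x x n) a \<oplus>\<^bsub>N\<^esub> concentrated (b x) (cact x x n') a) = concentrated (b x) (cact x x (n \<oplus>\<^bsub>N\<^esub> n'))"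
    using assms by (simp add: concentrated_def act_add fun_eq_iff)
  finally show ?thesis ..
qed

lemma unit_map_linear: "unit_map \<in> linear_maps (H_alg t L) N R.FM"
proof (rule H_linear_mapsI)
  show "left_module (H_alg t L) N" "left_module (H_alg t L) R.FM" by (rule left_module_H, rule R.FM_module)
  show "unit_map \<in> carrier N \<rightarrow>\<^sub>E carrier R.FM" using unit_map(1) by (auto simp: unit_map_def)
  fix n assume n: "n \<in> carrier N"
  show "unit_map (n \<oplus>\<^bsub>N\<^esub> n') = unit_map n \<oplus>\<^bsub>R.FM\<^esub> unit_map n'" if n': "n' \<in> carrier N" for n'
  proof (rule R.ev_eqI)
    have nn: "n \<oplus>\<^bsub>N\<^esub> n' \<in> carrier N" by (rule add.m_closed[OF n n'])
    fix x assume x: "x \<in> L"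
    show "R.ev (unit_map (n \<oplus>\<^bsub>N\<^esub> n')) x = R.ev (unit_map n \<oplus>\<^bsub>R.FM\<^esub> unit_map n') x"
      unfolding R.ev_add R.fadd_apply[OF x] unit_map(2)[OF n x] unit_map(2)[OF n' x] unit_map(2)[OF nn x]
      by (rule code_concentrated_add[OF x n n'])
  qed (intro unit_map add.m_closed R.F.add.m_closed n n')+
  show "unit_map (sact g n) = R.F.sact g (unit_map n)" for g
  proof (rule R.ev_eqI)
    fix x assume x: "x \<in> L"
    note c = component_idem[OF x n]
    have "code (concentrated (b x) (cact x x (sact g n))) = code (concentrated (b x) (sact g (cact x x n)))"
      by (simp only: sact_hact[OF n])
    then show "R.ev (unit_map (sact g n)) x = R.ev (R.F.sact g (unit_map n)) x"
      unfolding R.ev_sact[OF unit_map(1)[OF n] x] unit_map(2)[OF n x] unit_map(2)[OF sact_closed[OF n] x]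
        act_heval_code_concentrated[OF c(1,3,4)] .
  qed (intro unit_map sact_closed R.F.sact_closed n)+
  show "unit_map (cact y z n) = R.F.cact y z (unit_map n)" for y z
  proof (rule R.ev_eqI)
    fix x assume x: "x \<in> L"
    show "R.ev (unit_map (cact y z n)) x = R.ev (R.F.cact y z (unit_map n)) x"
    proof (cases "x = y \<and> z \<in> L")
      case True
      then have z: "z \<in> L" and xy: "y = x" by auto
      note c = component_idem[OF z n] and cx = component_idem[OF x n]
      have "R.tr (b x) (b z) (code (concentrated (b z) (cact z z n))) = code (concentrated (b x) (cact x z (cact z z n)))"
        using tr_code_concentrated[OF c(1) cx(1) c(3,4)] unfolding c(2) cx(2) .
      also have "cact x z (cact z z n) = cact x x (cact x z n)"
        by (simp only: cact_idem[OF x z n] cact_idem_right[OF x z n])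
      finally show ?thesis
        unfolding R.ev_cact[OF unit_map(1)[OF n] x] unit_map(2)[OF cact_closed[OF n] x] unit_map(2)[OF n z] xy
        using z by simp
    next
      case False
      have "cact x x (cact y z n) = \<zero>\<^bsub>N\<^esub>"
      proof (cases "y \<in> L \<and> z \<in> L")
        case True
        then show ?thesis using False by (intro cact_cact_neq x n) auto
      next
        case False
        then show ?thesis using cact_outside[OF _ n, of y z] by auto
      qed
      then show ?thesis
        unfolding R.ev_cact[OF unit_map(1)[OF n] x] unit_map(2)[OF cact_closed[OF n] x]
        using False by (auto simp: concentrated_def Rec_def)
    qed
  qed (intro unit_map cact_closed R.F.cact_closed n)+
qed

text \<open>A vector of \<open>N\<close> is the sum of its components.\<close>

lemma unit_map_bij: "bij_betw unit_map (carrier N) (carrier R.FM)"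
  unfolding bij_betw_def
proof
  show "inj_on unit_map (carrier N)"
  proof (rule inj_onI)
    fix n n' assume n: "n \<in> carrier N" "n' \<in> carrier N" and eq: "unit_map n = unit_map n'"
    have c: "cact x x n = cact x x n'" if x: "x \<in> L" for x
    proof -
      have f: "concentrated (b x) (cact x x m) \<in> families" if "m \<in> carrier N" for m
        by (rule code_concentrated_families) (fact component_idem[OF x that])+
      have "code (concentrated (b x) (cact x x n)) = code (concentrated (b x) (cact x x n'))"
        using unit_map(2)[OF n(1) x] unit_map(2)[OF n(2) x] eq by simp
      then have "concentrated (b x) (cact x x n) = concentrated (b x) (cact x x n')"
        by (rule inj_onD[OF code_inj _ f[OF n(1)] f[OF n(2)]])
      from fun_cong[OF this, of "b x"] show ?thesis by (simp add: concentrated_def)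
    qed
    have "(\<Oplus>\<^bsub>N\<^esub>x\<in>supp. cact x x n) = (\<Oplus>\<^bsub>N\<^esub>x\<in>supp. cact x x n')"
      by (rule finsum_cong') (use c supp_L n cact_closed in auto)
    then show "n = n'" by (simp only: sum_components[OF n(1)] sum_components[OF n(2)])
  qed
  show "unit_map ` carrier N = carrier R.FM"
  proof
    show "unit_map ` carrier N \<subseteq> carrier R.FM" using unit_map(1) by blast
    show "carrier R.FM \<subseteq> unit_map ` carrier N"
    proof
      fix \<Phi> assume \<Phi>: "\<Phi> \<in> carrier R.FM"
      define y where "y x = decode (R.ev \<Phi> x) (b x)" for x
      have ev: "R.ev \<Phi> x \<in> carrier Rec" "decode (R.ev \<Phi> x) = concentrated (b x) (y x)" if "x \<in> L" for x
        using R.ev_W[OF \<Phi> that] by (simp_all add: Rec_W_iff y_def)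
      have yc: "y x \<in> carrier N" and yi: "cact x x (y x) = y x" if x: "x \<in> L" for x
        unfolding y_def using families_carrier[OF decode_families[OF ev(1)[OF x]]]
          families_idem[OF decode_families[OF ev(1)[OF x]] R.b_fiber[OF x]] R.alcove_of_b[OF x] by simp_all
      have f: "y \<in> supp \<rightarrow> carrier N" using yc supp_L by blast
      let ?n = "\<Oplus>\<^bsub>N\<^esub>x\<in>supp. y x"
      have n: "?n \<in> carrier N" by (rule finsum_closed[OF f])
      have comp: "cact x x ?n = y x" if x: "x \<in> L" for x
      proof -
        have t: "cact x x (y z) = (if x = z then y z else \<zero>\<^bsub>N\<^esub>)" if z: "z \<in> L" for z
        proof (cases "x = z")
          case False
          have "cact x x (cact z z (y z)) = \<zero>\<^bsub>N\<^esub>" by (rule cact_cact_neq[OF x x z z False yc[OF z]])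
          then show ?thesis using False by (simp only: yi[OF z] if_False)
        qed (simp add: yi[OF z])
        have "cact x x ?n = (\<Oplus>\<^bsub>N\<^esub>z\<in>supp. cact x x (y z))" by (rule act_finsum[OF UNIV_I f])
        also have "\<dots> = (\<Oplus>\<^bsub>N\<^esub>z\<in>supp. if x = z then y z else \<zero>\<^bsub>N\<^esub>)"
          by (rule finsum_cong') (use t yc supp_L in auto)
        also have "\<dots> = y x"
        proof (cases "x \<in> supp")
          case True
          show ?thesis by (rule finsum_singleton[OF True finite_supp f])
        next
          case False
          then have "(\<Oplus>\<^bsub>N\<^esub>z\<in>supp. if x = z then y z else \<zero>\<^bsub>N\<^esub>) = (\<Oplus>\<^bsub>N\<^esub>z\<in>supp. \<zero>\<^bsub>N\<^esub>)"
            by (intro finsum_cong') auto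
          also have "\<dots> = y x" using cact_outside_supp[OF x False x yc[OF x]] by (simp add: yi[OF x])
          finally show ?thesis .
        qed
        finally show ?thesis .
      qed
      have "unit_map ?n = \<Phi>"
      proof (rule R.ev_eqI[OF unit_map(1)[OF n] \<Phi>])
        fix x assume x: "x \<in> L"
        show "R.ev (unit_map ?n) x = R.ev \<Phi> x"
          unfolding unit_map(2)[OF n x] comp[OF x] ev(2)[OF x, symmetric] by (rule code_decode[OF ev(1)[OF x]])
      qed
      then show "\<Phi> \<in> unit_map ` carrier N" using n by blast
    qed
  qed
qed

end

text \<open>The families can be coded by lists of scalars, hence by elements of \<open>'v\<close>.\<close>

theorem essentially_surjective:
  fixes N :: "(('n::finite, 'k::field) Hfree set, int ^ 'n \<Rightarrow> ('n, 'k) Qelt \<Rightarrow> 'v) module"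
    and large :: "'k list \<Rightarrow> 'v"
  assumes "CHAR('k) = p" "p > 0" and N: "N \<in> H_modules_o t (alcove_labels t lam p)"
    and b: "\<And>x. x \<in> alcove_labels t lam p \<Longrightarrow> b x \<in> alcove t lam p x" and large: "inj large"
  shows "\<exists>M\<in>(A_modules_D_o t lam p :: ('n, 'k, 'v) Dmod set). \<exists>\<theta>.
    is_iso (H_mod_o t (alcove_labels t lam p)) (Hom_sum_module t lam (alcove_labels t lam p) b M) N \<theta>"
proof -
  have "left_module (H_alg t (alcove_labels t lam p)) N" using N by (simp add: H_modules_o_def)
  then interpret H_object p t lam N
    by (intro H_object.intro H_object_axioms.intro H_action.intro char_p.intro assms(1,2) N)
  obtain e :: "(int ^ 'n \<Rightarrow> int ^ 'n \<Rightarrow> ('n, 'k) Qelt \<Rightarrow> 'v) \<Rightarrow> 'k list" where e: "inj_on e families"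
    by (rule families_injection)
  have "inj_on (\<lambda>n. large (e n)) families"
    by (rule inj_onI) (use e large in \<open>auto dest: injD inj_onD\<close>)
  then interpret surjectivity p t lam N "\<lambda>n. large (e n)" b
    by (intro surjectivity.intro surjectivity_axioms.intro coded_H_object.intro coded_H_object_axioms.intro
        H_object_axioms b)
  let ?g = "restrict (the_inv_into (carrier N) unit_map) (carrier R.FM)"
  note inv = linear_bij_inverse[OF left_module_H unit_map_linear unit_map_bij]
  have "is_iso (H_mod_o t L) R.FM N ?g"
    unfolding is_iso_def H_mod_o_simps
    by (intro conjI bexI[of _ unit_map] inv unit_map_linear)
  then show ?thesis using Rec_object by blast
qed

section \<open>The equivalence\<close>

lemma D_arrows_id: "M \<in> A_modules_D_o t lam p \<Longrightarrow> restrict id (carrier M) \<in> D_arrows t lam M M"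
  by (auto simp: D_arrows_def A_modules_D_o_def A_modules_o_def is_D_action_def intro: linear_maps_id)

lemma D_arrows_compose:
  assumes "M \<in> A_modules_D_o t lam p" and f: "f \<in> D_arrows t lam M N" and g: "g \<in> D_arrows t lam N P"
  shows "compose (carrier M) g f \<in> D_arrows t lam M P"
proof -
  have "left_module (A_lam t lam) M" and c: "\<And>v a. v \<in> carrier M \<Longrightarrow> coact M v a \<in> carrier M"
    using assms(1) by (auto simp: A_modules_D_o_def A_modules_o_def is_D_action_def)
  then have "compose (carrier M) g f \<in> linear_maps (A_lam t lam) M P"
    using f g linear_maps_compose by (force simp: D_arrows_def)
  moreover have "f v \<in> carrier N" if "v \<in> carrier M" for v
    using f that linear_maps_funcset by (fastforce simp: D_arrows_def)
  ultimately show ?thesis using f g c by (simp add: D_arrows_def compose_def)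
qed

lemma A_mod_D_o_category: "is_category (A_mod_D_o t lam p)"
  unfolding A_mod_D_o_def D_arrows_def[symmetric]
proof (rule linear_maps_category)
  show "left_module (A_lam t lam) M" if "M \<in> A_modules_D_o t lam p" for M
    using that by (simp add: A_modules_D_o_def A_modules_o_def)
  show "D_arrows t lam M N \<subseteq> linear_maps (A_lam t lam) M N" for M N
    by (auto simp: D_arrows_def)
  show "restrict id (carrier M) \<in> D_arrows t lam M M" if "M \<in> A_modules_D_o t lam p" for M
    using that by (rule D_arrows_id)
  show "compose (carrier M) g f \<in> D_arrows t lam M P"
    if "M \<in> A_modules_D_o t lam p" "f \<in> D_arrows t lam M N" "g \<in> D_arrows t lam N P" for M N P f g
    using that by (rule D_arrows_compose)
qed

theorem theorem3p18:
  fixes t :: "(int ^ 'n) set" and lam :: "int ^ 'n \<Rightarrow> int" and b :: "int ^ 'n \<Rightarrow> int ^ 'n"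
    and p :: nat and large :: "'k::field list \<Rightarrow> 'v"
  assumes "CHAR('k) = p" and "p > 0"
    and "subtorus_lattice t"
    and "\<And>x y. x \<in> t \<Longrightarrow> y \<in> t \<Longrightarrow> lam (x + y) = lam x + lam y"
    and "\<And>x. x \<in> alcove_labels t lam p \<Longrightarrow> b x \<in> alcove t lam p x"
    and "inj large"
  shows "is_equivalence
    (A_mod_D_o t lam p :: (('n::finite, 'k, 'v) Dmod, 'v \<Rightarrow> 'v) category)
    (H_mod_o t (alcove_labels t lam p))
    (Hom_P_functor t lam (alcove_labels t lam p) b)"
proof (rule equivalenceI)
  let ?C = "A_mod_D_o t lam p :: (('n, 'k, 'v) Dmod, 'v \<Rightarrow> 'v) category"
  let ?L = "alcove_labels t lam p"
  let ?D = "H_mod_o t ?L :: ((('n, 'k) Hfree set, int ^ 'n \<Rightarrow> ('n, 'k) Qelt \<Rightarrow> 'v) module, _) category"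
  let ?F = "Hom_P_functor t lam ?L b :: (('n, 'k, 'v) Dmod, 'v \<Rightarrow> 'v, _, _) cfunctor"
  have fam: "D_family p t lam M b" if "M \<in> A_modules_D_o t lam p" for M :: "('n, 'k, 'v) Dmod"
    by (rule D_familyI[OF assms(1,2) that assms(5)])
  have arr: "D_arrow p t lam M N b f"
    if "M \<in> A_modules_D_o t lam p" "N \<in> A_modules_D_o t lam p" "f \<in> D_arrows t lam M N" for M N :: "('n, 'k, 'v) Dmod" and f
    by (intro D_arrow.intro D_arrow_axioms.intro fam that)
  have FOb: "FOb ?F M = Hom_sum_module t lam ?L b M" for M by (simp add: Hom_P_functor_def)
  show "is_category ?C" by (rule A_mod_D_o_category)
  show "is_category ?D" by (rule H_mod_o_category)
  show "is_functor ?C ?D ?F"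
    unfolding is_functor_def A_mod_D_o_simps H_mod_o_simps FOb
  proof (intro conjI ballI)
    fix M :: "('n, 'k, 'v) Dmod" assume M: "M \<in> A_modules_D_o t lam p"
    interpret M: D_family p t lam M b by (rule fam[OF M])
    show "Hom_sum_module t lam ?L b M \<in> H_modules_o t ?L" by (rule M.FM_object)
    interpret id: D_arrow p t lam M M b "restrict id (carrier M)" by (rule arr[OF M M D_arrows_id[OF M]])
    show "FArr ?F M M (restrict id (carrier M)) = restrict id (carrier (Hom_sum_module t lam ?L b M))"
    proof (rule linear_maps_ext[OF id.Farr_linear linear_maps_id[OF M.FM_module]])
      fix \<Phi> assume \<Phi>: "\<Phi> \<in> carrier M.FM"
      have "id.Farr \<Phi> = \<Phi>"
      proof (rule M.ev_eqI[OF id.Farr_closed[OF \<Phi>] \<Phi>])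
        show "M.ev (id.Farr \<Phi>) x = M.ev \<Phi> x" if x: "x \<in> ?L" for x
          unfolding id.ev_Farr[OF \<Phi> x] using M.W_carrier[OF M.ev_W[OF \<Phi> x]] by simp
      qed
      then show "id.Farr \<Phi> = restrict id (carrier M.FM) \<Phi>" using \<Phi> by simp
    qed
    fix N :: "('n, 'k, 'v) Dmod" assume N: "N \<in> A_modules_D_o t lam p"
    interpret N: D_family p t lam N b by (rule fam[OF N])
    show "FArr ?F M N f \<in> linear_maps (H_alg t ?L) (Hom_sum_module t lam ?L b M) (Hom_sum_module t lam ?L b N)"
      if "f \<in> D_arrows t lam M N" for f
      by (rule D_arrow.Farr_linear[OF arr[OF M N that]])
    fix P :: "('n, 'k, 'v) Dmod" and f g
    assume P: "P \<in> A_modules_D_o t lam p" and f: "f \<in> D_arrows t lam M N" and g: "g \<in> D_arrows t lam N P"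
    interpret P: D_family p t lam P b by (rule fam[OF P])
    interpret f: D_arrow p t lam M N b f by (rule arr[OF M N f])
    interpret g: D_arrow p t lam N P b g by (rule arr[OF N P g])
    interpret gf: D_arrow p t lam M P b "compose (carrier M) g f" by (rule arr[OF M P D_arrows_compose[OF M f g]])
    show "FArr ?F M P (compose (carrier M) g f)
        = compose (carrier (Hom_sum_module t lam ?L b M)) (FArr ?F N P g) (FArr ?F M N f)"
    proof (rule linear_maps_ext[OF gf.Farr_linear linear_maps_compose[OF M.FM_module f.Farr_linear g.Farr_linear]])
      fix \<Phi> assume \<Phi>: "\<Phi> \<in> carrier M.FM"
      have "gf.Farr \<Phi> = g.Farr (f.Farr \<Phi>)"
      proof (rule P.ev_eqI[OF gf.Farr_closed[OF \<Phi>] g.Farr_closed[OF f.Farr_closed[OF \<Phi>]]])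
        show "P.ev (gf.Farr \<Phi>) x = P.ev (g.Farr (f.Farr \<Phi>)) x" if x: "x \<in> ?L" for x
          unfolding gf.ev_Farr[OF \<Phi> x] g.ev_Farr[OF f.Farr_closed[OF \<Phi>] x] f.ev_Farr[OF \<Phi> x]
          using M.W_carrier[OF M.ev_W[OF \<Phi> x]] by (simp add: compose_def)
      qed
      then show "gf.Farr \<Phi> = compose (carrier M.FM) g.Farr f.Farr \<Phi>" using \<Phi> by (simp add: compose_def)
    qed
  qed
next
  fix M N :: "('n, 'k, 'v) Dmod"
  let ?L = "alcove_labels t lam p"
  assume M: "M \<in> Ob (A_mod_D_o t lam p)" and N: "N \<in> Ob (A_mod_D_o t lam p)"
  then have D: "D_family p t lam M b" "D_family p t lam N b"
    using assms(1,2,5) by (auto simp: A_mod_D_o_simps intro: D_familyI)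
  show "\<exists>f\<in>Arr (A_mod_D_o t lam p) M N. FArr (Hom_P_functor t lam ?L b) M N f = g"
    if "g \<in> Arr (H_mod_o t ?L) (FOb (Hom_P_functor t lam ?L b) M) (FOb (Hom_P_functor t lam ?L b) N)" for g
  proof -
    have "g \<in> linear_maps (H_alg t ?L) (Hom_sum_module t lam ?L b M) (Hom_sum_module t lam ?L b N)"
      using that by (simp add: H_mod_o_simps Hom_P_functor_def)
    then interpret H_arrow p t lam M N b g by (intro H_arrow.intro H_arrow_axioms.intro D)
    show ?thesis using lift_arrow Farr_lift by (auto simp: A_mod_D_o_simps)
  qed
  show "f = f'"
    if f: "f \<in> Arr (A_mod_D_o t lam p) M N" "f' \<in> Arr (A_mod_D_o t lam p) M N"
      and eq: "FArr (Hom_P_functor t lam ?L b) M N f = FArr (Hom_P_functor t lam ?L b) M N f'" for f f'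
  proof (rule Farr_faithful[OF _ _ eq])
    show "D_arrow p t lam M N b f" "D_arrow p t lam M N b f'"
      using f by (intro D_arrow.intro D_arrow_axioms.intro D; simp add: A_mod_D_o_simps)+
  qed
next
  fix N assume "N \<in> Ob (H_mod_o t (alcove_labels t lam p)
    :: ((('n, 'k) Hfree set, int ^ 'n \<Rightarrow> ('n, 'k) Qelt \<Rightarrow> 'v) module, _) category)"
  then have "N \<in> H_modules_o t (alcove_labels t lam p)" by (simp add: H_mod_o_simps)
  from essentially_surjective[OF assms(1,2) this assms(5,6)]
  show "\<exists>M\<in>Ob (A_mod_D_o t lam p :: (('n, 'k, 'v) Dmod, 'v \<Rightarrow> 'v) category).
      \<exists>\<theta>. is_iso (H_mod_o t (alcove_labels t lam p)) (FOb (Hom_P_functor t lam (alcove_labels t lam p) b) M) N \<theta>"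
    by (simp add: A_mod_D_o_simps Hom_P_functor_def)
qed

end
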